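(* Let $(X,\omega_X)$ be a compact connected Kähler manifold of dimension $n$, and let $(\mathcal E_\lambda)_{\lambda\in Q'_0}$, $(\phi_a)_{a\in Q'_1}$ be a holomorphic family over $X\times S$ of stable $(Q,\mathcal K)$-bundles on $X$ parameterized by a reduced complex space $S$, equipped with hermitian metrics $k^\lambda$ on $\mathcal E_\lambda$ of class $C^\infty$ on $X\times S$ whose restrictions to each fiber $X\times\{s\}$ solve the quiver vortex equation with constants $\tau'_\lambda$. Let $\omega_{WP}$ be the generalized Weil-Petersson form on $S$. Then $$\frac1{4\pi^2}\omega_{WP}=-\sum_{\lambda\in Q'_0}n_\lambda\int_X\mathrm{ch}_2(\mathcal E_\lambda,k^\lambda)\wedge\frac{\omega_X^{n-1}}{(n-1)!}+\sum_{\lambda\in Q'_0}\frac{\tau'_\lambda}{2\pi}\int_X c_1(\mathcal E_\lambda,k^\lambda)\wedge\frac{\omega_X^n}{n!}+\partial\overline\partial\left(\frac{\sqrt{-1}}{4\pi^2}\sum_{a\in Q'_1}\int_X\mathrm{tr}(\phi_a\phi_a^* )\frac{\omega_X^n}{n!}\right),$$ where $\int_X$ denotes integration along the fibers of $X\times S\to S$, $c_1(\mathcal E_\lambda,k^\lambda)=\frac{\sqrt{-1}}{2\pi}\mathrm{tr}(\Omega^\lambda)$ and $\mathrm{ch}_2(\mathcal E_\lambda,k^\lambda)=\frac12\left(\frac{\sqrt{-1}}{2\pi}\right)^2\mathrm{tr}(\Omega^\lambda\wedge\Omega^\lambda)$ are the Chern and Chern character forms on $X\times S$, and $\omega_X^k=\omega_X\wedge\dots\wedge\omega_X$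 ($k$ factors).
   Context: Quiver bundles. $Q=(Q_0,Q_1)$ is a locally finite quiver with head and tail maps $h,t:Q_1\to Q_0$ (written $ha,ta$), and $\mathcal K$ is a set of relations, i.e. finite complex linear combinations of paths with common tail and common head; $(Q,\mathcal K)$ is the quiver with relations that Álvarez-Cónsul and García-Prada associate to a proper parabolic subgroup $P$ of a connected semisimple complex affine algebraic group $G$ (vertices $\lambda$ are the integral dominant weights of $P$, labelling irreducible $P$-representations $M_\lambda$), and $n_\lambda\ge 1$ is the integer (multiplicity of $M_\lambda$) attached to the vertex $\lambda$. Only these data enter the statement. A $(Q,\mathcal K)$-bundle on a complex manifold is a collection of holomorphic vector bundles $\mathcal E_\lambda$ ($\lambda\in Q_0$), zero for all but finitely many $\lambda$, and holomorphic bundle maps $\phi_a:\mathcal E_{ta}\to\mathcal E_{ha}$ ($a\in Q_1$) satisfying all relations in $\mathcal K$ (a path acts by composition). $Q'_0$ is the set of $\lambda$ with $\mathcal E_\lambda\ne0$, and $Q'_1$ the set of arrows with head and tail in $Q'_0$. A holomorphic family over $S$ is a $(Q,\mathcal K)$-bundle on $X\times S$; its members are the restrictions to $X\times\{s\}$. Quiver vortex equation. For real constants $\tau'_\lambda$, hermitian metrics $k_\lambda$ on $\mathcal E_\lambda$ over $X$ solve it if for every $\lambda\in Q'_0$ $$\sqrt{-1}\,n_\lambda\Lambda F_{k_\lambda}+\sum_{a\in h^{-1}(\lambda)}\phi_a\phi_a^*-\sum_{a\in t^{-1}(\lambda)}\phi_a^*\phi_a=\tau'_\lambda\,\mathrm{id}_{\mathcal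 E_\lambda},$$ where $F$ is the Chern curvature form, $\Lambda$ is the adjoint of wedging with $\omega_X$, and ${}^*$ is the adjoint with respect to the metrics. Stability is the slope stability corresponding to this equation: with $\deg\mathcal E=\mathrm{Vol}(X)^{-1}\int_X \mathrm{tr}(\sqrt{-1}\Lambda F)\,\omega_X^n/n!$ one has $\sum_\lambda(n_\lambda\deg\mathcal E_\lambda-\tau'_\lambda\,\mathrm{rk}\,\mathcal E_\lambda)=0$, and $\sum_\lambda(n_\lambda\deg\mathcal E'_\lambda-\tau'_\lambda\,\mathrm{rk}\,\mathcal E'_\lambda)<0$ for all coherent $Q$-subsheaves $\mathcal E'$ with $0<\sum\mathrm{rk}\,\mathcal E'_\lambda<\sum\mathrm{rk}\,\mathcal E_\lambda$. Tensor notation. $z^\alpha$ are local coordinates on $X$, $s^i$ local coordinates on $S$ (on a smooth ambient space of minimal dimension if $S$ is singular; all forms then are understood via local extensions to the ambient space). $\omega_X=\sqrt{-1}g_{\alpha\overline\beta}dz^\alpha\wedge dz^{\overline\beta}$, $g\,dV=\omega_X^n/n!$. $\nabla$ is the Chern connection of $(\mathcal E_\lambda,k^\lambda)$ on $X\times S$ and the induced connections on $\mathrm{Hom}$ bundles, $R^\lambda_{A\overline B}=[\nabla_A,\nabla_{\overline B}]$ for coordinate directions $A,B$ of $X\times S$, and $\Omega^\lambda=\sum R^\lambda_{A\overline B}\,dw^A\wedge dw^{\overline B}$ (all coordinates $w=(z,s)$) is the curvature form. A semicolon denotes covariant derivatives; $\phi_{a;i}=\nabla_{\partial/\partial s^i}\phi_a$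 and $\phi^*_{a;\overline\jmath}=\nabla_{\overline\jmath}(\phi_a^* )=(\phi_{a;j})^*$. Generalized Weil-Petersson form: $\omega_{WP}=\sqrt{-1}\,G^{WP}_{i\overline\jmath}\,ds^i\wedge ds^{\overline\jmath}$ with $$G^{WP}_{i\overline\jmath}=\int_X\sum_{a\in Q'_1}\mathrm{tr}(\phi_{a;i}\phi^*_{a;\overline\jmath})\,g\,dV+\int_X\sum_{\lambda\in Q'_0}n_\lambda\,\mathrm{tr}(g^{\overline\beta\alpha}R^\lambda_{i\overline\beta}R^\lambda_{\alpha\overline\jmath})\,g\,dV.$$ *)

theory Defs
  imports
    "HOL-Analysis.Analysis"
    "HOL-Combinatorics.Permutations"
    "Jordan_Normal_Form.Gauss_Jordan_Elimination"
    "Jordan_Normal_Form.Determinant"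
    "Jordan_Normal_Form.Schur_Decomposition"
    "Jordan_Normal_Form.DL_Submatrix"
    "Graph_Theory.Arc_Walk"
begin

section \<open>Calculus on \<open>\<complex>\<^sup>I\<close>\<close>

text \<open>
  Complex affine space with a finite coordinate set \<open>I\<close> is the set of functions
  that vanish off \<open>I\<close>; thus \<open>\<complex>\<^sup>n\<close> is \<open>cspace {..<n}\<close>, with \<open>n\<close> an ordinary natural
  number, and \<open>\<complex>\<^sup>n \<times> \<complex>\<^sup>N\<close> is \<open>cspace ({..<n} <+> {..<N})\<close>. Points of the latter are
  written \<open>case_sum z s\<close>. The topology is the product topology.
\<close>

definition cspace :: "'i set \<Rightarrow> ('i \<Rightarrow> complex) set" where
  "cspace I = {w. \<forall>A. A \<notin> I \<longrightarrow> w A = 0}"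

abbreviation copen :: "'i set \<Rightarrow> ('i \<Rightarrow> complex) set \<Rightarrow> bool" where
  "copen I D \<equiv> openin (top_of_set (cspace I)) D"

abbreviation prod_idx :: "nat \<Rightarrow> nat \<Rightarrow> (nat + nat) set" where
  "prod_idx n N \<equiv> {..<n} <+> {..<N}"

definition axis_vec :: "'i \<Rightarrow> complex \<Rightarrow> 'i \<Rightarrow> complex" where
  "axis_vec A c = (\<lambda>B. if B = A then c else 0)"

text \<open>Real directional derivative, and the Wirtinger derivatives built from it.\<close>

definition dir_deriv :: "('i \<Rightarrow> complex) \<Rightarrow> (('i \<Rightarrow> complex) \<Rightarrow> complex) \<Rightarrow> ('i \<Rightarrow> complex) \<Rightarrow> complex" where
  "dir_deriv u f w = vector_derivative (\<lambda>t::real. f (\<lambda>A. w A + of_real t * u A)) (at 0)"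

definition dz :: "'i \<Rightarrow> (('i \<Rightarrow> complex) \<Rightarrow> complex) \<Rightarrow> ('i \<Rightarrow> complex) \<Rightarrow> complex" where
  "dz A f w = (dir_deriv (axis_vec A 1) f w - \<i> * dir_deriv (axis_vec A \<i>) f w) / 2"

definition dzb :: "'i \<Rightarrow> (('i \<Rightarrow> complex) \<Rightarrow> complex) \<Rightarrow> ('i \<Rightarrow> complex) \<Rightarrow> complex" where
  "dzb A f w = (dir_deriv (axis_vec A 1) f w + \<i> * dir_deriv (axis_vec A \<i>) f w) / 2"

definition hol_on :: "'i set \<Rightarrow> ('i \<Rightarrow> complex) set \<Rightarrow> (('i \<Rightarrow> complex) \<Rightarrow> complex) \<Rightarrow> bool" where
  "hol_on I D f \<longleftrightarrow> continuous_on D f \<and>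
     (\<forall>w\<in>D. \<forall>A\<in>I. (\<lambda>\<zeta>. f (w(A := \<zeta>))) field_differentiable (at (w A)))"

text \<open>Class \<open>C\<^sup>m\<close>: all iterated real partial derivatives up to order \<open>m\<close> exist and are continuous.\<close>

primrec C_on :: "nat \<Rightarrow> 'i set \<Rightarrow> ('i \<Rightarrow> complex) set \<Rightarrow> (('i \<Rightarrow> complex) \<Rightarrow> complex) \<Rightarrow> bool" where
  "C_on 0 I D f \<longleftrightarrow> continuous_on D f"
| "C_on (Suc m) I D f \<longleftrightarrow> continuous_on D f \<and>
     (\<forall>A\<in>I. \<forall>c\<in>{1, \<i>}.
        (\<forall>w\<in>D. (\<lambda>t::real. f (\<lambda>B. w B + of_real t * axis_vec A c B)) differentiable (at 0)) \<and>
        C_on m I D (dir_deriv (axis_vec A c) f))"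

definition smooth_on :: "'i set \<Rightarrow> ('i \<Rightarrow> complex) set \<Rightarrow> (('i \<Rightarrow> complex) \<Rightarrow> complex) \<Rightarrow> bool" where
  "smooth_on I D f \<longleftrightarrow> (\<forall>m. C_on m I D f)"

section \<open>Exterior forms\<close>

text \<open>
  A complex-valued exterior form of degree \<open>p\<close> at a point is a function of a sequence of
  tangent vectors, alternating and real multilinear in the first \<open>p\<close> of them.
  Normalisation: \<open>(\<alpha> \<and> \<beta>)(v\<^sub>0, v\<^sub>1) = \<alpha>(v\<^sub>0)\<beta>(v\<^sub>1) - \<alpha>(v\<^sub>1)\<beta>(v\<^sub>0)\<close> for 1-forms.
\<close>

type_synonym 'i form = "(nat \<Rightarrow> 'i \<Rightarrow> complex) \<Rightarrow> complex"

definition wedge :: "nat \<Rightarrow> nat \<Rightarrow> 'i form \<Rightarrow> 'i form \<Rightarrow> 'i form" where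
  "wedge p q \<alpha> \<beta> v =
     (\<Sum>\<pi> | \<pi> permutes {..<p + q}.
        of_int (sign \<pi>) * \<alpha> (\<lambda>k. v (\<pi> k)) * \<beta> (\<lambda>k. v (\<pi> (p + k)))) / (fact p * fact q)"

primrec wedge_power2 :: "'i form \<Rightarrow> nat \<Rightarrow> 'i form" where
  "wedge_power2 \<omega> 0 = (\<lambda>_. 1)"
| "wedge_power2 \<omega> (Suc m) = wedge 2 (2 * m) \<omega> (wedge_power2 \<omega> m)"

text \<open>The form \<open>\<Sum> M\<^sub>A\<^sub>B dw\<^sup>A \<and> d(cnj w\<^sup>B)\<close> for \<open>A, B \<in> I\<close>.\<close>

definition form11 :: "'i set \<Rightarrow> ('i \<Rightarrow> 'i \<Rightarrow> complex) \<Rightarrow> 'i form" where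
  "form11 I M v = (\<Sum>A\<in>I. \<Sum>B\<in>I. M A B * wedge 1 1 (\<lambda>u. u 0 A) (\<lambda>u. cnj (u 0 B)) v)"

definition del_delbar :: "nat \<Rightarrow> ((nat \<Rightarrow> complex) \<Rightarrow> complex) \<Rightarrow> (nat \<Rightarrow> complex) \<Rightarrow> nat form" where
  "del_delbar N f s = form11 {..<N} (\<lambda>i j. dz i (dzb j f) s)"

text \<open>The exterior derivative of a 2-form, evaluated on three constant vector fields.\<close>

definition ext_deriv2 :: "((nat \<Rightarrow> complex) \<Rightarrow> nat form) \<Rightarrow> (nat \<Rightarrow> complex) \<Rightarrow> nat form" where
  "ext_deriv2 \<omega> z v =
     dir_deriv (v 0) (\<lambda>y. \<omega> y (\<lambda>k. if k = 0 then v 1 else v 2)) z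
   - dir_deriv (v 1) (\<lambda>y. \<omega> y (\<lambda>k. if k = 0 then v 0 else v 2)) z
   + dir_deriv (v 2) (\<lambda>y. \<omega> y (\<lambda>k. if k = 0 then v 0 else v 1)) z"

section \<open>Reduced complex spaces and complex manifolds\<close>

datatype 'x chart = Chart (cdom: "'x set") (ccoord: "'x \<Rightarrow> nat \<Rightarrow> complex") (cdim: nat)

definition cinv :: "'x chart \<Rightarrow> (nat \<Rightarrow> complex) \<Rightarrow> 'x" where
  "cinv b = inv_into (cdom b) (ccoord b)"

definition cimage :: "'x chart \<Rightarrow> (nat \<Rightarrow> complex) set" where
  "cimage b = ccoord b ` cdom b"

definition topological_chart :: "'x::topological_space chart \<Rightarrow> bool" where
  "topological_chart b \<longleftrightarrow> open (cdom b) \<and> inj_on (ccoord b) (cdom b) \<and>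
     cimage b \<subseteq> cspace {..<cdim b} \<and>
     homeomorphism (cdom b) (cimage b) (ccoord b) (cinv b)"

definition analytic_subset :: "'i set \<Rightarrow> ('i \<Rightarrow> complex) set \<Rightarrow> ('i \<Rightarrow> complex) set \<Rightarrow> bool" where
  "analytic_subset I D Z \<longleftrightarrow> Z \<subseteq> D \<and>
     (\<forall>p\<in>D. \<exists>V F. copen I V \<and> p \<in> V \<and> V \<subseteq> D \<and> finite F \<and> (\<forall>f\<in>F. hol_on I V f) \<and>
        Z \<inter> V = {w\<in>V. \<forall>f\<in>F. f w = 0})"

text \<open>The coordinate change is locally the restriction of a holomorphic map of the ambient spaces.\<close>

definition hol_transition :: "'x chart \<Rightarrow> 'x chart \<Rightarrow> bool" where
  "hol_transition b b' \<longleftrightarrow>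
     (\<forall>x\<in>cdom b \<inter> cdom b'. \<exists>D F. copen {..<cdim b} D \<and> ccoord b x \<in> D \<and>
        (\<forall>i<cdim b'. hol_on {..<cdim b} D (\<lambda>w. F w i)) \<and>
        (\<forall>y\<in>cdom b \<inter> cdom b'. ccoord b y \<in> D \<longrightarrow> (\<forall>i<cdim b'. ccoord b' y i = F (ccoord b y) i)))"

definition maximal_atlas :: "('x::topological_space chart \<Rightarrow> bool) \<Rightarrow> 'x chart set \<Rightarrow> bool" where
  "maximal_atlas model A \<longleftrightarrow>
     (\<Union>b\<in>A. cdom b) = UNIV \<and>
     (\<forall>b\<in>A. topological_chart b \<and> model b) \<and>
     (\<forall>b\<in>A. \<forall>b'\<in>A. hol_transition b b') \<and>
     (\<forall>b. topological_chart b \<and> model b \<and> (\<forall>b'\<in>A. hol_transition b b' \<and> hol_transition b' b)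
        \<longrightarrow> b \<in> A)"

text \<open>
  A reduced complex space is locally an analytic subset of an open set of some \<open>\<complex>\<^sup>N\<close>, with the
  restrictions of ambient holomorphic functions as structure sheaf. The dimension \<open>N\<close> of the
  ambient space depends on the chart; all local embeddings belong to the atlas, in
  particular those of minimal dimension.
\<close>

definition reduced_complex_space :: "'s::t2_space chart set \<Rightarrow> bool" where
  "reduced_complex_space A \<longleftrightarrow>
     maximal_atlas (\<lambda>c. \<exists>D. copen {..<cdim c} D \<and> analytic_subset {..<cdim c} D (cimage c)) A"

definition complex_manifold :: "nat \<Rightarrow> 'x::t2_space chart set \<Rightarrow> bool" where
  "complex_manifold n A \<longleftrightarrow>
     maximal_atlas (\<lambda>b. cdim b = n \<and> copen {..<n} (cimage b)) A"

definition hol_fun :: "'x::topological_space chart set \<Rightarrow> 'x set \<Rightarrow> ('x \<Rightarrow> complex) \<Rightarrow> bool" where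
  "hol_fun A U f \<longleftrightarrow>
     (\<forall>b\<in>A. hol_on {..<cdim b} (ccoord b ` (cdom b \<inter> U)) (\<lambda>z. f (cinv b z)))"

definition smooth_fun :: "'x::topological_space chart set \<Rightarrow> 'x set \<Rightarrow> ('x \<Rightarrow> complex) \<Rightarrow> bool" where
  "smooth_fun A U f \<longleftrightarrow>
     (\<forall>b\<in>A. smooth_on {..<cdim b} (ccoord b ` (cdom b \<inter> U)) (\<lambda>z. f (cinv b z)))"

text \<open>
  Functions on an open subset \<open>U\<close> of \<open>X \<times> S\<close> which in local coordinates extend locally to
  functions of class \<open>P\<close> on the ambient space \<open>\<complex>\<^sup>n \<times> \<complex>\<^sup>N\<close>.
\<close>

definition locally_extends ::
  "((nat + nat) set \<Rightarrow> (nat + nat \<Rightarrow> complex) set \<Rightarrow> ((nat + nat \<Rightarrow> complex) \<Rightarrow> complex) \<Rightarrow> bool) \<Rightarrow>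
   'x chart set \<Rightarrow> 's chart set \<Rightarrow> ('x \<times> 's) set \<Rightarrow> ('x \<times> 's \<Rightarrow> complex) \<Rightarrow> bool" where
  "locally_extends P AX AS U f \<longleftrightarrow>
     (\<forall>b\<in>AX. \<forall>c\<in>AS. \<forall>(x, s) \<in> U \<inter> cdom b \<times> cdom c.
        \<exists>D F. copen (prod_idx (cdim b) (cdim c)) D \<and> case_sum (ccoord b x) (ccoord c s) \<in> D \<and>
          P (prod_idx (cdim b) (cdim c)) D F \<and>
          (\<forall>(y, t) \<in> U \<inter> cdom b \<times> cdom c. case_sum (ccoord b y) (ccoord c t) \<in> D \<longrightarrow>
             f (y, t) = F (case_sum (ccoord b y) (ccoord c t))))"

section \<open>Integration on a compact complex manifold\<close>

text \<open>Lebesgue measure on \<open>\<complex>\<^sup>n\<close>.\<close>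

definition lebesgue_C :: "nat \<Rightarrow> (nat \<Rightarrow> complex) measure" where
  "lebesgue_C n = distr (PiM {..<n} (\<lambda>_. lborel)) borel (\<lambda>z i. if i < n then z i else 0)"

text \<open>The positively oriented real frame \<open>e\<^sub>0, \<i>e\<^sub>0, e\<^sub>1, \<i>e\<^sub>1, \<dots>\<close> of \<open>\<complex>\<^sup>n\<close>.\<close>

definition real_frame :: "nat \<Rightarrow> nat \<Rightarrow> complex" where
  "real_frame k = axis_vec (k div 2) (if even k then 1 else \<i>)"

definition partition_of_unity :: "'x::topological_space chart set \<Rightarrow> ('x chart \<times> ('x \<Rightarrow> real)) list \<Rightarrow> bool" where
  "partition_of_unity A P \<longleftrightarrow>
     (\<forall>(b, \<rho>) \<in> set P. b \<in> A \<and> continuous_on UNIV \<rho> \<and> (\<forall>x. 0 \<le> \<rho> x) \<and>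
        closure {x. \<rho> x \<noteq> 0} \<subseteq> cdom b) \<and>
     (\<forall>x. (\<Sum>k<length P. snd (P ! k) x) = 1)"

text \<open>\<open>\<eta> k z\<close> is the density, with respect to Lebesgue measure, in the \<open>k\<close>-th chart of \<open>P\<close>.\<close>

definition pou_integral ::
  "nat \<Rightarrow> ('x chart \<times> ('x \<Rightarrow> real)) list \<Rightarrow> (nat \<Rightarrow> (nat \<Rightarrow> complex) \<Rightarrow> complex) \<Rightarrow> complex" where
  "pou_integral n P \<eta> =
     (\<Sum>k<length P. LINT z : cimage (fst (P ! k)) | lebesgue_C n.
        of_real (snd (P ! k) (cinv (fst (P ! k)) z)) * \<eta> k z)"

text \<open>Integral of a top-degree form, given by its densities in the charts of the atlas.\<close>

definition mfd_integral ::
  "nat \<Rightarrow> 'x::topological_space chart set \<Rightarrow> ('x chart \<Rightarrow> (nat \<Rightarrow> complex) \<Rightarrow> complex) \<Rightarrow> complex" where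
  "mfd_integral n A \<eta> =
     (let P = (SOME P. partition_of_unity A P) in pou_integral n P (\<lambda>k. \<eta> (fst (P ! k))))"

text \<open>
  Fibre integral of forms of degree \<open>2n + q\<close> on \<open>X \<times> \<complex>\<^sup>N\<close> (\<open>q\<close> is implicit); \<open>\<Theta> k\<close>
  is the form on the \<open>k\<close>-th coordinate chart of \<open>P\<close>. The vectors \<open>v 0, \<dots>, v (q - 1)\<close> are tangent
  to the base.
\<close>

definition fiber_integral ::
  "nat \<Rightarrow> ('x chart \<times> ('x \<Rightarrow> real)) list \<Rightarrow> (nat \<Rightarrow> (nat + nat \<Rightarrow> complex) \<Rightarrow> (nat + nat) form) \<Rightarrow>
   (nat \<Rightarrow> complex) \<Rightarrow> nat form" where
  "fiber_integral n P \<Theta> s v =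
     pou_integral n P (\<lambda>k z. \<Theta> k (case_sum z s)
       (\<lambda>m. if m < 2 * n then case_sum (real_frame m) (\<lambda>_. 0)
            else case_sum (\<lambda>_. 0) (v (m - 2 * n))))"

section \<open>Matrices, connections and curvature\<close>

definition minv :: "complex mat \<Rightarrow> complex mat" where
  "minv M = the (mat_inverse M)"

definition mtrace :: "complex mat \<Rightarrow> complex" where
  "mtrace M = (\<Sum>i<dim_row M. M $$ (i, i))"

definition pos_hermitian :: "nat \<Rightarrow> complex mat \<Rightarrow> bool" where
  "pos_hermitian r M \<longleftrightarrow> M \<in> carrier_mat r r \<and> mat_adjoint M = M \<and>
     (\<forall>v\<in>carrier_vec r. v \<noteq> 0\<^sub>v r \<longrightarrow> 0 < Re ((M *\<^sub>v v) \<bullet>c v))"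

definition mat_fun_class ::
  "(('p \<Rightarrow> complex) \<Rightarrow> bool) \<Rightarrow> nat \<Rightarrow> nat \<Rightarrow> ('p \<Rightarrow> complex mat) \<Rightarrow> bool" where
  "mat_fun_class C r c M \<longleftrightarrow> (\<forall>i<r. \<forall>l<c. C (\<lambda>p. M p $$ (i, l)))"

text \<open>Entrywise application of a first-order differential operator to a matrix-valued function.\<close>

definition mder :: "(('p \<Rightarrow> complex) \<Rightarrow> 'p \<Rightarrow> complex) \<Rightarrow> ('p \<Rightarrow> complex mat) \<Rightarrow> 'p \<Rightarrow> complex mat" where
  "mder d M w = Matrix.mat (dim_row (M w)) (dim_col (M w)) (\<lambda>(i, l). d (\<lambda>y. M y $$ (i, l)) w)"

text \<open>
  In a local holomorphic frame, a hermitian metric is given by a matrix \<open>H\<close> with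
  \<open>\<langle>u, v\<rangle> = v\<^sup>* H u\<close>. Hence the adjoint of \<open>\<phi>\<close> is \<open>H\<^sub>t\<^sup>-\<^sup>1 \<phi>\<^sup>* H\<^sub>h\<close> (\<open>t\<close>, \<open>h\<close>: source and target),
  and the Chern connection has the \<open>(1,0)\<close>-part \<open>\<partial> + H\<^sup>-\<^sup>1 \<partial>H\<close> and the \<open>(0,1)\<close>-part \<open>\<partial>bar\<close>.
  The functions \<open>nabla\<close>, \<open>nabla_bar\<close> act on matrices whose columns are sections.
\<close>

definition adj :: "complex mat \<Rightarrow> complex mat \<Rightarrow> complex mat \<Rightarrow> complex mat" where
  "adj Ht Hh \<phi> = minv Ht * mat_adjoint \<phi> * Hh"

definition conn :: "(('i \<Rightarrow> complex) \<Rightarrow> complex mat) \<Rightarrow> 'i \<Rightarrow> ('i \<Rightarrow> complex) \<Rightarrow> complex mat" where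
  "conn H A w = minv (H w) * mder (dz A) H w"

definition nabla ::
  "(('i \<Rightarrow> complex) \<Rightarrow> complex mat) \<Rightarrow> 'i \<Rightarrow> (('i \<Rightarrow> complex) \<Rightarrow> complex mat) \<Rightarrow> ('i \<Rightarrow> complex) \<Rightarrow> complex mat" where
  "nabla H A \<sigma> w = mder (dz A) \<sigma> w + conn H A w * \<sigma> w"

definition nabla_bar ::
  "'i \<Rightarrow> (('i \<Rightarrow> complex) \<Rightarrow> complex mat) \<Rightarrow> ('i \<Rightarrow> complex) \<Rightarrow> complex mat" where
  "nabla_bar B \<sigma> w = mder (dzb B) \<sigma> w"

text \<open>The components \<open>R\<^sub>A\<^sub>B = [\<nabla>\<^sub>A, \<nabla>\<^sub>B\<^sub>b\<^sub>a\<^sub>r]\<close>, obtained by applying the commutator to the frame itself.\<close>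

definition curv ::
  "(('i \<Rightarrow> complex) \<Rightarrow> complex mat) \<Rightarrow> 'i \<Rightarrow> 'i \<Rightarrow> ('i \<Rightarrow> complex) \<Rightarrow> complex mat" where
  "curv H A B w =
     (let e = (\<lambda>y. 1\<^sub>m (dim_row (H y)))
      in nabla H A (nabla_bar B e) w - nabla_bar B (nabla H A e) w)"

text \<open>
  The induced connection on \<open>Hom(E\<^sub>t, E\<^sub>h)\<close>; its \<open>(0,1)\<close>-part is \<open>nabla_bar\<close> because
  the frames are holomorphic.
\<close>

definition nabla_hom ::
  "(('i \<Rightarrow> complex) \<Rightarrow> complex mat) \<Rightarrow> (('i \<Rightarrow> complex) \<Rightarrow> complex mat) \<Rightarrow> 'i \<Rightarrow>
   (('i \<Rightarrow> complex) \<Rightarrow> complex mat) \<Rightarrow> ('i \<Rightarrow> complex) \<Rightarrow> complex mat" where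
  "nabla_hom Ht Hh A \<phi> w = mder (dz A) \<phi> w + conn Hh A w * \<phi> w - \<phi> w * conn Ht A w"

text \<open>The \<open>(a, b)\<close> entry of the curvature form, on \<open>\<complex>\<^sup>n \<times> \<complex>\<^sup>N\<close>.\<close>

definition curv_form ::
  "nat \<Rightarrow> nat \<Rightarrow> ((nat + nat \<Rightarrow> complex) \<Rightarrow> complex mat) \<Rightarrow> (nat + nat \<Rightarrow> complex) \<Rightarrow>
   nat \<Rightarrow> nat \<Rightarrow> (nat + nat) form" where
  "curv_form n N H w a b = form11 (prod_idx n N) (\<lambda>A B. curv H A B w $$ (a, b))"

definition c1_form ::
  "nat \<Rightarrow> nat \<Rightarrow> ((nat + nat \<Rightarrow> complex) \<Rightarrow> complex mat) \<Rightarrow> (nat + nat \<Rightarrow> complex) \<Rightarrow> (nat + nat) form" where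
  "c1_form n N H w v = \<i> / (2 * of_real pi) * (\<Sum>a<dim_row (H w). curv_form n N H w a a v)"

definition ch2_form ::
  "nat \<Rightarrow> nat \<Rightarrow> ((nat + nat \<Rightarrow> complex) \<Rightarrow> complex mat) \<Rightarrow> (nat + nat \<Rightarrow> complex) \<Rightarrow> (nat + nat) form" where
  "ch2_form n N H w v = 1 / 2 * (\<i> / (2 * of_real pi))\<^sup>2 *
     (\<Sum>a<dim_row (H w). \<Sum>b<dim_row (H w).
        wedge 2 2 (curv_form n N H w a b) (curv_form n N H w b a) v)"

section \<open>Kaehler forms and the vortex equation\<close>

text \<open>
  \<open>G $$ (\<alpha>, \<beta>)\<close> is the coefficient \<open>g\<^sub>\<alpha>\<^sub>\<beta>\<close> of \<open>\<omega>\<^sub>X = \<i> \<Sum> g\<^sub>\<alpha>\<^sub>\<beta> dz\<^sup>\<alpha> \<and> d(cnj z\<^sup>\<beta>)\<close>. The second (antiholomorphic) index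
  of \<open>g\<close> comes first in the inverse: \<open>g\<^sup>\<beta>\<^sup>\<alpha>\<close> is \<open>minv G $$ (\<beta>, \<alpha>)\<close>.
\<close>

definition kform :: "nat \<Rightarrow> complex mat \<Rightarrow> nat form" where
  "kform n G = form11 {..<n} (\<lambda>\<alpha> \<beta>. \<i> * G $$ (\<alpha>, \<beta>))"

text \<open>\<open>\<omega>\<^sub>X\<^sup>p / p!\<close>, and its pull-back to \<open>X \<times> S\<close>.\<close>

definition kform_power :: "nat \<Rightarrow> complex mat \<Rightarrow> nat \<Rightarrow> nat form" where
  "kform_power n G p v = wedge_power2 (kform n G) p v / fact p"

definition kform_power_pullback :: "nat \<Rightarrow> complex mat \<Rightarrow> nat \<Rightarrow> (nat + nat) form" where
  "kform_power_pullback n G p v = kform_power n G p (\<lambda>k. v k \<circ> Inl)"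

definition vol_density :: "nat \<Rightarrow> complex mat \<Rightarrow> complex" where
  "vol_density n G = kform_power n G n real_frame"

definition kaehler_metric ::
  "nat \<Rightarrow> 'x chart set \<Rightarrow> ('x chart \<Rightarrow> (nat \<Rightarrow> complex) \<Rightarrow> complex mat) \<Rightarrow> bool" where
  "kaehler_metric n A g \<longleftrightarrow>
     (\<forall>b\<in>A. (\<forall>z\<in>cimage b. pos_hermitian n (g b z)) \<and>
        mat_fun_class (smooth_on {..<n} (cimage b)) n n (g b) \<and>
        (\<forall>z\<in>cimage b. \<forall>v. (\<forall>k<3. v k \<in> cspace {..<n}) \<longrightarrow>
           ext_deriv2 (\<lambda>y. kform n (g b y)) z v = 0)) \<and>
     (\<forall>b\<in>A. \<forall>b'\<in>A. \<forall>x\<in>cdom b \<inter> cdom b'. \<forall>\<alpha><n. \<forall>\<beta><n.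
        g b (ccoord b x) $$ (\<alpha>, \<beta>) =
          (\<Sum>\<gamma><n. \<Sum>\<delta><n.
             dz \<alpha> (\<lambda>z. ccoord b' (cinv b z) \<gamma>) (ccoord b x) *
             cnj (dz \<beta> (\<lambda>z. ccoord b' (cinv b z) \<delta>) (ccoord b x)) *
             g b' (ccoord b' x) $$ (\<gamma>, \<delta>)))"

text \<open>
  The hermitian inner product on \<open>(1,1)\<close>-forms (given by coefficients), normalised so
  that \<open>|dz\<^sup>\<alpha> \<and> d(cnj z\<^sup>\<beta>)| = 1\<close> in a unitary coframe, i.e. \<open>|\<omega>\<^sub>X|\<^sup>2 = n\<close>; and \<open>\<Lambda>\<close>
  as the adjoint of \<open>f \<mapsto> f \<omega>\<^sub>X\<close>.
\<close>

definition inner11 ::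
  "nat \<Rightarrow> complex mat \<Rightarrow> (nat \<Rightarrow> nat \<Rightarrow> complex) \<Rightarrow> (nat \<Rightarrow> nat \<Rightarrow> complex) \<Rightarrow> complex" where
  "inner11 n G \<eta> \<xi> =
     (\<Sum>\<alpha><n. \<Sum>\<beta><n. \<Sum>\<gamma><n. \<Sum>\<delta><n.
        minv G $$ (\<gamma>, \<alpha>) * minv G $$ (\<beta>, \<delta>) * \<eta> \<alpha> \<beta> * cnj (\<xi> \<gamma> \<delta>))"

definition Lam :: "nat \<Rightarrow> complex mat \<Rightarrow> (nat \<Rightarrow> nat \<Rightarrow> complex) \<Rightarrow> complex" where
  "Lam n G \<eta> = (THE l. \<forall>f. l * cnj f = inner11 n G \<eta> (\<lambda>\<gamma> \<delta>. f * (\<i> * G $$ (\<gamma>, \<delta>))))"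

text \<open>\<open>\<i>\<Lambda>F\<close> at the point \<open>z\<close> for the metric \<open>H\<close> in a holomorphic frame over a chart.\<close>

definition iLamF ::
  "nat \<Rightarrow> complex mat \<Rightarrow> ((nat \<Rightarrow> complex) \<Rightarrow> complex mat) \<Rightarrow> (nat \<Rightarrow> complex) \<Rightarrow> complex mat" where
  "iLamF n G H z =
     Matrix.mat (dim_row (H z)) (dim_row (H z))
       (\<lambda>(i, l). \<i> * Lam n G (\<lambda>\<alpha> \<beta>. curv H \<alpha> \<beta> z $$ (i, l)))"

section \<open>Quiver bundles\<close>

definition locally_finite_quiver :: "('v, 'b) pre_digraph \<Rightarrow> bool" where
  "locally_finite_quiver Q \<longleftrightarrow> wf_digraph Q \<and>
     (\<forall>v\<in>verts Q. finite (in_arcs Q v) \<and> finite (out_arcs Q v))"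

text \<open>
  A relation is a finitely supported function on paths from a common tail \<open>u\<close> to a common head \<open>v\<close>.
  A path is the list of its arrows, the arrow applied first standing first.
\<close>

type_synonym ('v, 'b) relation = "'v \<times> 'v \<times> ('b list \<Rightarrow> complex)"

definition quiver_relations :: "('v, 'b) pre_digraph \<Rightarrow> ('v, 'b) relation set \<Rightarrow> bool" where
  "quiver_relations Q K \<longleftrightarrow>
     (\<forall>(u, v, r) \<in> K. u \<in> verts Q \<and> v \<in> verts Q \<and> finite {p. r p \<noteq> 0} \<and>
        (\<forall>p. r p \<noteq> 0 \<longrightarrow> pre_digraph.awalk Q u p v))"

primrec path_map :: "('b \<Rightarrow> complex mat) \<Rightarrow> nat \<Rightarrow> 'b list \<Rightarrow> complex mat" where
  "path_map f r [] = 1\<^sub>m r"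
| "path_map f r (a # p) = path_map f (dim_row (f a)) p * f a"

text \<open>
  Holomorphic families of quiver bundles over \<open>X \<times> S\<close>. Only finitely many of the bundles are nonzero,
  so all of them are trivialised over one open cover \<open>cover j\<close>: \<open>rk \<lambda> j\<close> is
  the rank over \<open>cover j\<close>, sections transform by \<open>u\<^sub>j = transition \<lambda> j k u\<^sub>k\<close>,
  and \<open>arrow a j\<close> is the matrix of the bundle map in the \<open>j\<close>-th frames.
\<close>

record ('v, 'b, 'j, 'x, 's) quiver_family =
  cover :: "'j \<Rightarrow> ('x \<times> 's) set"
  rk :: "'v \<Rightarrow> 'j \<Rightarrow> nat"
  transition :: "'v \<Rightarrow> 'j \<Rightarrow> 'j \<Rightarrow> 'x \<times> 's \<Rightarrow> complex mat"
  arrow :: "'b \<Rightarrow> 'j \<Rightarrow> 'x \<times> 's \<Rightarrow> complex mat"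

definition support_verts :: "('v, 'b) pre_digraph \<Rightarrow> ('v, 'b, 'j, 'x, 's) quiver_family \<Rightarrow> 'v set" where
  "support_verts Q E = {v\<in>verts Q. \<exists>j. cover E j \<noteq> {} \<and> rk E v j \<noteq> 0}"

definition support_arcs :: "('v, 'b) pre_digraph \<Rightarrow> ('v, 'b, 'j, 'x, 's) quiver_family \<Rightarrow> 'b set" where
  "support_arcs Q E =
     {a\<in>arcs Q. tail Q a \<in> support_verts Q E \<and> head Q a \<in> support_verts Q E}"

definition holomorphic_quiver_family ::
  "'x::topological_space chart set \<Rightarrow> 's::topological_space chart set \<Rightarrow> ('v, 'b) pre_digraph \<Rightarrow>
   ('v, 'b) relation set \<Rightarrow> ('v, 'b, 'j, 'x, 's) quiver_family \<Rightarrow> bool" where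
  "holomorphic_quiver_family AX AS Q K E \<longleftrightarrow>
     (\<forall>j. open (cover E j)) \<and> (\<Union>j. cover E j) = UNIV \<and> finite (support_verts Q E) \<and>
     (\<forall>v\<in>verts Q. \<forall>j k.
        (\<forall>p\<in>cover E j \<inter> cover E k.
           rk E v j = rk E v k \<and> transition E v j k p \<in> carrier_mat (rk E v j) (rk E v k)) \<and>
        mat_fun_class (locally_extends hol_on AX AS (cover E j \<inter> cover E k))
          (rk E v j) (rk E v k) (transition E v j k)) \<and>
     (\<forall>v\<in>verts Q. \<forall>j. \<forall>p\<in>cover E j. transition E v j j p = 1\<^sub>m (rk E v j)) \<and>
     (\<forall>v\<in>verts Q. \<forall>j k l. \<forall>p\<in>cover E j \<inter> cover E k \<inter> cover E l.
        transition E v j k p * transition E v k l p = transition E v j l p) \<and>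
     (\<forall>a\<in>arcs Q. \<forall>j.
        (\<forall>p\<in>cover E j. arrow E a j p \<in> carrier_mat (rk E (head Q a) j) (rk E (tail Q a) j)) \<and>
        mat_fun_class (locally_extends hol_on AX AS (cover E j))
          (rk E (head Q a) j) (rk E (tail Q a) j) (arrow E a j)) \<and>
     (\<forall>a\<in>arcs Q. \<forall>j k. \<forall>p\<in>cover E j \<inter> cover E k.
        arrow E a j p * transition E (tail Q a) j k p =
        transition E (head Q a) j k p * arrow E a k p) \<and>
     (\<forall>(u, v, r) \<in> K. \<forall>j. \<forall>p\<in>cover E j. \<forall>i<rk E v j. \<forall>l<rk E u j.
        (\<Sum>q | r q \<noteq> 0. r q * path_map (\<lambda>a. arrow E a j p) (rk E u j) q $$ (i, l)) = 0)"

text \<open>Hermitian metrics of class \<open>C\<^sup>\<infinity>\<close> on \<open>X \<times> S\<close>, in the frames of the cover.\<close>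

definition family_metric ::
  "'x::topological_space chart set \<Rightarrow> 's::topological_space chart set \<Rightarrow> ('v, 'b) pre_digraph \<Rightarrow>
   ('v, 'b, 'j, 'x, 's) quiver_family \<Rightarrow> ('v \<Rightarrow> 'j \<Rightarrow> 'x \<times> 's \<Rightarrow> complex mat) \<Rightarrow> bool" where
  "family_metric AX AS Q E h \<longleftrightarrow>
     (\<forall>v\<in>verts Q. \<forall>j.
        (\<forall>p\<in>cover E j. pos_hermitian (rk E v j) (h v j p)) \<and>
        mat_fun_class (locally_extends smooth_on AX AS (cover E j)) (rk E v j) (rk E v j) (h v j)) \<and>
     (\<forall>v\<in>verts Q. \<forall>j k. \<forall>p\<in>cover E j \<inter> cover E k.
        h v k p = mat_adjoint (transition E v j k p) * h v j p * transition E v j k p)"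

definition fiber_iLamF ::
  "nat \<Rightarrow> ('x chart \<Rightarrow> (nat \<Rightarrow> complex) \<Rightarrow> complex mat) \<Rightarrow> ('j \<Rightarrow> 'x \<times> 's \<Rightarrow> complex mat) \<Rightarrow>
   's \<Rightarrow> 'j \<Rightarrow> 'x chart \<Rightarrow> (nat \<Rightarrow> complex) \<Rightarrow> complex mat" where
  "fiber_iLamF n g h s j b z = iLamF n (g b z) (\<lambda>y. h j (cinv b y, s)) z"

definition vortex_equation ::
  "nat \<Rightarrow> 'x chart set \<Rightarrow> ('x chart \<Rightarrow> (nat \<Rightarrow> complex) \<Rightarrow> complex mat) \<Rightarrow>
   ('v, 'b) pre_digraph \<Rightarrow> ('v \<Rightarrow> nat) \<Rightarrow> ('v \<Rightarrow> real) \<Rightarrow>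
   ('v, 'b, 'j, 'x, 's) quiver_family \<Rightarrow> ('v \<Rightarrow> 'j \<Rightarrow> 'x \<times> 's \<Rightarrow> complex mat) \<Rightarrow> 's \<Rightarrow> bool" where
  "vortex_equation n AX g Q \<nu> \<tau> E h s \<longleftrightarrow>
     (\<forall>v\<in>support_verts Q E. \<forall>b\<in>AX. \<forall>x\<in>cdom b. \<forall>j. (x, s) \<in> cover E j \<longrightarrow>
        (let \<phi> = (\<lambda>a. arrow E a j (x, s));
             \<phi>s = (\<lambda>a. adj (h (tail Q a) j (x, s)) (h (head Q a) j (x, s)) (\<phi> a))
         in \<forall>i<rk E v j. \<forall>l<rk E v j.
              of_nat (\<nu> v) * fiber_iLamF n g (h v) s j b (ccoord b x) $$ (i, l)
              + (\<Sum>a\<in>in_arcs Q v. (\<phi> a * \<phi>s a) $$ (i, l))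
              - (\<Sum>a\<in>out_arcs Q v. (\<phi>s a * \<phi> a) $$ (i, l))
              = of_real (\<tau> v) * 1\<^sub>m (rk E v j) $$ (i, l)))"

section \<open>Coherent subsheaves and stability\<close>

text \<open>
  A holomorphic vector bundle on \<open>X\<close>, given by an open cover \<open>U\<close>, ranks \<open>r\<close> and a cocycle \<open>T\<close>.
  A section over \<open>W\<close> is the family of its coordinate vectors in the given frames, made
  extensional so that equality of sections over \<open>W\<close> is equality of functions.
\<close>

type_synonym ('j, 'x) sect = "'j \<Rightarrow> 'x \<Rightarrow> complex vec"
type_synonym ('j, 'x) subsheaf = "'x set \<Rightarrow> ('j, 'x) sect set"

definition sections ::
  "'x::topological_space chart set \<Rightarrow> ('j \<Rightarrow> 'x set) \<Rightarrow> ('j \<Rightarrow> nat) \<Rightarrow> ('j \<Rightarrow> 'j \<Rightarrow> 'x \<Rightarrow> complex mat) \<Rightarrow>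
   ('j, 'x) subsheaf" where
  "sections A U r T W = {\<sigma>.
     (\<forall>j. \<forall>x\<in>W \<inter> U j. \<sigma> j x \<in> carrier_vec (r j)) \<and>
     (\<forall>j k. \<forall>x\<in>W \<inter> U j \<inter> U k. \<sigma> j x = T j k x *\<^sub>v \<sigma> k x) \<and>
     (\<forall>j. \<forall>i<r j. hol_fun A (W \<inter> U j) (\<lambda>x. vec_index (\<sigma> j x) i)) \<and>
     (\<forall>j x. x \<notin> W \<inter> U j \<longrightarrow> \<sigma> j x = undefined)}"

definition sect_restrict :: "'x set \<Rightarrow> ('j, 'x) sect \<Rightarrow> ('j, 'x) sect" where
  "sect_restrict W \<sigma> = (\<lambda>j x. if x \<in> W then \<sigma> j x else undefined)"

definition lin_comb ::
  "('j \<Rightarrow> 'x set) \<Rightarrow> ('j \<Rightarrow> nat) \<Rightarrow> 'x set \<Rightarrow> nat \<Rightarrow> (nat \<Rightarrow> 'x \<Rightarrow> complex) \<Rightarrow> (nat \<Rightarrow> ('j, 'x) sect) \<Rightarrow>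
   ('j, 'x) sect" where
  "lin_comb U r W m f \<sigma> = (\<lambda>j x. if x \<in> W \<inter> U j
     then vec (r j) (\<lambda>i. \<Sum>l<m. f l x * vec_index (\<sigma> l j x) i) else undefined)"

definition submodule_sheaf ::
  "'x::topological_space chart set \<Rightarrow> ('j \<Rightarrow> 'x set) \<Rightarrow> ('j \<Rightarrow> nat) \<Rightarrow> ('j \<Rightarrow> 'j \<Rightarrow> 'x \<Rightarrow> complex mat) \<Rightarrow>
   ('j, 'x) subsheaf \<Rightarrow> bool" where
  "submodule_sheaf A U r T F \<longleftrightarrow>
     (\<forall>W. open W \<longrightarrow> F W \<subseteq> sections A U r T W \<and>
        (\<forall>m f \<sigma>. (\<forall>l<m. hol_fun A W (f l) \<and> \<sigma> l \<in> F W) \<longrightarrow> lin_comb U r W m f \<sigma> \<in> F W) \<and>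
        (\<forall>V. open V \<and> V \<subseteq> W \<longrightarrow> sect_restrict V ` F W \<subseteq> F V)) \<and>
     (\<forall>\<V>. (\<forall>V\<in>\<V>. open V) \<longrightarrow>
        (\<forall>\<sigma>\<in>sections A U r T (\<Union>\<V>). (\<forall>V\<in>\<V>. sect_restrict V \<sigma> \<in> F V) \<longrightarrow> \<sigma> \<in> F (\<Union>\<V>)))"

definition finite_type ::
  "'x::topological_space chart set \<Rightarrow> ('j \<Rightarrow> 'x set) \<Rightarrow> ('j \<Rightarrow> nat) \<Rightarrow> ('j, 'x) subsheaf \<Rightarrow> bool" where
  "finite_type A U r F \<longleftrightarrow>
     (\<forall>x. \<exists>W m \<tau>. open W \<and> x \<in> W \<and> (\<forall>l<m. \<tau> l \<in> F W) \<and>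
        (\<forall>V. open V \<and> V \<subseteq> W \<longrightarrow> (\<forall>\<sigma>\<in>F V. \<forall>y\<in>V. \<exists>V' f. open V' \<and> y \<in> V' \<and> V' \<subseteq> V \<and>
           (\<forall>l<m. hol_fun A V' (f l)) \<and> sect_restrict V' \<sigma> = lin_comb U r V' m f \<tau>)))"

definition relation_sheaf ::
  "'x::topological_space chart set \<Rightarrow> ('j \<Rightarrow> 'x set) \<Rightarrow> ('j \<Rightarrow> nat) \<Rightarrow> nat \<Rightarrow> (nat \<Rightarrow> ('j, 'x) sect) \<Rightarrow>
   'x set \<Rightarrow> (nat \<Rightarrow> 'x \<Rightarrow> complex) set" where
  "relation_sheaf A U r m \<tau> W =
     {f. (\<forall>l<m. hol_fun A W (f l)) \<and>
         (\<forall>j. \<forall>x\<in>W \<inter> U j. lin_comb U r W m f \<tau> j x = 0\<^sub>v (r j))}"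

text \<open>Coherence: finite type, and all sheaves of relations between finitely many local sections
  are of finite type.\<close>

definition coherent_subsheaf ::
  "'x::topological_space chart set \<Rightarrow> ('j \<Rightarrow> 'x set) \<Rightarrow> ('j \<Rightarrow> nat) \<Rightarrow> ('j \<Rightarrow> 'j \<Rightarrow> 'x \<Rightarrow> complex mat) \<Rightarrow>
   ('j, 'x) subsheaf \<Rightarrow> bool" where
  "coherent_subsheaf A U r T F \<longleftrightarrow> submodule_sheaf A U r T F \<and> finite_type A U r F \<and>
     (\<forall>W m \<tau>. open W \<and> (\<forall>l<m. \<tau> l \<in> F W) \<longrightarrow>
        (\<forall>x\<in>W. \<exists>W' (q :: nat) \<kappa>. open W' \<and> x \<in> W' \<and> W' \<subseteq> W \<and>
           (\<forall>i<q. \<kappa> i \<in> relation_sheaf A U r m \<tau> W') \<and>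
           (\<forall>V. open V \<and> V \<subseteq> W' \<longrightarrow> (\<forall>f\<in>relation_sheaf A U r m \<tau> V. \<forall>y\<in>V.
              \<exists>V' c. open V' \<and> y \<in> V' \<and> V' \<subseteq> V \<and> (\<forall>i<q. hol_fun A V' (c i)) \<and>
                (\<forall>l<m. \<forall>x'\<in>V'. f l x' = (\<Sum>i<q. c i x' * \<kappa> i l x'))))))"

text \<open>The generic rank: the largest number of local sections that are linearly independent at
  some point.\<close>

definition sheaf_rank :: "('j \<Rightarrow> 'x::topological_space set) \<Rightarrow> ('j \<Rightarrow> nat) \<Rightarrow> ('j, 'x) subsheaf \<Rightarrow> nat" where
  "sheaf_rank U r F = Max {q. \<exists>W \<sigma> j. \<exists>x\<in>W \<inter> U j. open W \<and> (\<forall>l<q. \<sigma> l \<in> F W) \<and>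
     (\<forall>c. (\<forall>i<r j. (\<Sum>l<q. c l * vec_index (\<sigma> l j x) i) = 0) \<longrightarrow> (\<forall>l<q. c l = 0))}"

text \<open>The component with index \<open>I\<close> of \<open>\<sigma>\<^sub>0 \<and> \<dots> \<and> \<sigma>\<^sub>q\<^sub>-\<^sub>1\<close> in the \<open>j\<close>-th frame, a minor of size \<open>q\<close>.\<close>

definition sect_minor ::
  "('j \<Rightarrow> nat) \<Rightarrow> nat \<Rightarrow> (nat \<Rightarrow> ('j, 'x) sect) \<Rightarrow> 'j \<Rightarrow> 'x \<Rightarrow> nat set \<Rightarrow> complex" where
  "sect_minor r q \<sigma> j x I =
     Determinant.det (submatrix (Matrix.mat (r j) q (\<lambda>(i, l). vec_index (\<sigma> l j x) i)) I UNIV)"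

definition minor_idx :: "nat \<Rightarrow> nat \<Rightarrow> nat set set" where
  "minor_idx r q = {I. I \<subseteq> {..<r} \<and> card I = q}"

text \<open>
  Writing \<open>q\<close> for the rank of \<open>F\<close>: \<open>wedge_coeff \<dots> W j \<theta> a \<sigma>\<close> states \<open>\<sigma>\<^sub>0 \<and> \<dots> \<and> \<sigma>\<^sub>q\<^sub>-\<^sub>1 = a \<theta>\<close> on \<open>W\<close>, where
  \<open>\<theta>\<close> is a section of the \<open>q\<close>-th exterior power in the \<open>j\<close>-th frame.
\<close>

definition wedge_coeff ::
  "'x::topological_space chart set \<Rightarrow> ('j \<Rightarrow> nat) \<Rightarrow> nat \<Rightarrow> ('j, 'x) subsheaf \<Rightarrow> 'x set \<Rightarrow> 'j \<Rightarrow>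
   ('x \<Rightarrow> nat set \<Rightarrow> complex) \<Rightarrow> ('x \<Rightarrow> complex) \<Rightarrow> (nat \<Rightarrow> ('j, 'x) sect) \<Rightarrow> bool" where
  "wedge_coeff A r q F W j \<theta> a \<sigma> \<longleftrightarrow> (\<forall>l<q. \<sigma> l \<in> F W) \<and> hol_fun A W a \<and>
     (\<forall>y\<in>W. \<forall>I\<in>minor_idx (r j) q. sect_minor r q \<sigma> j y I = a y * \<theta> y I)"

text \<open>
  \<open>\<theta>\<close> generates over \<open>W\<close> the line bundle \<open>det F = (\<Lambda>\<^sup>q F)\<^sup>*\<^sup>*\<close>. The image of \<open>\<Lambda>\<^sup>q F\<close> in the exterior power of the
  bundle is \<open>J \<theta>\<close> for the ideal \<open>J\<close> of all coefficients \<open>a\<close>. The double dual of \<open>J \<theta>\<close> is generated by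
  \<open>\<theta>\<close> iff the elements of \<open>J\<close> have no common non-unit factor at any point (stalks are factorial).
\<close>

definition det_generator ::
  "'x::topological_space chart set \<Rightarrow> ('j \<Rightarrow> 'x set) \<Rightarrow> ('j \<Rightarrow> nat) \<Rightarrow> nat \<Rightarrow> ('j, 'x) subsheaf \<Rightarrow>
   'x set \<Rightarrow> 'j \<Rightarrow> ('x \<Rightarrow> nat set \<Rightarrow> complex) \<Rightarrow> bool" where
  "det_generator A U r q F W j \<theta> \<longleftrightarrow> open W \<and> W \<subseteq> U j \<and>
     (\<forall>I\<in>minor_idx (r j) q. hol_fun A W (\<lambda>x. \<theta> x I)) \<and>
     (\<forall>V. open V \<and> V \<subseteq> W \<and> V \<noteq> {} \<longrightarrow> (\<exists>y\<in>V. \<exists>I\<in>minor_idx (r j) q. \<theta> y I \<noteq> 0)) \<and>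
     (\<forall>V \<sigma>. open V \<and> V \<subseteq> W \<and> (\<forall>l<q. \<sigma> l \<in> F V) \<longrightarrow> (\<exists>a. wedge_coeff A r q F V j \<theta> a \<sigma>)) \<and>
     (\<forall>V f. open V \<and> V \<subseteq> W \<and> hol_fun A V f \<and>
        (\<forall>V' \<sigma> a. open V' \<and> V' \<subseteq> V \<and> wedge_coeff A r q F V' j \<theta> a \<sigma> \<longrightarrow>
           (\<exists>c. hol_fun A V' c \<and> (\<forall>y\<in>V'. a y = c y * f y)))
        \<longrightarrow> (\<forall>y\<in>V. f y \<noteq> 0))"

definition volume ::
  "nat \<Rightarrow> 'x::topological_space chart set \<Rightarrow> ('x chart \<Rightarrow> (nat \<Rightarrow> complex) \<Rightarrow> complex mat) \<Rightarrow> complex" where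
  "volume n A g = mfd_integral n A (\<lambda>b z. vol_density n (g b z))"

text \<open>
  The degree of a coherent subsheaf is the degree of its determinant bundle, computed with a hermitian metric on
  it: around each point \<open>x\<close> there is a generator \<open>\<theta> x\<close> over \<open>W x\<close>, whose squared length is \<open>\<eta> x\<close>;
  the lengths fit together on overlaps.
\<close>

definition sheaf_degree ::
  "nat \<Rightarrow> 'x::topological_space chart set \<Rightarrow> ('x chart \<Rightarrow> (nat \<Rightarrow> complex) \<Rightarrow> complex mat) \<Rightarrow>
   ('j \<Rightarrow> 'x set) \<Rightarrow> ('j \<Rightarrow> nat) \<Rightarrow> ('j, 'x) subsheaf \<Rightarrow> real \<Rightarrow> bool" where
  "sheaf_degree n A g U r F d \<longleftrightarrow>
     (\<exists>W j \<theta> (\<eta> :: 'x \<Rightarrow> 'x \<Rightarrow> real).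
        (\<forall>x. x \<in> W x \<and> det_generator A U r (sheaf_rank U r F) F (W x) (j x) (\<theta> x) \<and>
           smooth_fun A (W x) (\<lambda>y. of_real (\<eta> x y)) \<and> (\<forall>y\<in>W x. 0 < \<eta> x y)) \<and>
        (\<forall>x x' V \<sigma> a a'. open V \<and> V \<subseteq> W x \<inter> W x' \<and>
           wedge_coeff A r (sheaf_rank U r F) F V (j x) (\<theta> x) a \<sigma> \<and>
           wedge_coeff A r (sheaf_rank U r F) F V (j x') (\<theta> x') a' \<sigma> \<longrightarrow>
           (\<forall>y\<in>V. (cmod (a y))\<^sup>2 * \<eta> x y = (cmod (a' y))\<^sup>2 * \<eta> x' y)) \<and>
        d = Re (mfd_integral n A (\<lambda>b z.
              mtrace (iLamF n (g b z)
                (\<lambda>y. Matrix.mat 1 1 (\<lambda>_. of_real (\<eta> (cinv b z) (cinv b y)))) z)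
              * vol_density n (g b z)) / volume n A g))"

text \<open>Rank and degree of the member over \<open>s\<close> of one of the bundles of a family (\<open>X\<close> is connected).\<close>

definition fiber_rank :: "('v, 'b, 'j, 'x, 's) quiver_family \<Rightarrow> 's \<Rightarrow> 'v \<Rightarrow> nat" where
  "fiber_rank E s v = rk E v (SOME j. \<exists>x. (x, s) \<in> cover E j)"

definition fiber_degree ::
  "nat \<Rightarrow> 'x::topological_space chart set \<Rightarrow> ('x chart \<Rightarrow> (nat \<Rightarrow> complex) \<Rightarrow> complex mat) \<Rightarrow>
   ('v, 'b, 'j, 'x, 's) quiver_family \<Rightarrow> ('v \<Rightarrow> 'j \<Rightarrow> 'x \<times> 's \<Rightarrow> complex mat) \<Rightarrow> 's \<Rightarrow> 'v \<Rightarrow> real" where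
  "fiber_degree n A g E h s v =
     Re (mfd_integral n A (\<lambda>b z.
           mtrace (fiber_iLamF n g (h v) s (SOME j. (cinv b z, s) \<in> cover E j) b z)
           * vol_density n (g b z)) / volume n A g)"

definition coherent_Q_subsheaf ::
  "'x::topological_space chart set \<Rightarrow> ('v, 'b) pre_digraph \<Rightarrow> ('v, 'b, 'j, 'x, 's) quiver_family \<Rightarrow> 's \<Rightarrow>
   ('v \<Rightarrow> ('j, 'x) subsheaf) \<Rightarrow> bool" where
  "coherent_Q_subsheaf A Q E s F \<longleftrightarrow>
     (\<forall>v\<in>support_verts Q E.
        coherent_subsheaf A (\<lambda>j. {x. (x, s) \<in> cover E j}) (rk E v)
          (\<lambda>j k x. transition E v j k (x, s)) (F v)) \<and>
     (\<forall>a\<in>support_arcs Q E. \<forall>W. open W \<longrightarrow> (\<forall>\<sigma>\<in>F (tail Q a) W.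
        (\<lambda>j x. if x \<in> W \<and> (x, s) \<in> cover E j then arrow E a j (x, s) *\<^sub>v \<sigma> j x else undefined)
        \<in> F (head Q a) W))"

definition stable_member ::
  "nat \<Rightarrow> 'x::topological_space chart set \<Rightarrow> ('x chart \<Rightarrow> (nat \<Rightarrow> complex) \<Rightarrow> complex mat) \<Rightarrow>
   ('v, 'b) pre_digraph \<Rightarrow> ('v \<Rightarrow> nat) \<Rightarrow> ('v \<Rightarrow> real) \<Rightarrow>
   ('v, 'b, 'j, 'x, 's) quiver_family \<Rightarrow> ('v \<Rightarrow> 'j \<Rightarrow> 'x \<times> 's \<Rightarrow> complex mat) \<Rightarrow> 's \<Rightarrow> bool" where
  "stable_member n A g Q \<nu> \<tau> E h s \<longleftrightarrow>
     (\<Sum>v\<in>support_verts Q E.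
        real (\<nu> v) * fiber_degree n A g E h s v - \<tau> v * real (fiber_rank E s v)) = 0 \<and>
     (\<forall>F d. let U = (\<lambda>j. {x. (x, s) \<in> cover E j}); \<r> = (\<lambda>v. sheaf_rank U (rk E v) (F v)) in
        coherent_Q_subsheaf A Q E s F \<and>
        (\<forall>v\<in>support_verts Q E. sheaf_degree n A g U (rk E v) (F v) (d v)) \<and>
        0 < (\<Sum>v\<in>support_verts Q E. \<r> v) \<and>
        (\<Sum>v\<in>support_verts Q E. \<r> v) < (\<Sum>v\<in>support_verts Q E. fiber_rank E s v)
        \<longrightarrow> (\<Sum>v\<in>support_verts Q E. real (\<nu> v) * d v - \<tau> v * real (\<r> v)) < 0)"

section \<open>Local extensions to the ambient space, and the Weil-Petersson form\<close>

text \<open>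
  Forms on \<open>S\<close> and fibre integrals are evaluated in a chart \<open>C\<close> of \<open>S\<close> by means of
  local extensions of all data to the ambient space \<open>\<complex>\<^sup>N\<close>: \<open>ambient\<close> is an open subset of \<open>\<complex>\<^sup>N\<close>, and
  over the \<open>k\<close>-th chart of a partition of unity \<open>pieces\<close> of \<open>X\<close>, the arrows and
  metrics, in the frame with index \<open>frame_index k\<close>, are extended holomorphically and smoothly,
  respectively. If \<open>C\<close> is a chart of the regular locus (open image), then these extensions
  are just the coordinate expressions of the given arrows and metrics, and \<open>pou_integral\<close> is the
  usual definition of the integral over \<open>X\<close>.
\<close>

record ('v, 'b, 'j, 'x) ambient_extension =
  ambient :: "(nat \<Rightarrow> complex) set"
  pieces :: "('x chart \<times> ('x \<Rightarrow> real)) list"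
  frame_index :: "nat \<Rightarrow> 'j"
  ext_arrow :: "'b \<Rightarrow> nat \<Rightarrow> (nat + nat \<Rightarrow> complex) \<Rightarrow> complex mat"
  ext_metric :: "'v \<Rightarrow> nat \<Rightarrow> (nat + nat \<Rightarrow> complex) \<Rightarrow> complex mat"

definition local_extension ::
  "nat \<Rightarrow> 'x::topological_space chart set \<Rightarrow> 's chart \<Rightarrow> ('v, 'b) pre_digraph \<Rightarrow>
   ('v, 'b, 'j, 'x, 's) quiver_family \<Rightarrow> ('v \<Rightarrow> 'j \<Rightarrow> 'x \<times> 's \<Rightarrow> complex mat) \<Rightarrow>
   ('v, 'b, 'j, 'x) ambient_extension \<Rightarrow> bool" where
  "local_extension n AX C Q E h L \<longleftrightarrow>
     copen {..<cdim C} (ambient L) \<and> partition_of_unity AX (pieces L) \<and>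
     (\<forall>k<length (pieces L).
        let b = fst (pieces L ! k); j = frame_index L k; I = prod_idx n (cdim C);
            S0 = {s\<in>cdom C. ccoord C s \<in> ambient L};
            B = {case_sum z t | z t. z \<in> cimage b \<and> t \<in> ambient L}
        in cdom b \<times> S0 \<subseteq> cover E j \<and>
           (\<forall>v\<in>support_verts Q E.
              (\<forall>w\<in>B. pos_hermitian (rk E v j) (ext_metric L v k w)) \<and>
              mat_fun_class (smooth_on I B) (rk E v j) (rk E v j) (ext_metric L v k) \<and>
              (\<forall>x\<in>cdom b. \<forall>s\<in>S0.
                 ext_metric L v k (case_sum (ccoord b x) (ccoord C s)) = h v j (x, s))) \<and>
           (\<forall>a\<in>support_arcs Q E.
              (\<forall>w\<in>B. ext_arrow L a k w \<in> carrier_mat (rk E (head Q a) j) (rk E (tail Q a) j)) \<and>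
              mat_fun_class (hol_on I B) (rk E (head Q a) j) (rk E (tail Q a) j) (ext_arrow L a k) \<and>
              (\<forall>x\<in>cdom b. \<forall>s\<in>S0.
                 ext_arrow L a k (case_sum (ccoord b x) (ccoord C s)) = arrow E a j (x, s))))"

definition piece_metric ::
  "('x chart \<Rightarrow> (nat \<Rightarrow> complex) \<Rightarrow> complex mat) \<Rightarrow> ('v, 'b, 'j, 'x) ambient_extension \<Rightarrow>
   nat \<Rightarrow> (nat + nat \<Rightarrow> complex) \<Rightarrow> complex mat" where
  "piece_metric g L k w = g (fst (pieces L ! k)) (w \<circ> Inl)"

definition ext_adjoint ::
  "('v, 'b) pre_digraph \<Rightarrow> ('v, 'b, 'j, 'x) ambient_extension \<Rightarrow> 'b \<Rightarrow> nat \<Rightarrow>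
   (nat + nat \<Rightarrow> complex) \<Rightarrow> complex mat" where
  "ext_adjoint Q L a k w =
     adj (ext_metric L (tail Q a) k w) (ext_metric L (head Q a) k w) (ext_arrow L a k w)"

text \<open>The integrand of \<open>G\<^sub>i\<^sub>j\<close>, a form of degree \<open>2n\<close>.\<close>

definition wp_integrand ::
  "nat \<Rightarrow> ('x chart \<Rightarrow> (nat \<Rightarrow> complex) \<Rightarrow> complex mat) \<Rightarrow> ('v, 'b) pre_digraph \<Rightarrow> ('v \<Rightarrow> nat) \<Rightarrow>
   ('v, 'b, 'j, 'x, 's) quiver_family \<Rightarrow> ('v, 'b, 'j, 'x) ambient_extension \<Rightarrow> nat \<Rightarrow> nat \<Rightarrow>
   nat \<Rightarrow> (nat + nat \<Rightarrow> complex) \<Rightarrow> (nat + nat) form" where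
  "wp_integrand n g Q \<nu> E L i j k w u =
     ((\<Sum>a\<in>support_arcs Q E.
         mtrace (nabla_hom (ext_metric L (tail Q a) k) (ext_metric L (head Q a) k) (Inr i)
                   (ext_arrow L a k) w
                 * nabla_bar (Inr j) (ext_adjoint Q L a k) w))
      + (\<Sum>v\<in>support_verts Q E. of_nat (\<nu> v) *
           mtrace (Matrix.mat (dim_row (ext_metric L v k w)) (dim_row (ext_metric L v k w))
             (\<lambda>(p, q). \<Sum>\<alpha><n. \<Sum>\<beta><n. minv (piece_metric g L k w) $$ (\<beta>, \<alpha>) *
                (curv (ext_metric L v k) (Inr i) (Inl \<beta>) w *
                 curv (ext_metric L v k) (Inl \<alpha>) (Inr j) w) $$ (p, q)))))
     * kform_power_pullback n (piece_metric g L k w) n u"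

definition wp_coeff ::
  "nat \<Rightarrow> ('x chart \<Rightarrow> (nat \<Rightarrow> complex) \<Rightarrow> complex mat) \<Rightarrow> ('v, 'b) pre_digraph \<Rightarrow> ('v \<Rightarrow> nat) \<Rightarrow>
   ('v, 'b, 'j, 'x, 's) quiver_family \<Rightarrow> ('v, 'b, 'j, 'x) ambient_extension \<Rightarrow>
   (nat \<Rightarrow> complex) \<Rightarrow> nat \<Rightarrow> nat \<Rightarrow> complex" where
  "wp_coeff n g Q \<nu> E L s i j =
     fiber_integral n (pieces L) (wp_integrand n g Q \<nu> E L i j) s (\<lambda>_ _. 0)"

definition wp_form ::
  "nat \<Rightarrow> nat \<Rightarrow> ('x chart \<Rightarrow> (nat \<Rightarrow> complex) \<Rightarrow> complex mat) \<Rightarrow> ('v, 'b) pre_digraph \<Rightarrow> ('v \<Rightarrow> nat) \<Rightarrow>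
   ('v, 'b, 'j, 'x, 's) quiver_family \<Rightarrow> ('v, 'b, 'j, 'x) ambient_extension \<Rightarrow>
   (nat \<Rightarrow> complex) \<Rightarrow> nat form" where
  "wp_form n N g Q \<nu> E L s = form11 {..<N} (\<lambda>i j. \<i> * wp_coeff n g Q \<nu> E L s i j)"

definition fiber_ch2 ::
  "nat \<Rightarrow> nat \<Rightarrow> ('x chart \<Rightarrow> (nat \<Rightarrow> complex) \<Rightarrow> complex mat) \<Rightarrow>
   ('v, 'b, 'j, 'x) ambient_extension \<Rightarrow> 'v \<Rightarrow> (nat \<Rightarrow> complex) \<Rightarrow> nat form" where
  "fiber_ch2 n N g L v =
     fiber_integral n (pieces L) (\<lambda>k w.
       wedge 4 (2 * (n - 1)) (ch2_form n N (ext_metric L v k) w)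
         (kform_power_pullback n (piece_metric g L k w) (n - 1)))"

definition fiber_c1 ::
  "nat \<Rightarrow> nat \<Rightarrow> ('x chart \<Rightarrow> (nat \<Rightarrow> complex) \<Rightarrow> complex mat) \<Rightarrow>
   ('v, 'b, 'j, 'x) ambient_extension \<Rightarrow> 'v \<Rightarrow> (nat \<Rightarrow> complex) \<Rightarrow> nat form" where
  "fiber_c1 n N g L v =
     fiber_integral n (pieces L) (\<lambda>k w.
       wedge 2 (2 * n) (c1_form n N (ext_metric L v k) w)
         (kform_power_pullback n (piece_metric g L k w) n))"

definition fiber_norm2 ::
  "nat \<Rightarrow> ('x chart \<Rightarrow> (nat \<Rightarrow> complex) \<Rightarrow> complex mat) \<Rightarrow> ('v, 'b) pre_digraph \<Rightarrow>
   ('v, 'b, 'j, 'x) ambient_extension \<Rightarrow> 'b \<Rightarrow> (nat \<Rightarrow> complex) \<Rightarrow> complex" where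
  "fiber_norm2 n g Q L a s =
     fiber_integral n (pieces L) (\<lambda>k w u.
       mtrace (ext_arrow L a k w * ext_adjoint Q L a k w)
         * kform_power_pullback n (piece_metric g L k w) n u) s (\<lambda>_ _. 0)"

end

theory Submission
  imports Defs "HOL-Complex_Analysis.Cauchy_Integral_Formula"
begin

text \<open>
  Everything is checked pointwise on the pieces of the partition of unity, where the extensions of
  the metrics and arrows live. On a product chart, integrating \<open>tr(\<Omega> \<and> \<Omega>) \<and> \<omega>\<^sub>X\<^bsup>n-1\<^esup>\<close> along the fibers
  leaves the coefficients \<open>g\<^bsup>\<beta>\<alpha>\<^esup> tr(R\<^sub>\<alpha>\<^sub>\<beta> R\<^sub>i\<^sub>j) - g\<^bsup>\<beta>\<alpha>\<^esup> tr(R\<^sub>i\<^sub>\<beta> R\<^sub>\<alpha>\<^sub>j)\<close>. The second term is the curvature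
  part of the Weil-Petersson form, and the vortex equation replaces \<open>n\<^sub>\<lambda> g\<^bsup>\<beta>\<alpha>\<^esup> R\<^sub>\<alpha>\<^sub>\<beta>\<close> in the first term by
  \<open>\<tau>\<^sub>\<lambda> id - \<Sum> \<phi>\<phi>\<^sup>* + \<Sum> \<phi>\<^sup>*\<phi>\<close>. The constant gives the \<open>c\<^sub>1\<close> term. Commuting the covariant
  derivatives of the holomorphic \<open>\<phi>\<close> gives
  \<open>\<partial>\<^sub>i\<partial>\<^sub>j tr(\<phi>\<phi>\<^sup>*) = tr(\<phi>\<^sub>;\<^sub>i \<phi>\<^sup>*\<^sub>;\<^sub>j) + tr(\<phi>\<^sup>*\<phi> R\<^sub>i\<^sub>j) - tr(\<phi>\<phi>\<^sup>* R\<^sub>i\<^sub>j)\<close>, whose curvature terms are exactly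
  the remaining ones. Finally \<open>\<partial>\<^sub>i\<partial>\<^sub>j\<close> moves out of the fiber integral. (In all
  index pairs the second index is the antiholomorphic one.)
\<close>

section \<open>Wedge products of (1,1)-forms with powers of the Kaehler form\<close>

text \<open>If S is singular, the vortex equation is available only over points of S, while
  derivatives in base directions are taken in the ambient space. So it is never differentiated: it
  enters as a matrix identity over the single point \<open>t0\<close>, multiplied by R_ij and
  traced. What is differentiated is the squared norm of \<phi>, and for this the extended arrows are
  holomorphic and the extended metrics smooth on the whole ambient product. The constants match
  because \<open>ch2_form\<close> carries 1/2 (i/2pi)^2 = -1/(8 pi^2), cyclicity of the trace makes
  the four terms of tr(\<Omega> \<and> \<Omega>) agree in pairs, and writing \<omega>_X = i g dz
  \<and> dz-bar through the identity matrix costs a factor -i. Together this is i/(4 pi^2), the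
  factor of the coefficients in \<omega>_WP / (4 pi^2). Two facts depend on the form of the
  definitions. Differentiability is given along coordinate axes only, so mixed partials are commuted
  through two real parameters. Holomorphic means continuous and holomorphic in each variable
  separately, so smoothness of the arrows comes from Cauchy's integral formula.\<close>

text \<open>
  Up to normalization this is the product of the two-forms \<open>b 0, ..., b (m - 1)\<close>; the \<open>b k\<close> need not
  be antisymmetric, since the sum over all permutations antisymmetrizes them.
\<close>

definition alt_sum :: "nat \<Rightarrow> (nat \<Rightarrow> 'v \<Rightarrow> 'v \<Rightarrow> complex) \<Rightarrow> (nat \<Rightarrow> 'v) \<Rightarrow> complex" where
  "alt_sum m b v =
     (\<Sum>\<pi> | \<pi> permutes {..<2 * m}.
        of_int (sign \<pi>) * (\<Prod>k<m. b k (v (\<pi> (2 * k))) (v (\<pi> (2 * k + 1)))))"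

lemma permutes_lessThan_mem:
  assumes "\<pi> permutes {..<m::nat}" "k < m"
  shows "\<pi> k < m"
  using permutes_in_image[OF assms(1)] assms(2) by auto

lemma alt_sum_cong:
  assumes "\<And>k u w. k < m \<Longrightarrow> b k u w = b' k u w" "\<And>k. k < 2 * m \<Longrightarrow> v k = v' k"
  shows "alt_sum m b v = alt_sum m b' v'"
proof -
  have "\<pi> (2 * k) < 2 * m \<and> \<pi> (Suc (2 * k)) < 2 * m" if "\<pi> permutes {..<2 * m}" "k < m" for \<pi> k
    using permutes_lessThan_mem[OF that(1), of "2 * k"] permutes_lessThan_mem[OF that(1), of "Suc (2 * k)"] that(2)
    by auto
  then show ?thesis
    unfolding alt_sum_def by (intro sum.cong refl arg_cong2[where f = times] prod.cong) (auto simp: assms)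
qed

lemma of_int_sign_compose:
  assumes "\<pi> permutes S" "\<sigma> permutes S" "finite S"
  shows "(of_int (sign (\<pi> \<circ> \<sigma>)) :: complex) = of_int (sign \<pi>) * of_int (sign \<sigma>)"
  using sign_compose[of \<pi> \<sigma>] assms permutes_imp_permutation[OF assms(3)] by (metis of_int_mult)

lemma of_int_sign_square: "(of_int (sign \<pi>) :: complex) * of_int (sign \<pi>) = 1"
  by (simp add: sign_def)

lemma sum_swap3:
  "(\<Sum>x\<in>A. \<Sum>y\<in>B. \<Sum>z\<in>C. f x y z) = (\<Sum>z\<in>C. \<Sum>y\<in>B. \<Sum>x\<in>A. f x y z)"
proof -
  have "(\<Sum>x\<in>A. \<Sum>y\<in>B. \<Sum>z\<in>C. f x y z) = (\<Sum>x\<in>A. \<Sum>z\<in>C. \<Sum>y\<in>B. f x y z)"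
    by (intro sum.cong refl) (rule sum.swap)
  also have "\<dots> = (\<Sum>z\<in>C. \<Sum>x\<in>A. \<Sum>y\<in>B. f x y z)" by (rule sum.swap)
  also have "\<dots> = (\<Sum>z\<in>C. \<Sum>y\<in>B. \<Sum>x\<in>A. f x y z)"
    by (intro sum.cong refl) (rule sum.swap)
  finally show ?thesis .
qed

lemma sum_rotate3:
  "(\<Sum>x\<in>A. \<Sum>y\<in>B. \<Sum>z\<in>C. f x y z) = (\<Sum>y\<in>B. \<Sum>z\<in>C. \<Sum>x\<in>A. f x y z)"
  by (subst sum.swap) (rule sum.cong[OF refl], rule sum.swap)

lemma sum_swap4:
  "(\<Sum>w\<in>A. \<Sum>x\<in>B. \<Sum>y\<in>C. \<Sum>z\<in>D. f w x y z) = (\<Sum>y\<in>C. \<Sum>z\<in>D. \<Sum>w\<in>A. \<Sum>x\<in>B. f w x y z)"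
  by (rule trans[OF sum.cong[OF refl sum_rotate3] sum_rotate3])

text \<open>Lets a permutation act on the block of slots behind the first \<open>p\<close>.
  Induction over transpositions yields the sign, since a shifted transposition is again a
  transposition.\<close>

lemma shift_perm:
  fixes \<tau> :: "nat \<Rightarrow> nat" and p q :: nat
  assumes "\<tau> permutes {..<q}"
  defines "\<kappa> \<equiv> \<lambda>\<tau>' j. if j < p then j else p + \<tau>' (j - p)"
  shows "\<kappa> \<tau> permutes {..<p + q} \<and> sign (\<kappa> \<tau>) = sign \<tau>"
proof -
  have "finite {..<q}" by simp
  with assms(1) show ?thesis
  proof (induction rule: permutes_induct)
    case id
    have "\<kappa> id = id" by (auto simp: \<kappa>_def fun_eq_iff)
    then show ?case using permutes_id[of "{..<p + q}"] by (metis sign_id)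
  next
    case (swap a b \<sigma>)
    let ?t = "Transposition.transpose (p + a) (p + b)"
    have eq: "\<kappa> (Transposition.transpose a b \<circ> \<sigma>) = ?t \<circ> \<kappa> \<sigma>"
      using swap by (auto simp: \<kappa>_def fun_eq_iff Transposition.transpose_def)
    have t: "?t permutes {..<p + q}" using swap by (intro permutes_swap_id) auto
    have "sign ?t = -1" "sign (Transposition.transpose a b) = -1"
      using swap by (auto simp: sign_swap_id)
    moreover have "permutation (\<kappa> \<sigma>)" "permutation \<sigma>" "permutation ?t"
      using swap t by (auto intro: permutes_imp_permutation[of "{..<p+q}"] permutes_imp_permutation[of "{..<q}"])
    ultimately have "sign (?t \<circ> \<kappa> \<sigma>) = sign (Transposition.transpose a b \<circ> \<sigma>)"
      using swap by (simp add: sign_compose permutation_swap_id)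
    moreover have "?t \<circ> \<kappa> \<sigma> permutes {..<p + q}" using t swap by (intro permutes_compose) auto
    ultimately show ?case unfolding eq by blast
  qed
qed

text \<open>Permuting the arguments inside either factor can be absorbed into the outer sum over all
  slots, signs included. Hence each of the \<open>fact (2 * p) * fact (2 * q)\<close> pairs of inner
  permutations contributes the same total, and the denominator of \<open>wedge\<close>
  cancels.\<close>

lemma wedge_alt_sum:
  "wedge (2 * p) (2 * q) (alt_sum p b) (alt_sum q c) =
   alt_sum (p + q) (\<lambda>k. if k < p then b k else c (k - p))" (is "?l = ?r")
proof
  fix v :: "nat \<Rightarrow> 'a \<Rightarrow> complex"
  define d where "d = (\<lambda>k. if k < p then b k else c (k - p))"
  define F where "F \<pi> = of_int (sign \<pi>) * (\<Prod>k<p + q. d k (v (\<pi> (2 * k))) (v (\<pi> (2 * k + 1))))" for \<pi>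
  let ?S = "\<lambda>m. {\<pi>. \<pi> permutes {..<m::nat}}"
  have key: "(\<Sum>\<pi>\<in>?S (2 * p + 2 * q). of_int (sign \<pi>) *
      (of_int (sign \<sigma>) * (\<Prod>k<p. b k (v (\<pi> (\<sigma> (2 * k)))) (v (\<pi> (\<sigma> (2 * k + 1)))))) *
      (of_int (sign \<tau>) * (\<Prod>k<q. c k (v (\<pi> (2 * p + \<tau> (2 * k)))) (v (\<pi> (2 * p + \<tau> (2 * k + 1)))))))
     = alt_sum (p + q) d v" (is "?L = _")
    if st: "\<sigma> permutes {..<2 * p}" "\<tau> permutes {..<2 * q}" for \<sigma> \<tau>
  proof -
    define \<kappa> where "\<kappa> j = (if j < 2 * p then j else 2 * p + \<tau> (j - 2 * p))" for j
    have k: "\<kappa> permutes {..<2 * p + 2 * q}" "sign \<kappa> = sign \<tau>"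
      using shift_perm[OF st(2), of "2 * p"] by (simp_all add: \<kappa>_def[abs_def])
    have s: "\<sigma> permutes {..<2 * p + 2 * q}" using st(1) by (rule permutes_subset) auto
    \<comment> \<open>The block permutation with \<sigma> on the first 2p slots and \<tau> on the
      last 2q. It is what the inner permutations add to \<pi>.\<close>
    define \<mu> where "\<mu> = \<sigma> \<circ> \<kappa>"
    have m: "\<mu> permutes {..<2 * p + 2 * q}"
      unfolding \<mu>_def using k s by (intro permutes_compose)
    have sm: "(of_int (sign \<mu>) :: complex) = of_int (sign \<sigma>) * of_int (sign \<tau>)"
      unfolding \<mu>_def using of_int_sign_compose[OF s k(1)] k(2) by simp
    have m1: "\<mu> j = \<sigma> j" if "j < 2 * p" for j using that by (simp add: \<mu>_def \<kappa>_def)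
    have m2: "\<mu> (2 * p + j) = 2 * p + \<tau> j" for j
    proof -
      have "\<kappa> (2 * p + j) = 2 * p + \<tau> j" by (simp add: \<kappa>_def)
      moreover have "\<sigma> (2 * p + \<tau> j) = 2 * p + \<tau> j" by (rule permutes_not_in[OF st(1)]) simp
      ultimately show ?thesis unfolding \<mu>_def o_apply by (rule trans[OF arg_cong])
    qed
    have prod: "(\<Prod>k<p + q. d k (v (\<pi> (\<mu> (2 * k)))) (v (\<pi> (\<mu> (2 * k + 1))))) =
       (\<Prod>k<p. b k (v (\<pi> (\<sigma> (2 * k)))) (v (\<pi> (\<sigma> (2 * k + 1))))) *
       (\<Prod>k<q. c k (v (\<pi> (2 * p + \<tau> (2 * k)))) (v (\<pi> (2 * p + \<tau> (2 * k + 1)))))" for \<pi>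
    proof -
      have "{..<p + q} = {..<p} \<union> (\<lambda>k. p + k) ` {..<q}"
      proof (intro equalityI subsetI)
        fix x assume "x \<in> {..<p + q}"
        then show "x \<in> {..<p} \<union> (\<lambda>k. p + k) ` {..<q}"
          using image_eqI[of x "\<lambda>k. p + k" "x - p" "{..<q}"] by (cases "x < p") auto
      qed auto
      moreover have "{..<p} \<inter> (\<lambda>k. p + k) ` {..<q} = {}" by auto
      ultimately have "(\<Prod>k<p + q. d k (v (\<pi> (\<mu> (2 * k)))) (v (\<pi> (\<mu> (2 * k + 1))))) =
        (\<Prod>k<p. d k (v (\<pi> (\<mu> (2 * k)))) (v (\<pi> (\<mu> (2 * k + 1))))) *
        (\<Prod>k\<in>(\<lambda>k. p + k) ` {..<q}. d k (v (\<pi> (\<mu> (2 * k)))) (v (\<pi> (\<mu> (2 * k + 1)))))"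
        by (simp add: prod.union_disjoint)
      also have "(\<Prod>k\<in>(\<lambda>k. p + k) ` {..<q}. d k (v (\<pi> (\<mu> (2 * k)))) (v (\<pi> (\<mu> (2 * k + 1)))))
        = (\<Prod>k<q. d (p + k) (v (\<pi> (\<mu> (2 * (p + k))))) (v (\<pi> (\<mu> (2 * (p + k) + 1)))))"
        by (subst prod.reindex) (auto simp: inj_on_def)
      also have "\<dots> = (\<Prod>k<q. c k (v (\<pi> (2 * p + \<tau> (2 * k)))) (v (\<pi> (2 * p + \<tau> (2 * k + 1)))))"
        using m2 by (intro prod.cong refl) (simp only: distrib_left add.assoc m2, simp add: d_def)
      also have "(\<Prod>k<p. d k (v (\<pi> (\<mu> (2 * k)))) (v (\<pi> (\<mu> (2 * k + 1))))) =
          (\<Prod>k<p. b k (v (\<pi> (\<sigma> (2 * k)))) (v (\<pi> (\<sigma> (2 * k + 1)))))"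
        by (intro prod.cong refl) (auto simp: d_def m1)
      finally show ?thesis .
    qed
    have "?L = (\<Sum>\<pi>\<in>?S (2 * p + 2 * q). F (\<pi> \<circ> \<mu>))"
    proof (intro sum.cong refl)
      fix \<pi> assume "\<pi> \<in> ?S (2 * p + 2 * q)"
      then have "(of_int (sign (\<pi> \<circ> \<mu>)) :: complex) = of_int (sign \<pi>) * (of_int (sign \<sigma>) * of_int (sign \<tau>))"
        using of_int_sign_compose[of \<pi> _ \<mu>] m sm by simp
      then show "of_int (sign \<pi>) *
      (of_int (sign \<sigma>) * (\<Prod>k<p. b k (v (\<pi> (\<sigma> (2 * k)))) (v (\<pi> (\<sigma> (2 * k + 1)))))) *
      (of_int (sign \<tau>) * (\<Prod>k<q. c k (v (\<pi> (2 * p + \<tau> (2 * k)))) (v (\<pi> (2 * p + \<tau> (2 * k + 1))))))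
        = F (\<pi> \<circ> \<mu>)"
        unfolding F_def o_apply prod by simp
    qed
    also have "\<dots> = (\<Sum>\<pi>\<in>?S (2 * p + 2 * q). F \<pi>)"
      by (rule sum_permutations_compose_right[OF m, symmetric])
    also have "\<dots> = alt_sum (p + q) d v"
      by (simp add: alt_sum_def F_def)
    finally show ?thesis .
  qed
  have "wedge (2 * p) (2 * q) (alt_sum p b) (alt_sum q c) v * (fact (2 * p) * fact (2 * q)) =
    (\<Sum>\<pi>\<in>?S (2 * p + 2 * q). of_int (sign \<pi>) *
      (\<Sum>\<sigma>\<in>?S (2 * p). of_int (sign \<sigma>) * (\<Prod>k<p. b k (v (\<pi> (\<sigma> (2 * k)))) (v (\<pi> (\<sigma> (2 * k + 1)))))) *
      (\<Sum>\<tau>\<in>?S (2 * q). of_int (sign \<tau>) * (\<Prod>k<q. c k (v (\<pi> (2 * p + \<tau> (2 * k)))) (v (\<pi> (2 * p + \<tau> (2 * k + 1)))))))"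
    by (simp add: wedge_def alt_sum_def)
  also have "\<dots> = (\<Sum>\<sigma>\<in>?S (2 * p). \<Sum>\<tau>\<in>?S (2 * q). \<Sum>\<pi>\<in>?S (2 * p + 2 * q). of_int (sign \<pi>) *
      (of_int (sign \<sigma>) * (\<Prod>k<p. b k (v (\<pi> (\<sigma> (2 * k)))) (v (\<pi> (\<sigma> (2 * k + 1)))))) *
      (of_int (sign \<tau>) * (\<Prod>k<q. c k (v (\<pi> (2 * p + \<tau> (2 * k)))) (v (\<pi> (2 * p + \<tau> (2 * k + 1)))))))"
    unfolding sum_distrib_left sum_distrib_right
    by (subst sum_swap3) simp
  also have "\<dots> = (\<Sum>\<sigma>\<in>?S (2 * p). \<Sum>\<tau>\<in>?S (2 * q). alt_sum (p + q) d v)"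
    by (intro sum.cong refl key) auto
  also have "\<dots> = (fact (2 * p) * fact (2 * q)) * alt_sum (p + q) d v"
    by (simp add: card_permutations[OF refl])
  finally have "wedge (2 * p) (2 * q) (alt_sum p b) (alt_sum q c) v * (fact (2 * p) * fact (2 * q)) =
    (fact (2 * p) * fact (2 * q)) * alt_sum (p + q) d v" .
  then have "wedge (2 * p) (2 * q) (alt_sum p b) (alt_sum q c) v = alt_sum (p + q) d v"
    by (simp add: mult.commute)
  then show "wedge (2 * p) (2 * q) (alt_sum p b) (alt_sum q c) v = ?r v"
    unfolding d_def .
qed

text \<open>A coefficient matrix as a sesquilinear form: the (1,1)-form before antisymmetrization,
  which is how \<open>alt_sum\<close> takes its factors.\<close>

definition sesq :: "'i set \<Rightarrow> ('i \<Rightarrow> 'i \<Rightarrow> complex) \<Rightarrow> ('i \<Rightarrow> complex) \<Rightarrow> ('i \<Rightarrow> complex) \<Rightarrow> complex" where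
  "sesq I M u w = (\<Sum>A\<in>I. \<Sum>B\<in>I. M A B * u A * cnj (w B))"

lemma wedge11_eq:
  "wedge 1 1 (\<lambda>u. u 0 A) (\<lambda>u. cnj (u 0 B)) v = v 0 A * cnj (v 1 B) - v 1 A * cnj (v 0 B)"
proof -
  have s: "{..<Suc (Suc 0)} = insert 1 (insert 0 {})" by auto
  have "(\<Sum>\<pi> | \<pi> permutes {..<Suc (Suc 0)}. of_int (sign \<pi>) * v (\<pi> 0) A * cnj (v (\<pi> 1) B)) =
     v 0 A * cnj (v 1 B) - v 1 A * cnj (v 0 B)"
    unfolding s by (subst sum_over_permutations_insert) (auto simp: sign_swap_id permutes_sing)
  then show ?thesis by (simp add: wedge_def)
qed

lemma form11_eq: "form11 I M v = (\<Sum>A\<in>I. \<Sum>B\<in>I. M A B * (v 0 A * cnj (v 1 B) - v 1 A * cnj (v 0 B)))"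
  unfolding form11_def wedge11_eq ..

lemma alt_sum_1: "alt_sum (Suc 0) b v = b 0 (v 0) (v 1) - b 0 (v 1) (v 0)"
proof -
  have s: "{..<Suc (Suc 0)} = insert 1 (insert 0 {})" by auto
  have "(\<Sum>\<pi> | \<pi> permutes {..<Suc (Suc 0)}. of_int (sign \<pi>) * b 0 (v (\<pi> 0)) (v (\<pi> 1))) =
     b 0 (v 0) (v 1) - b 0 (v 1) (v 0)"
    unfolding s by (subst sum_over_permutations_insert) (auto simp: sign_swap_id permutes_sing)
  then show ?thesis by (simp add: alt_sum_def numeral_2_eq_2)
qed

lemma form11_alt_sum: "form11 I M = alt_sum 1 (\<lambda>_. sesq I M)"
proof
  fix v :: "nat \<Rightarrow> 'a \<Rightarrow> complex"
  show "form11 I M v = alt_sum 1 (\<lambda>_. sesq I M) v"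
    unfolding form11_eq One_nat_def alt_sum_1 sesq_def sum_subtractf[symmetric] right_diff_distrib mult.assoc ..
qed

text \<open>Each wedge with the two-form prepends one factor. For \<open>m = 0\<close> the only
  permutation is \<open>id\<close> and the empty product is 1.\<close>

lemma wedge_power2_alt_sum: "wedge_power2 (alt_sum 1 (\<lambda>_. b)) m = alt_sum m (\<lambda>_. b)"
proof (induction m)
  case 0
  have "{\<pi>. \<pi> permutes {..<0::nat}} = {id}" by auto
  then show ?case by (simp add: alt_sum_def fun_eq_iff del: permutes_empty)
next
  case (Suc m)
  show ?case
    using wedge_alt_sum[of 1 m "\<lambda>_. b" "\<lambda>_. b"] by (simp add: Suc[unfolded One_nat_def])
qed

lemma kform_power_pullback_eq:
  "kform_power_pullback n G p v =
     alt_sum p (\<lambda>_ u w. sesq {..<n} (\<lambda>\<alpha> \<beta>. \<i> * G $$ (\<alpha>, \<beta>)) (u \<circ> Inl) (w \<circ> Inl)) v / fact p"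
  unfolding kform_power_pullback_def kform_power_def kform_def form11_alt_sum wedge_power2_alt_sum
  by (simp only: alt_sum_def)

section \<open>Behaviour under permutation of the factors, and multilinear expansion\<close>

lemma alt_sum_transpose_left:
  assumes "a < m" "b < m" "a \<noteq> b"
  shows "alt_sum m (\<lambda>k u w. P (Transposition.transpose a b k) u * R k w) v = - alt_sum m (\<lambda>k u w. P k u * R k w) v"
proof -
  let ?t = "Transposition.transpose a b"
  let ?T = "Transposition.transpose (2 * a) (2 * b)"
  define F where "F \<pi> = of_int (sign \<pi>) * (\<Prod>k<m. P k (v (\<pi> (2 * k))) * R k (v (\<pi> (2 * k + 1))))" for \<pi>
  have T: "?T permutes {..<2 * m}" using assms by (intro permutes_swap_id) auto
  have t: "?t permutes {..<m}" using assms by (intro permutes_swap_id) auto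
  have sT: "sign ?T = -1" using assms by (simp add: sign_swap_id)
  have T1: "?T (2 * ?t k) = 2 * k" "?T (2 * k) = 2 * ?t k" "?T (2 * k + 1) = 2 * k + 1" for k
    by (auto simp: Transposition.transpose_def) presburger+
  have pr: "(\<Prod>k<m. P (?t k) (v (\<pi> (2 * k))) * R k (v (\<pi> (2 * k + 1)))) =
      (\<Prod>k<m. P k (v (\<pi> (?T (2 * k)))) * R k (v (\<pi> (?T (2 * k + 1)))))" for \<pi>
  proof -
    have "(\<Prod>k<m. P k (v (\<pi> (2 * ?t k)))) = (\<Prod>k<m. P (?t k) (v (\<pi> (2 * ?t (?t k)))))"
      by (rule prod.permute[OF t, unfolded o_def])
    then show ?thesis unfolding T1 prod.distrib by simp
  qed
  have "alt_sum m (\<lambda>k u w. P (?t k) u * R k w) v =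
     (\<Sum>\<pi> | \<pi> permutes {..<2 * m}. - F (\<pi> \<circ> ?T))"
    unfolding alt_sum_def F_def
  proof (intro sum.cong refl)
    fix \<pi> assume "\<pi> \<in> {\<pi>. \<pi> permutes {..<2 * m}}"
    then have "(of_int (sign (\<pi> \<circ> ?T)) :: complex) = - of_int (sign \<pi>)"
      using of_int_sign_compose[of \<pi> _ ?T] T sT by simp
    then show "of_int (sign \<pi>) * (\<Prod>k<m. P (?t k) (v (\<pi> (2 * k))) * R k (v (\<pi> (2 * k + 1)))) =
        - (of_int (sign (\<pi> \<circ> ?T)) * (\<Prod>k<m. P k (v ((\<pi> \<circ> ?T) (2 * k))) * R k (v ((\<pi> \<circ> ?T) (2 * k + 1)))))"
      unfolding pr by simp
  qed
  also have "\<dots> = - (\<Sum>\<pi> | \<pi> permutes {..<2 * m}. F \<pi>)"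
    unfolding sum_negf by (subst sum_permutations_compose_right[OF T]) simp
  finally show ?thesis by (simp add: F_def alt_sum_def)
qed

text \<open>As for the left factors, which sit in the even slots 2k: exchanging two right factors
  amounts to composing \<pi> with the transposition of the odd slots 2a + 1 and 2b + 1, whose sign
  is -1.\<close>

lemma alt_sum_transpose_right:
  assumes "a < m" "b < m" "a \<noteq> b"
  shows "alt_sum m (\<lambda>k u w. P k u * R (Transposition.transpose a b k) w) v = - alt_sum m (\<lambda>k u w. P k u * R k w) v"
proof -
  let ?t = "Transposition.transpose a b"
  let ?T = "Transposition.transpose (2 * a + 1) (2 * b + 1)"
  define F where "F \<pi> = of_int (sign \<pi>) * (\<Prod>k<m. P k (v (\<pi> (2 * k))) * R k (v (\<pi> (2 * k + 1))))" for \<pi>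
  have T: "?T permutes {..<2 * m}" using assms by (intro permutes_swap_id) auto
  have t: "?t permutes {..<m}" using assms by (intro permutes_swap_id) auto
  have sT: "sign ?T = -1" using assms by (simp add: sign_swap_id)
  have T1: "?T (2 * k + 1) = 2 * ?t k + 1" "?T (2 * k) = 2 * k" for k
    by (auto simp: Transposition.transpose_def) presburger+
  have pr: "(\<Prod>k<m. P k (v (\<pi> (2 * k))) * R (?t k) (v (\<pi> (2 * k + 1)))) =
      (\<Prod>k<m. P k (v (\<pi> (?T (2 * k)))) * R k (v (\<pi> (?T (2 * k + 1)))))" for \<pi>
  proof -
    have "(\<Prod>k<m. R k (v (\<pi> (2 * ?t k + 1)))) = (\<Prod>k<m. R (?t k) (v (\<pi> (2 * ?t (?t k) + 1))))"
      by (rule prod.permute[OF t, unfolded o_def])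
    then show ?thesis unfolding T1 prod.distrib by simp
  qed
  have "alt_sum m (\<lambda>k u w. P k u * R (?t k) w) v =
     (\<Sum>\<pi> | \<pi> permutes {..<2 * m}. - F (\<pi> \<circ> ?T))"
    unfolding alt_sum_def F_def
  proof (intro sum.cong refl)
    fix \<pi> assume "\<pi> \<in> {\<pi>. \<pi> permutes {..<2 * m}}"
    then have "(of_int (sign (\<pi> \<circ> ?T)) :: complex) = - of_int (sign \<pi>)"
      using of_int_sign_compose[of \<pi> _ ?T] T sT by simp
    then show "of_int (sign \<pi>) * (\<Prod>k<m. P k (v (\<pi> (2 * k))) * R (?t k) (v (\<pi> (2 * k + 1)))) =
        - (of_int (sign (\<pi> \<circ> ?T)) * (\<Prod>k<m. P k (v ((\<pi> \<circ> ?T) (2 * k))) * R k (v ((\<pi> \<circ> ?T) (2 * k + 1)))))"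
      unfolding pr by simp
  qed
  also have "\<dots> = - (\<Sum>\<pi> | \<pi> permutes {..<2 * m}. F \<pi>)"
    unfolding sum_negf by (subst sum_permutations_compose_right[OF T]) simp
  finally show ?thesis by (simp add: F_def alt_sum_def)
qed

text \<open>Induction over transpositions, with \<open>P\<close> kept general because each
  transposition relabels it.\<close>

lemma alt_sum_permute_left:
  assumes "\<sigma> permutes {..<m}"
  shows "alt_sum m (\<lambda>k u w. P (\<sigma> k) u * R k w) v = of_int (sign \<sigma>) * alt_sum m (\<lambda>k u w. P k u * R k w) v"
proof -
  have "finite {..<m}" by simp
  with assms show ?thesis
  proof (induction arbitrary: P rule: permutes_induct)
    case id
    show ?case by simp
  next
    case (swap a b \<sigma>)
    have t: "Transposition.transpose a b permutes {..<m}" using swap by (intro permutes_swap_id) auto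
    show ?case
      using swap.IH[of "\<lambda>k. P (Transposition.transpose a b k)"] alt_sum_transpose_left[of a m b P R v]
        of_int_sign_compose[OF t swap.hyps(4)] swap.hyps
      by (simp add: sign_swap_id o_def)
  qed
qed

lemma alt_sum_permute_right:
  assumes "\<sigma> permutes {..<m}"
  shows "alt_sum m (\<lambda>k u w. P k u * R (\<sigma> k) w) v = of_int (sign \<sigma>) * alt_sum m (\<lambda>k u w. P k u * R k w) v"
proof -
  have "finite {..<m}" by simp
  with assms show ?thesis
  proof (induction arbitrary: R rule: permutes_induct)
    case id
    show ?case by simp
  next
    case (swap a b \<sigma>)
    have t: "Transposition.transpose a b permutes {..<m}" using swap by (intro permutes_swap_id) auto
    show ?case
      using swap.IH[of "\<lambda>k. R (Transposition.transpose a b k)"] alt_sum_transpose_right[of a m b P R v]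
        of_int_sign_compose[OF t swap.hyps(4)] swap.hyps
      by (simp add: sign_swap_id o_def)
  qed
qed

text \<open>Exchanging two equal factors changes nothing and yet flips the sign.\<close>

lemma alt_sum_repeat_left:
  assumes "a < m" "b < m" "a \<noteq> b" "P a = P b"
  shows "alt_sum m (\<lambda>k u w. P k u * R k w) v = 0"
proof -
  have "P (Transposition.transpose a b k) = P k" for k
    using assms by (auto simp: Transposition.transpose_def)
  then have "alt_sum m (\<lambda>k u w. P k u * R k w) v = - alt_sum m (\<lambda>k u w. P k u * R k w) v"
    using alt_sum_transpose_left[of a m b P R v] assms by simp
  then have "2 * alt_sum m (\<lambda>k u w. P k u * R k w) v = 0"
    by (simp only: eq_neg_iff_add_eq_0 mult_2)
  then show ?thesis by simp
qed

lemma alt_sum_repeat_right: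
  assumes "a < m" "b < m" "a \<noteq> b" "R a = R b"
  shows "alt_sum m (\<lambda>k u w. P k u * R k w) v = 0"
proof -
  have "R (Transposition.transpose a b k) = R k" for k
    using assms by (auto simp: Transposition.transpose_def)
  then have "alt_sum m (\<lambda>k u w. P k u * R k w) v = - alt_sum m (\<lambda>k u w. P k u * R k w) v"
    using alt_sum_transpose_right[of a m b P R v] assms by simp
  then have "2 * alt_sum m (\<lambda>k u w. P k u * R k w) v = 0"
    by (simp only: eq_neg_iff_add_eq_0 mult_2)
  then show ?thesis by simp
qed

text \<open>Multilinearity: choosing one summand in each of the \<open>m\<close> factors is the same
  as choosing two index maps \<open>f\<close> and \<open>g\<close>.\<close>

lemma alt_sum_expand:
  assumes fin: "finite I"
    and b: "\<And>k u w. k < m \<Longrightarrow> b k u w = (\<Sum>A\<in>I. \<Sum>B\<in>I. c k A B * (\<theta> A u * \<eta> B w))"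
  shows "alt_sum m b v =
    (\<Sum>f\<in>{..<m} \<rightarrow>\<^sub>E I. \<Sum>g\<in>{..<m} \<rightarrow>\<^sub>E I.
       (\<Prod>k<m. c k (f k) (g k)) * alt_sum m (\<lambda>k u w. \<theta> (f k) u * \<eta> (g k) w) v)"
proof -
  have "(\<Prod>k<m. b k (v (\<pi> (2 * k))) (v (\<pi> (2 * k + 1)))) =
    (\<Sum>f\<in>{..<m} \<rightarrow>\<^sub>E I. \<Sum>g\<in>{..<m} \<rightarrow>\<^sub>E I.
       (\<Prod>k<m. c k (f k) (g k)) * (\<Prod>k<m. \<theta> (f k) (v (\<pi> (2 * k))) * \<eta> (g k) (v (\<pi> (2 * k + 1)))))" for \<pi>
  proof -
    have "(\<Prod>k<m. b k (v (\<pi> (2 * k))) (v (\<pi> (2 * k + 1)))) =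
      (\<Prod>k<m. \<Sum>A\<in>I. \<Sum>B\<in>I. c k A B * (\<theta> A (v (\<pi> (2 * k))) * \<eta> B (v (\<pi> (2 * k + 1)))))"
      by (intro prod.cong refl b) simp
    also have "\<dots> = (\<Sum>f\<in>{..<m} \<rightarrow>\<^sub>E I. \<Prod>k<m. \<Sum>B\<in>I. c k (f k) B * (\<theta> (f k) (v (\<pi> (2 * k))) * \<eta> B (v (\<pi> (2 * k + 1)))))"
      by (rule prod_sum_PiE) (simp_all add: fin)
    also have "\<dots> = (\<Sum>f\<in>{..<m} \<rightarrow>\<^sub>E I. \<Sum>g\<in>{..<m} \<rightarrow>\<^sub>E I. \<Prod>k<m. c k (f k) (g k) * (\<theta> (f k) (v (\<pi> (2 * k))) * \<eta> (g k) (v (\<pi> (2 * k + 1)))))"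
      by (intro sum.cong refl prod_sum_PiE) (simp_all add: fin)
    finally show ?thesis by (simp only: prod.distrib)
  qed
  then have "alt_sum m b v = (\<Sum>\<pi> | \<pi> permutes {..<2 * m}. \<Sum>f\<in>{..<m} \<rightarrow>\<^sub>E I. \<Sum>g\<in>{..<m} \<rightarrow>\<^sub>E I.
      (\<Prod>k<m. c k (f k) (g k)) * (of_int (sign \<pi>) * (\<Prod>k<m. \<theta> (f k) (v (\<pi> (2 * k))) * \<eta> (g k) (v (\<pi> (2 * k + 1))))))"
    by (simp add: alt_sum_def sum_distrib_left mult.left_commute)
  also have "\<dots> = (\<Sum>f\<in>{..<m} \<rightarrow>\<^sub>E I. \<Sum>g\<in>{..<m} \<rightarrow>\<^sub>E I. \<Sum>\<pi> | \<pi> permutes {..<2 * m}.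
      (\<Prod>k<m. c k (f k) (g k)) * (of_int (sign \<pi>) * (\<Prod>k<m. \<theta> (f k) (v (\<pi> (2 * k))) * \<eta> (g k) (v (\<pi> (2 * k + 1))))))"
    by (subst sum.swap) (intro sum.cong refl sum.swap)
  finally show ?thesis by (simp add: alt_sum_def sum_distrib_left)
qed

text \<open>When the coefficients are the identity matrix, both slots of a factor carry the same
  index. Index maps with a repetition vanish, and for each of the m! bijections the signs from the
  left and the right slots cancel, so all contribute the same term.\<close>

lemma alt_sum_identity:
  assumes b: "\<And>u w. b u w = (\<Sum>\<alpha><m. \<theta> \<alpha> u * \<eta> \<alpha> w)"
  shows "alt_sum m (\<lambda>_. b) v = fact m * alt_sum m (\<lambda>k u w. \<theta> k u * \<eta> k w) v"
proof -
  let ?E = "{..<m} \<rightarrow>\<^sub>E {..<m}"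
  let ?\<Psi> = "\<lambda>f. alt_sum m (\<lambda>k u w. \<theta> (f k) u * \<eta> (f k) w) v"
  let ?P = "{\<sigma>. \<sigma> permutes {..<m}}"
  let ?r = "\<lambda>\<sigma>. restrict \<sigma> {..<m}"
  have "(\<Prod>k<m. b (v (\<pi> (2 * k))) (v (\<pi> (2 * k + 1)))) =
    (\<Sum>f\<in>?E. \<Prod>k<m. \<theta> (f k) (v (\<pi> (2 * k))) * \<eta> (f k) (v (\<pi> (2 * k + 1))))" for \<pi>
    by (simp add: b prod_sum_PiE)
  then have "alt_sum m (\<lambda>_. b) v = (\<Sum>f\<in>?E. ?\<Psi> f)"
    unfolding alt_sum_def by (subst sum.swap) (simp add: sum_distrib_left)
  also have "\<dots> = (\<Sum>f\<in>?r ` ?P. ?\<Psi> f)"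
  proof (rule sum.mono_neutral_right)
    show "?r ` ?P \<subseteq> ?E" by (intro image_subsetI) (simp only: restrict_PiE_iff mem_Collect_eq, auto simp: permutes_lessThan_mem)
    show "\<forall>f\<in>?E - ?r ` ?P. ?\<Psi> f = 0"
    proof
      fix f assume f: "f \<in> ?E - ?r ` ?P"
      \<comment> \<open>\<open>f\<close> is undefined outside \<open>{..<m}\<close>, whereas
        \<open>permutes\<close> asks for the identity there.\<close>
      define \<sigma> where "\<sigma> k = (if k < m then f k else k)" for k
      have fm: "f ` {..<m} \<subseteq> {..<m}" using f by auto
      have "f = ?r \<sigma>" using f by (auto simp: \<sigma>_def fun_eq_iff PiE_def extensional_def)
      then have "\<not> \<sigma> permutes {..<m}" using f by auto
      moreover have "\<sigma> permutes {..<m}" if "inj_on f {..<m}"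
      proof (rule bij_imp_permutes)
        have "f ` {..<m} = {..<m}" using that fm by (intro endo_inj_surj) auto
        then have "bij_betw f {..<m} {..<m}" using that by (simp add: bij_betw_def)
        then show "bij_betw \<sigma> {..<m} {..<m}" by (rule bij_betw_cong[THEN iffD1, rotated]) (simp add: \<sigma>_def)
      qed (simp add: \<sigma>_def)
      ultimately obtain a b where "a < m" "b < m" "a \<noteq> b" "f a = f b"
        by (auto simp: inj_on_def)
      then show "?\<Psi> f = 0"
        using alt_sum_repeat_left[of a m b "\<lambda>k. \<theta> (f k)"] by simp
    qed
  qed (auto intro: finite_PiE)
  also have "\<dots> = (\<Sum>\<sigma>\<in>?P. ?\<Psi> (?r \<sigma>))"
  proof (rule sum.reindex[unfolded o_def])
    show "inj_on ?r ?P"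
    proof (rule inj_onI)
      fix \<sigma> \<tau> assume st: "\<sigma> \<in> ?P" "\<tau> \<in> ?P" "?r \<sigma> = ?r \<tau>"
      show "\<sigma> = \<tau>"
      proof
        fix k show "\<sigma> k = \<tau> k"
        proof (cases "k < m")
          case True
          then show ?thesis using fun_cong[OF st(3), of k] by simp
        next
          case False
          then have "k \<notin> {..<m}" by simp
          then have "\<sigma> k = k" "\<tau> k = k"
            using st(1,2) by (auto intro: permutes_not_in)
          then show ?thesis by simp
        qed
      qed
    qed
  qed
  also have "\<dots> = (\<Sum>\<sigma>\<in>?P. ?\<Psi> id)"
  proof (intro sum.cong refl)
    fix \<sigma> assume "\<sigma> \<in> ?P"
    then have s: "\<sigma> permutes {..<m}" by simp
    have "?\<Psi> (?r \<sigma>) = ?\<Psi> \<sigma>" by (rule alt_sum_cong) auto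
    also have "\<dots> = ?\<Psi> id"
      using alt_sum_permute_left[OF s, of \<theta> "\<lambda>k. \<eta> (\<sigma> k)" v] alt_sum_permute_right[OF s, of \<theta> \<eta> v]
      by (simp add: mult.assoc[symmetric] of_int_sign_square)
    finally show "?\<Psi> (?r \<sigma>) = ?\<Psi> id" .
  qed
  also have "\<dots> = fact m * ?\<Psi> id" by (simp add: card_permutations[OF refl])
  finally show ?thesis by simp
qed

section \<open>Evaluation on a frame split into directions of X and of the base\<close>

text \<open>
  A term of the expanded product vanishes on a split frame unless, in the \<open>dz\<close> and in the \<open>dz-bar\<close> slots
  alike, it uses each horizontal index once and a single vertical one. Such index maps are
  permutations of \<open>{..<n + 1}\<close> followed by \<open>emb n i\<close>, the value \<open>n\<close> standing for the vertical
  index \<open>i\<close>.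
\<close>

definition emb :: "nat \<Rightarrow> nat \<Rightarrow> nat \<Rightarrow> nat + nat" where
  "emb n i k = (if k < n then Inl k else Inr i)"

text \<open>The first 2n vectors are tangent to X, those at 2n and 2n + 1 to the base. The coframes
  are abstract so that \<open>kcof\<close> can later take the place of the conjugate
  coordinates.\<close>

locale split_frame =
  fixes n :: nat and \<theta> \<eta> :: "nat + nat \<Rightarrow> 'v \<Rightarrow> complex" and v :: "nat \<Rightarrow> 'v"
  assumes hor: "\<And>m i. m < 2 * n \<Longrightarrow> \<theta> (Inr i) (v m) = 0 \<and> \<eta> (Inr i) (v m) = 0"
    and ver: "\<And>m \<alpha>. m = 2 * n \<or> m = 2 * n + 1 \<Longrightarrow> \<theta> (Inl \<alpha>) (v m) = 0 \<and> \<eta> (Inl \<alpha>) (v m) = 0"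
begin

abbreviation "\<Psi> m f g \<equiv> alt_sum m (\<lambda>k u w. \<theta> (f k) u * \<eta> (g k) w) v"

text \<open>The value of the two-form \<theta>_i \<and> \<eta>_j on the two base vectors.\<close>

definition base_coeff :: "nat \<Rightarrow> nat \<Rightarrow> complex" where
  "base_coeff i j = \<theta> (Inr i) (v (2 * n)) * \<eta> (Inr j) (v (2 * n + 1))
     - \<theta> (Inr i) (v (2 * n + 1)) * \<eta> (Inr j) (v (2 * n))"

text \<open>A surviving permutation sends the last pair of slots to the two base vectors, in one of
  two orders, and permutes the first 2n slots among themselves. The two orders give the two terms of
  \<open>base_coeff\<close>.\<close>

lemma alt_sum_emb: "\<Psi> (n + 1) (emb n i) (emb n j) = base_coeff i j * \<Psi> n Inl Inl"
proof -
  define F where "F \<pi> = of_int (sign \<pi>) *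
     (\<Prod>k<n + 1. \<theta> (emb n i k) (v (\<pi> (2 * k))) * \<eta> (emb n j k) (v (\<pi> (2 * k + 1))))" for \<pi>
  define P where "P q = (\<Prod>k<n. \<theta> (Inl k) (v (q (2 * k))) * \<eta> (Inl k) (v (q (2 * k + 1))))" for q
  let ?t = "Transposition.transpose :: nat \<Rightarrow> nat \<Rightarrow> nat \<Rightarrow> nat"
  have F_eq: "F \<pi> = of_int (sign \<pi>) * (P \<pi> *
      (\<theta> (Inr i) (v (\<pi> (2 * n))) * \<eta> (Inr j) (v (\<pi> (2 * n + 1)))))" for \<pi>
    by (simp add: F_def P_def emb_def)
  have set_eq: "{..<2 * (n + 1)} = insert (2 * n + 1) (insert (2 * n) {..<2 * n})" by auto
  have "\<Psi> (n + 1) (emb n i) (emb n j) = (\<Sum>\<pi> | \<pi> permutes {..<2 * (n + 1)}. F \<pi>)"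
    by (simp add: alt_sum_def F_def)
  also have "\<dots> = (\<Sum>b\<in>insert (2 * n + 1) (insert (2 * n) {..<2 * n}).
      \<Sum>c\<in>insert (2 * n) {..<2 * n}. \<Sum>q | q permutes {..<2 * n}.
        F (?t (2 * n + 1) b \<circ> (?t (2 * n) c \<circ> q)))"
    unfolding set_eq by (simp add: sum_over_permutations_insert)
  also have "\<dots> = (\<Sum>b\<in>{2 * n + 1, 2 * n}.
      \<Sum>c\<in>{2 * n}. \<Sum>q | q permutes {..<2 * n}.
        F (?t (2 * n + 1) b \<circ> (?t (2 * n) c \<circ> q)))"
  proof -
    \<comment> \<open>The peeled-off transpositions determine the images of the slots 2n + 1 and 2n.
      If either image is below 2n, a vertical covector meets a vector tangent to X and the summand
      is 0.\<close>
    have q: "(?t (2 * n + 1) b \<circ> (?t (2 * n) c \<circ> q)) (2 * n) = ?t (2 * n + 1) b c"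
      "(?t (2 * n + 1) b \<circ> (?t (2 * n) c \<circ> q)) (2 * n + 1) = b"
      if "q permutes {..<2 * n}" "c \<noteq> 2 * n + 1" for b c q
    proof -
      have q: "q (2 * n) = 2 * n" "q (2 * n + 1) = 2 * n + 1"
        using permutes_not_in[OF that(1)] by auto
      show "(?t (2 * n + 1) b \<circ> (?t (2 * n) c \<circ> q)) (2 * n) = ?t (2 * n + 1) b c"
        using q that(2) by (simp add: Transposition.transpose_def)
      show "(?t (2 * n + 1) b \<circ> (?t (2 * n) c \<circ> q)) (2 * n + 1) = b"
        using q that(2) by (simp add: Transposition.transpose_def)
    qed
    have z1: "F (?t (2 * n + 1) b \<circ> (?t (2 * n) c \<circ> q)) = 0"
      if "q permutes {..<2 * n}" "c \<noteq> 2 * n + 1" "b < 2 * n" for b c q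
      unfolding F_eq q[OF that(1,2)] using hor[OF that(3)] by simp
    have z2: "F (?t (2 * n + 1) b \<circ> (?t (2 * n) c \<circ> q)) = 0"
      if "q permutes {..<2 * n}" "c < 2 * n" "b = 2 * n + 1 \<or> b = 2 * n" for b c q
    proof -
      have c: "c \<noteq> 2 * n + 1" "?t (2 * n + 1) b c = c"
        using that by (auto simp: Transposition.transpose_def)
      show ?thesis unfolding F_eq q[OF that(1) c(1)] c(2) using hor[OF that(2)] by simp
    qed
    have "(\<Sum>b\<in>insert (2 * n + 1) (insert (2 * n) {..<2 * n}).
      \<Sum>c\<in>insert (2 * n) {..<2 * n}. \<Sum>q | q permutes {..<2 * n}.
        F (?t (2 * n + 1) b \<circ> (?t (2 * n) c \<circ> q))) = (\<Sum>b\<in>{2 * n + 1, 2 * n}.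
      \<Sum>c\<in>insert (2 * n) {..<2 * n}. \<Sum>q | q permutes {..<2 * n}.
        F (?t (2 * n + 1) b \<circ> (?t (2 * n) c \<circ> q)))"
    proof (rule sum.mono_neutral_right)
      show "\<forall>b\<in>insert (2 * n + 1) (insert (2 * n) {..<2 * n}) - {2 * n + 1, 2 * n}.
        (\<Sum>c\<in>insert (2 * n) {..<2 * n}. \<Sum>q | q permutes {..<2 * n}.
           F (?t (2 * n + 1) b \<circ> (?t (2 * n) c \<circ> q))) = 0"
      proof (intro ballI sum.neutral)
        fix b c q
        assume "b \<in> insert (2 * n + 1) (insert (2 * n) {..<2 * n}) - {2 * n + 1, 2 * n}"
          "c \<in> insert (2 * n) {..<2 * n}" "q \<in> {q. q permutes {..<2 * n}}"
        then show "F (?t (2 * n + 1) b \<circ> (?t (2 * n) c \<circ> q)) = 0"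
          by (intro z1) auto
      qed
    qed auto
    also have "\<dots> = (\<Sum>b\<in>{2 * n + 1, 2 * n}.
      \<Sum>c\<in>{2 * n}. \<Sum>q | q permutes {..<2 * n}.
        F (?t (2 * n + 1) b \<circ> (?t (2 * n) c \<circ> q)))"
    proof (intro sum.cong[OF refl])
      fix b assume b: "b \<in> {2 * n + 1, 2 * n}"
      show "(\<Sum>c\<in>insert (2 * n) {..<2 * n}. \<Sum>q | q permutes {..<2 * n}.
        F (?t (2 * n + 1) b \<circ> (?t (2 * n) c \<circ> q))) = (\<Sum>c\<in>{2 * n}. \<Sum>q | q permutes {..<2 * n}.
        F (?t (2 * n + 1) b \<circ> (?t (2 * n) c \<circ> q)))"
      proof (rule sum.mono_neutral_right)
        show "\<forall>c\<in>insert (2 * n) {..<2 * n} - {2 * n}. (\<Sum>q | q permutes {..<2 * n}.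
           F (?t (2 * n + 1) b \<circ> (?t (2 * n) c \<circ> q))) = 0"
        proof (intro ballI sum.neutral)
          fix c q assume "c \<in> insert (2 * n) {..<2 * n} - {2 * n}" "q \<in> {q. q permutes {..<2 * n}}"
          then show "F (?t (2 * n + 1) b \<circ> (?t (2 * n) c \<circ> q)) = 0"
            using b by (intro z2) auto
        qed
      qed auto
    qed
    finally show ?thesis .
  qed
  also have "\<dots> = (\<Sum>q | q permutes {..<2 * n}. F q) + (\<Sum>q | q permutes {..<2 * n}. F (?t (2 * n + 1) (2 * n) \<circ> q))"
    by simp
  also have "(\<Sum>q | q permutes {..<2 * n}. F q) =
     (\<theta> (Inr i) (v (2 * n)) * \<eta> (Inr j) (v (2 * n + 1))) * \<Psi> n Inl Inl"
  proof -
    have "F q = (\<theta> (Inr i) (v (2 * n)) * \<eta> (Inr j) (v (2 * n + 1))) * (of_int (sign q) * P q)"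
      if "q permutes {..<2 * n}" for q
      using permutes_not_in[OF that, of "2 * n"] permutes_not_in[OF that, of "2 * n + 1"]
      unfolding F_eq by simp
    then show ?thesis unfolding alt_sum_def P_def sum_distrib_left by (intro sum.cong) auto
  qed
  also have "(\<Sum>q | q permutes {..<2 * n}. F (?t (2 * n + 1) (2 * n) \<circ> q)) =
     - (\<theta> (Inr i) (v (2 * n + 1)) * \<eta> (Inr j) (v (2 * n))) * \<Psi> n Inl Inl"
  proof -
    have "F (?t (2 * n + 1) (2 * n) \<circ> q) =
        - (\<theta> (Inr i) (v (2 * n + 1)) * \<eta> (Inr j) (v (2 * n))) * (of_int (sign q) * P q)"
      if q: "q permutes {..<2 * n}" for q
    proof -
      let ?T = "?t (2 * n + 1) (2 * n)"
      have s: "?T permutes {..<2 * (n + 1)}" "q permutes {..<2 * (n + 1)}"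
        using permutes_subset[OF q] by (auto intro: permutes_swap_id)
      have sg: "(of_int (sign (?T \<circ> q)) :: complex) = - of_int (sign q)"
        using of_int_sign_compose[OF s] by (simp add: sign_swap_id)
      have qq: "(?T \<circ> q) (2 * n) = 2 * n + 1" "(?T \<circ> q) (2 * n + 1) = 2 * n"
        using permutes_not_in[OF q, of "2 * n"] permutes_not_in[OF q, of "2 * n + 1"] by auto
      have "(?T \<circ> q) m = q m" if "m < 2 * n" for m
        using permutes_lessThan_mem[OF q that] by (simp add: Transposition.transpose_def)
      then have "P (?T \<circ> q) = P q" unfolding P_def by (intro prod.cong refl) auto
      then show ?thesis unfolding F_eq sg qq by simp
    qed
    then show ?thesis unfolding alt_sum_def P_def sum_distrib_left by (intro sum.cong) auto
  qed
  finally show ?thesis by (simp add: base_coeff_def algebra_simps)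
qed

text \<open>With a single vertical value, injectivity forces the remaining n values to exhaust the
  horizontal indices. Coding the vertical value as n therefore gives a permutation.\<close>

lemma unique_vertical_index:
  fixes f :: "nat \<Rightarrow> nat + nat"
  assumes inj: "inj_on f {..<n + 1}" and f: "\<And>k. k < n + 1 \<Longrightarrow> f k \<in> Inl ` {..<n} \<union> Inr ` {..<N}"
    and uniq: "\<And>p q. p < n + 1 \<Longrightarrow> q < n + 1 \<Longrightarrow> f p \<in> range Inr \<Longrightarrow> f q \<in> range Inr \<Longrightarrow> p = q"
    and p: "p < n + 1" "f p \<in> range Inr"
  shows "\<exists>i<N. \<exists>\<sigma>. \<sigma> permutes {..<n + 1} \<and> (\<forall>k<n + 1. f k = emb n i (\<sigma> k))"
proof -
  obtain i where i: "f p = Inr i" "i < N" using f[OF p(1)] p(2) by auto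
  define \<sigma> where "\<sigma> k = (if k < n + 1 then case f k of Inl a \<Rightarrow> a | Inr _ \<Rightarrow> n else k)" for k
  have fk: "f k = emb n i (\<sigma> k) \<and> \<sigma> k < n + 1" if k: "k < n + 1" for k
  proof (cases "f k")
    case (Inl a)
    then show ?thesis using f[OF k] k by (auto simp: \<sigma>_def emb_def)
  next
    case (Inr b)
    then have "k = p" using uniq[OF k p(1)] p(2) by auto
    then show ?thesis using i k by (auto simp: \<sigma>_def emb_def)
  qed
  have "\<sigma> permutes {..<n + 1}"
  proof (rule bij_imp_permutes)
    have "inj_on \<sigma> {..<n + 1}"
    proof (rule inj_onI)
      fix k l assume "k \<in> {..<n + 1}" "l \<in> {..<n + 1}" "\<sigma> k = \<sigma> l"
      then have "f k = f l" using fk[of k] fk[of l] by simp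
      then show "k = l" using inj \<open>k \<in> _\<close> \<open>l \<in> _\<close> by (auto dest: inj_onD)
    qed
    moreover have "\<sigma> ` {..<n + 1} \<subseteq> {..<n + 1}" using fk by auto
    ultimately show "bij_betw \<sigma> {..<n + 1} {..<n + 1}"
      unfolding bij_betw_def using endo_inj_surj[of "{..<n + 1}" \<sigma>] by auto
  qed (simp add: \<sigma>_def)
  then show ?thesis using fk i(2) by blast
qed

text \<open>Pigeonhole principle: there are n + 1 slots but only n horizontal indices.\<close>

lemma vertical_index_exists:
  fixes f :: "nat \<Rightarrow> nat + nat"
  assumes inj: "inj_on f {..<n + 1}" and f: "\<And>k. k < n + 1 \<Longrightarrow> f k \<in> Inl ` {..<n} \<union> Inr ` {..<N}"
  shows "\<exists>p<n + 1. f p \<in> range Inr"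
proof (rule ccontr)
  assume "\<not> ?thesis"
  then have "f ` {..<n + 1} \<subseteq> Inl ` {..<n}" using f by fastforce
  then have "card (f ` {..<n + 1}) \<le> card (Inl ` {..<n} :: (nat + nat) set)" by (intro card_mono) auto
  then show False using inj by (simp add: card_image)
qed

text \<open>Each of \<open>f\<close> and \<open>g\<close> takes a vertical value, and in a nonzero
  summand vertical covectors meet only the two base vectors. A base vector serves one slot only, so
  neither map can take a second vertical value.\<close>

lemma alt_sum_nonzero:
  assumes nz: "\<Psi> (n + 1) f g \<noteq> 0"
    and f: "\<And>k. k < n + 1 \<Longrightarrow> f k \<in> Inl ` {..<n} \<union> Inr ` {..<N}"
    and g: "\<And>k. k < n + 1 \<Longrightarrow> g k \<in> Inl ` {..<n} \<union> Inr ` {..<N}"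
  shows "(\<exists>i<N. \<exists>\<sigma>. \<sigma> permutes {..<n + 1} \<and> (\<forall>k<n + 1. f k = emb n i (\<sigma> k))) \<and>
         (\<exists>i<N. \<exists>\<sigma>. \<sigma> permutes {..<n + 1} \<and> (\<forall>k<n + 1. g k = emb n i (\<sigma> k)))"
proof -
  have injf: "inj_on f {..<n + 1}"
  proof (rule inj_onI, rule ccontr)
    fix a b assume "a \<in> {..<n + 1}" "b \<in> {..<n + 1}" "f a = f b" "a \<noteq> b"
    then show False
      using nz alt_sum_repeat_left[where P = "\<lambda>k. \<theta> (f k)" and R = "\<lambda>k. \<eta> (g k)" and m = "n + 1" and v = v and a = a and b = b]
      by simp
  qed
  have injg: "inj_on g {..<n + 1}"
  proof (rule inj_onI, rule ccontr)
    fix a b assume "a \<in> {..<n + 1}" "b \<in> {..<n + 1}" "g a = g b" "a \<noteq> b"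
    then show False
      using nz alt_sum_repeat_right[where P = "\<lambda>k. \<theta> (f k)" and R = "\<lambda>k. \<eta> (g k)" and m = "n + 1" and v = v and a = a and b = b]
      by simp
  qed
  obtain \<pi> where \<pi>: "\<pi> permutes {..<2 * (n + 1)}"
    and prod: "(\<Prod>k<n + 1. \<theta> (f k) (v (\<pi> (2 * k))) * \<eta> (g k) (v (\<pi> (2 * k + 1)))) \<noteq> 0"
  proof -
    have "\<exists>\<pi>\<in>{\<pi>. \<pi> permutes {..<2 * (n + 1)}}. of_int (sign \<pi>) *
        (\<Prod>k<n + 1. \<theta> (f k) (v (\<pi> (2 * k))) * \<eta> (g k) (v (\<pi> (2 * k + 1)))) \<noteq> 0"
      using nz unfolding alt_sum_def by (rule sum.not_neutral_contains_not_neutral) blast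
    then show ?thesis using that by auto
  qed
  have t: "\<theta> (f k) (v (\<pi> (2 * k))) \<noteq> 0" "\<eta> (g k) (v (\<pi> (2 * k + 1))) \<noteq> 0" if "k < n + 1" for k
    using prod that by (auto simp del: lessThan_Suc prod.lessThan_Suc)
  have pf: "\<pi> (2 * k) = 2 * n \<or> \<pi> (2 * k) = 2 * n + 1" if "k < n + 1" "f k \<in> range Inr" for k
  proof -
    have "\<not> \<pi> (2 * k) < 2 * n" using t(1)[OF that(1)] that(2) hor by auto
    moreover have "\<pi> (2 * k) < 2 * (n + 1)" using that by (intro permutes_lessThan_mem[OF \<pi>]) auto
    ultimately show ?thesis by auto
  qed
  have pg: "\<pi> (2 * k + 1) = 2 * n \<or> \<pi> (2 * k + 1) = 2 * n + 1" if "k < n + 1" "g k \<in> range Inr" for k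
  proof -
    have "\<not> \<pi> (2 * k + 1) < 2 * n" using t(2)[OF that(1)] that(2) hor by auto
    moreover have "\<pi> (2 * k + 1) < 2 * (n + 1)" using that by (intro permutes_lessThan_mem[OF \<pi>]) auto
    ultimately show ?thesis by auto
  qed
  have ipi: "\<pi> a = \<pi> b \<longleftrightarrow> a = b" for a b using permutes_inj[OF \<pi>] by (simp add: inj_eq)
  obtain p where p: "p < n + 1" "f p \<in> range Inr" using vertical_index_exists[OF injf f] by blast
  obtain q where q: "q < n + 1" "g q \<in> range Inr" using vertical_index_exists[OF injg g] by blast
  have pq: "\<pi> (2 * k) \<noteq> \<pi> (2 * l + 1)" for k l unfolding ipi by presburger
  \<comment> \<open>\<open>f\<close> belongs to the even slots and \<open>g\<close> to the odd ones.
    Two vertical values of \<open>f\<close> would use up both base vectors and leave none for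
    \<open>g\<close>.\<close>
  have "k = l" if "k < n + 1" "l < n + 1" "f k \<in> range Inr" "f l \<in> range Inr" for k l
  proof -
    have "\<pi> (2 * k) = \<pi> (2 * l)"
      using pf[OF that(1,3)] pf[OF that(2,4)] pg[OF q] pq[of k q] pq[of l q] by metis
    then show ?thesis by (simp add: ipi)
  qed
  moreover have "k = l" if "k < n + 1" "l < n + 1" "g k \<in> range Inr" "g l \<in> range Inr" for k l
  proof -
    have "\<pi> (2 * k + 1) = \<pi> (2 * l + 1)"
      using pg[OF that(1,3)] pg[OF that(2,4)] pf[OF p] pq[of p k] pq[of p l] by metis
    then show ?thesis by (simp add: ipi)
  qed
  ultimately show ?thesis
    using unique_vertical_index[OF injf f _ p] unique_vertical_index[OF injg g _ q] by auto
qed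

text \<open>Only index maps of the form \<open>emb n i\<close> after a permutation survive the
  expansion. Sorting the factors turns each surviving term into one and the same frame value, at the
  price of the two signs.\<close>

lemma alt_sum_split:
  assumes b: "\<And>k u w. k < n + 1 \<Longrightarrow>
      b k u w = (\<Sum>A\<in>prod_idx n N. \<Sum>B\<in>prod_idx n N. c k A B * (\<theta> A u * \<eta> B w))"
  shows "alt_sum (n + 1) b v =
    (\<Sum>i<N. \<Sum>j<N. base_coeff i j * (\<Sum>\<sigma> | \<sigma> permutes {..<n + 1}. \<Sum>\<rho> | \<rho> permutes {..<n + 1}.
       of_int (sign \<sigma>) * of_int (sign \<rho>) * (\<Prod>k<n + 1. c k (emb n i (\<sigma> k)) (emb n j (\<rho> k))))) * \<Psi> n Inl Inl"
proof -
  let ?E = "{..<n + 1} \<rightarrow>\<^sub>E prod_idx n N"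
  let ?P = "{\<sigma>. \<sigma> permutes {..<n + 1}}"
  let ?r = "\<lambda>(i, \<sigma>). restrict (\<lambda>k. emb n i (\<sigma> k)) {..<n + 1}"
  let ?D = "{..<N} \<times> ?P"
  define T where "T f g = (\<Prod>k<n + 1. c k (f k) (g k)) * \<Psi> (n + 1) f g" for f g
  have idx: "prod_idx n N = Inl ` {..<n} \<union> Inr ` {..<N}" by (auto simp: Plus_def)
  have sub: "?r ` ?D \<subseteq> ?E"
  proof (rule image_subsetI)
    fix d assume "d \<in> ?D"
    then obtain i \<sigma> where d: "d = (i, \<sigma>)" "i < N" "\<sigma> permutes {..<n + 1}" by auto
    then show "?r d \<in> ?E"
      unfolding d(1) prod.case restrict_PiE_iff idx
      using permutes_lessThan_mem[OF d(3)] by (auto simp: emb_def)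
  qed
  have inj: "inj_on ?r ?D"
  proof (rule inj_onI)
    fix d d' assume d: "d \<in> ?D" "d' \<in> ?D" "?r d = ?r d'"
    obtain i \<sigma> j \<rho> where dd: "d = (i, \<sigma>)" "d' = (j, \<rho>)" by (metis surj_pair)
    have s: "\<sigma> permutes {..<n + 1}" and r: "\<rho> permutes {..<n + 1}"
      and eq: "restrict (\<lambda>k. emb n i (\<sigma> k)) {..<n + 1} = restrict (\<lambda>k. emb n j (\<rho> k)) {..<n + 1}"
      using d unfolding dd by auto
    have e: "emb n i (\<sigma> k) = emb n j (\<rho> k)" if "k < n + 1" for k
      using fun_cong[OF eq, of k] that by simp
    \<comment> \<open>Where \<sigma> takes the value n, the common index map reveals the vertical
      index, so \<open>i = j\<close>.\<close>
    obtain k where k: "\<sigma> k = n" using permutes_surj[OF s] by (metis surjD)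
    have kn: "k < n + 1"
    proof (rule ccontr)
      assume "\<not> k < n + 1"
      then have "\<sigma> k = k" by (intro permutes_not_in[OF s]) auto
      then show False using k \<open>\<not> k < n + 1\<close> by simp
    qed
    have "i = j" using e[OF kn] k by (auto simp: emb_def split: if_splits)
    moreover have "\<sigma> = \<rho>"
    proof
      fix l show "\<sigma> l = \<rho> l"
      proof (cases "l < n + 1")
        case True
        then show ?thesis
          using e[OF True] permutes_lessThan_mem[OF s True] permutes_lessThan_mem[OF r True]
          by (auto simp: emb_def split: if_splits)
      next
        case False
        then have "\<sigma> l = l" "\<rho> l = l" using s r by (auto intro: permutes_not_in)
        then show ?thesis by simp
      qed
    qed
    ultimately show "d = d'" by (simp add: dd)
  qed
  have van: "T f g = 0" if "f \<in> ?E" "g \<in> ?E" "f \<notin> ?r ` ?D \<or> g \<notin> ?r ` ?D" for f g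
  proof (rule ccontr)
    assume "T f g \<noteq> 0"
    then have nz: "\<Psi> (n + 1) f g \<noteq> 0" by (auto simp: T_def)
    have mem: "f \<in> ?r ` ?D" if "f \<in> ?E" "i < N" "\<sigma> permutes {..<n + 1}" "\<forall>k<n + 1. f k = emb n i (\<sigma> k)" for f i \<sigma>
    proof -
      have "f = ?r (i, \<sigma>)" using that(1,4) by (auto simp: fun_eq_iff PiE_def extensional_def)
      then show ?thesis using that(2,3) by blast
    qed
    have "f k \<in> Inl ` {..<n} \<union> Inr ` {..<N}" "g k \<in> Inl ` {..<n} \<union> Inr ` {..<N}" if "k < n + 1" for k
      using \<open>f \<in> ?E\<close> \<open>g \<in> ?E\<close> that unfolding idx by (auto simp: PiE_iff)
    from alt_sum_nonzero[OF nz this] have "f \<in> ?r ` ?D" "g \<in> ?r ` ?D"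
      using mem[OF \<open>f \<in> ?E\<close>] mem[OF \<open>g \<in> ?E\<close>] by blast+
    then show False using that(3) by blast
  qed
  have finE: "finite ?E" by (intro finite_PiE) auto
  have "alt_sum (n + 1) b v = (\<Sum>f\<in>?E. \<Sum>g\<in>?E. T f g)"
    unfolding T_def by (rule alt_sum_expand[OF _ b]) auto
  also have "\<dots> = (\<Sum>f\<in>?r ` ?D. \<Sum>g\<in>?E. T f g)"
    using van by (intro sum.mono_neutral_right sub finE ballI sum.neutral) auto
  also have "\<dots> = (\<Sum>f\<in>?r ` ?D. \<Sum>g\<in>?r ` ?D. T f g)"
  proof (rule sum.cong[OF refl])
    fix f assume "f \<in> ?r ` ?D"
    then show "(\<Sum>g\<in>?E. T f g) = (\<Sum>g\<in>?r ` ?D. T f g)"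
      using sub by (intro sum.mono_neutral_right sub finE ballI van) blast+
  qed
  also have "\<dots> = (\<Sum>d\<in>?D. \<Sum>e\<in>?D. T (?r d) (?r e))"
    by (simp only: sum.reindex[OF inj] o_def)
  also have "\<dots> = (\<Sum>i<N. \<Sum>\<sigma>\<in>?P. \<Sum>j<N. \<Sum>\<rho>\<in>?P. T (?r (i, \<sigma>)) (?r (j, \<rho>)))"
    by (simp only: sum.cartesian_product')
  also have "\<dots> = (\<Sum>i<N. \<Sum>\<sigma>\<in>?P. \<Sum>j<N. \<Sum>\<rho>\<in>?P. (base_coeff i j * \<Psi> n Inl Inl) *
      (of_int (sign \<sigma>) * of_int (sign \<rho>) * (\<Prod>k<n + 1. c k (emb n i (\<sigma> k)) (emb n j (\<rho> k)))))"
  proof (intro sum.cong refl)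
    fix i \<sigma> j \<rho> assume "\<sigma> \<in> ?P" "\<rho> \<in> ?P"
    then have s: "\<sigma> permutes {..<n + 1}" "\<rho> permutes {..<n + 1}" by auto
    have "T (?r (i, \<sigma>)) (?r (j, \<rho>)) = T (\<lambda>k. emb n i (\<sigma> k)) (\<lambda>k. emb n j (\<rho> k))"
      unfolding T_def by (intro arg_cong2[where f = times] prod.cong alt_sum_cong) auto
    also have "\<Psi> (n + 1) (\<lambda>k. emb n i (\<sigma> k)) (\<lambda>k. emb n j (\<rho> k)) =
        of_int (sign \<sigma>) * (of_int (sign \<rho>) * \<Psi> (n + 1) (emb n i) (emb n j))"
      using alt_sum_permute_left[OF s(1), of "\<lambda>k. \<theta> (emb n i k)" "\<lambda>k. \<eta> (emb n j (\<rho> k))" v]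
        alt_sum_permute_right[OF s(2), of "\<lambda>k. \<theta> (emb n i k)" "\<lambda>k. \<eta> (emb n j k)" v]
      by simp
    then have "T (\<lambda>k. emb n i (\<sigma> k)) (\<lambda>k. emb n j (\<rho> k)) = (base_coeff i j * \<Psi> n Inl Inl) *
      (of_int (sign \<sigma>) * of_int (sign \<rho>) * (\<Prod>k<n + 1. c k (emb n i (\<sigma> k)) (emb n j (\<rho> k))))"
      unfolding T_def alt_sum_emb by simp
    finally show "T (?r (i, \<sigma>)) (?r (j, \<rho>)) = (base_coeff i j * \<Psi> n Inl Inl) *
      (of_int (sign \<sigma>) * of_int (sign \<rho>) * (\<Prod>k<n + 1. c k (emb n i (\<sigma> k)) (emb n j (\<rho> k))))" .
  qed
  also have "\<dots> = (\<Sum>i<N. \<Sum>j<N. \<Sum>\<sigma>\<in>?P. \<Sum>\<rho>\<in>?P. (base_coeff i j * \<Psi> n Inl Inl) *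
      (of_int (sign \<sigma>) * of_int (sign \<rho>) * (\<Prod>k<n + 1. c k (emb n i (\<sigma> k)) (emb n j (\<rho> k)))))"
    by (intro sum.cong refl) (rule sum.swap)
  finally show ?thesis
    by (simp only: sum_distrib_left sum_distrib_right mult_ac)
qed

end

section \<open>A mixed discriminant with identity entries\<close>

lemma sum_permutes_first_two:
  fixes h :: "nat \<Rightarrow> nat \<Rightarrow> complex"
  assumes n: "1 \<le> n"
  shows "(\<Sum>\<sigma> | \<sigma> permutes {..<n + 1}. h (\<sigma> 0) (\<sigma> 1)) =
     fact (n - 1) * (\<Sum>p<n + 1. \<Sum>q\<in>{..<n + 1} - {p}. h p q)"
proof -
  let ?t = "Transposition.transpose :: nat \<Rightarrow> nat \<Rightarrow> nat \<Rightarrow> nat"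
  let ?S = "{2..<n + 1}"
  have set_eq: "{..<n + 1} = insert 0 (insert 1 ?S)" using n by auto
  have set_eq1: "insert 1 ?S = {1..<n + 1}" using n by auto
  have "(\<Sum>\<sigma> | \<sigma> permutes {..<n + 1}. h (\<sigma> 0) (\<sigma> 1)) =
     (\<Sum>b\<in>insert 0 (insert 1 ?S). \<Sum>c\<in>insert 1 ?S. \<Sum>q | q permutes ?S.
        h ((?t 0 b \<circ> (?t 1 c \<circ> q)) 0) ((?t 0 b \<circ> (?t 1 c \<circ> q)) 1))"
    unfolding set_eq by (subst sum_over_permutations_insert, simp, simp, subst sum_over_permutations_insert, simp_all)
  also have "\<dots> = (\<Sum>b\<in>{..<n + 1}. \<Sum>c\<in>{1..<n + 1}. \<Sum>q | q permutes ?S. h b (?t 0 b c))"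
  proof -
    have "h ((?t 0 b \<circ> (?t 1 c \<circ> q)) 0) ((?t 0 b \<circ> (?t 1 c \<circ> q)) 1) = h b (?t 0 b c)"
      if "q permutes ?S" "c \<in> {1..<n + 1}" for b c q
    proof -
      have "q 0 = 0" "q 1 = 1" using permutes_not_in[OF that(1)] by auto
      then show ?thesis using that(2) by (simp add: Transposition.transpose_def)
    qed
    then show ?thesis unfolding set_eq[symmetric] set_eq1 by (intro sum.cong refl) auto
  qed
  also have "\<dots> = (\<Sum>b\<in>{..<n + 1}. \<Sum>c\<in>{1..<n + 1}. fact (n - 1) * h b (?t 0 b c))"
    by (simp add: card_permutations[OF refl])
  also have "\<dots> = (\<Sum>b\<in>{..<n + 1}. \<Sum>q\<in>{..<n + 1} - {b}. fact (n - 1) * h b q)"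
  proof (rule sum.cong[OF refl])
    fix b assume b: "b \<in> {..<n + 1}"
    show "(\<Sum>c\<in>{1..<n + 1}. fact (n - 1) * h b (?t 0 b c)) = (\<Sum>q\<in>{..<n + 1} - {b}. fact (n - 1) * h b q)"
      \<comment> \<open>Transposing 0 and \<open>b\<close> carries \<open>{1..<n + 1}\<close> onto
        the complement of \<open>b\<close> and is its own inverse.\<close>
      by (rule sum.reindex_bij_witness[of _ "?t 0 b" "?t 0 b"])
        (use b in \<open>auto simp: Transposition.transpose_def split: if_splits\<close>)
  qed
  finally show ?thesis by (simp only: sum_distrib_left)
qed

lemma permutes_fixing_except_two:
  assumes "\<kappa> permutes S" "\<And>k. k \<in> S \<Longrightarrow> k \<noteq> a \<Longrightarrow> k \<noteq> b \<Longrightarrow> \<kappa> k = k"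
  shows "\<kappa> = id \<or> \<kappa> = Transposition.transpose a b"
proof -
  have fix': "\<kappa> k = k" if "k \<noteq> a" "k \<noteq> b" for k
    using assms that permutes_not_in[OF assms(1), of k] by blast
  have inj: "\<kappa> x = \<kappa> y \<longleftrightarrow> x = y" for x y using permutes_inj[OF assms(1)] by (simp add: inj_eq)
  have a: "\<kappa> a = a \<or> \<kappa> a = b" using fix' inj by metis
  have b: "\<kappa> b = a \<or> \<kappa> b = b" using fix' inj by metis
  show ?thesis
  proof (cases "\<kappa> a = a")
    case True
    then have "\<kappa> b = b" using b inj by metis
    then have "\<kappa> = id" using True fix' by (metis eq_id_iff)
    then show ?thesis ..
  next
    case False
    then have "\<kappa> a = b" using a by simp
    moreover have "\<kappa> b = a" using b inj False calculation by metis
    ultimately have "\<kappa> k = Transposition.transpose a b k" for k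
      using fix' by (simp add: Transposition.transpose_def)
    then show ?thesis by auto
  qed
qed

text \<open>Up to normalization this is the mixed discriminant of \<open>X\<close>, \<open>Y\<close>
  and n - 1 copies of diag(1, ..., 1, 0). The diagonal factors force \<rho> and \<sigma> to agree
  outside the slots 0 and 1, so only \<rho> = \<sigma> and \<rho> = \<sigma> composed with the
  transposition of 0 and 1 survive.\<close>

lemma mixed_discriminant:
  fixes X Y :: "nat \<Rightarrow> nat \<Rightarrow> complex"
  assumes n: "1 \<le> n"
    and c0: "\<And>r s. c 0 r s = X r s" and c1: "\<And>r s. c 1 r s = Y r s"
    and c2: "\<And>k r s. 2 \<le> k \<Longrightarrow> c k r s = (if r = s \<and> r < n then 1 else 0)"
  shows "(\<Sum>\<sigma> | \<sigma> permutes {..<n + 1}. \<Sum>\<rho> | \<rho> permutes {..<n + 1}.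
       of_int (sign \<sigma>) * of_int (sign \<rho>) * (\<Prod>k<n + 1. c k (\<sigma> k) (\<rho> k))) =
     fact (n - 1) * (\<Sum>\<alpha><n. X \<alpha> \<alpha> * Y n n - X \<alpha> n * Y n \<alpha> + X n n * Y \<alpha> \<alpha> - X n \<alpha> * Y \<alpha> n)"
proof -
  let ?P = "{\<sigma>. \<sigma> permutes {..<n + 1}}"
  let ?t = "Transposition.transpose 0 (1::nat)"
  \<comment> \<open>The guard is there because the diagonal factors vanish at index n: one of the
    slots 0 and 1 has to take it.\<close>
  define h where "h p q = (if p = n \<or> q = n then X p p * Y q q - X p q * Y q p else 0)" for p q
  have split: "{..<n + 1} = insert 0 (insert 1 {2..<n + 1})" using n by auto
  have inner: "(\<Sum>\<rho>\<in>?P. of_int (sign \<sigma>) * of_int (sign \<rho>) * (\<Prod>k<n + 1. c k (\<sigma> k) (\<rho> k))) = h (\<sigma> 0) (\<sigma> 1)"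
    if s: "\<sigma> permutes {..<n + 1}" for \<sigma>
  proof -
    define R where "R \<kappa> = (\<Prod>k\<in>{2..<n + 1}. c k (\<sigma> k) (\<sigma> (\<kappa> k)))" for \<kappa>
    define F where "F \<kappa> = of_int (sign \<kappa>) * (X (\<sigma> 0) (\<sigma> (\<kappa> 0)) * Y (\<sigma> 1) (\<sigma> (\<kappa> 1)) * R \<kappa>)" for \<kappa>
    have inj: "\<sigma> x = \<sigma> y \<longleftrightarrow> x = y" for x y using permutes_inj[OF s] by (simp add: inj_eq)
    have t: "?t permutes {..<n + 1}" using n by (intro permutes_swap_id) auto
    \<comment> \<open>Substituting \<rho> = \<sigma> \<circ> \<kappa> turns agreement with \<sigma>
      on a slot into being fixed by \<kappa>.\<close>
    have "(\<Sum>\<rho>\<in>?P. of_int (sign \<sigma>) * of_int (sign \<rho>) * (\<Prod>k<n + 1. c k (\<sigma> k) (\<rho> k))) =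
        (\<Sum>\<kappa>\<in>?P. of_int (sign \<sigma>) * of_int (sign (\<sigma> \<circ> \<kappa>)) * (\<Prod>k<n + 1. c k (\<sigma> k) ((\<sigma> \<circ> \<kappa>) k)))"
      by (rule setum_permutations_compose_left[OF s])
    also have "\<dots> = (\<Sum>\<kappa>\<in>?P. F \<kappa>)"
    proof (intro sum.cong refl)
      fix \<kappa> assume "\<kappa> \<in> ?P"
      then have "(of_int (sign \<sigma>) :: complex) * of_int (sign (\<sigma> \<circ> \<kappa>)) = of_int (sign \<kappa>)"
        using of_int_sign_compose[OF s, of \<kappa>] by (simp add: mult.assoc[symmetric] of_int_sign_square)
      moreover have "(\<Prod>k<n + 1. c k (\<sigma> k) ((\<sigma> \<circ> \<kappa>) k)) = X (\<sigma> 0) (\<sigma> (\<kappa> 0)) * Y (\<sigma> 1) (\<sigma> (\<kappa> 1)) * R \<kappa>"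
        unfolding split R_def by (simp add: c0 c1[unfolded One_nat_def])
      ultimately show "of_int (sign \<sigma>) * of_int (sign (\<sigma> \<circ> \<kappa>)) * (\<Prod>k<n + 1. c k (\<sigma> k) ((\<sigma> \<circ> \<kappa>) k)) = F \<kappa>"
        by (simp add: F_def)
    qed
    also have "\<dots> = (\<Sum>\<kappa>\<in>{id, ?t}. F \<kappa>)"
    proof (rule sum.mono_neutral_right)
      show "\<forall>\<kappa>\<in>?P - {id, ?t}. F \<kappa> = 0"
      proof
        fix \<kappa> assume k: "\<kappa> \<in> ?P - {id, ?t}"
        then obtain k where k: "k \<in> {..<n + 1}" "k \<noteq> 0" "k \<noteq> 1" "\<kappa> k \<noteq> k"
          using permutes_fixing_except_two[of \<kappa> "{..<n + 1}" 0 1] by blast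
        then have "c k (\<sigma> k) (\<sigma> (\<kappa> k)) = 0" by (subst c2) (auto simp: inj)
        then have "R \<kappa> = 0" unfolding R_def using k by (intro prod_zero) auto
        then show "F \<kappa> = 0" by (simp add: F_def)
      qed
    qed (use t in \<open>auto simp: permutes_id finite_permutations\<close>)
    also have "\<dots> = F id + F ?t"
    proof -
      have "id \<noteq> ?t" by (auto simp: fun_eq_iff Transposition.transpose_def)
      then show ?thesis by simp
    qed
    also have "\<dots> = h (\<sigma> 0) (\<sigma> 1)"
    proof -
      have Rid: "R id = (if \<sigma> 0 = n \<or> \<sigma> 1 = n then 1 else 0)"
      proof (cases "\<sigma> 0 = n \<or> \<sigma> 1 = n")
        case True
        have "c k (\<sigma> k) (\<sigma> (id k)) = 1" if "k \<in> {2..<n + 1}" for k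
        proof -
          have "\<sigma> k \<noteq> n" using True inj[of k 0] inj[of k 1] that by auto
          moreover have "\<sigma> k < n + 1" using that by (intro permutes_lessThan_mem[OF s]) auto
          ultimately show ?thesis using that by (subst c2) auto
        qed
        then show ?thesis using True unfolding R_def by (simp add: prod.neutral)
      next
        case False
        obtain k where k: "\<sigma> k = n" using permutes_surj[OF s] by (metis surjD)
        have "k < n + 1"
        proof (rule ccontr)
          assume "\<not> k < n + 1"
          then have "\<sigma> k = k" by (intro permutes_not_in[OF s]) auto
          then show False using k \<open>\<not> k < n + 1\<close> by simp
        qed
        moreover have "k \<noteq> 0" "k \<noteq> 1" using False k by metis+
        ultimately have "k \<in> {2..<n + 1}" by auto
        moreover have "c k (\<sigma> k) (\<sigma> (id k)) = 0" using calculation k by (subst c2) auto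
        ultimately have "R id = 0" unfolding R_def by (intro prod_zero) auto
        then show ?thesis using False by simp
      qed
      have Rt: "R ?t = R id"
        unfolding R_def by (intro prod.cong refl) (auto simp: Transposition.transpose_def)
      have "sign ?t = -1" by (simp add: sign_swap_id)
      then show ?thesis unfolding F_def Rt Rid h_def by (simp add: algebra_simps)
    qed
    finally show ?thesis .
  qed
  have "(\<Sum>\<sigma>\<in>?P. \<Sum>\<rho>\<in>?P. of_int (sign \<sigma>) * of_int (sign \<rho>) * (\<Prod>k<n + 1. c k (\<sigma> k) (\<rho> k))) =
     (\<Sum>\<sigma>\<in>?P. h (\<sigma> 0) (\<sigma> 1))"
    by (intro sum.cong refl inner) simp
  also have "\<dots> = fact (n - 1) * (\<Sum>p<n + 1. \<Sum>q\<in>{..<n + 1} - {p}. h p q)"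
    by (rule sum_permutes_first_two[OF n])
  also have "(\<Sum>p<n + 1. \<Sum>q\<in>{..<n + 1} - {p}. h p q) = (\<Sum>p<n. h p n) + (\<Sum>q<n. h n q)"
  proof -
    have "(\<Sum>q\<in>{..<n + 1} - {p}. h p q) = h p n" if "p < n" for p
    proof -
      have "(\<Sum>q\<in>{..<n + 1} - {p}. h p q) = (\<Sum>q\<in>{n}. h p q)"
        by (rule sum.mono_neutral_right) (use that in \<open>auto simp: h_def\<close>)
      then show ?thesis by simp
    qed
    moreover have "{..<n + 1} - {n} = {..<n}" by auto
    ultimately show ?thesis by simp
  qed
  also have "\<dots> = (\<Sum>\<alpha><n. X \<alpha> \<alpha> * Y n n - X \<alpha> n * Y n \<alpha> + X n n * Y \<alpha> \<alpha> - X n \<alpha> * Y \<alpha> n)"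
    unfolding sum.distrib[symmetric] by (intro sum.cong refl) (simp add: h_def algebra_simps)
  finally show ?thesis .
qed

section \<open>The Kaehler form on the frame of the fiber integral\<close>

definition fvec :: "nat \<Rightarrow> (nat \<Rightarrow> nat \<Rightarrow> complex) \<Rightarrow> nat \<Rightarrow> nat + nat \<Rightarrow> complex" where
  "fvec n v m = (if m < 2 * n then case_sum (real_frame m) (\<lambda>_. 0) else case_sum (\<lambda>_. 0) (v (m - 2 * n)))"

text \<open>
  In the coframe \<open>kcof\<close>, with \<open>d(z-bar)\<^sup>\<alpha>\<close> replaced by \<open>\<i> g\<^sub>\<alpha>\<^sub>\<gamma> d(z-bar)\<^sup>\<gamma>\<close>, the Kaehler form has the identity
  matrix as coefficients, so that no determinant of \<open>g\<close> ever has to be expanded; \<open>kcoeff\<close> gives the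
  coefficients of an arbitrary (1,1)-form in it.
\<close>

definition kcof :: "nat \<Rightarrow> complex mat \<Rightarrow> nat + nat \<Rightarrow> (nat + nat \<Rightarrow> complex) \<Rightarrow> complex" where
  "kcof n G B w = (case B of Inl \<beta> \<Rightarrow> \<Sum>\<gamma><n. \<i> * G $$ (\<beta>, \<gamma>) * cnj (w (Inl \<gamma>)) | Inr j \<Rightarrow> cnj (w (Inr j)))"

definition kcoeff :: "nat \<Rightarrow> (nat \<Rightarrow> nat \<Rightarrow> complex) \<Rightarrow> (nat + nat \<Rightarrow> nat + nat \<Rightarrow> complex) \<Rightarrow> nat + nat \<Rightarrow> nat + nat \<Rightarrow> complex" where
  "kcoeff n Ginv M A B = (case B of Inl \<gamma> \<Rightarrow> \<Sum>\<beta><n. M A (Inl \<beta>) * (- \<i> * Ginv \<beta> \<gamma>) | Inr j \<Rightarrow> M A (Inr j))"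

text \<open>The coefficients of \<omega>_X itself in the coframe \<open>kcof\<close>.\<close>

definition id_coeff :: "nat + nat \<Rightarrow> nat + nat \<Rightarrow> complex" where
  "id_coeff A B = (if A = B \<and> A \<in> range Inl then 1 else 0)"

lemma id_coeff_simps:
  "id_coeff (Inl \<alpha>) (Inl \<beta>) = (if \<alpha> = \<beta> then 1 else 0)"
  "id_coeff (Inr i) B = 0"
  "id_coeff A (Inr j) = 0"
  by (auto simp: id_coeff_def)

definition gform :: "nat \<Rightarrow> complex mat \<Rightarrow> (nat + nat \<Rightarrow> complex) \<Rightarrow> (nat + nat \<Rightarrow> complex) \<Rightarrow> complex" where
  "gform n G u w = sesq {..<n} (\<lambda>\<alpha> \<beta>. \<i> * G $$ (\<alpha>, \<beta>)) (u \<circ> Inl) (w \<circ> Inl)"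

lemma gform_eq: "gform n G u w = (\<Sum>\<alpha><n. u (Inl \<alpha>) * kcof n G (Inl \<alpha>) w)"
  by (simp add: gform_def sesq_def kcof_def sum_distrib_left mult_ac)

lemma split_frame_fvec: "split_frame n (\<lambda>A u. u A) (kcof n G) (fvec n v)"
  by unfold_locales (auto simp: fvec_def kcof_def)

lemma base_coeff_fvec:
  "split_frame.base_coeff n (\<lambda>A u. u A) (kcof n G) (fvec n v) i j = v 0 i * cnj (v 1 j) - v 1 i * cnj (v 0 j)"
  by (simp add: split_frame.base_coeff_def[OF split_frame_fvec] fvec_def kcof_def)

text \<open>The change of coframe inverted: \<open>- \<i> * Ginv\<close> in \<open>kcoeff\<close>
  undoes \<open>\<i> * G\<close> in \<open>kcof\<close>.\<close>

lemma sesq_kcoeff: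
  assumes inv: "\<And>\<beta> \<gamma>. \<beta> < n \<Longrightarrow> \<gamma> < n \<Longrightarrow> (\<Sum>\<delta><n. Ginv \<beta> \<delta> * G $$ (\<delta>, \<gamma>)) = (if \<beta> = \<gamma> then 1 else 0)"
  shows "sesq (prod_idx n N) M u w =
    (\<Sum>A\<in>prod_idx n N. \<Sum>B\<in>prod_idx n N. kcoeff n Ginv M A B * (u A * kcof n G B w))"
proof -
  have c: "cnj (w (Inl \<beta>)) = (\<Sum>\<gamma><n. - \<i> * Ginv \<beta> \<gamma> * kcof n G (Inl \<gamma>) w)" if "\<beta> < n" for \<beta>
  proof -
    have "(\<Sum>\<gamma><n. - \<i> * Ginv \<beta> \<gamma> * kcof n G (Inl \<gamma>) w) =
        (\<Sum>\<gamma><n. \<Sum>\<delta><n. Ginv \<beta> \<gamma> * G $$ (\<gamma>, \<delta>) * cnj (w (Inl \<delta>)))"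
      by (simp add: kcof_def sum_distrib_left mult_ac)
    also have "\<dots> = (\<Sum>\<delta><n. (\<Sum>\<gamma><n. Ginv \<beta> \<gamma> * G $$ (\<gamma>, \<delta>)) * cnj (w (Inl \<delta>)))"
      by (subst sum.swap) (simp add: sum_distrib_right)
    also have "\<dots> = (\<Sum>\<delta><n. if \<delta> = \<beta> then cnj (w (Inl \<delta>)) else 0)"
      using that by (intro sum.cong refl) (simp add: inv)
    also have "\<dots> = cnj (w (Inl \<beta>))" using that by simp
    finally show ?thesis ..
  qed
  have "(\<Sum>B\<in>prod_idx n N. M A B * u A * cnj (w B)) =
      (\<Sum>B\<in>prod_idx n N. kcoeff n Ginv M A B * (u A * kcof n G B w))" for A
  proof -
    have "(\<Sum>\<beta><n. M A (Inl \<beta>) * u A * cnj (w (Inl \<beta>))) =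
       (\<Sum>\<beta><n. \<Sum>\<gamma><n. M A (Inl \<beta>) * (- \<i> * Ginv \<beta> \<gamma>) * (u A * kcof n G (Inl \<gamma>) w))"
      by (intro sum.cong refl) (simp add: c sum_distrib_left mult_ac)
    also have "\<dots> = (\<Sum>\<gamma><n. kcoeff n Ginv M A (Inl \<gamma>) * (u A * kcof n G (Inl \<gamma>) w))"
      by (subst sum.swap) (simp add: kcoeff_def sum_distrib_right)
    finally show ?thesis
      by (simp add: sum.Plus kcoeff_def kcof_def mult_ac)
  qed
  then show ?thesis by (simp add: sesq_def)
qed

lemma gform_id_coeff:
  "gform n G u w = (\<Sum>A\<in>prod_idx n N. \<Sum>B\<in>prod_idx n N. id_coeff A B * (u A * kcof n G B w))"
proof -
  have "(\<Sum>B\<in>prod_idx n N. id_coeff (Inl \<alpha>) B * (u (Inl \<alpha>) * kcof n G B w)) = u (Inl \<alpha>) * kcof n G (Inl \<alpha>) w"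
    if "\<alpha> < n" for \<alpha>
  proof -
    have "(\<Sum>B\<in>prod_idx n N. id_coeff (Inl \<alpha>) B * (u (Inl \<alpha>) * kcof n G B w)) =
       (\<Sum>B\<in>{Inl \<alpha>}. id_coeff (Inl \<alpha>) B * (u (Inl \<alpha>) * kcof n G B w))"
      by (rule sum.mono_neutral_right) (use that in \<open>auto simp: id_coeff_def\<close>)
    then show ?thesis by (simp add: id_coeff_def)
  qed
  moreover have "id_coeff (Inr i) B = 0" for i B by (auto simp: id_coeff_def)
  moreover have "(\<Sum>A\<in>prod_idx n N. \<Sum>B\<in>prod_idx n N. id_coeff A B * (u A * kcof n G B w)) =
      (\<Sum>\<alpha><n. \<Sum>B\<in>prod_idx n N. id_coeff (Inl \<alpha>) B * (u (Inl \<alpha>) * kcof n G B w)) +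
      (\<Sum>i<N. \<Sum>B\<in>prod_idx n N. id_coeff (Inr i) B * (u (Inr i) * kcof n G B w))"
    by (rule sum.Plus[unfolded o_def]) simp_all
  ultimately show ?thesis by (simp only: gform_eq) simp
qed

lemma wedge_scale_right: "wedge p q \<alpha> (\<lambda>v. \<beta> v / c) v = wedge p q \<alpha> \<beta> v / c"
  unfolding wedge_def times_divide_eq_right sum_divide_distrib[symmetric]
  by (simp only: divide_divide_eq_left mult.commute)

lemma kform_power_pullback_eq':
  "kform_power_pullback n G p = (\<lambda>v. alt_sum p (\<lambda>_. gform n G) v / fact p)"
  unfolding kform_power_pullback_eq gform_def ..

text \<open>The n! that arises from n equal identity factors cancels the one in \<omega>_X^n / n!,
  so the volume density is a single antisymmetrized product.\<close>

lemma kform_power_pullback_fvec: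
  "kform_power_pullback n G n (fvec n v) =
     alt_sum n (\<lambda>k u w. u (Inl k) * kcof n G (Inl k) w) (fvec n v)"
  unfolding kform_power_pullback_eq'
  by (subst alt_sum_identity[where \<theta> = "\<lambda>\<alpha> u. u (Inl \<alpha>)" and \<eta> = "\<lambda>\<alpha>. kcof n G (Inl \<alpha>)", OF gform_eq]) simp

text \<open>Two arbitrary (1,1)-forms against n - 1 copies of \<omega>_X. In the coframe
  \<open>kcof\<close> the latter are identity matrices, so the mixed discriminant applies with the
  base index in the role of n.\<close>

lemma alt_sum_fvec:
  assumes n: "1 \<le> n"
    and b0: "\<And>u w. b 0 u w = (\<Sum>A\<in>prod_idx n N. \<Sum>B\<in>prod_idx n N. cM A B * (u A * kcof n G B w))"
    and b1: "\<And>u w. b 1 u w = (\<Sum>A\<in>prod_idx n N. \<Sum>B\<in>prod_idx n N. cM' A B * (u A * kcof n G B w))"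
    and b2: "\<And>k. 2 \<le> k \<Longrightarrow> b k = gform n G"
  shows "alt_sum (n + 1) b (fvec n v) = fact (n - 1) *
    (\<Sum>i<N. \<Sum>j<N. (v 0 i * cnj (v 1 j) - v 1 i * cnj (v 0 j)) *
       (\<Sum>\<alpha><n. cM (Inl \<alpha>) (Inl \<alpha>) * cM' (Inr i) (Inr j) - cM (Inl \<alpha>) (Inr j) * cM' (Inr i) (Inl \<alpha>)
            + cM (Inr i) (Inr j) * cM' (Inl \<alpha>) (Inl \<alpha>) - cM (Inr i) (Inl \<alpha>) * cM' (Inl \<alpha>) (Inr j)))
    * kform_power_pullback n G n (fvec n v)"
proof -
  define c where "c k = (if k = 0 then cM else if k = 1 then cM' else id_coeff)" for k :: nat
  have b: "b k u w = (\<Sum>A\<in>prod_idx n N. \<Sum>B\<in>prod_idx n N. c k A B * (u A * kcof n G B w))" for k u w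
  proof -
    consider "k = 0" | "k = 1" | "2 \<le> k" by linarith
    then show ?thesis
      by cases (simp_all add: c_def b0 b1[unfolded One_nat_def] b2 gform_id_coeff[of _ _ _ _ N])
  qed
  have D: "(\<Sum>\<sigma> | \<sigma> permutes {..<n + 1}. \<Sum>\<rho> | \<rho> permutes {..<n + 1}.
       of_int (sign \<sigma>) * of_int (sign \<rho>) * (\<Prod>k<n + 1. c k (emb n i (\<sigma> k)) (emb n j (\<rho> k)))) =
     fact (n - 1) * (\<Sum>\<alpha><n. cM (Inl \<alpha>) (Inl \<alpha>) * cM' (Inr i) (Inr j) - cM (Inl \<alpha>) (Inr j) * cM' (Inr i) (Inl \<alpha>)
            + cM (Inr i) (Inr j) * cM' (Inl \<alpha>) (Inl \<alpha>) - cM (Inr i) (Inl \<alpha>) * cM' (Inl \<alpha>) (Inr j))" for i j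
  proof -
    have "c k (emb n i r) (emb n j s) = (if r = s \<and> r < n then 1 else 0)" if "2 \<le> k" for k r s
      using that by (auto simp: c_def id_coeff_def emb_def)
    then show ?thesis
      by (subst mixed_discriminant[OF n, where X = "\<lambda>r s. cM (emb n i r) (emb n j s)"
            and Y = "\<lambda>r s. cM' (emb n i r) (emb n j s)"]) (simp_all add: c_def emb_def)
  qed
  show ?thesis
    unfolding split_frame.alt_sum_split[OF split_frame_fvec b] base_coeff_fvec D kform_power_pullback_fvec
    by (simp add: sum_distrib_left mult_ac)
qed

text \<open>\<omega>_X^n exhausts the directions of X and leaves only the base block of
  \<open>M\<close>. One copy of \<omega>_X plays the second arbitrary form; its trace n together
  with (n - 1)! cancels n!.\<close>

lemma wedge_form11_kform_power:
  assumes n: "1 \<le> n"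
    and inv: "\<And>\<beta> \<gamma>. \<beta> < n \<Longrightarrow> \<gamma> < n \<Longrightarrow> (\<Sum>\<delta><n. Ginv \<beta> \<delta> * G $$ (\<delta>, \<gamma>)) = (if \<beta> = \<gamma> then 1 else 0)"
  shows "wedge 2 (2 * n) (form11 (prod_idx n N) M) (kform_power_pullback n G n) (fvec n v) =
    form11 {..<N} (\<lambda>i j. M (Inr i) (Inr j)) v * kform_power_pullback n G n (fvec n v)"
proof -
  let ?b = "\<lambda>k::nat. if k = 0 then sesq (prod_idx n N) M else gform n G"
  have "wedge 2 (2 * n) (form11 (prod_idx n N) M) (kform_power_pullback n G n) (fvec n v) =
     wedge (2 * 1) (2 * n) (alt_sum 1 (\<lambda>_. sesq (prod_idx n N) M)) (alt_sum n (\<lambda>_. gform n G)) (fvec n v) / fact n"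
    unfolding kform_power_pullback_eq' wedge_scale_right form11_alt_sum by simp
  also have "\<dots> = alt_sum (1 + n) (\<lambda>k. if k < 1 then sesq (prod_idx n N) M else gform n G) (fvec n v) / fact n"
    unfolding wedge_alt_sum ..
  also have "\<dots> = alt_sum (n + 1) ?b (fvec n v) / fact n" by (simp add: add.commute)
  also have "alt_sum (n + 1) ?b (fvec n v) = fact (n - 1) *
    (\<Sum>i<N. \<Sum>j<N. (v 0 i * cnj (v 1 j) - v 1 i * cnj (v 0 j)) * (of_nat n * M (Inr i) (Inr j)))
    * kform_power_pullback n G n (fvec n v)"
    by (subst alt_sum_fvec[OF n, where cM' = id_coeff and N = N and G = G and cM = "kcoeff n Ginv M"])
      (auto simp: sesq_kcoeff[OF inv] gform_id_coeff[of _ _ _ _ N] id_coeff_simps kcoeff_def)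
  also have "\<dots> / fact n = form11 {..<N} (\<lambda>i j. M (Inr i) (Inr j)) v * kform_power_pullback n G n (fvec n v)"
  proof -
    have f: "fact n = (of_nat n * fact (n - 1) :: complex)" using n by (subst fact_reduce) auto
    have "(\<Sum>i<N. \<Sum>j<N. (v 0 i * cnj (v 1 j) - v 1 i * cnj (v 0 j)) * (of_nat n * M (Inr i) (Inr j))) =
      of_nat n * form11 {..<N} (\<lambda>i j. M (Inr i) (Inr j)) v"
      by (simp add: form11_eq sum_distrib_left mult_ac)
    then show ?thesis unfolding f using n by simp
  qed
  finally show ?thesis .
qed

text \<open>\<omega>_X^(n-1) leaves one pair of directions of X beside the base pair. Either each
  form takes a whole pair, or they share them, which costs a sign; \<open>- \<i> * Ginv\<close>
  contracts the X-indices.\<close>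

lemma wedge_form11_form11_kform_power:
  assumes n: "1 \<le> n"
    and inv: "\<And>\<beta> \<gamma>. \<beta> < n \<Longrightarrow> \<gamma> < n \<Longrightarrow> (\<Sum>\<delta><n. Ginv \<beta> \<delta> * G $$ (\<delta>, \<gamma>)) = (if \<beta> = \<gamma> then 1 else 0)"
  shows "wedge 4 (2 * (n - 1)) (wedge 2 2 (form11 (prod_idx n N) M) (form11 (prod_idx n N) M'))
       (kform_power_pullback n G (n - 1)) (fvec n v) =
    form11 {..<N} (\<lambda>i j. \<Sum>\<alpha><n. \<Sum>\<beta><n. - \<i> * Ginv \<beta> \<alpha> *
       (M (Inl \<alpha>) (Inl \<beta>) * M' (Inr i) (Inr j) + M (Inr i) (Inr j) * M' (Inl \<alpha>) (Inl \<beta>)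
        - M (Inl \<alpha>) (Inr j) * M' (Inr i) (Inl \<beta>) - M (Inr i) (Inl \<beta>) * M' (Inl \<alpha>) (Inr j))) v
     * kform_power_pullback n G n (fvec n v)"
proof -
  let ?I = "prod_idx n N"
  let ?b = "\<lambda>k::nat. if k = 0 then sesq ?I M else if k = 1 then sesq ?I M' else gform n G"
  have w2: "wedge 2 2 (form11 ?I M) (form11 ?I M') = alt_sum 2 (\<lambda>k. if k < 1 then sesq ?I M else sesq ?I M')"
    unfolding form11_alt_sum using wedge_alt_sum[of 1 1 "\<lambda>_. sesq ?I M" "\<lambda>_. sesq ?I M'"] by (simp add: numeral_2_eq_2)
  have "wedge 4 (2 * (n - 1)) (wedge 2 2 (form11 ?I M) (form11 ?I M')) (kform_power_pullback n G (n - 1)) (fvec n v) =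
     wedge (2 * 2) (2 * (n - 1)) (alt_sum 2 (\<lambda>k. if k < 1 then sesq ?I M else sesq ?I M'))
       (alt_sum (n - 1) (\<lambda>_. gform n G)) (fvec n v) / fact (n - 1)"
    unfolding kform_power_pullback_eq' wedge_scale_right w2 by simp
  also have "\<dots> = alt_sum (2 + (n - 1)) (\<lambda>k::nat. if k < 2 then if k < 1 then sesq ?I M else sesq ?I M' else gform n G) (fvec n v) / fact (n - 1)"
    unfolding wedge_alt_sum ..
  also have "2 + (n - 1) = n + 1" using n by simp
  also have "(\<lambda>k::nat. if k < 2 then if k < 1 then sesq ?I M else sesq ?I M' else gform n G) = ?b"
    by (auto simp: fun_eq_iff less_2_cases_iff)
  also have "alt_sum (n + 1) ?b (fvec n v) = fact (n - 1) *
    (\<Sum>i<N. \<Sum>j<N. (v 0 i * cnj (v 1 j) - v 1 i * cnj (v 0 j)) *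
       (\<Sum>\<alpha><n. kcoeff n Ginv M (Inl \<alpha>) (Inl \<alpha>) * M' (Inr i) (Inr j) - M (Inl \<alpha>) (Inr j) * kcoeff n Ginv M' (Inr i) (Inl \<alpha>)
            + M (Inr i) (Inr j) * kcoeff n Ginv M' (Inl \<alpha>) (Inl \<alpha>) - kcoeff n Ginv M (Inr i) (Inl \<alpha>) * M' (Inl \<alpha>) (Inr j)))
    * kform_power_pullback n G n (fvec n v)"
    by (subst alt_sum_fvec[OF n, where cM = "kcoeff n Ginv M" and cM' = "kcoeff n Ginv M'" and N = N and G = G])
      (auto simp: sesq_kcoeff[OF inv] kcoeff_def)
  also have "(\<lambda>i j. \<Sum>\<alpha><n. kcoeff n Ginv M (Inl \<alpha>) (Inl \<alpha>) * M' (Inr i) (Inr j) - M (Inl \<alpha>) (Inr j) * kcoeff n Ginv M' (Inr i) (Inl \<alpha>)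
            + M (Inr i) (Inr j) * kcoeff n Ginv M' (Inl \<alpha>) (Inl \<alpha>) - kcoeff n Ginv M (Inr i) (Inl \<alpha>) * M' (Inl \<alpha>) (Inr j)) =
     (\<lambda>i j. \<Sum>\<alpha><n. \<Sum>\<beta><n. - \<i> * Ginv \<beta> \<alpha> *
       (M (Inl \<alpha>) (Inl \<beta>) * M' (Inr i) (Inr j) + M (Inr i) (Inr j) * M' (Inl \<alpha>) (Inl \<beta>)
        - M (Inl \<alpha>) (Inr j) * M' (Inr i) (Inl \<beta>) - M (Inr i) (Inl \<beta>) * M' (Inl \<alpha>) (Inr j)))"
    unfolding kcoeff_def sum.case sum_distrib_left sum_distrib_right sum.distrib[symmetric] sum_subtractf[symmetric]
    by (intro ext sum.cong refl) (simp add: algebra_simps)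
  finally show ?thesis by (simp add: form11_eq[of "{..<N}"] mult_ac)
qed

lemma wedge_linear_left:
  "wedge p q (\<lambda>v. c * (\<Sum>a\<in>A. \<alpha> a v)) \<beta> v = c * (\<Sum>a\<in>A. wedge p q (\<alpha> a) \<beta> v)"
proof -
  have "(\<Sum>\<pi> | \<pi> permutes {..<p + q}. of_int (sign \<pi>) * (c * (\<Sum>a\<in>A. \<alpha> a (\<lambda>k. v (\<pi> k)))) * \<beta> (\<lambda>k. v (\<pi> (p + k)))) =
     c * (\<Sum>a\<in>A. \<Sum>\<pi> | \<pi> permutes {..<p + q}. of_int (sign \<pi>) * \<alpha> a (\<lambda>k. v (\<pi> k)) * \<beta> (\<lambda>k. v (\<pi> (p + k))))"
    unfolding sum_distrib_left sum_distrib_right by (subst sum.swap) (simp only: mult_ac)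
  then show ?thesis by (simp add: wedge_def sum_divide_distrib[symmetric])
qed

lemma wedge_sum_left: "wedge p q (\<lambda>v. \<Sum>a\<in>A. \<alpha> a v) \<beta> v = (\<Sum>a\<in>A. wedge p q (\<alpha> a) \<beta> v)"
  using wedge_linear_left[of p q 1 \<alpha> A \<beta> v] by simp

section \<open>Smooth functions and Wirtinger derivatives\<close>

definition line :: "('i \<Rightarrow> complex) \<Rightarrow> ('i \<Rightarrow> complex) \<Rightarrow> real \<Rightarrow> 'i \<Rightarrow> complex" where
  "line w u t = (\<lambda>A. w A + of_real t * u A)"

lemma dir_deriv_line: "dir_deriv u f w = vector_derivative (\<lambda>t. f (line w u t)) (at 0)"
  by (simp add: dir_deriv_def line_def)

lemma line_0 [simp]: "line w u 0 = w" by (simp add: line_def)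

lemma line_line: "line (line w u s) u t = line w u (s + t)"
  by (simp add: line_def algebra_simps)

lemma line_axis_vec: "line w (axis_vec A c) t = w(A := w A + of_real t * c)"
  by (auto simp: line_def axis_vec_def fun_eq_iff)

lemma continuous_on_line [continuous_intros]: "continuous_on S (line w u)"
  unfolding line_def by (intro continuous_on_coordinatewise_then_product continuous_intros)

lemma cspace_upd: "w \<in> cspace I \<Longrightarrow> A \<in> I \<Longrightarrow> w(A := z) \<in> cspace I"
  by (auto simp: cspace_def)

lemma copen_sub: "copen I D \<Longrightarrow> w \<in> D \<Longrightarrow> w \<in> cspace I"
  by (auto dest: openin_imp_subset)

lemma copen_open_preimage:
  assumes "copen I D" "continuous_on UNIV \<gamma>" "\<And>t. \<gamma> t \<in> cspace I"
  shows "open {t. \<gamma> t \<in> D}"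
proof -
  obtain T where T: "open T" "D = cspace I \<inter> T" using assms(1) by (auto simp: openin_open)
  have "{t. \<gamma> t \<in> D} = \<gamma> -` T" using T(2) assms(3) by auto
  then show ?thesis using assms(2) T(1) by (simp add: open_vimage)
qed

text \<open>\<open>D\<close> is open only relative to \<open>cspace I\<close>, but lines along an
  axis in \<open>I\<close> do not leave \<open>cspace I\<close>. So derivatives along these axes
  depend on values in \<open>D\<close> alone.\<close>

lemma copen_line:
  assumes "copen I D" "w \<in> D" "A \<in> I"
  shows "open {t. line w (axis_vec A c) t \<in> D}"
  using assms copen_sub[OF assms(1,2)]
  by (intro copen_open_preimage[OF assms(1)] continuous_on_line) (auto simp: line_axis_vec intro: cspace_upd)

lemma copen_line_eventually:
  assumes "copen I D" "w \<in> D" "A \<in> I"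
  shows "\<forall>\<^sub>F t in nhds 0. line w (axis_vec A c) t \<in> D"
  using eventually_nhds_in_open[OF copen_line[OF assms], of 0 c] assms(2) by simp

lemma dir_deriv_cong:
  assumes "copen I D" "w \<in> D" "A \<in> I" "\<And>y. y \<in> D \<Longrightarrow> f y = g y"
  shows "((\<lambda>t. f (line w (axis_vec A c) t)) has_vector_derivative d) (at 0) \<longleftrightarrow>
         ((\<lambda>t. g (line w (axis_vec A c) t)) has_vector_derivative d) (at 0)"
    and "dir_deriv (axis_vec A c) f w = dir_deriv (axis_vec A c) g w"
proof -
  have ev: "\<forall>\<^sub>F t in nhds 0. f (line w (axis_vec A c) t) = g (line w (axis_vec A c) t)"
    using copen_line_eventually[OF assms(1-3), of c] by eventually_elim (rule assms(4))
  have *: "((\<lambda>t. f (line w (axis_vec A c) t)) has_vector_derivative d) (at 0) \<longleftrightarrow>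
         ((\<lambda>t. g (line w (axis_vec A c) t)) has_vector_derivative d) (at 0)" for d
    using ev by (intro has_vector_derivative_cong_ev) (auto elim: eventually_mono simp: eventually_nhds_x_imp_x assms)
  then show "((\<lambda>t. f (line w (axis_vec A c) t)) has_vector_derivative d) (at 0) \<longleftrightarrow>
         ((\<lambda>t. g (line w (axis_vec A c) t)) has_vector_derivative d) (at 0)" .
  show "dir_deriv (axis_vec A c) f w = dir_deriv (axis_vec A c) g w"
    unfolding dir_deriv_line vector_derivative_def * ..
qed

lemma dir_deriv_unique:
  "((\<lambda>t. f (line w u t)) has_vector_derivative d) (at 0) \<Longrightarrow> dir_deriv u f w = d"
  unfolding dir_deriv_line by (rule vector_derivative_at)

lemma C_on_Suc_iff:
  "C_on (Suc m) I D f \<longleftrightarrow> continuous_on D f \<and>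
     (\<forall>A\<in>I. \<forall>c\<in>{1, \<i>}.
        (\<forall>w\<in>D. ((\<lambda>t. f (line w (axis_vec A c) t)) has_vector_derivative dir_deriv (axis_vec A c) f w) (at 0)) \<and>
        C_on m I D (dir_deriv (axis_vec A c) f))"
  unfolding C_on.simps dir_deriv_line line_def vector_derivative_works ..

lemma C_on_imp_continuous: "C_on m I D f \<Longrightarrow> continuous_on D f"
  by (cases m) auto

lemma C_on_has_dir_deriv:
  assumes "C_on (Suc m) I D f" "w \<in> D" "A \<in> I" "c \<in> {1, \<i>}"
  shows "((\<lambda>t. f (line w (axis_vec A c) t)) has_vector_derivative dir_deriv (axis_vec A c) f w) (at 0)"
  using assms unfolding C_on_Suc_iff by blast

lemma C_on_cong:
  assumes "copen I D" "\<And>y. y \<in> D \<Longrightarrow> f y = g y"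
  shows "C_on m I D f \<longleftrightarrow> C_on m I D g"
  using assms(2)
proof (induction m arbitrary: f g)
  case 0
  then show ?case by (simp cong: continuous_on_cong)
next
  case (Suc m)
  have c: "continuous_on D f \<longleftrightarrow> continuous_on D g" using Suc.prems by (intro continuous_on_cong) auto
  have "C_on m I D (dir_deriv (axis_vec A c) f) \<longleftrightarrow> C_on m I D (dir_deriv (axis_vec A c) g)"
    if "A \<in> I" for A c
    by (rule Suc.IH) (rule dir_deriv_cong(2)[OF assms(1) _ that Suc.prems])
  then show ?case
    unfolding C_on_Suc_iff c
    using dir_deriv_cong[OF assms(1), where f = f and g = g, OF _ _ Suc.prems] by (auto simp: c)
qed

text \<open>The sum, product and quotient rules produce an explicit candidate \<open>f'\<close> for
  the derivatives; uniqueness of the vector derivative identifies it with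
  \<open>dir_deriv\<close>.\<close>

lemma C_on_SucI:
  assumes op: "copen I D" and cont: "continuous_on D f"
    and d: "\<And>A c w. A \<in> I \<Longrightarrow> c \<in> {1, \<i>} \<Longrightarrow> w \<in> D \<Longrightarrow>
      ((\<lambda>t. f (line w (axis_vec A c) t)) has_vector_derivative f' A c w) (at 0)"
    and C: "\<And>A c. A \<in> I \<Longrightarrow> c \<in> {1, \<i>} \<Longrightarrow> C_on m I D (f' A c)"
  shows "C_on (Suc m) I D f"
proof -
  have eq: "dir_deriv (axis_vec A c) f w = f' A c w" if "A \<in> I" "c \<in> {1, \<i>}" "w \<in> D" for A c w
    by (rule dir_deriv_unique[OF d[OF that]])
  have "C_on m I D (dir_deriv (axis_vec A c) f)" if "A \<in> I" "c \<in> {1, \<i>}" for A c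
    using C_on_cong[OF op, of "dir_deriv (axis_vec A c) f" "f' A c" m] eq[OF that] C[OF that] by blast
  then show ?thesis unfolding C_on_Suc_iff using cont d eq by auto
qed

lemma C_on_Suc_imp:
  assumes "C_on (Suc m) I D f"
  shows "C_on m I D f"
  using assms
proof (induction m arbitrary: f)
  case 0
  then show ?case by simp
next
  case (Suc m)
  then show ?case unfolding C_on_Suc_iff[of "Suc m"] C_on_Suc_iff[of m I D f] by blast
qed

lemma C_on_dir_deriv:
  "C_on (Suc m) I D f \<Longrightarrow> A \<in> I \<Longrightarrow> c \<in> {1, \<i>} \<Longrightarrow> C_on m I D (dir_deriv (axis_vec A c) f)"
  unfolding C_on_Suc_iff by blast

lemma C_on_const: "copen I D \<Longrightarrow> C_on m I D (\<lambda>_. k)"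
proof (induction m arbitrary: k)
  case (Suc m)
  show ?case by (rule C_on_SucI[where f' = "\<lambda>_ _ _. 0"]) (use Suc in \<open>auto intro: derivative_intros\<close>)
qed simp

lemma C_on_add:
  assumes op: "copen I D"
  shows "C_on m I D f \<Longrightarrow> C_on m I D g \<Longrightarrow> C_on m I D (\<lambda>w. f w + g w)"
proof (induction m arbitrary: f g)
  case 0
  then show ?case by (auto intro: continuous_intros)
next
  case (Suc m)
  show ?case
  proof (rule C_on_SucI[OF op, where f' = "\<lambda>A c w. dir_deriv (axis_vec A c) f w + dir_deriv (axis_vec A c) g w"])
    show "continuous_on D (\<lambda>w. f w + g w)"
      using Suc.prems C_on_imp_continuous by (intro continuous_intros) blast+
  next
    fix A c w assume a: "A \<in> I" "c \<in> {1, \<i>}" "w \<in> D"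
    show "((\<lambda>t. f (line w (axis_vec A c) t) + g (line w (axis_vec A c) t)) has_vector_derivative
        dir_deriv (axis_vec A c) f w + dir_deriv (axis_vec A c) g w) (at 0)"
      by (rule has_vector_derivative_add[OF C_on_has_dir_deriv[OF Suc.prems(1) a(3,1,2)] C_on_has_dir_deriv[OF Suc.prems(2) a(3,1,2)]])
  next
    fix A c assume a: "A \<in> I" "c \<in> {1, \<i>}"
    show "C_on m I D (\<lambda>w. dir_deriv (axis_vec A c) f w + dir_deriv (axis_vec A c) g w)"
      using a Suc.prems by (intro Suc.IH C_on_dir_deriv)
  qed
qed

lemma C_on_mult:
  assumes op: "copen I D"
  shows "C_on m I D f \<Longrightarrow> C_on m I D g \<Longrightarrow> C_on m I D (\<lambda>w. f w * g w)"
proof (induction m arbitrary: f g)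
  case 0
  then show ?case by (auto intro: continuous_intros)
next
  case (Suc m)
  show ?case
  proof (rule C_on_SucI[OF op, where f' = "\<lambda>A c w. f w * dir_deriv (axis_vec A c) g w + dir_deriv (axis_vec A c) f w * g w"])
    show "continuous_on D (\<lambda>w. f w * g w)"
      using Suc.prems C_on_imp_continuous by (intro continuous_intros) blast+
  next
    fix A c w assume a: "A \<in> I" "c \<in> {1, \<i>}" "w \<in> D"
    show "((\<lambda>t. f (line w (axis_vec A c) t) * g (line w (axis_vec A c) t)) has_vector_derivative
        f w * dir_deriv (axis_vec A c) g w + dir_deriv (axis_vec A c) f w * g w) (at 0)"
      using has_vector_derivative_mult[OF C_on_has_dir_deriv[OF Suc.prems(1) a(3,1,2)] C_on_has_dir_deriv[OF Suc.prems(2) a(3,1,2)]]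
      by simp
  next
    fix A c assume a: "A \<in> I" "c \<in> {1, \<i>}"
    show "C_on m I D (\<lambda>w. f w * dir_deriv (axis_vec A c) g w + dir_deriv (axis_vec A c) f w * g w)"
      by (intro C_on_add op Suc.IH C_on_dir_deriv[OF _ a] Suc.prems C_on_Suc_imp[OF Suc.prems(1)] C_on_Suc_imp[OF Suc.prems(2)])
  qed
qed

lemma C_on_cnj:
  assumes op: "copen I D"
  shows "C_on m I D f \<Longrightarrow> C_on m I D (\<lambda>w. cnj (f w))"
proof (induction m arbitrary: f)
  case 0
  then show ?case by (auto intro: continuous_intros)
next
  case (Suc m)
  show ?case
  proof (rule C_on_SucI[OF op, where f' = "\<lambda>A c w. cnj (dir_deriv (axis_vec A c) f w)"])
    show "continuous_on D (\<lambda>w. cnj (f w))"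
      using Suc.prems C_on_imp_continuous by (intro continuous_intros) blast+
  next
    fix A c w assume a: "A \<in> I" "c \<in> {1, \<i>}" "w \<in> D"
    show "((\<lambda>t. cnj (f (line w (axis_vec A c) t))) has_vector_derivative cnj (dir_deriv (axis_vec A c) f w)) (at 0)"
      by (rule bounded_linear.has_vector_derivative[OF bounded_linear_cnj C_on_has_dir_deriv[OF Suc.prems(1) a(3,1,2)]])
  next
    fix A c assume a: "A \<in> I" "c \<in> {1, \<i>}"
    show "C_on m I D (\<lambda>w. cnj (dir_deriv (axis_vec A c) f w))"
      using a Suc.prems by (intro Suc.IH C_on_dir_deriv)
  qed
qed

lemma C_on_inverse:
  assumes op: "copen I D" and nz: "\<And>w. w \<in> D \<Longrightarrow> f w \<noteq> 0"
  shows "C_on m I D f \<Longrightarrow> C_on m I D (\<lambda>w. inverse (f w))"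
proof (induction m)
  case 0
  then show ?case using nz by (auto intro!: continuous_intros)
next
  case (Suc m)
  show ?case
  \<comment> \<open>The derivative is written with products of \<open>inverse (f w)\<close> only, so
    that the induction hypothesis covers it.\<close>
  proof (rule C_on_SucI[OF op, where f' = "\<lambda>A c w. - 1 * (dir_deriv (axis_vec A c) f w * (inverse (f w) * inverse (f w)))"])
    show "continuous_on D (\<lambda>w. inverse (f w))"
      using Suc.prems C_on_imp_continuous nz by (intro continuous_intros) blast+
  next
    fix A c w assume a: "A \<in> I" "c \<in> {1, \<i>}" "w \<in> D"
    have "((\<lambda>t. inverse (f (line w (axis_vec A c) t))) has_vector_derivative
        dir_deriv (axis_vec A c) f w * - (inverse (f w) ^ Suc (Suc 0))) (at 0)"
      using nz[OF a(3)]
      by (intro field_vector_diff_chain_at[OF C_on_has_dir_deriv[OF Suc.prems(1) a(3,1,2)], of inverse, unfolded o_def line_0])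
         (rule DERIV_inverse)
    then show "((\<lambda>t. inverse (f (line w (axis_vec A c) t))) has_vector_derivative
        - 1 * (dir_deriv (axis_vec A c) f w * (inverse (f w) * inverse (f w)))) (at 0)" by simp
  next
    fix A c assume a: "A \<in> I" "c \<in> {1, \<i>}"
    show "C_on m I D (\<lambda>w. - 1 * (dir_deriv (axis_vec A c) f w * (inverse (f w) * inverse (f w))))"
      by (intro C_on_mult op Suc.IH[OF C_on_Suc_imp[OF Suc.prems]] C_on_dir_deriv[OF _ a] Suc.prems C_on_const)
  qed
qed

section \<open>Symmetry of mixed partial derivatives\<close>

lemma real_mixed_partials:
  fixes G Gs Gt Gst Gts :: "real \<Rightarrow> real \<Rightarrow> real"
  assumes e: "0 < e"
    and d1: "\<And>s t. \<bar>s\<bar> < e \<Longrightarrow> \<bar>t\<bar> < e \<Longrightarrow> ((\<lambda>s. G s t) has_real_derivative Gs s t) (at s)"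
    and d2: "\<And>s t. \<bar>s\<bar> < e \<Longrightarrow> \<bar>t\<bar> < e \<Longrightarrow> ((\<lambda>t. G s t) has_real_derivative Gt s t) (at t)"
    and d12: "\<And>s t. \<bar>s\<bar> < e \<Longrightarrow> \<bar>t\<bar> < e \<Longrightarrow> ((\<lambda>t. Gs s t) has_real_derivative Gst s t) (at t)"
    and d21: "\<And>s t. \<bar>s\<bar> < e \<Longrightarrow> \<bar>t\<bar> < e \<Longrightarrow> ((\<lambda>s. Gt s t) has_real_derivative Gts s t) (at s)"
    and c12: "isCont (\<lambda>p. Gst (fst p) (snd p)) (0, 0)"
    and c21: "isCont (\<lambda>p. Gts (fst p) (snd p)) (0, 0)"
  shows "Gst 0 0 = Gts 0 0"
proof (rule ccontr)
  assume ne: "Gst 0 0 \<noteq> Gts 0 0"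
  \<comment> \<open>Half the gap: no number lies within less than this of both values.\<close>
  define \<epsilon> where "\<epsilon> = \<bar>Gst 0 0 - Gts 0 0\<bar> / 2"
  have \<epsilon>: "0 < \<epsilon>" using ne by (simp add: \<epsilon>_def)
  obtain r1 where r1: "0 < r1" "\<And>p. dist p (0, 0) < r1 \<Longrightarrow> \<bar>Gst (fst p) (snd p) - Gst 0 0\<bar> < \<epsilon>"
    using c12 \<epsilon> unfolding continuous_at_eps_delta dist_real_def by (metis fst_conv snd_conv)
  obtain r2 where r2: "0 < r2" "\<And>p. dist p (0, 0) < r2 \<Longrightarrow> \<bar>Gts (fst p) (snd p) - Gts 0 0\<bar> < \<epsilon>"
    using c21 \<epsilon> unfolding continuous_at_eps_delta dist_real_def by (metis fst_conv snd_conv)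
  \<comment> \<open>A point of the open square of side \<open>h\<close> at the origin is at distance
    less than 2h from it, hence the halved radii.\<close>
  define h where "h = min e (min (r1 / 2) (r2 / 2)) / 2"
  have h: "0 < h" "h < e" "h < r1 / 2" "h < r2 / 2" using e r1(1) r2(1) by (auto simp: h_def)
  have near: "dist (\<xi>, \<eta>) (0, 0) < r" if "0 < \<xi>" "\<xi> < h" "0 < \<eta>" "\<eta> < h" "h < r / 2" for \<xi> \<eta> r :: real
  proof -
    have "dist (\<xi>, \<eta>) (0, 0) = sqrt (\<xi>\<^sup>2 + \<eta>\<^sup>2)" by (simp add: dist_Pair_Pair dist_real_def)
    also have "\<dots> \<le> \<xi> + \<eta>" using that by (simp add: sqrt_sum_squares_le_sum)
    finally show ?thesis using that by simp
  qed
  \<comment> \<open>The second difference over the square. The mean value theorem, applied in either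
    order of the variables, expresses it as h^2 times either mixed partial at a point of the
    square.\<close>
  define \<Delta> where "\<Delta> = G h h - G h 0 - G 0 h + G 0 0"
  obtain \<xi> where \<xi>: "0 < \<xi>" "\<xi> < h" "(G h h - G h 0) - (G 0 h - G 0 0) = (h - 0) * (Gs \<xi> h - Gs \<xi> 0)"
  proof -
    have "((\<lambda>s. G s h - G s 0) has_real_derivative (\<lambda>s. Gs s h - Gs s 0) x) (at x)" if "0 \<le> x" "x \<le> h" for x
      using that h by (auto intro!: DERIV_diff d1)
    from MVT2[OF h(1) this] show ?thesis using that by auto
  qed
  obtain \<eta> where \<eta>: "0 < \<eta>" "\<eta> < h" "Gs \<xi> h - Gs \<xi> 0 = (h - 0) * Gst \<xi> \<eta>"
  proof -
    have "((Gs \<xi>) has_real_derivative (Gst \<xi>) x) (at x)" if "0 \<le> x" "x \<le> h" for x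
      using that h \<xi> by (auto intro!: DERIV_diff d12)
    from MVT2[OF h(1) this] show ?thesis using that by auto
  qed
  have 1: "\<Delta> = h * h * Gst \<xi> \<eta>" using \<xi>(3) \<eta>(3) by (simp add: \<Delta>_def)
  obtain \<eta>' where \<eta>': "0 < \<eta>'" "\<eta>' < h" "(G h h - G 0 h) - (G h 0 - G 0 0) = (h - 0) * (Gt h \<eta>' - Gt 0 \<eta>')"
  proof -
    have "((\<lambda>t. G h t - G 0 t) has_real_derivative (\<lambda>t. Gt h t - Gt 0 t) x) (at x)" if "0 \<le> x" "x \<le> h" for x
      using that h by (auto intro!: DERIV_diff d2)
    from MVT2[OF h(1) this] show ?thesis using that by auto
  qed
  obtain \<xi>' where \<xi>': "0 < \<xi>'" "\<xi>' < h" "Gt h \<eta>' - Gt 0 \<eta>' = (h - 0) * Gts \<xi>' \<eta>'"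
  proof -
    have "((\<lambda>s. Gt s \<eta>') has_real_derivative (\<lambda>s. Gts s \<eta>') x) (at x)" if "0 \<le> x" "x \<le> h" for x
      using that h \<eta>' by (auto intro!: DERIV_diff d21)
    from MVT2[OF h(1) this] show ?thesis using that by auto
  qed
  have "\<Delta> = h * h * Gts \<xi>' \<eta>'" using \<eta>'(3) \<xi>'(3) by (simp add: \<Delta>_def)
  then have "Gst \<xi> \<eta> = Gts \<xi>' \<eta>'" using 1 h by simp
  moreover have "\<bar>Gst \<xi> \<eta> - Gst 0 0\<bar> < \<epsilon>"
    using r1(2)[of "(\<xi>, \<eta>)"] near[of \<xi> \<eta> r1] \<xi> \<eta> h by simp
  moreover have "\<bar>Gts \<xi>' \<eta>' - Gts 0 0\<bar> < \<epsilon>"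
    using r2(2)[of "(\<xi>', \<eta>')"] near[of \<xi>' \<eta>' r2] \<xi>' \<eta>' h by simp
  ultimately show False unfolding \<epsilon>_def by (simp add: abs_if field_simps split: if_splits)
qed

lemma Schwarz_complex:
  fixes G Gs Gt Gst Gts :: "real \<Rightarrow> real \<Rightarrow> complex"
  assumes e: "0 < e"
    and d1: "\<And>s t. \<bar>s\<bar> < e \<Longrightarrow> \<bar>t\<bar> < e \<Longrightarrow> ((\<lambda>s. G s t) has_vector_derivative Gs s t) (at s)"
    and d2: "\<And>s t. \<bar>s\<bar> < e \<Longrightarrow> \<bar>t\<bar> < e \<Longrightarrow> ((\<lambda>t. G s t) has_vector_derivative Gt s t) (at t)"
    and d12: "\<And>s t. \<bar>s\<bar> < e \<Longrightarrow> \<bar>t\<bar> < e \<Longrightarrow> ((\<lambda>t. Gs s t) has_vector_derivative Gst s t) (at t)"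
    and d21: "\<And>s t. \<bar>s\<bar> < e \<Longrightarrow> \<bar>t\<bar> < e \<Longrightarrow> ((\<lambda>s. Gt s t) has_vector_derivative Gts s t) (at s)"
    and c12: "isCont (\<lambda>p. Gst (fst p) (snd p)) (0, 0)"
    and c21: "isCont (\<lambda>p. Gts (fst p) (snd p)) (0, 0)"
  shows "Gst 0 0 = Gts 0 0"
proof (rule complex_eqI)
  note re = bounded_linear.has_vector_derivative[OF bounded_linear_Re, folded has_real_derivative_iff_has_vector_derivative]
  note im = bounded_linear.has_vector_derivative[OF bounded_linear_Im, folded has_real_derivative_iff_has_vector_derivative]
  show "Re (Gst 0 0) = Re (Gts 0 0)"
    by (rule real_mixed_partials[OF e, where G = "\<lambda>s t. Re (G s t)" and Gs = "\<lambda>s t. Re (Gs s t)" and Gt = "\<lambda>s t. Re (Gt s t)"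
          and Gst = "\<lambda>s t. Re (Gst s t)" and Gts = "\<lambda>s t. Re (Gts s t)"])
      (intro re d1 d2 d12 d21 continuous_Re c12 c21; assumption)+
  show "Im (Gst 0 0) = Im (Gts 0 0)"
    by (rule real_mixed_partials[OF e, where G = "\<lambda>s t. Im (G s t)" and Gs = "\<lambda>s t. Im (Gs s t)" and Gt = "\<lambda>s t. Im (Gt s t)"
          and Gst = "\<lambda>s t. Im (Gst s t)" and Gts = "\<lambda>s t. Im (Gts s t)"])
      (intro im d1 d2 d12 d21 continuous_Im c12 c21; assumption)+
qed

lemma line_commute: "line (line w u s) u' t = line (line w u' t) u s"
  by (simp add: line_def add_ac)

text \<open>The class \<open>C_on\<close> gives the derivative at parameter 0 of lines through every
  point; moving the base point along the line gives it at parameter \<open>t\<close>.\<close>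

lemma C_on_has_dir_deriv_along:
  assumes f: "C_on (Suc m) I D f" and A: "A \<in> I" "c \<in> {1, \<i>}" and D: "line w (axis_vec A c) t \<in> D"
  shows "((\<lambda>t. f (line w (axis_vec A c) t)) has_vector_derivative dir_deriv (axis_vec A c) f (line w (axis_vec A c) t)) (at t)"
proof -
  have "((\<lambda>s. f (line w (axis_vec A c) (t + s))) has_vector_derivative dir_deriv (axis_vec A c) f (line w (axis_vec A c) t)) (at 0)"
    using C_on_has_dir_deriv[OF f D A] unfolding line_line .
  then have "((\<lambda>s. f (line w (axis_vec A c) (t + s))) \<circ> (\<lambda>x. x - t) has_vector_derivative
      1 *\<^sub>R dir_deriv (axis_vec A c) f (line w (axis_vec A c) t)) (at t)"
    by (intro vector_diff_chain_at) (auto intro!: derivative_eq_intros)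
  then show ?thesis by (simp add: o_def)
qed

text \<open>Reduces to two real parameters by restricting \<open>f\<close> to the map \<gamma>
  spanned at \<open>w\<close> by the two axis vectors, which may belong to the same complex
  coordinate.\<close>

lemma dir_deriv_commute:
  assumes op: "copen I D" and f: "C_on 2 I D f" and w: "w \<in> D"
    and A: "A \<in> I" "c \<in> {1, \<i>}" and B: "B \<in> I" "d \<in> {1, \<i>}"
  shows "dir_deriv (axis_vec B d) (dir_deriv (axis_vec A c) f) w = dir_deriv (axis_vec A c) (dir_deriv (axis_vec B d) f) w"
proof -
  let ?u = "axis_vec A c" and ?v = "axis_vec B d"
  define \<gamma> where "\<gamma> p = line (line w ?u (fst p)) ?v (snd p)" for p :: "real \<times> real"
  have f2: "C_on (Suc (Suc 0)) I D f" using f by (simp only: numeral_2_eq_2)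
  have fA: "C_on (Suc 0) I D (dir_deriv ?u f)" using C_on_dir_deriv[OF f2 A] .
  have fB: "C_on (Suc 0) I D (dir_deriv ?v f)" using C_on_dir_deriv[OF f2 B] .
  have fAB: "continuous_on D (dir_deriv ?v (dir_deriv ?u f))" using C_on_dir_deriv[OF fA B] by simp
  have fBA: "continuous_on D (dir_deriv ?u (dir_deriv ?v f))" using C_on_dir_deriv[OF fB A] by simp
  have g: "continuous_on UNIV \<gamma>"
    unfolding \<gamma>_def line_def by (intro continuous_on_coordinatewise_then_product continuous_intros)
  have "\<gamma> p \<in> cspace I" for p
    using copen_sub[OF op w] A B unfolding \<gamma>_def line_axis_vec by (intro cspace_upd)
  then have opg: "open {p. \<gamma> p \<in> D}" by (rule copen_open_preimage[OF op g])
  have g0: "\<gamma> (0, 0) = w" by (simp add: \<gamma>_def)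
  have "(0, 0) \<in> {p. \<gamma> p \<in> D}" using w g0 by simp
  then obtain r where r0: "0 < r" "ball (0, 0) r \<subseteq> {p. \<gamma> p \<in> D}" using openE[OF opg] by blast
  then have r: "0 < r" "\<And>p. dist p (0, 0) < r \<Longrightarrow> \<gamma> p \<in> D" by (auto simp: subset_iff dist_commute)
  define e where "e = r / 2"
  have e: "0 < e" using r by (simp add: e_def)
  have inD: "\<gamma> (s, t) \<in> D" if "\<bar>s\<bar> < e" "\<bar>t\<bar> < e" for s t
  proof (rule r(2))
    have "dist (s, t) (0, 0) = sqrt (s\<^sup>2 + t\<^sup>2)" by (simp add: dist_Pair_Pair dist_real_def)
    also have "\<dots> \<le> \<bar>s\<bar> + \<bar>t\<bar>" by (rule sqrt_sum_squares_le_sum_abs)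
    finally show "dist (s, t) (0, 0) < r" using that by (simp add: e_def)
  qed
  have cont: "isCont (\<lambda>p. F (\<gamma> (fst p, snd p))) (0, 0)" if F: "continuous_on D F" for F :: "_ \<Rightarrow> complex"
  proof -
    have "continuous_on {p. \<gamma> p \<in> D} (\<lambda>p. F (\<gamma> p))"
      by (rule continuous_on_compose2[OF F continuous_on_subset[OF g]]) auto
    then show ?thesis using opg w g0 by (simp add: continuous_on_eq_continuous_at)
  qed
  have g1: "\<gamma> (s, t) = line (line w ?u s) ?v t" "\<gamma> (s, t) = line (line w ?v t) ?u s" for s t
    by (simp_all add: \<gamma>_def line_commute)
  have "dir_deriv ?v (dir_deriv ?u f) (\<gamma> (0, 0)) = dir_deriv ?u (dir_deriv ?v f) (\<gamma> (0, 0))"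
  proof (rule Schwarz_complex[OF e, where G = "\<lambda>s t. f (\<gamma> (s, t))" and Gs = "\<lambda>s t. dir_deriv ?u f (\<gamma> (s, t))"
        and Gt = "\<lambda>s t. dir_deriv ?v f (\<gamma> (s, t))" and Gst = "\<lambda>s t. dir_deriv ?v (dir_deriv ?u f) (\<gamma> (s, t))"
        and Gts = "\<lambda>s t. dir_deriv ?u (dir_deriv ?v f) (\<gamma> (s, t))"])
    fix s t :: real assume "\<bar>s\<bar> < e" "\<bar>t\<bar> < e"
    then have D: "\<gamma> (s, t) \<in> D" by (rule inD)
    show "((\<lambda>s. f (\<gamma> (s, t))) has_vector_derivative dir_deriv ?u f (\<gamma> (s, t))) (at s)"
      using D unfolding g1(2) by (rule C_on_has_dir_deriv_along[OF f2 A])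
    show "((\<lambda>t. f (\<gamma> (s, t))) has_vector_derivative dir_deriv ?v f (\<gamma> (s, t))) (at t)"
      using D unfolding g1(1) by (rule C_on_has_dir_deriv_along[OF f2 B])
    show "((\<lambda>t. dir_deriv ?u f (\<gamma> (s, t))) has_vector_derivative dir_deriv ?v (dir_deriv ?u f) (\<gamma> (s, t))) (at t)"
      using D unfolding g1(1) by (rule C_on_has_dir_deriv_along[OF fA B])
    show "((\<lambda>s. dir_deriv ?v f (\<gamma> (s, t))) has_vector_derivative dir_deriv ?u (dir_deriv ?v f) (\<gamma> (s, t))) (at s)"
      using D unfolding g1(2) by (rule C_on_has_dir_deriv_along[OF fB A])
  qed (intro cont fAB fBA)+
  then show ?thesis unfolding g0 .
qed

lemma smooth_on_C_on: "smooth_on I D f \<Longrightarrow> C_on m I D f" by (simp add: smooth_on_def)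

lemma smooth_on_imp_continuous: "smooth_on I D f \<Longrightarrow> continuous_on D f"
  using C_on_imp_continuous smooth_on_C_on by blast

lemma smooth_on_cong:
  "copen I D \<Longrightarrow> (\<And>y. y \<in> D \<Longrightarrow> f y = g y) \<Longrightarrow> smooth_on I D f \<longleftrightarrow> smooth_on I D g"
  by (simp add: smooth_on_def C_on_cong[of I D f g])

lemma smooth_on_const: "copen I D \<Longrightarrow> smooth_on I D (\<lambda>_. k)"
  by (simp add: smooth_on_def C_on_const)

lemma smooth_on_add: "copen I D \<Longrightarrow> smooth_on I D f \<Longrightarrow> smooth_on I D g \<Longrightarrow> smooth_on I D (\<lambda>w. f w + g w)"
  by (simp add: smooth_on_def C_on_add)

lemma smooth_on_mult: "copen I D \<Longrightarrow> smooth_on I D f \<Longrightarrow> smooth_on I D g \<Longrightarrow> smooth_on I D (\<lambda>w. f w * g w)"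
  by (simp add: smooth_on_def C_on_mult)

lemma smooth_on_cnj: "copen I D \<Longrightarrow> smooth_on I D f \<Longrightarrow> smooth_on I D (\<lambda>w. cnj (f w))"
  by (simp add: smooth_on_def C_on_cnj)

lemma smooth_on_inverse:
  "copen I D \<Longrightarrow> (\<And>w. w \<in> D \<Longrightarrow> f w \<noteq> 0) \<Longrightarrow> smooth_on I D f \<Longrightarrow> smooth_on I D (\<lambda>w. inverse (f w))"
  by (simp add: smooth_on_def C_on_inverse)

lemma smooth_on_diff:
  assumes "copen I D" "smooth_on I D f" "smooth_on I D g"
  shows "smooth_on I D (\<lambda>w. f w - g w)"
  using smooth_on_add[OF assms(1,2) smooth_on_mult[OF assms(1) smooth_on_const[OF assms(1), of "-1"] assms(3)]]
  by simp

lemma smooth_on_sum: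
  assumes "copen I D"
  shows "(\<And>a. a \<in> J \<Longrightarrow> smooth_on I D (f a)) \<Longrightarrow> smooth_on I D (\<lambda>w. \<Sum>a\<in>J. f a w)"
  by (induction J rule: infinite_finite_induct) (auto intro: smooth_on_const smooth_on_add assms)

lemma smooth_on_prod:
  assumes "copen I D"
  shows "(\<And>a. a \<in> J \<Longrightarrow> smooth_on I D (f a)) \<Longrightarrow> smooth_on I D (\<lambda>w. \<Prod>a\<in>J. f a w)"
  by (induction J rule: infinite_finite_induct) (auto intro: smooth_on_const smooth_on_mult assms)

lemma smooth_on_dir_deriv:
  "smooth_on I D f \<Longrightarrow> A \<in> I \<Longrightarrow> c \<in> {1, \<i>} \<Longrightarrow> smooth_on I D (dir_deriv (axis_vec A c) f)"
  by (subst smooth_on_def) (intro allI C_on_dir_deriv smooth_on_C_on)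

lemma smooth_on_has_dir_deriv:
  "smooth_on I D f \<Longrightarrow> w \<in> D \<Longrightarrow> A \<in> I \<Longrightarrow> c \<in> {1, \<i>} \<Longrightarrow>
   ((\<lambda>t. f (line w (axis_vec A c) t)) has_vector_derivative dir_deriv (axis_vec A c) f w) (at 0)"
  by (rule C_on_has_dir_deriv[OF smooth_on_C_on])

text \<open>
  Both Wirtinger derivatives at once: \<open>\<epsilon> = - \<i>\<close> gives \<open>\<partial>/\<partial>w\<close>, \<open>\<epsilon> = \<i>\<close> its conjugate.
\<close>

definition wd :: "complex \<Rightarrow> 'i \<Rightarrow> (('i \<Rightarrow> complex) \<Rightarrow> complex) \<Rightarrow> ('i \<Rightarrow> complex) \<Rightarrow> complex" where
  "wd \<epsilon> A f w = (dir_deriv (axis_vec A 1) f w + \<epsilon> * dir_deriv (axis_vec A \<i>) f w) / 2"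

lemma dz_wd: "dz A = wd (- \<i>) A" and dzb_wd: "dzb A = wd \<i> A"
  by (simp_all add: wd_def dz_def dzb_def fun_eq_iff)

lemma wd_cong:
  "copen I D \<Longrightarrow> w \<in> D \<Longrightarrow> A \<in> I \<Longrightarrow> (\<And>y. y \<in> D \<Longrightarrow> f y = g y) \<Longrightarrow> wd \<epsilon> A f w = wd \<epsilon> A g w"
  unfolding wd_def by (simp only: dir_deriv_cong(2)[of I D w A f g])

lemma wd_const [simp]: "wd \<epsilon> A (\<lambda>_. k) w = 0"
proof -
  have "dir_deriv (axis_vec A c) (\<lambda>_. k) w = 0" for c by (rule dir_deriv_unique) simp
  then show ?thesis by (simp add: wd_def)
qed

lemma wd_add:
  assumes "smooth_on I D f" "smooth_on I D g" "w \<in> D" "A \<in> I"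
  shows "wd \<epsilon> A (\<lambda>w. f w + g w) w = wd \<epsilon> A f w + wd \<epsilon> A g w"
proof -
  have "dir_deriv (axis_vec A c) (\<lambda>w. f w + g w) w = dir_deriv (axis_vec A c) f w + dir_deriv (axis_vec A c) g w"
    if "c \<in> {1, \<i>}" for c
    by (rule dir_deriv_unique) (intro has_vector_derivative_add smooth_on_has_dir_deriv[OF _ assms(3,4) that] assms)
  then show ?thesis by (simp add: wd_def algebra_simps add_divide_distrib)
qed

lemma wd_mult:
  assumes "smooth_on I D f" "smooth_on I D g" "w \<in> D" "A \<in> I"
  shows "wd \<epsilon> A (\<lambda>w. f w * g w) w = wd \<epsilon> A f w * g w + f w * wd \<epsilon> A g w"
proof -
  have "dir_deriv (axis_vec A c) (\<lambda>w. f w * g w) w = f w * dir_deriv (axis_vec A c) g w + dir_deriv (axis_vec A c) f w * g w"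
    if "c \<in> {1, \<i>}" for c
    using has_vector_derivative_mult[OF smooth_on_has_dir_deriv[OF assms(1,3,4) that] smooth_on_has_dir_deriv[OF assms(2,3,4) that]]
    by (intro dir_deriv_unique) simp
  then show ?thesis by (simp add: wd_def field_simps)
qed

lemma wd_cmult:
  assumes "copen I D" "smooth_on I D f" "w \<in> D" "A \<in> I"
  shows "wd \<epsilon> A (\<lambda>w. k * f w) w = k * wd \<epsilon> A f w"
  using wd_mult[OF smooth_on_const[OF assms(1), of k] assms(2-4)] by simp

lemma wd_diff:
  assumes "copen I D" "smooth_on I D f" "smooth_on I D g" "w \<in> D" "A \<in> I"
  shows "wd \<epsilon> A (\<lambda>w. f w - g w) w = wd \<epsilon> A f w - wd \<epsilon> A g w"
  using wd_add[OF assms(2) smooth_on_mult[OF assms(1) smooth_on_const[OF assms(1), of "-1"] assms(3)] assms(4,5)]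
    wd_cmult[OF assms(1,3,4,5), of \<epsilon> "-1"] by simp

lemma wd_sum:
  assumes op: "copen I D" and f: "\<And>a. a \<in> J \<Longrightarrow> smooth_on I D (f a)" and w: "w \<in> D" "A \<in> I"
  shows "wd \<epsilon> A (\<lambda>w. \<Sum>a\<in>J. f a w) w = (\<Sum>a\<in>J. wd \<epsilon> A (f a) w)"
  using f
proof (induction J rule: infinite_finite_induct)
  case (insert a J)
  then show ?case
    by (simp add: wd_add[OF _ smooth_on_sum[OF op] w])
qed auto

lemma wd_cnj:
  assumes "smooth_on I D f" "w \<in> D" "A \<in> I"
  shows "wd \<epsilon> A (\<lambda>w. cnj (f w)) w = cnj (wd (cnj \<epsilon>) A f w)"
proof -
  have "dir_deriv (axis_vec A c) (\<lambda>w. cnj (f w)) w = cnj (dir_deriv (axis_vec A c) f w)"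
    if "c \<in> {1, \<i>}" for c
    by (rule dir_deriv_unique, rule bounded_linear.has_vector_derivative[OF bounded_linear_cnj])
       (rule smooth_on_has_dir_deriv[OF assms that])
  then show ?thesis by (simp add: wd_def)
qed

lemma smooth_on_wd:
  assumes "copen I D" "smooth_on I D f" "A \<in> I"
  shows "smooth_on I D (wd \<epsilon> A f)"
proof -
  have "smooth_on I D (\<lambda>w. 1 / 2 * (dir_deriv (axis_vec A 1) f w + \<epsilon> * dir_deriv (axis_vec A \<i>) f w))"
    by (intro smooth_on_mult[OF assms(1)] smooth_on_add[OF assms(1)] smooth_on_const[OF assms(1)]
        smooth_on_dir_deriv[OF assms(2,3)]) simp_all
  moreover have "(\<lambda>w. 1 / 2 * (dir_deriv (axis_vec A 1) f w + \<epsilon> * dir_deriv (axis_vec A \<i>) f w)) = wd \<epsilon> A f"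
    by (simp add: fun_eq_iff wd_def)
  ultimately show ?thesis by simp
qed

lemma wd_commute:
  assumes op: "copen I D" and f: "smooth_on I D f" and w: "w \<in> D" and AB: "A \<in> I" "B \<in> I"
  shows "wd \<epsilon> A (wd \<delta> B f) w = wd \<delta> B (wd \<epsilon> A f) w"
proof -
  let ?d = "\<lambda>A c. dir_deriv (axis_vec A c)"
  have lin: "?d A c (wd \<delta> B f) w = (?d A c (?d B 1 f) w + \<delta> * ?d A c (?d B \<i> f) w) / 2"
    if "A \<in> I" "B \<in> I" "c \<in> {1, \<i>}" for A B c \<delta>
  proof (rule dir_deriv_unique)
    have "((\<lambda>t. (?d B 1 f (line w (axis_vec A c) t) + \<delta> * ?d B \<i> f (line w (axis_vec A c) t)) / 2) has_vector_derivative
        (?d A c (?d B 1 f) w + \<delta> * ?d A c (?d B \<i> f) w) / 2) (at 0)"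
      by (intro has_vector_derivative_divide has_vector_derivative_add has_vector_derivative_mult_right
          smooth_on_has_dir_deriv[OF smooth_on_dir_deriv[OF f that(2)] w that(1,3)]) simp_all
    then show "((\<lambda>t. wd \<delta> B f (line w (axis_vec A c) t)) has_vector_derivative
        (?d A c (?d B 1 f) w + \<delta> * ?d A c (?d B \<i> f) w) / 2) (at 0)"
      by (simp add: wd_def)
  qed
  have sw: "?d A c (?d B d f) w = ?d B d (?d A c f) w" if "c \<in> {1, \<i>}" "d \<in> {1, \<i>}" for c d
    by (rule dir_deriv_commute[OF op smooth_on_C_on[OF f] w AB(2) that(2) AB(1) that(1)])
  have "wd \<epsilon> A (wd \<delta> B f) w = (?d A 1 (wd \<delta> B f) w + \<epsilon> * ?d A \<i> (wd \<delta> B f) w) / 2"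
    by (simp add: wd_def)
  also have "\<dots> = (?d B 1 (wd \<epsilon> A f) w + \<delta> * ?d B \<i> (wd \<epsilon> A f) w) / 2"
    using AB by (simp add: lin sw field_simps)
  finally show ?thesis by (simp add: wd_def[of \<delta> B "wd \<epsilon> A f"])
qed

section \<open>Polydiscs and holomorphic functions of several variables\<close>

definition box_at :: "'i set \<Rightarrow> ('i \<Rightarrow> complex) \<Rightarrow> real \<Rightarrow> ('i \<Rightarrow> complex) set" where
  "box_at I w e = {y \<in> cspace I. \<forall>A\<in>I. dist (y A) (w A) < e}"

lemma copen_box_at:
  assumes "finite I"
  shows "copen I (box_at I w e)"
proof -
  have "open {y :: 'a \<Rightarrow> complex. \<forall>A\<in>I. y A \<in> ball (w A) e}"
    using product_topology_basis'[of I "\<lambda>A. ball (w A) e" "\<lambda>A. A"] assms by simp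
  moreover have "box_at I w e = cspace I \<inter> {y. \<forall>A\<in>I. y A \<in> ball (w A) e}"
    by (auto simp: box_at_def dist_commute)
  ultimately show ?thesis by (auto simp: openin_open)
qed

text \<open>Coordinates outside \<open>I\<close> are pinned to 0, so only the finitely many radii at
  indices in \<open>I\<close> matter, and they have a positive minimum.\<close>

lemma copen_contains_box:
  assumes I: "finite I" and op: "copen I D" and w: "w \<in> D"
  obtains e where "0 < e" "box_at I w e \<subseteq> D"
proof -
  obtain T where T: "open T" "D = cspace I \<inter> T" using op by (auto simp: openin_open)
  have "openin (product_topology (\<lambda>i. euclidean) UNIV) T" using T(1) by (simp add: open_fun_def)
  then obtain X where X: "w \<in> (\<Pi>\<^sub>E i\<in>UNIV. X i)" "\<And>i. open (X i)" "(\<Pi>\<^sub>E i\<in>UNIV. X i) \<subseteq> T"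
    using product_topology_open_contains_basis[of "\<lambda>i. euclidean" UNIV T w] w T(2) by auto
  have "\<exists>e>0. ball (w A) e \<subseteq> X A" for A
    using X(1) by (intro open_contains_ball[THEN iffD1, OF X(2), rule_format]) (auto simp: PiE_iff)
  then obtain e where e: "\<And>A. 0 < e A" "\<And>A. ball (w A) (e A) \<subseteq> X A" by metis
  \<comment> \<open>The inserted 1 keeps the minimum meaningful when \<open>I\<close> is
    empty.\<close>
  define m where "m = Min (insert 1 (e ` I))"
  have m: "0 < m" "\<And>A. A \<in> I \<Longrightarrow> m \<le> e A" using I e(1) by (auto simp: m_def)
  have "box_at I w m \<subseteq> D"
  proof
    fix y assume y: "y \<in> box_at I w m"
    have "y A \<in> X A" for A
    proof (cases "A \<in> I")
      case True
      then have "dist (y A) (w A) < e A" using y m(2)[OF True] by (auto simp: box_at_def)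
      then show ?thesis using e(2)[of A] by (auto simp: dist_commute)
    next
      case False
      then have "y A = w A" using y copen_sub[OF op w] by (auto simp: box_at_def cspace_def)
      then show ?thesis using X(1) by (auto simp: PiE_iff)
    qed
    then show "y \<in> D" using X(3) y T(2) by (auto simp: box_at_def PiE_iff)
  qed
  with m(1) show ?thesis by (rule that)
qed

definition hderiv :: "'i \<Rightarrow> (('i \<Rightarrow> complex) \<Rightarrow> complex) \<Rightarrow> ('i \<Rightarrow> complex) \<Rightarrow> complex" where
  "hderiv A f w = deriv (\<lambda>\<zeta>. f (w(A := \<zeta>))) (w A)"

lemma continuous_on_upd [continuous_intros]:
  fixes f :: "'a::topological_space \<Rightarrow> 'i \<Rightarrow> complex"
  assumes "continuous_on S f" "continuous_on S g"
  shows "continuous_on S (\<lambda>x. (f x)(A := g x))"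
proof (rule continuous_on_coordinatewise_then_product)
  fix i show "continuous_on S (\<lambda>x. ((f x)(A := g x)) i)"
    using assms continuous_on_product_then_coordinatewise[OF assms(1), of i] by (cases "i = A") auto
qed

lemma hol_on_DERIV:
  assumes "hol_on I D f" "w \<in> D" "A \<in> I"
  shows "((\<lambda>\<zeta>. f (w(A := \<zeta>))) has_field_derivative hderiv A f w) (at (w A))"
  using assms unfolding hol_on_def hderiv_def by (auto simp: DERIV_deriv_iff_field_differentiable)

lemma hol_on_holomorphic:
  assumes "hol_on I D f" "A \<in> I" "\<And>\<zeta>. \<zeta> \<in> S \<Longrightarrow> w(A := \<zeta>) \<in> D"
  shows "(\<lambda>\<zeta>. f (w(A := \<zeta>))) holomorphic_on S"
proof -
  have "(\<lambda>\<zeta>'. f (w(A := \<zeta>'))) field_differentiable (at \<zeta> within S)" if "\<zeta> \<in> S" for \<zeta>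
    using hol_on_DERIV[OF assms(1) assms(3)[OF that] assms(2)]
    by (auto simp: field_differentiable_def intro: has_field_derivative_at_within)
  then show ?thesis by (simp add: holomorphic_on_def)
qed

text \<open>Cauchy's formula for the derivative over a real parameter: the factor 2 pi i and the
  speed of the circle cancel. In this shape the other coordinates are mere parameters of the
  integral.\<close>

lemma hderiv_Cauchy:
  assumes hol: "hol_on I D f" and A: "A \<in> I" and r: "0 < r"
    and D: "\<And>\<zeta>. dist \<zeta> (w A) \<le> r \<Longrightarrow> w(A := \<zeta>) \<in> D"
  shows "hderiv A f w = integral (cbox 0 1)
    (\<lambda>x. f (w(A := w A + of_real r * exp (2 * of_real pi * \<i> * of_real x))) / (of_real r * exp (2 * of_real pi * \<i> * of_real x)))"
proof -
  let ?g = "\<lambda>\<zeta>. f (w(A := \<zeta>))"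
  let ?E = "\<lambda>x::real. exp (2 * of_real pi * \<i> * of_real x)"
  have h: "?g holomorphic_on cball (w A) r"
    using D by (intro hol_on_holomorphic[OF hol A]) (auto simp: dist_commute)
  have "(?g has_field_derivative 1 / (2 * of_real pi * \<i>) *
      contour_integral (circlepath (w A) r) (\<lambda>u. ?g u / (u - w A)\<^sup>2)) (at (w A))"
    by (rule Cauchy_derivative_integral_circlepath(2)[OF holomorphic_on_imp_continuous_on[OF h]
          holomorphic_on_subset[OF h ball_subset_cball]]) (use r in auto)
  then have "hderiv A f w = 1 / (2 * of_real pi * \<i>) * contour_integral (circlepath (w A) r) (\<lambda>u. ?g u / (u - w A)\<^sup>2)"
    unfolding hderiv_def by (rule DERIV_imp_deriv)
  also have "\<dots> = integral {0..1} (\<lambda>x. 1 / (2 * of_real pi * \<i>) * (?g (circlepath (w A) r x) / (circlepath (w A) r x - w A)\<^sup>2 *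
      vector_derivative (circlepath (w A) r) (at x)))"
    unfolding contour_integral_integral by (rule integral_mult_right[symmetric])
  also have "\<dots> = integral {0..1} (\<lambda>x. ?g (w A + of_real r * ?E x) / (of_real r * ?E x))"
  proof (rule integral_cong)
    fix x :: real
    show "1 / (2 * of_real pi * \<i>) * (?g (circlepath (w A) r x) / (circlepath (w A) r x - w A)\<^sup>2 *
      vector_derivative (circlepath (w A) r) (at x)) = ?g (w A + of_real r * ?E x) / (of_real r * ?E x)"
      by (subst vector_derivative_circlepath) (use r in \<open>simp add: circlepath power2_eq_square field_simps\<close>)
  qed
  finally show ?thesis by (simp add: cbox_interval)
qed

lemma box_upd:
  assumes "y \<in> box_at I w e" "A \<in> I" "dist \<zeta> (w A) < e"
  shows "y(A := \<zeta>) \<in> box_at I w e"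
  using assms by (auto simp: box_at_def intro: cspace_upd)

text \<open>From any point of the half-size polydisc a circle of radius e/4 stays inside the full
  one, so a single radius serves all these points at once.\<close>

lemma hderiv_cauchy_box:
  assumes hol: "hol_on I D f" and A: "A \<in> I" and e: "0 < e" "box_at I w0 e \<subseteq> D" and w: "w \<in> box_at I w0 (e / 2)"
    and E: "E = (\<lambda>x::real. of_real (e / 4) * exp (2 * of_real pi * \<i> * of_real x))"
  shows "hderiv A f w = integral (cbox 0 1) (\<lambda>x. f (w(A := w A + E x)) / E x)"
    and "w(A := w A + E x) \<in> box_at I w0 e"
proof -
  have wb: "w \<in> box_at I w0 e" using w e(1) by (fastforce simp: box_at_def)
  have d: "dist \<zeta> (w0 A) < e" if "dist \<zeta> (w A) \<le> e / 4" for \<zeta>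
  proof -
    have "dist (w A) (w0 A) < e / 2" using w A by (simp add: box_at_def)
    then show ?thesis using dist_triangle[of \<zeta> "w0 A" "w A"] that e(1) by simp
  qed
  show "hderiv A f w = integral (cbox 0 1) (\<lambda>x. f (w(A := w A + E x)) / E x)"
    unfolding E using e by (intro hderiv_Cauchy[OF hol A]) (auto intro!: subsetD[OF e(2)] box_upd[OF wb A] d)
  have "dist (w A + E x) (w A) = e / 4"
    using e(1) by (simp add: E dist_norm norm_mult)
  then show "w(A := w A + E x) \<in> box_at I w0 e"
    by (intro box_upd[OF wb A] d) simp
qed

text \<open>Near each point the derivative is a Cauchy integral over a compact interval whose
  integrand is jointly continuous in the parameter.\<close>

lemma continuous_on_hderiv:
  assumes I: "finite I" and op: "copen I D" and hol: "hol_on I D f" and A: "A \<in> I"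
  shows "continuous_on D (hderiv A f)"
  unfolding continuous_on_def
proof
  fix w0 assume w0: "w0 \<in> D"
  obtain e where e: "0 < e" "box_at I w0 e \<subseteq> D" using copen_contains_box[OF I op w0] by blast
  define E where "E = (\<lambda>x::real. complex_of_real (e / 4) * exp (2 * of_real pi * \<i> * of_real x))"
  have E0: "E x \<noteq> 0" for x using e(1) by (simp add: E_def)
  let ?V = "box_at I w0 (e / 2)"
  have "continuous_on ?V (\<lambda>w. integral (cbox 0 1) (\<lambda>x. f (w(A := w A + E x)) / E x))"
  proof (rule integral_continuous_on_param, unfold split_def, rule continuous_on_divide)
    have c: "continuous_on (?V \<times> cbox 0 1) (\<lambda>p. (fst p)(A := fst p A + E (snd p)))"
      unfolding E_def
      by (intro continuous_intros continuous_on_product_then_coordinatewise[where f = fst])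
    show "continuous_on (?V \<times> cbox 0 1) (\<lambda>p. f ((fst p)(A := fst p A + E (snd p))))"
      by (rule continuous_on_compose2[OF _ c, of D f])
        (use hol e hderiv_cauchy_box(2)[OF hol A e _ E_def] in \<open>auto simp: hol_on_def\<close>)
    show "continuous_on (?V \<times> cbox 0 1) (\<lambda>p. E (snd p))"
      unfolding E_def by (intro continuous_intros)
  qed (use E0 in auto)
  then have cV: "continuous_on ?V (hderiv A f)"
    by (rule continuous_on_eq) (simp add: hderiv_cauchy_box(1)[OF hol A e _ E_def])
  have w0V: "w0 \<in> ?V" using copen_sub[OF op w0] e(1) by (simp add: box_at_def)
  have "?V \<subseteq> D"
  proof -
    have "?V \<subseteq> box_at I w0 e" using e(1) by (fastforce simp: box_at_def)
    then show ?thesis using e(2) by simp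
  qed
  moreover obtain T where T: "open T" "?V = cspace I \<inter> T"
    using copen_box_at[OF I, of w0 "e / 2"] unfolding openin_open by blast
  ultimately have "at w0 within D = at w0 within ?V"
    using w0V copen_sub[OF op] by (intro at_within_nhd[of _ T]) auto
  then show "(hderiv A f \<longlongrightarrow> hderiv A f w0) (at w0 within D)"
    using cV w0V by (simp add: continuous_on_def)
qed

text \<open>In the direction \<open>A\<close> itself this is the one-variable fact. In another
  direction \<open>B\<close> the Cauchy integral is differentiated under the integral sign, which
  needs \<open>hderiv B f\<close> to be continuous.\<close>

lemma hol_on_hderiv:
  assumes I: "finite I" and op: "copen I D" and hol: "hol_on I D f" and A: "A \<in> I"
  shows "hol_on I D (hderiv A f)"
  unfolding hol_on_def
proof (intro conjI ballI)
  show "continuous_on D (hderiv A f)" by (rule continuous_on_hderiv[OF assms])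
  fix w0 B assume w0: "w0 \<in> D" and B: "B \<in> I"
  obtain e where e: "0 < e" "box_at I w0 e \<subseteq> D" using copen_contains_box[OF I op w0] by blast
  have w0b: "w0 \<in> box_at I w0 r" if "0 < r" for r using copen_sub[OF op w0] that by (simp add: box_at_def)
  show "(\<lambda>\<zeta>. hderiv A f (w0(B := \<zeta>))) field_differentiable (at (w0 B))"
  proof (cases "B = A")
    case True
    have "(\<lambda>\<zeta>. f (w0(A := \<zeta>))) holomorphic_on ball (w0 A) e"
      by (rule hol_on_holomorphic[OF hol A]) (auto intro!: subsetD[OF e(2)] box_upd[OF w0b A] e simp: dist_commute)
    then have "deriv (\<lambda>\<zeta>. f (w0(A := \<zeta>))) holomorphic_on ball (w0 A) e"
      by (rule holomorphic_deriv) simp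
    then have "deriv (\<lambda>\<zeta>. f (w0(A := \<zeta>))) field_differentiable (at (w0 A))"
      using e(1) by (intro holomorphic_on_imp_differentiable_at) auto
    then show ?thesis by (simp add: hderiv_def True)
  next
    case False
    define E where "E = (\<lambda>x::real. complex_of_real (e / 4) * exp (2 * of_real pi * \<i> * of_real x))"
    have E0: "E x \<noteq> 0" for x using e(1) by (simp add: E_def)
    let ?U = "ball (w0 B) (e / 2)"
    let ?y = "\<lambda>\<zeta> x. (w0(B := \<zeta>))(A := w0 A + E x)"
    have U: "w0(B := \<zeta>) \<in> box_at I w0 (e / 2)" if "\<zeta> \<in> ?U" for \<zeta>
      using that e(1) by (intro box_upd w0b B) (auto simp: dist_commute)
    have y: "?y \<zeta> x \<in> D" if "\<zeta> \<in> ?U" for \<zeta> x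
      using hderiv_cauchy_box(2)[OF hol A e U[OF that] E_def, of x] e(2) False by auto
    have cy: "continuous_on (?U \<times> cbox 0 1) (\<lambda>p. ?y (fst p) (snd p))"
      unfolding E_def by (intro continuous_intros)
    have cy1: "continuous_on (cbox 0 1) (\<lambda>x. ?y \<zeta> x)" for \<zeta>
      unfolding E_def by (intro continuous_intros)
    have cE: "continuous_on S E" for S unfolding E_def by (intro continuous_intros)
    have hI: "(\<lambda>\<zeta>. integral (cbox 0 1) (\<lambda>x. f (?y \<zeta> x) / E x)) holomorphic_on ?U"
    proof (rule leibniz_rule_holomorphic[where fx = "\<lambda>\<zeta> x. hderiv B f (?y \<zeta> x) / E x"])
      fix \<zeta> x assume z: "\<zeta> \<in> ?U"
      have "((\<lambda>\<zeta>'. f ((?y \<zeta> x)(B := \<zeta>'))) has_field_derivative hderiv B f (?y \<zeta> x)) (at (?y \<zeta> x B))"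
        by (rule hol_on_DERIV[OF hol y[OF z] B])
      moreover have "(?y \<zeta> x)(B := \<zeta>') = ?y \<zeta>' x" for \<zeta>' using False by (auto simp: fun_upd_twist)
      moreover have "?y \<zeta> x B = \<zeta>" using False by simp
      ultimately have "((\<lambda>\<zeta>'. f (?y \<zeta>' x)) has_field_derivative hderiv B f (?y \<zeta> x)) (at \<zeta>)" by simp
      then show "((\<lambda>\<zeta>. f (?y \<zeta> x) / E x) has_field_derivative hderiv B f (?y \<zeta> x) / E x) (at \<zeta> within ?U)"
        by (rule DERIV_cdivide[OF has_field_derivative_at_within])
    next
      fix \<zeta> assume z: "\<zeta> \<in> ?U"
      have "continuous_on (cbox 0 1) (\<lambda>x. f (?y \<zeta> x) / E x)"
        using E0 hol by (intro continuous_on_divide cE continuous_on_compose2[OF _ cy1, of D f]) (auto simp: hol_on_def y[OF z])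
      then show "(\<lambda>x. f (?y \<zeta> x) / E x) integrable_on cbox 0 1" by (rule integrable_continuous)
    next
      show "continuous_on (?U \<times> cbox 0 1) (\<lambda>(\<zeta>, x). hderiv B f (?y \<zeta> x) / E x)"
        unfolding split_def
      proof (rule continuous_on_divide)
        show "continuous_on (?U \<times> cbox 0 1) (\<lambda>p. hderiv B f (?y (fst p) (snd p)))"
          by (rule continuous_on_compose2[OF continuous_on_hderiv[OF I op hol B] cy]) (auto intro: y)
        show "continuous_on (?U \<times> cbox 0 1) (\<lambda>p. E (snd p))"
          by (rule continuous_on_compose2[OF cE[of UNIV] continuous_on_snd[OF continuous_on_id]]) simp
      qed (use E0 in auto)
    qed simp
    have "hderiv A f (w0(B := \<zeta>)) = integral (cbox 0 1) (\<lambda>x. f (?y \<zeta> x) / E x)" if "\<zeta> \<in> ?U" for \<zeta>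
      using hderiv_cauchy_box(1)[OF hol A e U[OF that] E_def] False by simp
    then have "(\<lambda>\<zeta>. hderiv A f (w0(B := \<zeta>))) holomorphic_on ?U"
      by (intro holomorphic_transform[OF hI]) simp
    then show ?thesis using e(1) by (intro holomorphic_on_imp_differentiable_at) auto
  qed
qed

lemma hol_on_has_dir_deriv:
  assumes "hol_on I D f" "w \<in> D" "A \<in> I"
  shows "((\<lambda>t. f (line w (axis_vec A c) t)) has_vector_derivative c * hderiv A f w) (at 0)"
proof -
  have "((\<lambda>t. w A + of_real t * c) has_vector_derivative c) (at 0)"
    by (auto intro!: derivative_eq_intros)
  then have "((\<lambda>\<zeta>. f (w(A := \<zeta>))) \<circ> (\<lambda>t. w A + of_real t * c) has_vector_derivative c * hderiv A f w) (at 0)"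
    by (rule field_vector_diff_chain_at) (simp add: hol_on_DERIV[OF assms])
  then show ?thesis by (simp add: o_def line_axis_vec)
qed

text \<open>The complex partial derivatives are again continuous and separately holomorphic, and the
  real derivative in direction \<open>c\<close> is \<open>c\<close> times the complex one, so the
  order of differentiability grows by induction.\<close>

lemma hol_on_C_on:
  assumes "finite I" "copen I D"
  shows "hol_on I D f \<Longrightarrow> C_on m I D f"
proof (induction m arbitrary: f)
  case 0
  then show ?case by (simp add: hol_on_def)
next
  case (Suc m)
  show ?case
  proof (rule C_on_SucI[OF assms(2), where f' = "\<lambda>A c w. c * hderiv A f w"])
    show "continuous_on D f" using Suc.prems by (simp add: hol_on_def)
  next
    fix A c assume "A \<in> I"
    then show "C_on m I D (\<lambda>w. c * hderiv A f w)"
      by (intro C_on_mult[OF assms(2)] C_on_const[OF assms(2)] Suc.IH hol_on_hderiv[OF assms Suc.prems])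
  qed (rule hol_on_has_dir_deriv[OF Suc.prems])
qed

lemma hol_on_smooth: "finite I \<Longrightarrow> copen I D \<Longrightarrow> hol_on I D f \<Longrightarrow> smooth_on I D f"
  by (simp add: smooth_on_def hol_on_C_on)

text \<open>The Cauchy-Riemann equations: the factor is 1 for \<epsilon> = - \<i> and 0 for
  \<epsilon> = \<i>.\<close>

lemma hol_on_wd:
  assumes "hol_on I D f" "w \<in> D" "A \<in> I"
  shows "wd \<epsilon> A f w = (1 + \<epsilon> * \<i>) / 2 * hderiv A f w"
  by (simp add: wd_def dir_deriv_unique[OF hol_on_has_dir_deriv[OF assms]] field_simps)

lemma hol_on_dzb: "hol_on I D f \<Longrightarrow> w \<in> D \<Longrightarrow> A \<in> I \<Longrightarrow> dzb A f w = 0"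
  by (simp add: dzb_wd hol_on_wd)

section \<open>Matrix-valued functions\<close>

lemma mat_adjoint_carrier: "A \<in> carrier_mat r c \<Longrightarrow> mat_adjoint A \<in> carrier_mat c r"
  by (auto simp: mat_adjoint_def)

lemma mat_adjoint_index:
  fixes A :: "complex mat"
  assumes "A \<in> carrier_mat r c" "i < c" "l < r"
  shows "mat_adjoint A $$ (i, l) = cnj (A $$ (l, i))"
proof -
  have "mat_adjoint A $$ (i, l) = vec_index (map conjugate (cols A) ! i) l"
    unfolding mat_adjoint_def using assms by (intro mat_of_rows_index) auto
  then show ?thesis using assms by simp
qed

lemma index_mult_mat_sum:
  assumes "A \<in> carrier_mat r k" "B \<in> carrier_mat k c" "i < r" "l < c"
  shows "(A * B) $$ (i, l) = (\<Sum>j<k. A $$ (i, j) * B $$ (j, l))"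
  using assms by (simp add: scalar_prod_def lessThan_atLeast0)

lemma minv_inverse:
  assumes A: "A \<in> carrier_mat n n" and d: "Determinant.det A \<noteq> 0"
  shows "minv A \<in> carrier_mat n n" "A * minv A = 1\<^sub>m n" "minv A * A = 1\<^sub>m n"
proof -
  obtain B where B: "mat_inverse A = Some B"
    using mat_inverse(1)[OF A, of "()"] det_non_zero_imp_unit[OF A d, of "()"] by (cases "mat_inverse A") auto
  then have "minv A = B" by (simp add: minv_def)
  then show "minv A \<in> carrier_mat n n" "A * minv A = 1\<^sub>m n" "minv A * A = 1\<^sub>m n"
    using mat_inverse(2)[OF A B] by auto
qed

text \<open>Cramer's rule, the form in which smoothness of the inverse can be read off.\<close>

lemma minv_eq_adj_mat:
  assumes A: "A \<in> carrier_mat n n" and d: "Determinant.det A \<noteq> 0" and il: "i < n" "l < n"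
  shows "minv A $$ (i, l) = inverse (Determinant.det A) * adj_mat A $$ (i, l)"
proof -
  note inv = minv_inverse[OF A d]
  note adj = adj_mat[OF A]
  have "minv A * (A * adj_mat A) = adj_mat A"
    using assoc_mult_mat[OF inv(1) A adj(1)] inv(3) adj(1) by simp
  then have "adj_mat A = Determinant.det A \<cdot>\<^sub>m minv A"
    unfolding adj(2) using inv(1) by (simp add: mult_smult_distrib[of _ n n _ n])
  then have "adj_mat A $$ (i, l) = Determinant.det A * minv A $$ (i, l)"
    using inv(1) il by simp
  then show ?thesis using d by simp
qed

lemma pos_hermitian_det:
  assumes "pos_hermitian r M"
  shows "M \<in> carrier_mat r r" "Determinant.det M \<noteq> 0"
proof -
  show M: "M \<in> carrier_mat r r" using assms by (simp add: pos_hermitian_def)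
  show "Determinant.det M \<noteq> 0"
  proof
    assume "Determinant.det M = 0"
    then obtain v where v: "v \<in> carrier_vec r" "v \<noteq> 0\<^sub>v r" "M *\<^sub>v v = 0\<^sub>v r"
      using det_0_iff_vec_prod_zero_field[OF M] by auto
    then have "0 < Re ((M *\<^sub>v v) \<bullet>c v)" using assms by (auto simp: pos_hermitian_def)
    then show False using v by simp
  qed
qed

lemma mtrace_eq: "A \<in> carrier_mat n m \<Longrightarrow> mtrace A = (\<Sum>i<n. A $$ (i, i))"
  by (auto simp: mtrace_def)

lemma mtrace_add: "A \<in> carrier_mat n n \<Longrightarrow> B \<in> carrier_mat n n \<Longrightarrow> mtrace (A + B) = mtrace A + mtrace B"
  by (simp add: mtrace_eq[of _ n n] sum.distrib)

lemma mtrace_minus: "A \<in> carrier_mat n n \<Longrightarrow> B \<in> carrier_mat n n \<Longrightarrow> mtrace (A - B) = mtrace A - mtrace B"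
  by (simp add: mtrace_eq[of _ n n] minus_carrier_mat[of B n n] sum_subtractf)

lemma mtrace_uminus: "A \<in> carrier_mat n n \<Longrightarrow> mtrace (- A) = - mtrace A"
  by (simp add: mtrace_eq[of _ n n] sum_negf)

lemma mtrace_comm:
  assumes "A \<in> carrier_mat n m" "B \<in> carrier_mat m n"
  shows "mtrace (A * B) = mtrace (B * A)"
proof -
  have "mtrace (A * B) = (\<Sum>i<n. \<Sum>j<m. A $$ (i, j) * B $$ (j, i))"
    unfolding mtrace_eq[OF mult_carrier_mat[OF assms]]
    by (intro sum.cong refl index_mult_mat_sum[OF assms]) auto
  also have "\<dots> = (\<Sum>j<m. \<Sum>i<n. B $$ (j, i) * A $$ (i, j))"
    by (subst sum.swap) (simp add: mult.commute)
  also have "\<dots> = mtrace (B * A)"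
    unfolding mtrace_eq[OF mult_carrier_mat[OF assms(2,1)]]
    by (intro sum.cong refl index_mult_mat_sum[OF assms(2,1), symmetric]) auto
  finally show ?thesis .
qed

section \<open>Smooth matrix-valued functions and their derivatives\<close>

definition smat :: "'i set \<Rightarrow> ('i \<Rightarrow> complex) set \<Rightarrow> nat \<Rightarrow> nat \<Rightarrow> (('i \<Rightarrow> complex) \<Rightarrow> complex mat) \<Rightarrow> bool" where
  "smat I D r c M \<longleftrightarrow> (\<forall>w\<in>D. M w \<in> carrier_mat r c) \<and> mat_fun_class (smooth_on I D) r c M"

lemma smat_carrier: "smat I D r c M \<Longrightarrow> w \<in> D \<Longrightarrow> M w \<in> carrier_mat r c"
  by (simp add: smat_def)

lemma smat_entry: "smat I D r c M \<Longrightarrow> i < r \<Longrightarrow> l < c \<Longrightarrow> smooth_on I D (\<lambda>w. M w $$ (i, l))"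
  by (simp add: smat_def mat_fun_class_def)

lemma smatI:
  assumes "copen I D" "\<And>w. w \<in> D \<Longrightarrow> M w \<in> carrier_mat r c"
    "\<And>i l. i < r \<Longrightarrow> l < c \<Longrightarrow> smooth_on I D (f i l)"
    "\<And>i l w. i < r \<Longrightarrow> l < c \<Longrightarrow> w \<in> D \<Longrightarrow> M w $$ (i, l) = f i l w"
  shows "smat I D r c M"
  unfolding smat_def mat_fun_class_def
proof (intro conjI ballI allI impI)
  fix i l assume "i < r" "l < c"
  then show "smooth_on I D (\<lambda>w. M w $$ (i, l))"
    using smooth_on_cong[OF assms(1), of "\<lambda>w. M w $$ (i, l)" "f i l"] assms(3,4) by simp
qed (rule assms(2))

lemma smat_cong:
  assumes "copen I D" "smat I D r c M" "\<And>w. w \<in> D \<Longrightarrow> N w = M w"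
  shows "smat I D r c N"
  by (rule smatI[OF assms(1) _ smat_entry[OF assms(2)]]) (auto simp: assms(3) smat_carrier[OF assms(2)])

lemma smat_mult:
  assumes op: "copen I D" and M: "smat I D r k M" and N: "smat I D k c N"
  shows "smat I D r c (\<lambda>w. M w * N w)"
proof (rule smatI[OF op])
  fix i l assume "i < r" "l < c"
  then show "smooth_on I D (\<lambda>w. \<Sum>j<k. M w $$ (i, j) * N w $$ (j, l))"
    by (intro smooth_on_sum[OF op] smooth_on_mult[OF op] smat_entry[OF M] smat_entry[OF N]) auto
  fix w assume "w \<in> D"
  then show "(M w * N w) $$ (i, l) = (\<Sum>j<k. M w $$ (i, j) * N w $$ (j, l))"
    using index_mult_mat_sum[OF smat_carrier[OF M] smat_carrier[OF N]] \<open>i < r\<close> \<open>l < c\<close> by blast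
qed (auto intro: mult_carrier_mat[OF smat_carrier[OF M] smat_carrier[OF N]])

lemma smat_minus:
  assumes op: "copen I D" and M: "smat I D r c M" and N: "smat I D r c N"
  shows "smat I D r c (\<lambda>w. M w - N w)"
proof (rule smatI[OF op])
  fix w assume "w \<in> D"
  then show "M w - N w \<in> carrier_mat r c"
    using smat_carrier[OF M, of w] smat_carrier[OF N, of w] by (auto intro: minus_carrier_mat)
next
  fix i l assume il: "i < r" "l < c"
  then show "smooth_on I D (\<lambda>w. M w $$ (i, l) - N w $$ (i, l))"
    by (intro smooth_on_diff[OF op] smat_entry[OF M] smat_entry[OF N])
  fix w assume "w \<in> D"
  then show "(M w - N w) $$ (i, l) = M w $$ (i, l) - N w $$ (i, l)"
    using smat_carrier[OF M, of w] smat_carrier[OF N, of w] il by simp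
qed

lemma smat_uminus:
  assumes op: "copen I D" and M: "smat I D r c M"
  shows "smat I D r c (\<lambda>w. - M w)"
proof (rule smatI[OF op])
  fix w assume "w \<in> D"
  then show "- M w \<in> carrier_mat r c"
    using smat_carrier[OF M, of w] by (auto intro: minus_carrier_mat)
next
  fix i l assume il: "i < r" "l < c"
  then show "smooth_on I D (\<lambda>w. - 1 * M w $$ (i, l))"
    by (intro smooth_on_mult[OF op] smooth_on_const[OF op] smat_entry[OF M])
  fix w assume "w \<in> D"
  then show "(- M w) $$ (i, l) = - 1 * M w $$ (i, l)"
    using smat_carrier[OF M, of w] il by simp
qed

lemma smat_adjoint:
  assumes op: "copen I D" and M: "smat I D r c M"
  shows "smat I D c r (\<lambda>w. mat_adjoint (M w))"
  by (rule smatI[OF op, where f = "\<lambda>i l w. cnj (M w $$ (l, i))"])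
     (auto intro!: mat_adjoint_carrier smat_carrier[OF M] smooth_on_cnj[OF op] smat_entry[OF M] mat_adjoint_index[of _ r c])

lemma smooth_on_det:
  assumes op: "copen I D" and M: "smat I D r r M"
  shows "smooth_on I D (\<lambda>w. Determinant.det (M w))"
proof -
  have "smooth_on I D (\<lambda>w. \<Sum>p | p permutes {0..<r}. signof p * (\<Prod>i = 0..<r. M w $$ (i, p i)))"
  proof (intro smooth_on_sum[OF op] smooth_on_mult[OF op] smooth_on_prod[OF op] smooth_on_const[OF op] smat_entry[OF M])
    fix p i assume "p \<in> {p. p permutes {0..<r}}" "i \<in> {0..<r}"
    then show "i < r" "p i < r" using permutes_in_image[of p "{0..<r}" i] by auto
  qed
  moreover have "Determinant.det (M w) = (\<Sum>p | p permutes {0..<r}. signof p * (\<Prod>i = 0..<r. M w $$ (i, p i)))"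
    if "w \<in> D" for w
    by (rule det_def'[OF smat_carrier[OF M that]])
  ultimately show ?thesis
    using smooth_on_cong[OF op, of "\<lambda>w. Determinant.det (M w)"
        "\<lambda>w. \<Sum>p | p permutes {0..<r}. signof p * (\<Prod>i = 0..<r. M w $$ (i, p i))"] by blast
qed

lemma smat_minv:
  assumes op: "copen I D" and M: "smat I D r r M" and d: "\<And>w. w \<in> D \<Longrightarrow> Determinant.det (M w) \<noteq> 0"
  shows "smat I D r r (\<lambda>w. minv (M w))"
proof -
  have del: "smat I D (r - 1) (r - 1) (\<lambda>w. mat_delete (M w) l i)" if il: "i < r" "l < r" for i l
  proof (rule smatI[OF op, where f = "\<lambda>i' l' w. M w $$ (if i' < l then i' else Suc i', if l' < i then l' else Suc l')"])
    fix w assume "w \<in> D"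
    then show "mat_delete (M w) l i \<in> carrier_mat (r - 1) (r - 1)" by (intro mat_delete_carrier smat_carrier[OF M])
  next
    fix i' l' assume i': "i' < r - 1" "l' < r - 1"
    let ?a = "if i' < l then i' else Suc i'" and ?b = "if l' < i then l' else Suc l'"
    show "smooth_on I D (\<lambda>w. M w $$ (?a, ?b))" using i' by (intro smat_entry[OF M]) auto
    fix w assume "w \<in> D"
    from smat_carrier[OF M this] show "mat_delete (M w) l i $$ (i', l') = M w $$ (?a, ?b)"
      using i' by (simp add: mat_delete_def)
  qed
  show ?thesis
  proof (rule smatI[OF op, where f = "\<lambda>i l w. inverse (Determinant.det (M w)) * ((-1) ^ (l + i) * Determinant.det (mat_delete (M w) l i))"])
    fix w assume "w \<in> D"
    then show "minv (M w) \<in> carrier_mat r r" by (intro minv_inverse smat_carrier[OF M] d)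
  next
    fix i l assume il: "i < r" "l < r"
    show "smooth_on I D (\<lambda>w. inverse (Determinant.det (M w)) * ((-1) ^ (l + i) * Determinant.det (mat_delete (M w) l i)))"
      by (rule smooth_on_mult[OF op smooth_on_inverse[OF op d smooth_on_det[OF op M]]
            smooth_on_mult[OF op smooth_on_const[OF op] smooth_on_det[OF op del[OF il]]]])
    fix w assume w: "w \<in> D"
    show "minv (M w) $$ (i, l) = inverse (Determinant.det (M w)) * ((-1) ^ (l + i) * Determinant.det (mat_delete (M w) l i))"
      using minv_eq_adj_mat[OF smat_carrier[OF M w] d[OF w] il] smat_carrier[OF M w] il
      by (simp add: adj_mat_def cofactor_def)
  qed
qed

lemma smooth_on_mtrace:
  assumes op: "copen I D" and M: "smat I D r r M"
  shows "smooth_on I D (\<lambda>w. mtrace (M w))"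
proof -
  have "smooth_on I D (\<lambda>w. \<Sum>i<r. M w $$ (i, i))"
    by (intro smooth_on_sum[OF op] smat_entry[OF M]) auto
  then show ?thesis
    using smooth_on_cong[OF op, of "\<lambda>w. mtrace (M w)" "\<lambda>w. \<Sum>i<r. M w $$ (i, i)"]
      mtrace_eq[OF smat_carrier[OF M]] by blast
qed

lemma mder_carrier: "smat I D r c M \<Longrightarrow> w \<in> D \<Longrightarrow> mder d M w \<in> carrier_mat r c"
  using smat_carrier[of I D r c M w] by (auto simp: mder_def)

lemma mder_index:
  "smat I D r c M \<Longrightarrow> w \<in> D \<Longrightarrow> i < r \<Longrightarrow> l < c \<Longrightarrow> mder d M w $$ (i, l) = d (\<lambda>y. M y $$ (i, l)) w"
  using smat_carrier[of I D r c M w] by (auto simp: mder_def)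

lemma smat_mder:
  assumes op: "copen I D" and M: "smat I D r c M" and A: "A \<in> I"
  shows "smat I D r c (mder (wd \<epsilon> A) M)"
  by (rule smatI[OF op, where f = "\<lambda>i l. wd \<epsilon> A (\<lambda>y. M y $$ (i, l))"])
     (auto intro!: mder_carrier[OF M] mder_index[OF M] smooth_on_wd[OF op] smat_entry[OF M] A)

lemma mder_eqI:
  assumes "smat I D r c M" "w \<in> D" "K \<in> carrier_mat r c"
    "\<And>i l. i < r \<Longrightarrow> l < c \<Longrightarrow> d (\<lambda>y. M y $$ (i, l)) w = K $$ (i, l)"
  shows "mder d M w = K"
  using assms(3) mder_carrier[OF assms(1,2), of d]
  by (intro eq_matI) (auto simp: mder_index[OF assms(1,2)] assms(4))

lemma mder_cong:
  assumes op: "copen I D" and eq: "\<And>y. y \<in> D \<Longrightarrow> M y = N y" and w: "w \<in> D" "A \<in> I"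
  shows "mder (wd \<epsilon> A) M w = mder (wd \<epsilon> A) N w"
proof -
  have "wd \<epsilon> A (\<lambda>y. M y $$ (i, l)) w = wd \<epsilon> A (\<lambda>y. N y $$ (i, l)) w" for i l
    by (rule wd_cong[OF op w]) (simp add: eq)
  then show ?thesis by (simp add: mder_def eq[OF w(1)])
qed

lemma mder_const: "K \<in> carrier_mat r c \<Longrightarrow> mder (wd \<epsilon> A) (\<lambda>_. K) w = 0\<^sub>m r c"
  by (intro eq_matI) (auto simp: mder_def)

lemma mder_mult:
  assumes op: "copen I D" and M: "smat I D r k M" and N: "smat I D k c N" and w: "w \<in> D" "A \<in> I"
  shows "mder (wd \<epsilon> A) (\<lambda>y. M y * N y) w = mder (wd \<epsilon> A) M w * N w + M w * mder (wd \<epsilon> A) N w"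
proof (rule mder_eqI[OF smat_mult[OF op M N] w(1)])
  note Mc = smat_carrier[OF M w(1)] and Nc = smat_carrier[OF N w(1)]
  note dM = mder_carrier[OF M w(1), of "wd \<epsilon> A"] and dN = mder_carrier[OF N w(1), of "wd \<epsilon> A"]
  show "mder (wd \<epsilon> A) M w * N w + M w * mder (wd \<epsilon> A) N w \<in> carrier_mat r c"
    using Mc Nc dM dN by auto
  fix i l assume il: "i < r" "l < c"
  have "wd \<epsilon> A (\<lambda>y. (M y * N y) $$ (i, l)) w = wd \<epsilon> A (\<lambda>y. \<Sum>j<k. M y $$ (i, j) * N y $$ (j, l)) w"
    by (rule wd_cong[OF op w]) (rule index_mult_mat_sum[OF smat_carrier[OF M] smat_carrier[OF N] il])
  also have "\<dots> = (\<Sum>j<k. wd \<epsilon> A (\<lambda>y. M y $$ (i, j) * N y $$ (j, l)) w)"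
    using il by (intro wd_sum[OF op _ w] smooth_on_mult[OF op] smat_entry[OF M] smat_entry[OF N]) auto
  also have "\<dots> = (\<Sum>j<k. mder (wd \<epsilon> A) M w $$ (i, j) * N w $$ (j, l) + M w $$ (i, j) * mder (wd \<epsilon> A) N w $$ (j, l))"
    using il by (intro sum.cong refl)
      (simp add: wd_mult[OF smat_entry[OF M] smat_entry[OF N] w] mder_index[OF M w(1)] mder_index[OF N w(1)])
  also have "\<dots> = (mder (wd \<epsilon> A) M w * N w + M w * mder (wd \<epsilon> A) N w) $$ (i, l)"
    using il Mc Nc dM dN by (simp add: index_mult_mat_sum[OF dM Nc il] index_mult_mat_sum[OF Mc dN il] sum.distrib del: index_mult_mat(1))
  finally show "wd \<epsilon> A (\<lambda>y. (M y * N y) $$ (i, l)) w = (mder (wd \<epsilon> A) M w * N w + M w * mder (wd \<epsilon> A) N w) $$ (i, l)" .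
qed

lemma mder_minus:
  assumes op: "copen I D" and M: "smat I D r c M" and N: "smat I D r c N" and w: "w \<in> D" "A \<in> I"
  shows "mder (wd \<epsilon> A) (\<lambda>y. M y - N y) w = mder (wd \<epsilon> A) M w - mder (wd \<epsilon> A) N w"
proof (rule mder_eqI[OF smat_minus[OF op M N] w(1)])
  note Mc = smat_carrier[OF M w(1)] and Nc = smat_carrier[OF N w(1)]
  show "mder (wd \<epsilon> A) M w - mder (wd \<epsilon> A) N w \<in> carrier_mat r c"
    using mder_carrier[OF N w(1)] by (rule minus_carrier_mat)
  fix i l assume il: "i < r" "l < c"
  have "wd \<epsilon> A (\<lambda>y. (M y - N y) $$ (i, l)) w = wd \<epsilon> A (\<lambda>y. M y $$ (i, l) - N y $$ (i, l)) w"
  proof (rule wd_cong[OF op w])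
    fix y assume "y \<in> D"
    then show "(M y - N y) $$ (i, l) = M y $$ (i, l) - N y $$ (i, l)"
      using smat_carrier[OF M, of y] smat_carrier[OF N, of y] il by simp
  qed
  then show "wd \<epsilon> A (\<lambda>y. (M y - N y) $$ (i, l)) w = (mder (wd \<epsilon> A) M w - mder (wd \<epsilon> A) N w) $$ (i, l)"
    using il carrier_matD[OF mder_carrier[OF N w(1), of "wd \<epsilon> A"]]
    by (simp add: wd_diff[OF op smat_entry[OF M] smat_entry[OF N] w] mder_index[OF M w(1)] mder_index[OF N w(1)])
qed

lemma mder_adjoint:
  assumes op: "copen I D" and M: "smat I D r c M" and w: "w \<in> D" "A \<in> I"
  shows "mder (wd \<epsilon> A) (\<lambda>y. mat_adjoint (M y)) w = mat_adjoint (mder (wd (cnj \<epsilon>) A) M w)"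
proof (rule mder_eqI[OF smat_adjoint[OF op M] w(1)])
  note Mc = smat_carrier[OF M w(1)]
  show "mat_adjoint (mder (wd (cnj \<epsilon>) A) M w) \<in> carrier_mat c r"
    by (rule mat_adjoint_carrier[OF mder_carrier[OF M w(1)]])
  fix i l assume il: "i < c" "l < r"
  have "wd \<epsilon> A (\<lambda>y. mat_adjoint (M y) $$ (i, l)) w = wd \<epsilon> A (\<lambda>y. cnj (M y $$ (l, i))) w"
    by (rule wd_cong[OF op w]) (rule mat_adjoint_index[OF smat_carrier[OF M] il])
  then show "wd \<epsilon> A (\<lambda>y. mat_adjoint (M y) $$ (i, l)) w = mat_adjoint (mder (wd (cnj \<epsilon>) A) M w) $$ (i, l)"
    using il mat_adjoint_index[OF mder_carrier[OF M w(1)] il]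
    by (simp add: wd_cnj[OF smat_entry[OF M] w] mder_index[OF M w(1)])
qed

lemma mder_commute:
  assumes op: "copen I D" and M: "smat I D r c M" and w: "w \<in> D" and AB: "A \<in> I" "B \<in> I"
  shows "mder (wd \<epsilon> A) (mder (wd \<delta> B) M) w = mder (wd \<delta> B) (mder (wd \<epsilon> A) M) w"
proof (rule mder_eqI[OF smat_mder[OF op M AB(2)] w])
  note dA = smat_mder[OF op M AB(1), of \<epsilon>] and dB = smat_mder[OF op M AB(2), of \<delta>]
  show "mder (wd \<delta> B) (mder (wd \<epsilon> A) M) w \<in> carrier_mat r c"
    by (rule mder_carrier[OF dA w])
  fix i l assume il: "i < r" "l < c"
  have e: "wd \<epsilon> A (\<lambda>y. mder (wd \<delta> B) M y $$ (i, l)) w = wd \<epsilon> A (wd \<delta> B (\<lambda>y. M y $$ (i, l))) w"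
    if "A \<in> I" for A B \<epsilon> \<delta>
    by (rule wd_cong[OF op w that]) (rule mder_index[OF M _ il])
  have "wd \<epsilon> A (\<lambda>y. mder (wd \<delta> B) M y $$ (i, l)) w = wd \<epsilon> A (wd \<delta> B (\<lambda>y. M y $$ (i, l))) w" by (rule e[OF AB(1)])
  also have "\<dots> = wd \<delta> B (wd \<epsilon> A (\<lambda>y. M y $$ (i, l))) w"
    by (rule wd_commute[OF op smat_entry[OF M il] w AB])
  also have "\<dots> = wd \<delta> B (\<lambda>y. mder (wd \<epsilon> A) M y $$ (i, l)) w" by (rule e[OF AB(2), symmetric])
  also have "\<dots> = mder (wd \<delta> B) (mder (wd \<epsilon> A) M) w $$ (i, l)"
    by (rule mder_index[symmetric, OF dA w il])
  finally show "wd \<epsilon> A (\<lambda>y. mder (wd \<delta> B) M y $$ (i, l)) w = mder (wd \<delta> B) (mder (wd \<epsilon> A) M) w $$ (i, l)" .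
qed

lemma wd_mtrace:
  assumes op: "copen I D" and M: "smat I D r r M" and w: "w \<in> D" "A \<in> I"
  shows "wd \<epsilon> A (\<lambda>y. mtrace (M y)) w = mtrace (mder (wd \<epsilon> A) M w)"
proof -
  have "wd \<epsilon> A (\<lambda>y. mtrace (M y)) w = wd \<epsilon> A (\<lambda>y. \<Sum>i<r. M y $$ (i, i)) w"
    by (rule wd_cong[OF op w]) (rule mtrace_eq[OF smat_carrier[OF M]])
  also have "\<dots> = (\<Sum>i<r. wd \<epsilon> A (\<lambda>y. M y $$ (i, i)) w)"
    by (intro wd_sum[OF op _ w] smat_entry[OF M]) auto
  also have "\<dots> = mtrace (mder (wd \<epsilon> A) M w)"
    by (simp add: mtrace_eq[OF mder_carrier[OF M w(1)]] mder_index[OF M w(1)])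
  finally show ?thesis .
qed

text \<open>Differentiate \<open>M y * minv (M y) = 1\<close> and multiply by the inverse from the
  left.\<close>

lemma mder_minv:
  assumes op: "copen I D" and M: "smat I D r r M" and d: "\<And>w. w \<in> D \<Longrightarrow> Determinant.det (M w) \<noteq> 0"
    and w: "w \<in> D" "A \<in> I"
  shows "mder (wd \<epsilon> A) (\<lambda>y. minv (M y)) w = - (minv (M w) * mder (wd \<epsilon> A) M w * minv (M w))"
proof -
  note inv = smat_minv[OF op M d]
  let ?H = "M w" and ?Hi = "minv (M w)" and ?dH = "mder (wd \<epsilon> A) M w" and ?dHi = "mder (wd \<epsilon> A) (\<lambda>y. minv (M y)) w"
  have c: "?H \<in> carrier_mat r r" "?Hi \<in> carrier_mat r r" "?dH \<in> carrier_mat r r" "?dHi \<in> carrier_mat r r"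
    using smat_carrier[OF M w(1)] smat_carrier[OF inv w(1)] mder_carrier[OF M w(1)] mder_carrier[OF inv w(1)] by auto
  have "mder (wd \<epsilon> A) (\<lambda>y. M y * minv (M y)) w = mder (wd \<epsilon> A) (\<lambda>_. 1\<^sub>m r) w"
    by (rule mder_cong[OF op _ w]) (auto simp: minv_inverse(2)[OF smat_carrier[OF M] d])
  then have "?dH * ?Hi + ?H * ?dHi = 0\<^sub>m r r"
    using mder_mult[OF op M inv w, of \<epsilon>] mder_const[of "1\<^sub>m r" r r \<epsilon> A w] by simp
  then have "?Hi * (?dH * ?Hi + ?H * ?dHi) = ?Hi * 0\<^sub>m r r" by simp
  then have z: "?Hi * (?dH * ?Hi) + ?Hi * (?H * ?dHi) = 0\<^sub>m r r"
    using c by (subst (asm) mult_add_distrib_mat[of _ r r _ r]) auto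
  have "?Hi * (?H * ?dHi) = (?Hi * ?H) * ?dHi" using c by (intro assoc_mult_mat[symmetric, of _ r r _ r _ r]) auto
  also have "?Hi * ?H = 1\<^sub>m r" by (rule minv_inverse(3)[OF c(1) d[OF w(1)]])
  finally have "?Hi * (?H * ?dHi) = ?dHi" using c by simp
  with z have z: "?Hi * (?dH * ?Hi) + ?dHi = 0\<^sub>m r r" by simp
  have "?Hi * (?dH * ?Hi) = ?Hi * ?dH * ?Hi" using c by (intro assoc_mult_mat[symmetric, of _ r r _ r _ r]) auto
  with z have z: "?Hi * ?dH * ?Hi + ?dHi = 0\<^sub>m r r" by simp
  show ?thesis
  proof (rule eq_matI)
    fix i l assume "i < dim_row (- (?Hi * ?dH * ?Hi))" "l < dim_col (- (?Hi * ?dH * ?Hi))"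
    then have il: "i < r" "l < r" using c by auto
    have "(?Hi * ?dH * ?Hi + ?dHi) $$ (i, l) = 0" unfolding z using il by simp
    then have "(?Hi * ?dH * ?Hi) $$ (i, l) + ?dHi $$ (i, l) = 0" using c il by (simp del: index_mult_mat(1))
    then show "?dHi $$ (i, l) = (- (?Hi * ?dH * ?Hi)) $$ (i, l)"
      using c il by (simp del: index_mult_mat(1) add: eq_neg_iff_add_eq_0 add.commute)
  qed (use c in auto)
qed

section \<open>Hermitian metrics and Chern curvature\<close>

text \<open>What the Chern connection asks of a metric matrix: smoothness and an inverse, which is
  then smooth as well.\<close>

definition smetric :: "'i set \<Rightarrow> ('i \<Rightarrow> complex) set \<Rightarrow> nat \<Rightarrow> (('i \<Rightarrow> complex) \<Rightarrow> complex mat) \<Rightarrow> bool" where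
  "smetric I D r H \<longleftrightarrow> smat I D r r H \<and> (\<forall>w\<in>D. Determinant.det (H w) \<noteq> 0)"

lemma smetric_smat: "smetric I D r H \<Longrightarrow> smat I D r r H"
  and smetric_det: "smetric I D r H \<Longrightarrow> w \<in> D \<Longrightarrow> Determinant.det (H w) \<noteq> 0"
  by (auto simp: smetric_def)

lemma smat_conn:
  assumes op: "copen I D" and H: "smetric I D r H" and A: "A \<in> I"
  shows "smat I D r r (conn H A)"
  unfolding conn_def dz_wd
  by (rule smat_mult[OF op smat_minv[OF op smetric_smat[OF H] smetric_det[OF H]] smat_mder[OF op smetric_smat[OF H] A]])

text \<open>The frame \<open>e\<close> is constant: \<nabla>-bar kills it and \<nabla>_A sends it to
  the connection matrix. The commutator is therefore minus the dbar-derivative of that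
  matrix.\<close>

lemma curv_eq:
  assumes op: "copen I D" and H: "smetric I D r H" and w: "w \<in> D" and AB: "A \<in> I" "B \<in> I"
  shows "curv H A B w = - mder (wd \<i> B) (conn H A) w"
proof -
  define e where "e = (\<lambda>y. 1\<^sub>m (dim_row (H y)) :: complex mat)"
  note Hs = smetric_smat[OF H]
  have e: "e y = 1\<^sub>m r" if "y \<in> D" for y using smat_carrier[OF Hs that] by (simp add: e_def)
  have de: "mder (wd \<epsilon> C) e y = 0\<^sub>m r r" if "y \<in> D" "C \<in> I" for y C \<epsilon>
    using mder_cong[OF op e that] mder_const[of "1\<^sub>m r" r r] by simp
  note cH = smat_conn[OF op H AB(1)]
  have bar: "nabla_bar B e y = 0\<^sub>m r r" if "y \<in> D" for y
    unfolding nabla_bar_def dzb_wd by (rule de[OF that AB(2)])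
  have "mder (dz A) (nabla_bar B e) w = 0\<^sub>m r r"
    unfolding dz_wd using mder_cong[OF op bar w AB(1)] mder_const[of "0\<^sub>m r r" r r] by simp
  then have 1: "nabla H A (nabla_bar B e) w = 0\<^sub>m r r"
    unfolding nabla_def bar[OF w] using smat_carrier[OF cH w] by simp
  have "nabla H A e y = conn H A y" if "y \<in> D" for y
    unfolding nabla_def e[OF that] dz_wd de[OF that AB(1)] using smat_carrier[OF cH that] by simp
  then have 2: "nabla_bar B (nabla H A e) w = mder (wd \<i> B) (conn H A) w"
    unfolding nabla_bar_def dzb_wd by (rule mder_cong[OF op _ w AB(2)])
  have "mder (wd \<i> B) (conn H A) w \<in> carrier_mat r r" by (rule mder_carrier[OF cH w])
  then show ?thesis
    unfolding curv_def Let_def e_def[symmetric] 1 2 by (intro eq_matI) auto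
qed

lemma smat_curv:
  assumes op: "copen I D" and H: "smetric I D r H" and AB: "A \<in> I" "B \<in> I"
  shows "smat I D r r (curv H A B)"
  by (rule smat_cong[OF op smat_uminus[OF op smat_mder[OF op smat_conn[OF op H AB(1)] AB(2)]] curv_eq[OF op H _ AB]])

lemma smat_adj:
  assumes op: "copen I D" and Ht: "smetric I D t Ht" and Hh: "smat I D h h Hh" and \<phi>: "smat I D h t \<phi>"
  shows "smat I D t h (\<lambda>y. adj (Ht y) (Hh y) (\<phi> y))"
  unfolding adj_def
  by (rule smat_mult[OF op smat_mult[OF op smat_minv[OF op smetric_smat[OF Ht] smetric_det[OF Ht]] smat_adjoint[OF op \<phi>]] Hh])

text \<open>The adjoint of a holomorphic map is covariantly constant in (1,0)-directions, being the
  adjoint of the vanishing (0,1)-derivative of \<phi>. Written out in frames, this expresses its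
  plain derivative by the two connection matrices.\<close>

lemma mder_dz_adj:
  assumes op: "copen I D" and Ht: "smetric I D t Ht" and Hh: "smetric I D h Hh" and \<phi>: "smat I D h t \<phi>"
    and hol: "mder (wd \<i> A) \<phi> w = 0\<^sub>m h t" and w: "w \<in> D" "A \<in> I"
  shows "mder (wd (- \<i>) A) (\<lambda>y. adj (Ht y) (Hh y) (\<phi> y)) w =
    adj (Ht w) (Hh w) (\<phi> w) * conn Hh A w - conn Ht A w * adj (Ht w) (Hh w) (\<phi> w)"
proof -
  let ?d = "mder (wd (- \<i>) A)"
  note Hts = smetric_smat[OF Ht] and Hhs = smetric_smat[OF Hh]
  note inv = smat_minv[OF op Hts smetric_det[OF Ht]] and invh = smat_minv[OF op Hhs smetric_det[OF Hh]]
  note ad = smat_adjoint[OF op \<phi>]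
  define K where "K = minv (Ht w)"
  define L where "L = minv (Hh w)"
  define F where "F = mat_adjoint (\<phi> w)"
  define X where "X = ?d Ht w"
  define Z where "Z = ?d Hh w"
  have c: "K \<in> carrier_mat t t" "L \<in> carrier_mat h h" "F \<in> carrier_mat t h" "X \<in> carrier_mat t t" "Z \<in> carrier_mat h h"
      "Hh w \<in> carrier_mat h h"
    unfolding K_def L_def F_def X_def Z_def
    using smat_carrier[OF inv w(1)] smat_carrier[OF invh w(1)] smat_carrier[OF ad w(1)] mder_carrier[OF Hts w(1)]
      mder_carrier[OF Hhs w(1)] smat_carrier[OF Hhs w(1)] by auto
  \<comment> \<open>The (1,0)-derivative of the conjugate transpose is the conjugate transpose of
    the (0,1)-derivative.\<close>
  have "?d (\<lambda>y. mat_adjoint (\<phi> y)) w = mat_adjoint (0\<^sub>m h t)"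
    using mder_adjoint[OF op \<phi> w, of "- \<i>"] hol by simp
  also have "\<dots> = 0\<^sub>m t h"
    using mat_adjoint_carrier[of "0\<^sub>m h t :: complex mat" h t] mat_adjoint_index[of "0\<^sub>m h t" h t]
    by (intro eq_matI) auto
  finally have dF: "?d (\<lambda>y. mat_adjoint (\<phi> y)) w = 0\<^sub>m t h" .
  have dK: "?d (\<lambda>y. minv (Ht y)) w = - (K * X * K)"
    unfolding K_def X_def by (rule mder_minv[OF op Hts smetric_det[OF Ht] w])
  have "?d (\<lambda>y. minv (Ht y) * mat_adjoint (\<phi> y)) w = - (K * X * K) * F + K * 0\<^sub>m t h"
    using mder_mult[OF op inv ad w, of "- \<i>"] unfolding dF dK K_def F_def by simp
  also have "\<dots> = - (K * X * K * F)"
  proof -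
    have "- (K * X * K * F) \<in> carrier_mat t h" using c by auto
    from right_add_zero_mat[OF this] show ?thesis using c by simp
  qed
  finally have 1: "?d (\<lambda>y. minv (Ht y) * mat_adjoint (\<phi> y)) w = - (K * X * K * F)" .
  have "?d (\<lambda>y. adj (Ht y) (Hh y) (\<phi> y)) w = - (K * X * K * F) * Hh w + K * F * Z"
    unfolding adj_def using mder_mult[OF op smat_mult[OF op inv ad] Hhs w, of "- \<i>"] unfolding 1
    by (simp add: K_def F_def Z_def)
  \<comment> \<open>Inserting \<open>Hh w * L = 1\<close> turns the derivative of the target metric
    into its connection matrix \<open>L * Z\<close>.\<close>
  also have "K * F * Z = K * F * Hh w * (L * Z)"
  proof -
    have "K * F * Hh w * (L * Z) = K * F * (Hh w * (L * Z))"
      using c by (intro assoc_mult_mat[of _ t h _ h _ h]) auto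
    also have "Hh w * (L * Z) = (Hh w * L) * Z" using c by (intro assoc_mult_mat[symmetric, of _ h h _ h _ h]) auto
    also have "Hh w * L = 1\<^sub>m h" unfolding L_def by (rule minv_inverse(2)[OF c(6) smetric_det[OF Hh w(1)]])
    finally show ?thesis using c by simp
  qed
  also have "- (K * X * K * F) * Hh w = - (K * X * (K * F * Hh w))"
  proof -
    have "K * X * K * F = K * X * (K * F)" using c by (intro assoc_mult_mat[of _ t t _ t _ h]) auto
    moreover have "K * X * (K * F) * Hh w = K * X * (K * F * Hh w)" using c by (intro assoc_mult_mat[of _ t t _ h _ h]) auto
    ultimately show ?thesis using c by simp
  qed
  also have "- (K * X * (K * F * Hh w)) + K * F * Hh w * (L * Z) = K * F * Hh w * (L * Z) - K * X * (K * F * Hh w)"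
    using c by (intro eq_matI) (auto simp del: index_mult_mat(1))
  finally show ?thesis
    unfolding adj_def conn_def dz_wd K_def L_def F_def X_def Z_def .
qed

text \<open>Since \<phi> is holomorphic, the dbar-derivative falls on the adjoint alone. The
  curvature terms then measure the failure of the covariant derivatives of the adjoint to commute,
  because its (1,0)-derivative vanishes covariantly.\<close>

theorem dz_dzb_norm2:
  assumes op: "copen I D" and Ht: "smetric I D t Ht" and Hh: "smetric I D h Hh" and \<phi>: "smat I D h t \<phi>"
    and hol: "\<And>y B. y \<in> D \<Longrightarrow> B \<in> I \<Longrightarrow> mder (wd \<i> B) \<phi> y = 0\<^sub>m h t"
    and w: "w \<in> D" and ij: "i \<in> I" "j \<in> I"
  defines "P \<equiv> \<lambda>y. adj (Ht y) (Hh y) (\<phi> y)"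
  shows "dz i (dzb j (\<lambda>y. mtrace (\<phi> y * P y))) w =
      mtrace (nabla_hom Ht Hh i \<phi> w * nabla_bar j P w)
      + mtrace (P w * \<phi> w * curv Ht i j w) - mtrace (\<phi> w * P w * curv Hh i j w)"
proof -
  let ?X = "wd (- \<i>) i" and ?Y = "wd \<i> j"
  note Hts = smetric_smat[OF Ht] and Hhs = smetric_smat[OF Hh]
  have P: "smat I D t h P" unfolding P_def by (rule smat_adj[OF op Ht Hhs \<phi>])
  note YP = smat_mder[OF op P ij(2), of \<i>]
  note ct = smat_conn[OF op Ht ij(1)] and ch = smat_conn[OF op Hh ij(1)]
  have 1: "?Y (\<lambda>y. mtrace (\<phi> y * P y)) y = mtrace (\<phi> y * mder ?Y P y)" if y: "y \<in> D" for y
  proof -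
    have "?Y (\<lambda>y. mtrace (\<phi> y * P y)) y = mtrace (mder ?Y \<phi> y * P y + \<phi> y * mder ?Y P y)"
      using wd_mtrace[OF op smat_mult[OF op \<phi> P] y ij(2)] mder_mult[OF op \<phi> P y ij(2)] by simp
    then show ?thesis
      unfolding hol[OF y ij(2)]
      using smat_carrier[OF P y] mult_carrier_mat[OF smat_carrier[OF \<phi> y] smat_carrier[OF YP y]] by simp
  qed
  have "dz i (dzb j (\<lambda>y. mtrace (\<phi> y * P y))) w = ?X (\<lambda>y. mtrace (\<phi> y * mder ?Y P y)) w"
    unfolding dz_wd dzb_wd by (rule wd_cong[OF op w ij(1) 1])
  also have "\<dots> = mtrace (mder ?X \<phi> w * mder ?Y P w + \<phi> w * mder ?X (mder ?Y P) w)"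
    using wd_mtrace[OF op smat_mult[OF op \<phi> YP] w ij(1)] mder_mult[OF op \<phi> YP w ij(1)] by simp
  \<comment> \<open>The derivatives are exchanged because the (1,0)-derivative of \<open>P\<close>
    is explicit in the connection matrices, whose dbar-derivatives are minus the curvatures.\<close>
  also have "mder ?X (mder ?Y P) w = mder ?Y (mder ?X P) w"
    by (rule mder_commute[OF op P w ij])
  also have "\<dots> = mder ?Y (\<lambda>y. P y * conn Hh i y - conn Ht i y * P y) w"
    unfolding P_def by (rule mder_cong[OF op _ w ij(2)]) (rule mder_dz_adj[OF op Ht Hh \<phi> hol _ ij(1)], auto simp: ij)
  also have "\<dots> = (mder ?Y P w * conn Hh i w + P w * mder ?Y (conn Hh i) w)
      - (mder ?Y (conn Ht i) w * P w + conn Ht i w * mder ?Y P w)"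
    using mder_minus[OF op smat_mult[OF op P ch] smat_mult[OF op ct P] w ij(2), of \<i>]
      mder_mult[OF op P ch w ij(2), of \<i>] mder_mult[OF op ct P w ij(2), of \<i>] by simp
  finally have main: "dz i (dzb j (\<lambda>y. mtrace (\<phi> y * P y))) w = mtrace (mder ?X \<phi> w * mder ?Y P w
     + \<phi> w * ((mder ?Y P w * conn Hh i w + P w * mder ?Y (conn Hh i) w)
      - (mder ?Y (conn Ht i) w * P w + conn Ht i w * mder ?Y P w)))" .
  define F where "F = \<phi> w"
  define p where "p = P w"
  define Q where "Q = mder ?Y P w"
  define a where "a = conn Hh i w"
  define b where "b = conn Ht i w"
  define da where "da = mder ?Y (conn Hh i) w"
  define db where "db = mder ?Y (conn Ht i) w"
  define XF where "XF = mder ?X \<phi> w"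
  have c: "F \<in> carrier_mat h t" "p \<in> carrier_mat t h" "Q \<in> carrier_mat t h" "a \<in> carrier_mat h h" "b \<in> carrier_mat t t"
      "da \<in> carrier_mat h h" "db \<in> carrier_mat t t" "XF \<in> carrier_mat h t"
    unfolding F_def p_def Q_def a_def b_def da_def db_def XF_def
    using smat_carrier[OF \<phi> w] smat_carrier[OF P w] smat_carrier[OF YP w] smat_carrier[OF ct w] smat_carrier[OF ch w]
      mder_carrier[OF ct w] mder_carrier[OF ch w] mder_carrier[OF \<phi> w] by auto
  \<comment> \<open>The terms with undifferentiated \<open>a\<close> and \<open>b\<close> complete
    \<open>XF\<close> to the covariant derivative, after cyclic rotation of the trace; those with
    \<open>da\<close> and \<open>db\<close> become the curvature terms.\<close>
  have "mtrace (XF * Q + F * ((Q * a + p * da) - (db * p + b * Q))) =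
      mtrace (XF * Q) + (mtrace (F * (Q * a)) + mtrace (F * (p * da)) - (mtrace (F * (db * p)) + mtrace (F * (b * Q))))"
  proof -
    have cc: "XF * Q \<in> carrier_mat h h" "Q * a \<in> carrier_mat t h" "p * da \<in> carrier_mat t h" "db * p \<in> carrier_mat t h" "b * Q \<in> carrier_mat t h"
      using c by auto
    then have cF: "F * (Q * a) \<in> carrier_mat h h" "F * (p * da) \<in> carrier_mat h h" "F * (db * p) \<in> carrier_mat h h" "F * (b * Q) \<in> carrier_mat h h"
      using c(1) by auto
    have "F * ((Q * a + p * da) - (db * p + b * Q)) = F * (Q * a + p * da) - F * (db * p + b * Q)"
      using c(1) cc by (intro mult_minus_distrib_mat[of _ h t _ h]) auto
    also have "F * (Q * a + p * da) = F * (Q * a) + F * (p * da)" using c(1) cc by (intro mult_add_distrib_mat[of _ h t _ h]) auto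
    also have "F * (db * p + b * Q) = F * (db * p) + F * (b * Q)" using c(1) cc by (intro mult_add_distrib_mat[of _ h t _ h]) auto
    finally have e: "F * ((Q * a + p * da) - (db * p + b * Q)) = F * (Q * a) + F * (p * da) - (F * (db * p) + F * (b * Q))" .
    have s1: "F * (Q * a) + F * (p * da) \<in> carrier_mat h h" and s2: "F * (db * p) + F * (b * Q) \<in> carrier_mat h h"
      using cF by auto
    have s3: "F * (Q * a) + F * (p * da) - (F * (db * p) + F * (b * Q)) \<in> carrier_mat h h"
      using s2 by (rule minus_carrier_mat)
    show ?thesis
      unfolding e mtrace_add[OF cc(1) s3] mtrace_minus[OF s1 s2] mtrace_add[OF cF(1,2)] mtrace_add[OF cF(3,4)] ..
  qed
  moreover have "mtrace (F * (Q * a)) = mtrace (a * F * Q)"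
  proof -
    have "F * (Q * a) = F * Q * a" using c by (intro assoc_mult_mat[symmetric, of _ h t _ h _ h]) auto
    moreover have "mtrace (F * Q * a) = mtrace (a * (F * Q))" using c by (intro mtrace_comm[of _ h h]) auto
    moreover have "a * (F * Q) = a * F * Q" using c by (intro assoc_mult_mat[symmetric, of _ h h _ t _ h]) auto
    ultimately show ?thesis by simp
  qed
  moreover have "mtrace (F * (b * Q)) = mtrace (F * b * Q)"
    using assoc_mult_mat[of F h t b t Q h] c by simp
  moreover have "mtrace (F * (p * da)) = - mtrace (F * p * - da)"
  proof -
    have "F * (p * da) = F * p * da" using c by (intro assoc_mult_mat[symmetric, of _ h t _ h _ h]) auto
    moreover have "F * p * - da = - (F * p * da)" using c by simp
    moreover have "mtrace (- (F * p * da)) = - mtrace (F * p * da)" using c by (intro mtrace_uminus[of _ h]) auto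
    ultimately show ?thesis by simp
  qed
  moreover have "mtrace (F * (db * p)) = - mtrace (p * F * - db)"
  proof -
    have "mtrace (F * (db * p)) = mtrace (db * p * F)" using c by (intro mtrace_comm[of _ h t]) auto
    also have "db * p * F = db * (p * F)" using c by (intro assoc_mult_mat[of _ t t _ h _ t]) auto
    also have "mtrace (db * (p * F)) = mtrace (p * F * db)" using c by (intro mtrace_comm[of _ t t]) auto
    also have "p * F * - db = - (p * F * db)" using c by simp
    moreover have "mtrace (- (p * F * db)) = - mtrace (p * F * db)" using c by (intro mtrace_uminus[of _ t]) auto
    ultimately show ?thesis by simp
  qed
  moreover have "mtrace ((XF + a * F - F * b) * Q) = mtrace (XF * Q) + mtrace (a * F * Q) - mtrace (F * b * Q)"
  proof -
    have "(XF + a * F - F * b) * Q = (XF + a * F) * Q - F * b * Q"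
      using c by (intro minus_mult_distrib_mat[of _ h t _ _ h]) auto
    also have "(XF + a * F) * Q = XF * Q + a * F * Q"
      using c by (intro add_mult_distrib_mat[of _ h t _ _ h]) auto
    finally have e: "(XF + a * F - F * b) * Q = XF * Q + a * F * Q - F * b * Q" .
    have k: "XF * Q \<in> carrier_mat h h" "a * F * Q \<in> carrier_mat h h" "F * b * Q \<in> carrier_mat h h" "XF * Q + a * F * Q \<in> carrier_mat h h"
      using c by auto
    show ?thesis unfolding e mtrace_minus[OF k(4,3)] mtrace_add[OF k(1,2)] ..
  qed
  ultimately have "mtrace (XF * Q + F * ((Q * a + p * da) - (db * p + b * Q))) =
      mtrace ((XF + a * F - F * b) * Q) + mtrace (p * F * - db) - mtrace (F * p * - da)"
    by simp
  then show ?thesis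
    using main
    unfolding nabla_hom_def nabla_bar_def dz_wd dzb_wd curv_eq[OF op Ht w ij] curv_eq[OF op Hh w ij]
      F_def p_def Q_def a_def b_def da_def db_def XF_def
    by (simp only:)
qed

section \<open>Restriction of the curvature to a fiber\<close>

lemma dir_deriv_case_sum:
  "dir_deriv (axis_vec A c) (\<lambda>y. f (case_sum y t)) z = dir_deriv (axis_vec (Inl A) c) f (case_sum z t)"
proof -
  have "case_sum (line z (axis_vec A c) s) t = line (case_sum z t) (axis_vec (Inl A) c) s" for s
    by (auto simp: line_def axis_vec_def fun_eq_iff split: sum.split)
  then show ?thesis by (simp add: dir_deriv_line)
qed

lemma wd_case_sum: "wd \<epsilon> A (\<lambda>y. f (case_sum y t)) z = wd \<epsilon> (Inl A) f (case_sum z t)"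
  by (simp add: wd_def dir_deriv_case_sum)

lemma mder_case_sum: "mder (wd \<epsilon> A) (\<lambda>y. M (case_sum y t)) z = mder (wd \<epsilon> (Inl A)) M (case_sum z t)"
  by (simp add: mder_def wd_case_sum[of \<epsilon> A "\<lambda>w. M w $$ _"])

text \<open>The vortex equation speaks of the curvature of the fiber metrics; here it becomes the
  horizontal block of the curvature on the product.\<close>

lemma curv_case_sum: "curv (\<lambda>y. H (case_sum y t)) A B z = curv H (Inl A) (Inl B) (case_sum z t)"
proof -
  have cn: "conn (\<lambda>y. H (case_sum y t)) A z = conn H (Inl A) (case_sum z t)" for z
    by (simp add: conn_def dz_wd mder_case_sum)
  have nb: "nabla (\<lambda>y. H (case_sum y t)) A (\<lambda>y. M (case_sum y t)) z = nabla H (Inl A) M (case_sum z t)" for M z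
    by (simp add: nabla_def cn dz_wd mder_case_sum)
  have bar: "nabla_bar B (\<lambda>y. M (case_sum y t)) z = nabla_bar (Inl B) M (case_sum z t)" for M z
    by (simp add: nabla_bar_def dzb_wd mder_case_sum)
  let ?e = "\<lambda>w. 1\<^sub>m (dim_row (H w)) :: complex mat"
  have "nabla_bar B (\<lambda>y. ?e (case_sum y t)) = (\<lambda>z. nabla_bar (Inl B) ?e (case_sum z t))"
    by (rule ext) (rule bar)
  moreover have "nabla (\<lambda>y. H (case_sum y t)) A (\<lambda>y. ?e (case_sum y t)) = (\<lambda>z. nabla H (Inl A) ?e (case_sum z t))"
    by (rule ext) (rule nb)
  ultimately show ?thesis
    unfolding curv_def Let_def by (simp only: bar nb)
qed

text \<open>Curvature is local, so a metric may be replaced by an extension that agrees with it on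
  an open set.\<close>

lemma curv_cong:
  assumes op: "copen I D" and eq: "\<And>y. y \<in> D \<Longrightarrow> H y = H' y" and w: "w \<in> D" and AB: "A \<in> I" "B \<in> I"
  shows "curv H A B w = curv H' A B w"
proof -
  have cn: "conn H A y = conn H' A y" if "y \<in> D" for y
    using mder_cong[OF op eq that AB(1)] by (simp add: conn_def dz_wd eq[OF that])
  let ?e = "\<lambda>H y. 1\<^sub>m (dim_row (H y)) :: complex mat"
  have e: "mder (wd \<epsilon> C) (?e H) y = mder (wd \<epsilon> C) (?e H') y" if "y \<in> D" "C \<in> I" for y C \<epsilon>
    by (rule mder_cong[OF op _ that]) (simp add: eq)
  have 1: "mder (wd \<epsilon> C) (mder (wd \<delta> C') (?e H)) y = mder (wd \<epsilon> C) (mder (wd \<delta> C') (?e H')) y"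
    if "y \<in> D" "C \<in> I" "C' \<in> I" for y C C' \<epsilon> \<delta>
    by (rule mder_cong[OF op _ that(1,2)]) (rule e[OF _ that(3)])
  have 2: "mder (wd \<i> B) (\<lambda>y. mder (wd (- \<i>) A) (?e H) y + conn H A y * ?e H y) w =
      mder (wd \<i> B) (\<lambda>y. mder (wd (- \<i>) A) (?e H') y + conn H' A y * ?e H' y) w"
    by (rule mder_cong[OF op _ w AB(2)]) (simp add: e[OF _ AB(1)] cn eq)
  have 3: "mder (wd (- \<i>) A) (\<lambda>y. mder (wd \<i> B) (?e H) y) w = mder (wd (- \<i>) A) (\<lambda>y. mder (wd \<i> B) (?e H') y) w"
    by (rule 1[OF w AB])
  show ?thesis
    unfolding curv_def Let_def nabla_def nabla_bar_def dz_wd dzb_wd using 2 3 e[OF w AB(2)] cn[OF w] by simp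
qed

section \<open>Differentiation under the fiber integral\<close>

lemma closed_cspace: "closed (cspace I :: ('i \<Rightarrow> complex) set)"
proof -
  have "closed {w :: 'i \<Rightarrow> complex. w A = 0}" for A
    by (rule closed_Collect_eq[OF continuous_on_product_coordinates continuous_on_const])
  moreover have "cspace I = (\<Inter>A\<in>-I. {w :: 'i \<Rightarrow> complex. w A = 0})" by (auto simp: cspace_def)
  ultimately show ?thesis by auto
qed

lemma copen_borel:
  fixes U :: "(nat \<Rightarrow> complex) set"
  shows "copen I U \<Longrightarrow> U \<in> sets borel"
  by (auto simp: openin_open intro!: sets.Int[OF borel_closed[OF closed_cspace] borel_open])

lemma measurable_extend_zero:
  "(\<lambda>z (i::nat). if i < n then z i else (0::complex)) \<in> borel_measurable (PiM {..<n} (\<lambda>_. lborel))"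
proof (rule measurable_coordinatewise_then_product)
  fix i
  have "(\<lambda>z. z i) \<in> measurable (PiM {..<n} (\<lambda>_. lborel)) (lborel :: complex measure)" if "i < n"
    using that by (intro measurable_component_singleton) simp
  then show "(\<lambda>z. if i < n then z i else (0::complex)) \<in> borel_measurable (PiM {..<n} (\<lambda>_. lborel))"
    by (cases "i < n") auto
qed

lemma sets_lebesgue_C [simp]: "sets (lebesgue_C n) = sets borel"
  and space_lebesgue_C [simp]: "space (lebesgue_C n) = UNIV"
  by (simp_all add: lebesgue_C_def)

text \<open>The coordinate projections of a compact set are bounded, so the set lies over a finite
  product of discs, which has finite measure.\<close>

lemma emeasure_lebesgue_C_compact:
  assumes K: "compact K"
  shows "emeasure (lebesgue_C n) K < \<infinity>"
proof -
  interpret product_sigma_finite "\<lambda>_::nat. lborel :: complex measure" ..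
  let ?e = "\<lambda>z (i::nat). if i < n then z i else (0::complex)"
  let ?P = "PiM {..<n} (\<lambda>_::nat. lborel :: complex measure)"
  have "bounded ((\<lambda>z. z i) ` K)" for i
    by (intro compact_imp_bounded compact_continuous_image K continuous_on_subset[OF continuous_on_product_coordinates]) simp
  then have "\<exists>R. \<forall>z\<in>K. norm (z i) \<le> R" for i by (auto simp: bounded_iff)
  then obtain R where R: "\<And>i z. z \<in> K \<Longrightarrow> norm (z i) \<le> R i" by metis
  have "emeasure (lebesgue_C n) K = emeasure ?P (?e -` K \<inter> space ?P)"
    unfolding lebesgue_C_def
    by (rule emeasure_distr[OF measurable_extend_zero]) (use K in \<open>auto intro: borel_compact\<close>)
  also have "\<dots> \<le> emeasure ?P (Pi\<^sub>E {..<n} (\<lambda>i. cball 0 (R i)))"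
  proof (rule emeasure_mono)
    show "?e -` K \<inter> space ?P \<subseteq> Pi\<^sub>E {..<n} (\<lambda>i. cball 0 (R i))"
    proof
      fix z assume z: "z \<in> ?e -` K \<inter> space ?P"
      have "norm (z i) \<le> R i" if "i < n" for i using R[of "?e z" i] z that by auto
      then show "z \<in> Pi\<^sub>E {..<n} (\<lambda>i. cball 0 (R i))" using z by (auto simp: space_PiM PiE_iff)
    qed
  qed (auto intro: sets_PiM_I_finite)
  also have "\<dots> = (\<Prod>i<n. emeasure lborel (cball 0 (R i) :: complex set))"
    by (rule emeasure_PiM) auto
  also have "\<dots> < \<infinity>"
    using emeasure_bounded_finite[of "cball (0 :: complex) _"] by (auto simp: less_top[symmetric] ennreal_prod_eq_top)
  finally show ?thesis .
qed

lemma continuous_on_case_sum [continuous_intros]: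
  fixes f :: "'a::topological_space \<Rightarrow> 'i \<Rightarrow> complex" and g :: "'a \<Rightarrow> 'j \<Rightarrow> complex"
  assumes "continuous_on S f" "continuous_on S g"
  shows "continuous_on S (\<lambda>p. case_sum (f p) (g p))"
proof (rule continuous_on_coordinatewise_then_product)
  fix i show "continuous_on S (\<lambda>p. case_sum (f p) (g p) i)"
    using continuous_on_product_then_coordinatewise[OF assms(1)] continuous_on_product_then_coordinatewise[OF assms(2)]
    by (cases i) auto
qed

section \<open>Product domains and weighted integrals over a chart\<close>

definition prod_dom :: "(nat \<Rightarrow> complex) set \<Rightarrow> (nat \<Rightarrow> complex) set \<Rightarrow> (nat + nat \<Rightarrow> complex) set" where
  "prod_dom U T = {case_sum z t | z t. z \<in> U \<and> t \<in> T}"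

lemma prod_domI: "z \<in> U \<Longrightarrow> t \<in> T \<Longrightarrow> case_sum z t \<in> prod_dom U T"
  by (auto simp: prod_dom_def)

lemma copen_prod_dom:
  assumes U: "copen {..<n} U" and T: "copen {..<N} T"
  shows "copen (prod_idx n N) (prod_dom U T)"
proof -
  obtain U' where U': "open U'" "U = cspace {..<n} \<inter> U'" using U by (auto simp: openin_open)
  obtain T' where T': "open T'" "T = cspace {..<N} \<inter> T'" using T by (auto simp: openin_open)
  have c: "continuous_on UNIV (\<lambda>w :: nat + nat \<Rightarrow> complex. (\<lambda>i. w (f i)))" for f :: "nat \<Rightarrow> nat + nat"
    by (intro continuous_on_coordinatewise_then_product continuous_on_product_coordinates)
  have "open ((\<lambda>w. (\<lambda>i. w (Inl i))) -` U' \<inter> (\<lambda>w. (\<lambda>i. w (Inr i))) -` T')"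
    using U'(1) T'(1) by (intro open_Int open_vimage c)
  moreover have "prod_dom U T = cspace (prod_idx n N) \<inter> ((\<lambda>w. (\<lambda>i. w (Inl i))) -` U' \<inter> (\<lambda>w. (\<lambda>i. w (Inr i))) -` T')"
  proof (intro equalityI subsetI)
    fix w assume "w \<in> prod_dom U T"
    then show "w \<in> cspace (prod_idx n N) \<inter> ((\<lambda>w. (\<lambda>i. w (Inl i))) -` U' \<inter> (\<lambda>w. (\<lambda>i. w (Inr i))) -` T')"
      using U'(2) T'(2) by (auto simp: prod_dom_def cspace_def split: sum.splits)
  next
    fix w assume w: "w \<in> cspace (prod_idx n N) \<inter> ((\<lambda>w. (\<lambda>i. w (Inl i))) -` U' \<inter> (\<lambda>w. (\<lambda>i. w (Inr i))) -` T')"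
    have "w = case_sum (\<lambda>i. w (Inl i)) (\<lambda>i. w (Inr i))" by (auto simp: fun_eq_iff split: sum.split)
    moreover have "(\<lambda>i. w (Inl i)) \<in> U" "(\<lambda>i. w (Inr i)) \<in> T"
      using w U'(2) T'(2) by (auto simp: cspace_def)
    ultimately show "w \<in> prod_dom U T" using prod_domI by metis
  qed
  ultimately show ?thesis by (auto simp: openin_open)
qed

text \<open>\<kappa> will be a partition function times the volume density. The integrands are
  merely continuous on the chart image and may blow up at its boundary; integrability comes from
  \<kappa> vanishing outside \<open>K\<close>.\<close>

locale compact_weight =
  fixes n :: nat and U K :: "(nat \<Rightarrow> complex) set" and \<kappa> :: "(nat \<Rightarrow> complex) \<Rightarrow> complex"
  assumes U: "copen {..<n} U" and K: "compact K" "K \<subseteq> U"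
    and \<kappa>: "continuous_on U \<kappa>" "\<And>z. z \<in> U - K \<Longrightarrow> \<kappa> z = 0"
begin

definition J :: "((nat \<Rightarrow> complex) \<Rightarrow> complex) \<Rightarrow> complex" where
  "J \<eta> = (LINT z : U | lebesgue_C n. \<kappa> z * \<eta> z)"

lemma measurable_on_U:
  fixes g :: "(nat \<Rightarrow> complex) \<Rightarrow> complex"
  assumes "continuous_on U g"
  shows "(\<lambda>z. indicator U z *\<^sub>R g z) \<in> borel_measurable (lebesgue_C n)"
  using borel_measurable_continuous_on_indicator[OF copen_borel[OF U] assms]
  by (simp cong: measurable_cong_sets)

lemma integrable_const_K: "integrable (lebesgue_C n) (\<lambda>z. indicator K z *\<^sub>R (c :: real))"
  using K(1) emeasure_lebesgue_C_compact[OF K(1)]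
  by (intro integrable_scaleR_left integrable_real_indicator) (auto intro: borel_compact)

lemma continuous_bounded_K:
  fixes g :: "(nat \<Rightarrow> complex) \<Rightarrow> complex"
  assumes "continuous_on U g"
  obtains M where "0 \<le> M" "\<And>z. z \<in> K \<Longrightarrow> norm (g z) \<le> M"
proof -
  have "bounded (g ` K)"
    using assms K by (intro compact_imp_bounded compact_continuous_image) (auto intro: continuous_on_subset)
  then obtain M where "\<And>z. z \<in> K \<Longrightarrow> norm (g z) \<le> M" by (auto simp: bounded_iff)
  then show ?thesis using that[of "max M 0"] by fastforce
qed

lemma set_integrable_weight:
  assumes "continuous_on U \<eta>"
  shows "set_integrable (lebesgue_C n) U (\<lambda>z. \<kappa> z * \<eta> z)"
proof -
  have c: "continuous_on U (\<lambda>z. \<kappa> z * \<eta> z)" using assms \<kappa>(1) by (intro continuous_intros)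
  obtain M where M: "0 \<le> M" "\<And>z. z \<in> K \<Longrightarrow> norm (\<kappa> z * \<eta> z) \<le> M" using continuous_bounded_K[OF c] by blast
  show ?thesis unfolding set_integrable_def
  proof (rule Bochner_Integration.integrable_bound[OF integrable_const_K[of M] measurable_on_U[OF c]], rule AE_I2)
    fix z
    show "norm (indicator U z *\<^sub>R (\<kappa> z * \<eta> z)) \<le> norm (indicator K z *\<^sub>R M)"
      using M \<kappa>(2)[of z] by (auto simp: indicator_def split: if_splits)
  qed
qed

lemma J_add: "continuous_on U f \<Longrightarrow> continuous_on U g \<Longrightarrow> J (\<lambda>z. f z + g z) = J f + J g"
  unfolding J_def distrib_left by (intro set_integral_add set_integrable_weight)

lemma J_cmult: "J (\<lambda>z. c * f z) = c * J f"
  unfolding J_def mult.left_commute[of _ c] by (rule set_integral_mult_right)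

lemma J_cong: "(\<And>z. z \<in> U \<Longrightarrow> f z = g z) \<Longrightarrow> J f = J g"
  unfolding J_def set_lebesgue_integral_def by (intro Bochner_Integration.integral_cong refl) (auto simp: indicator_def)

lemma J_zero [simp]: "J (\<lambda>_. 0) = 0" by (simp add: J_def)

lemma J_sum: "(\<And>a. a \<in> A \<Longrightarrow> continuous_on U (f a)) \<Longrightarrow> J (\<lambda>z. \<Sum>a\<in>A. f a z) = (\<Sum>a\<in>A. J (f a))"
  by (induction A rule: infinite_finite_induct) (auto simp: J_add continuous_on_sum)

text \<open>The remainder of the difference quotient tends to 0 pointwise, and by the mean value
  inequality it is at most 2M over the compact set \<open>K\<close>. Dominated convergence
  concludes.\<close>

lemma J_has_vector_derivative:
  assumes e: "0 < e"
    and d: "\<And>z t. z \<in> U \<Longrightarrow> \<bar>t\<bar> \<le> e \<Longrightarrow> ((\<lambda>t. F z t) has_vector_derivative F' z t) (at t)"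
    and cF: "\<And>t. \<bar>t\<bar> \<le> e \<Longrightarrow> continuous_on U (\<lambda>z. F z t)"
    and cF': "continuous_on (U \<times> {-e..e}) (\<lambda>p. F' (fst p) (snd p))"
  shows "((\<lambda>t. J (\<lambda>z. F z t)) has_vector_derivative J (\<lambda>z. F' z 0)) (at 0)"
proof -
  let ?q = "\<lambda>z t. (1 / \<bar>t\<bar>) *\<^sub>R (F z t - F z 0 - of_real t * F' z 0)"
  have "bounded ((\<lambda>p. F' (fst p) (snd p)) ` (K \<times> {-e..e}))"
    using K by (intro compact_imp_bounded compact_continuous_image compact_Times compact_Icc)
      (auto intro: continuous_on_subset[OF cF'])
  then obtain M0 where M0: "\<And>z t. z \<in> K \<Longrightarrow> \<bar>t\<bar> \<le> e \<Longrightarrow> norm (F' z t) \<le> M0"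
    unfolding bounded_iff by (force simp: abs_le_iff)
  \<comment> \<open>\<open>K\<close> may be empty, in which case \<open>M0\<close> is arbitrary and
    could be negative.\<close>
  define M where "M = max M0 0"
  have M: "0 \<le> M" "\<And>z t. z \<in> K \<Longrightarrow> \<bar>t\<bar> \<le> e \<Longrightarrow> norm (F' z t) \<le> M"
    using M0 by (fastforce simp: M_def)+
  obtain C where C: "0 \<le> C" "\<And>z. z \<in> K \<Longrightarrow> norm (\<kappa> z) \<le> C" using continuous_bounded_K[OF \<kappa>(1)] by blast
  have cF0: "continuous_on U (\<lambda>z. F' z 0)"
    by (rule continuous_on_compose2[OF cF', of U "\<lambda>z. (z, 0)", simplified]) (use e in \<open>auto intro: continuous_intros\<close>)
  have mv: "norm (F z t - F z 0) \<le> M * \<bar>t\<bar>" if "z \<in> K" "\<bar>t\<bar> \<le> e" for z t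
  proof -
    have "norm (F z t - F z 0) \<le> M * norm (t - 0)"
    proof (rule differentiable_bound[of "{-e..e}"])
      fix x assume x: "x \<in> {-e..e}"
      then show "(F z has_derivative (\<lambda>h. h *\<^sub>R F' z x)) (at x within {-e..e})"
        using d[of z x] that(1) K(2) by (auto simp: has_vector_derivative_def abs_le_iff intro: has_derivative_at_withinI)
      show "onorm (\<lambda>h. h *\<^sub>R F' z x) \<le> M"
      proof (rule onorm_le)
        fix h :: real
        show "norm (h *\<^sub>R F' z x) \<le> M * norm h"
          using mult_right_mono[OF M(2)[OF that(1), of x], of "\<bar>h\<bar>"] x by (auto simp: abs_le_iff mult.commute)
      qed
    qed (use that e in \<open>auto simp: abs_le_iff\<close>)
    then show ?thesis by simp
  qed
  have bound: "norm (\<kappa> z * ?q z t) \<le> C * (2 * M)" if "z \<in> K" "\<bar>t\<bar> \<le> e" "t \<noteq> 0" for z t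
  proof -
    have "norm (F z t - F z 0 - of_real t * F' z 0) \<le> M * \<bar>t\<bar> + \<bar>t\<bar> * M"
    proof (rule order_trans[OF norm_triangle_ineq4 add_mono])
      show "norm (of_real t * F' z 0) \<le> \<bar>t\<bar> * M"
        using M(2)[OF that(1), of 0] e by (simp add: norm_mult mult_left_mono)
    qed (rule mv[OF that(1,2)])
    then have "1 / \<bar>t\<bar> * norm (F z t - F z 0 - of_real t * F' z 0) \<le> 1 / \<bar>t\<bar> * (M * \<bar>t\<bar> + \<bar>t\<bar> * M)"
      by (intro mult_left_mono) auto
    moreover have "1 / \<bar>t\<bar> * (M * \<bar>t\<bar> + \<bar>t\<bar> * M) = 2 * M" using that(3) by (simp add: field_simps)
    ultimately have "norm (?q z t) \<le> 2 * M" unfolding norm_scaleR by simp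
    then show ?thesis
      unfolding norm_mult using C that(1) M(1) by (intro mult_mono) auto
  qed
  have lim: "(?q z \<longlongrightarrow> 0) (at 0)" if "z \<in> U" for z
  proof -
    have "((\<lambda>t. (1 / norm (t - 0)) *\<^sub>R (F z t - (F z 0 + (t - 0) *\<^sub>R F' z 0))) \<longlongrightarrow> 0) (at 0)"
      using d[OF that, of 0] e unfolding has_vector_derivative_def has_derivative_within by simp
    then show ?thesis by (simp add: scaleR_conv_of_real algebra_simps)
  qed
  have cq: "continuous_on U (\<lambda>z. \<kappa> z * ?q z t)" if "\<bar>t\<bar> \<le> e" for t
    using \<kappa>(1) cF[OF that] cF[of 0] cF0 e by (intro continuous_intros) auto
  have Jq: "J (\<lambda>z. ?q z t) = (1 / \<bar>t\<bar>) *\<^sub>R (J (\<lambda>z. F z t) - (J (\<lambda>z. F z 0) + t *\<^sub>R J (\<lambda>z. F' z 0)))" if "\<bar>t\<bar> \<le> e" for t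
  proof -
    have "?q z t = of_real (1 / \<bar>t\<bar>) * (F z t + ((-1) * F z 0 + (- of_real t) * F' z 0))" for z
      by (simp add: scaleR_conv_of_real)
    then have "J (\<lambda>z. ?q z t) = of_real (1 / \<bar>t\<bar>) * J (\<lambda>z. F z t + ((-1) * F z 0 + (- of_real t) * F' z 0))"
      by (simp only: J_cmult)
    also have "J (\<lambda>z. F z t + ((-1) * F z 0 + (- of_real t) * F' z 0)) = J (\<lambda>z. F z t) + ((-1) * J (\<lambda>z. F z 0) + (- of_real t) * J (\<lambda>z. F' z 0))"
      using cF[OF that] cF[of 0] cF0 e
      by (subst J_add, simp, intro continuous_intros, simp, simp, subst J_add, intro continuous_intros, simp, intro continuous_intros, simp)
         (simp only: J_cmult)
    finally show ?thesis by (simp add: scaleR_conv_of_real)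
  qed
  have "((\<lambda>t. J (\<lambda>z. ?q z t)) \<longlongrightarrow> 0) (at 0 within {-e..e})"
    unfolding tendsto_at_iff_sequentially
  proof (intro allI impI)
    fix X :: "nat \<Rightarrow> real" assume X: "\<forall>i. X i \<in> {-e..e} - {0}" "X \<longlonglongrightarrow> 0"
    have Xe: "\<bar>X i\<bar> \<le> e" "X i \<noteq> 0" for i using X(1)[rule_format, of i] by (auto simp: abs_le_iff)
    have X0: "filterlim X (at 0) sequentially" using X Xe(2) by (simp add: filterlim_at)
    let ?s = "\<lambda>i z. indicator U z *\<^sub>R (\<kappa> z * ?q z (X i))"
    have "(\<lambda>i. integral\<^sup>L (lebesgue_C n) (?s i)) \<longlonglongrightarrow> integral\<^sup>L (lebesgue_C n) (\<lambda>_. 0)"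
    proof (rule integral_dominated_convergence[where w = "\<lambda>z. indicator K z *\<^sub>R (C * (2 * M))"])
      show "integrable (lebesgue_C n) (\<lambda>z. indicator K z *\<^sub>R (C * (2 * M)))" by (rule integrable_const_K)
      show "?s i \<in> borel_measurable (lebesgue_C n)" for i by (rule measurable_on_U[OF cq[OF Xe(1)]])
      show "AE z in lebesgue_C n. (\<lambda>i. ?s i z) \<longlonglongrightarrow> 0"
      proof (rule AE_I2)
        fix z
        show "(\<lambda>i. ?s i z) \<longlonglongrightarrow> 0"
        proof (cases "z \<in> U")
          case True
          from tendsto_mult_right_zero[OF filterlim_compose[OF lim[OF True] X0], of "\<kappa> z"] True
          show ?thesis by simp
        qed simp
      qed
      show "AE z in lebesgue_C n. norm (?s i z) \<le> indicator K z *\<^sub>R (C * (2 * M))" for i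
      proof (rule AE_I2)
        fix z
        show "norm (?s i z) \<le> indicator K z *\<^sub>R (C * (2 * M))"
          using bound[OF _ Xe, of z i] \<kappa>(2)[of z] K(2) by (cases "z \<in> K"; cases "z \<in> U") auto
      qed
    qed simp
    then show "((\<lambda>t. J (\<lambda>z. ?q z t)) \<circ> X) \<longlonglongrightarrow> 0"
      unfolding J_def set_lebesgue_integral_def o_def Bochner_Integration.integral_zero .
  qed
  then have "((\<lambda>t. (1 / \<bar>t\<bar>) *\<^sub>R (J (\<lambda>z. F z t) - (J (\<lambda>z. F z 0) + t *\<^sub>R J (\<lambda>z. F' z 0)))) \<longlongrightarrow> 0) (at 0 within {-e..e})"
    by (rule Lim_transform_eventually) (auto simp: eventually_at_filter abs_le_iff intro!: always_eventually Jq)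
  moreover have "at 0 within {-e..e} = at 0"
    using e by (intro at_within_interior) (simp add: interior_atLeastAtMost_real)
  ultimately show ?thesis
    unfolding has_vector_derivative_def has_derivative_within
    by (simp add: bounded_linear_scaleR_left)
qed

lemma J_has_dir_deriv:
  assumes T: "copen {..<N} T" and f: "smooth_on (prod_idx n N) (prod_dom U T) f"
    and s: "s \<in> T" and i: "i < N" and c: "c \<in> {1, \<i>}"
  shows "((\<lambda>t. J (\<lambda>z. f (case_sum z (line s (axis_vec i c) t)))) has_vector_derivative
     J (\<lambda>z. dir_deriv (axis_vec (Inr i) c) f (case_sum z s))) (at 0)"
proof -
  let ?u = "axis_vec i c"
  have op: "open {t. line s ?u t \<in> T}" using i by (intro copen_line[OF T s]) auto
  have "0 \<in> {t. line s ?u t \<in> T}" using s by simp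
  \<comment> \<open>A closed interval is chosen because the derivative is bounded over the compact
    product of \<open>K\<close> with it.\<close>
  then obtain e where e: "0 < e" "cball 0 e \<subseteq> {t. line s ?u t \<in> T}"
    using op unfolding open_contains_cball by blast
  have inT: "line s ?u t \<in> T" if "\<bar>t\<bar> \<le> e" for t using e(2) that by (auto simp: subset_iff dist_real_def)
  have ln: "case_sum z (line s ?u t) = line (case_sum z s) (axis_vec (Inr i) c) t" for z t
    by (auto simp: line_def axis_vec_def fun_eq_iff split: sum.split)
  have iI: "Inr i \<in> prod_idx n N" using i by auto
  have "((\<lambda>t. J (\<lambda>z. f (case_sum z (line s ?u t)))) has_vector_derivative
     J (\<lambda>z. dir_deriv (axis_vec (Inr i) c) f (case_sum z (line s ?u 0)))) (at 0)"
  proof (rule J_has_vector_derivative[OF e(1)])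
    fix z t assume z: "z \<in> U" and t: "\<bar>t\<bar> \<le> e"
    show "((\<lambda>t. f (case_sum z (line s ?u t))) has_vector_derivative dir_deriv (axis_vec (Inr i) c) f (case_sum z (line s ?u t))) (at t)"
      unfolding ln
      by (rule C_on_has_dir_deriv_along[OF smooth_on_C_on[OF f] iI c]) (use prod_domI[OF z inT[OF t]] in \<open>simp add: ln\<close>)
  next
    fix t assume t: "\<bar>t\<bar> \<le> e"
    show "continuous_on U (\<lambda>z. f (case_sum z (line s ?u t)))"
      by (rule continuous_on_compose2[OF smooth_on_imp_continuous[OF f] continuous_on_case_sum[OF continuous_on_id continuous_on_const]])
        (auto intro!: prod_domI inT t)
  next
    show "continuous_on (U \<times> {- e..e}) (\<lambda>p. dir_deriv (axis_vec (Inr i) c) f (case_sum (fst p) (line s ?u (snd p))))"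
      by (rule continuous_on_compose2[OF smooth_on_imp_continuous[OF smooth_on_dir_deriv[OF f iI c]]])
        (auto intro!: continuous_on_case_sum continuous_on_fst continuous_on_id
          continuous_on_compose2[OF continuous_on_line[of UNIV] continuous_on_snd[OF continuous_on_id]] prod_domI inT simp: abs_le_iff)
  qed
  then show ?thesis by simp
qed

lemma continuous_on_fiber:
  assumes "smooth_on (prod_idx n N) (prod_dom U T) f" "s \<in> T"
  shows "continuous_on U (\<lambda>z. f (case_sum z s))"
  by (rule continuous_on_compose2[OF smooth_on_imp_continuous[OF assms(1)] continuous_on_case_sum[OF continuous_on_id continuous_on_const]])
    (auto intro!: prod_domI assms(2))

end

lemma wd_sum_J:
  fixes m :: nat
  assumes w: "\<And>k. k < m \<Longrightarrow> compact_weight n (U k) (K k) (\<kappa> k)" and T: "copen {..<N} T"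
    and f: "\<And>k. k < m \<Longrightarrow> smooth_on (prod_idx n N) (prod_dom (U k) T) (f k)" and s: "s \<in> T" and i: "i < N"
  shows "wd \<epsilon> i (\<lambda>s. \<Sum>k<m. compact_weight.J n (U k) (\<kappa> k) (\<lambda>z. f k (case_sum z s))) s =
     (\<Sum>k<m. compact_weight.J n (U k) (\<kappa> k) (\<lambda>z. wd \<epsilon> (Inr i) (f k) (case_sum z s)))"
proof -
  let ?J = "\<lambda>k. compact_weight.J n (U k) (\<kappa> k)"
  let ?d = "\<lambda>c k z. dir_deriv (axis_vec (Inr i) c) (f k) (case_sum z s)"
  have d: "dir_deriv (axis_vec i c) (\<lambda>s. \<Sum>k<m. ?J k (\<lambda>z. f k (case_sum z s))) s = (\<Sum>k<m. ?J k (?d c k))"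
    if "c \<in> {1, \<i>}" for c
    by (rule dir_deriv_unique, rule has_vector_derivative_sum)
       (auto intro: compact_weight.J_has_dir_deriv[OF w T f s i that])
  have "?J k (\<lambda>z. wd \<epsilon> (Inr i) (f k) (case_sum z s)) = 1 / 2 * ?J k (?d 1 k) + \<epsilon> / 2 * ?J k (?d \<i> k)" if k: "k < m" for k
  proof -
    interpret compact_weight n "U k" "K k" "\<kappa> k" by (rule w[OF k])
    have c: "continuous_on (U k) (?d c k)" if "c \<in> {1, \<i>}" for c
      using i by (intro continuous_on_fiber[OF smooth_on_dir_deriv[OF f[OF k] _ that] s]) auto
    have "J (\<lambda>z. wd \<epsilon> (Inr i) (f k) (case_sum z s)) = J (\<lambda>z. 1 / 2 * ?d 1 k z + \<epsilon> / 2 * ?d \<i> k z)"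
      by (simp add: wd_def add_divide_distrib)
    also have "\<dots> = 1 / 2 * J (?d 1 k) + \<epsilon> / 2 * J (?d \<i> k)"
      by (subst J_add) (intro continuous_intros c, simp, intro continuous_intros c, simp, simp only: J_cmult)
    finally show ?thesis .
  qed
  then have "(\<Sum>k<m. ?J k (\<lambda>z. wd \<epsilon> (Inr i) (f k) (case_sum z s))) = (\<Sum>k<m. 1 / 2 * ?J k (?d 1 k) + \<epsilon> / 2 * ?J k (?d \<i> k))"
    by (intro sum.cong) auto
  then show ?thesis
    by (simp add: wd_def d sum.distrib sum_distrib_left[symmetric] sum_divide_distrib[symmetric] add_divide_distrib)
qed

lemma dz_dzb_sum_J:
  fixes m :: nat
  assumes w: "\<And>k. k < m \<Longrightarrow> compact_weight n (U k) (K k) (\<kappa> k)" and T: "copen {..<N} T"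
    and f: "\<And>k. k < m \<Longrightarrow> smooth_on (prod_idx n N) (prod_dom (U k) T) (f k)" and s: "s \<in> T" and ij: "i < N" "j < N"
  shows "dz i (dzb j (\<lambda>s. \<Sum>k<m. compact_weight.J n (U k) (\<kappa> k) (\<lambda>z. f k (case_sum z s)))) s =
     (\<Sum>k<m. compact_weight.J n (U k) (\<kappa> k) (\<lambda>z. dz (Inr i) (dzb (Inr j) (f k)) (case_sum z s)))"
proof -
  have sm: "smooth_on (prod_idx n N) (prod_dom (U k) T) (wd \<i> (Inr j) (f k))" if "k < m" for k
    using ij by (intro smooth_on_wd[OF copen_prod_dom[OF compact_weight.U[OF w[OF that]] T] f[OF that]]) auto
  let ?J = "\<lambda>k. compact_weight.J n (U k) (\<kappa> k)"
  have "wd (- \<i>) i (wd \<i> j (\<lambda>s. \<Sum>k<m. ?J k (\<lambda>z. f k (case_sum z s)))) s =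
      wd (- \<i>) i (\<lambda>s. \<Sum>k<m. ?J k (\<lambda>z. wd \<i> (Inr j) (f k) (case_sum z s))) s"
    using ij by (intro wd_cong[OF T s] wd_sum_J[OF w T f]) auto
  also have "\<dots> = (\<Sum>k<m. ?J k (\<lambda>z. wd (- \<i>) (Inr i) (wd \<i> (Inr j) (f k)) (case_sum z s)))"
    by (rule wd_sum_J[OF w T sm s ij(1)])
  finally show ?thesis by (simp only: dz_wd dzb_wd)
qed

section \<open>Local extensions of a family\<close>

lemma mat_adjoint_hermitian_index:
  assumes "pos_hermitian n G" "i < n" "l < n"
  shows "cnj (G $$ (i, l)) = G $$ (l, i)"
  using mat_adjoint_index[of G n n l i] assms by (simp add: pos_hermitian_def)

lemma minv_mult_entry:
  assumes G: "G \<in> carrier_mat n n" "Determinant.det G \<noteq> 0" and "\<beta> < n" "\<gamma> < n"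
  shows "(\<Sum>\<delta><n. minv G $$ (\<beta>, \<delta>) * G $$ (\<delta>, \<gamma>)) = (if \<beta> = \<gamma> then 1 else 0)"
proof -
  note inv = minv_inverse[OF G]
  have "(\<Sum>\<delta><n. minv G $$ (\<beta>, \<delta>) * G $$ (\<delta>, \<gamma>)) = (minv G * G) $$ (\<beta>, \<gamma>)"
    by (rule index_mult_mat_sum[symmetric, OF inv(1) G(1) assms(3,4)])
  then show ?thesis unfolding inv(3) using assms(3,4) by simp
qed

text \<open>In the inner product with f \<omega>_X one inverse metric cancels against the conjugated
  coefficients, as \<open>G\<close> is hermitian, and the conjugate of \<i> leaves the factor -
  \<i>. Testing with f = 1 shows that no other \<open>l\<close> qualifies.\<close>

lemma Lam_eq:
  assumes G: "pos_hermitian n G"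
  shows "Lam n G \<eta> = - \<i> * (\<Sum>\<alpha><n. \<Sum>\<beta><n. minv G $$ (\<beta>, \<alpha>) * \<eta> \<alpha> \<beta>)"
proof -
  let ?S = "\<Sum>\<alpha><n. \<Sum>\<beta><n. minv G $$ (\<beta>, \<alpha>) * \<eta> \<alpha> \<beta>"
  have inner: "inner11 n G \<eta> (\<lambda>\<gamma> \<delta>. f * (\<i> * G $$ (\<gamma>, \<delta>))) = - \<i> * ?S * cnj f" for f
  proof -
    have "inner11 n G \<eta> (\<lambda>\<gamma> \<delta>. f * (\<i> * G $$ (\<gamma>, \<delta>))) =
      (\<Sum>\<alpha><n. \<Sum>\<beta><n. \<Sum>\<gamma><n. - \<i> * cnj f * \<eta> \<alpha> \<beta> * minv G $$ (\<gamma>, \<alpha>) * (\<Sum>\<delta><n. minv G $$ (\<beta>, \<delta>) * G $$ (\<delta>, \<gamma>)))"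
      unfolding inner11_def sum_distrib_left
      by (intro sum.cong refl) (simp add: mat_adjoint_hermitian_index[OF G])
    also have "\<dots> = (\<Sum>\<alpha><n. \<Sum>\<beta><n. \<Sum>\<gamma><n. if \<gamma> = \<beta> then - \<i> * cnj f * \<eta> \<alpha> \<beta> * minv G $$ (\<gamma>, \<alpha>) else 0)"
      by (intro sum.cong refl) (simp add: minv_mult_entry[OF pos_hermitian_det[OF G]])
    also have "\<dots> = (\<Sum>\<alpha><n. \<Sum>\<beta><n. - \<i> * cnj f * \<eta> \<alpha> \<beta> * minv G $$ (\<beta>, \<alpha>))"
      by (intro sum.cong refl) simp
    finally show ?thesis by (simp add: sum_distrib_left sum_distrib_right mult_ac)
  qed
  have eq: "l * cnj f = inner11 n G \<eta> (\<lambda>\<gamma> \<delta>. f * (\<i> * G $$ (\<gamma>, \<delta>))) \<longleftrightarrow> (l + \<i> * ?S) * cnj f = 0" for l f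
    unfolding inner distrib_right by (simp add: eq_neg_iff_add_eq_0)
  show ?thesis unfolding Lam_def eq
  proof (rule the_equality)
    fix l assume "\<forall>f. (l + \<i> * ?S) * cnj f = 0"
    then have "(l + \<i> * ?S) * cnj 1 = 0" by blast
    then show "l = - \<i> * ?S" by (simp add: add_eq_0_iff)
  qed simp
qed

lemma sum_entries_mult:
  assumes "A \<in> carrier_mat r k" "B \<in> carrier_mat k r"
  shows "(\<Sum>i<r. \<Sum>l<k. A $$ (i, l) * B $$ (l, i)) = mtrace (A * B)"
  unfolding mtrace_eq[OF mult_carrier_mat[OF assms]]
  by (intro sum.cong refl index_mult_mat_sum[OF assms, symmetric]) auto

text \<open>One point \<open>s\<close> of S, seen in one chart through one extension. The vortex
  equation is assumed for the member over this \<open>s\<close>.\<close>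

locale family_extension =
  fixes n :: nat
    and AX :: "'x::t2_space chart set"
    and g :: "'x chart \<Rightarrow> (nat \<Rightarrow> complex) \<Rightarrow> complex mat"
    and AS :: "'s::t2_space chart set"
    and Q :: "('v, 'b) pre_digraph"
    and K :: "('v, 'b) relation set"
    and \<nu> :: "'v \<Rightarrow> nat"
    and \<tau> :: "'v \<Rightarrow> real"
    and E :: "('v, 'b, 'j, 'x, 's) quiver_family"
    and h :: "'v \<Rightarrow> 'j \<Rightarrow> 'x \<times> 's \<Rightarrow> complex mat"
    and C :: "'s chart"
    and L :: "('v, 'b, 'j, 'x) ambient_extension"
    and s :: 's
  assumes n: "1 \<le> n"
    and mfd: "complex_manifold n AX"
    and cpt: "compact (UNIV :: 'x set)"
    and kaehler: "kaehler_metric n AX g"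
    and quiver: "locally_finite_quiver Q"
    and hol_family: "holomorphic_quiver_family AX AS Q K E"
    and metric: "family_metric AX AS Q E h"
    and vortex: "vortex_equation n AX g Q \<nu> \<tau> E h s"
    and ext: "local_extension n AX C Q E h L"
    and s: "s \<in> cdom C" "ccoord C s \<in> ambient L"
begin

abbreviation "N \<equiv> cdim C"
abbreviation "T \<equiv> ambient L"
abbreviation "t0 \<equiv> ccoord C s"
abbreviation "VV \<equiv> support_verts Q E"
abbreviation "AA \<equiv> support_arcs Q E"
abbreviation "m \<equiv> length (pieces L)"
abbreviation "bc k \<equiv> fst (pieces L ! k)"
abbreviation "\<rho> k \<equiv> snd (pieces L ! k)"
abbreviation "U k \<equiv> cimage (bc k)"
abbreviation "jx k \<equiv> frame_index L k"
abbreviation "B k \<equiv> prod_dom (U k) T"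
abbreviation "I \<equiv> prod_idx n N"
abbreviation "rv k v \<equiv> rk E v (jx k)"

lemma ambient_copen: "copen {..<N} T"
  and pou: "partition_of_unity AX (pieces L)"
  using ext by (simp_all add: local_extension_def)

lemma piece_mem:
  assumes "k < m"
  shows "bc k \<in> AX" "continuous_on UNIV (\<rho> k)" "closure {x. \<rho> k x \<noteq> 0} \<subseteq> cdom (bc k)"
proof -
  have "(bc k, \<rho> k) \<in> set (pieces L)" using assms by simp
  then show "bc k \<in> AX" "continuous_on UNIV (\<rho> k)" "closure {x. \<rho> k x \<noteq> 0} \<subseteq> cdom (bc k)"
    using pou unfolding partition_of_unity_def by fast+
qed

lemma chart:
  assumes "k < m"
  shows "cdim (bc k) = n" "copen {..<n} (U k)" "homeomorphism (cdom (bc k)) (U k) (ccoord (bc k)) (cinv (bc k))"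
  using mfd piece_mem(1)[OF assms] unfolding complex_manifold_def maximal_atlas_def topological_chart_def by blast+

lemma piece_copen: "k < m \<Longrightarrow> copen I (B k)"
  by (rule copen_prod_dom[OF chart(2) ambient_copen])

lemma B_eq: "B k = {case_sum z t | z t. z \<in> U k \<and> t \<in> T}" by (simp add: prod_dom_def)

lemma ext_piece:
  assumes "k < m"
  shows "cdom (bc k) \<times> {s \<in> cdom C. ccoord C s \<in> T} \<subseteq> cover E (jx k)"
    and "v \<in> VV \<Longrightarrow> w \<in> B k \<Longrightarrow> pos_hermitian (rv k v) (ext_metric L v k w)"
    and "v \<in> VV \<Longrightarrow> mat_fun_class (smooth_on I (B k)) (rv k v) (rv k v) (ext_metric L v k)"
    and "v \<in> VV \<Longrightarrow> x \<in> cdom (bc k) \<Longrightarrow> ext_metric L v k (case_sum (ccoord (bc k) x) t0) = h v (jx k) (x, s)"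
    and "a \<in> AA \<Longrightarrow> w \<in> B k \<Longrightarrow> ext_arrow L a k w \<in> carrier_mat (rv k (head Q a)) (rv k (tail Q a))"
    and "a \<in> AA \<Longrightarrow> mat_fun_class (hol_on I (B k)) (rv k (head Q a)) (rv k (tail Q a)) (ext_arrow L a k)"
    and "a \<in> AA \<Longrightarrow> x \<in> cdom (bc k) \<Longrightarrow> ext_arrow L a k (case_sum (ccoord (bc k) x) t0) = arrow E a (jx k) (x, s)"
  using ext[unfolded local_extension_def Let_def, folded B_eq] assms s by simp_all

lemma metric_smetric: "k < m \<Longrightarrow> v \<in> VV \<Longrightarrow> smetric I (B k) (rv k v) (ext_metric L v k)"
  using ext_piece(2,3) pos_hermitian_det unfolding smetric_def smat_def by blast

lemma arrow_smat: "k < m \<Longrightarrow> a \<in> AA \<Longrightarrow> smat I (B k) (rv k (head Q a)) (rv k (tail Q a)) (ext_arrow L a k)"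
  using ext_piece(5,6) hol_on_smooth[OF _ piece_copen] unfolding smat_def mat_fun_class_def by auto

lemma arrow_hol:
  assumes "k < m" "a \<in> AA" "y \<in> B k" "A \<in> I"
  shows "mder (wd \<i> A) (ext_arrow L a k) y = 0\<^sub>m (rv k (head Q a)) (rv k (tail Q a))"
proof (rule mder_eqI[OF arrow_smat[OF assms(1,2)] assms(3)])
  fix i l assume il: "i < rv k (head Q a)" "l < rv k (tail Q a)"
  have "hol_on I (B k) (\<lambda>y. ext_arrow L a k y $$ (i, l))"
    using ext_piece(6)[OF assms(1,2)] il by (simp add: mat_fun_class_def)
  from hol_on_dzb[OF this assms(3,4)]
  show "wd \<i> A (\<lambda>y. ext_arrow L a k y $$ (i, l)) y = 0\<^sub>m (rv k (head Q a)) (rv k (tail Q a)) $$ (i, l)"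
    using il by (simp add: dzb_wd)
qed simp

lemma arc_ends: "a \<in> AA \<Longrightarrow> tail Q a \<in> VV \<and> head Q a \<in> VV \<and> a \<in> arcs Q"
  by (simp add: support_arcs_def)

lemma finite_VV: "finite VV"
  using hol_family by (simp add: holomorphic_quiver_family_def)

lemma finite_arcs_at: "v \<in> VV \<Longrightarrow> finite (in_arcs Q v) \<and> finite (out_arcs Q v)"
  using quiver by (simp add: locally_finite_quiver_def support_verts_def)

lemma finite_AA: "finite AA"
proof -
  have "AA \<subseteq> (\<Union>v\<in>VV. in_arcs Q v)" using arc_ends by (auto simp: in_arcs_def)
  then show ?thesis using finite_VV finite_arcs_at by (meson finite_UN_I finite_subset)
qed

section \<open>Reduction of fiber integrals to weighted chart integrals\<close>

definition vol :: "nat \<Rightarrow> (nat \<Rightarrow> complex) \<Rightarrow> complex" where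
  "vol k z = kform_power_pullback n (g (bc k) z) n (fvec n (\<lambda>_ _. 0))"

definition \<kappa> :: "nat \<Rightarrow> (nat \<Rightarrow> complex) \<Rightarrow> complex" where
  "\<kappa> k z = of_real (\<rho> k (cinv (bc k) z)) * vol k z"

lemma g_pos: "k < m \<Longrightarrow> z \<in> U k \<Longrightarrow> pos_hermitian n (g (bc k) z)"
  using kaehler piece_mem(1) unfolding kaehler_metric_def by blast

lemma g_smat: "k < m \<Longrightarrow> smat {..<n} (U k) n n (g (bc k))"
  using kaehler piece_mem(1) g_pos pos_hermitian_det(1) unfolding kaehler_metric_def smat_def by blast

text \<open>The pulled-back volume form sees only the X-components of the frame, so any base vectors
  may be put in, in particular the zeros in \<open>vol\<close>.\<close>

lemma vol_eq: "kform_power_pullback n (g (bc k) z) n (fvec n v) = vol k z"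
  unfolding vol_def kform_power_pullback_fvec by (rule alt_sum_cong) (auto simp: fvec_def)

lemma continuous_on_vol:
  assumes "k < m"
  shows "continuous_on (U k) (vol k)"
proof -
  have "continuous_on (U k) (\<lambda>z. g (bc k) z $$ (\<alpha>, \<beta>))" if "\<alpha> < n" "\<beta> < n" for \<alpha> \<beta>
    by (rule smooth_on_imp_continuous[OF smat_entry[OF g_smat[OF assms] that]])
  then show ?thesis
    unfolding vol_def kform_power_pullback_fvec alt_sum_def kcof_def
    by (auto intro!: continuous_intros)
qed

definition KK :: "nat \<Rightarrow> (nat \<Rightarrow> complex) set" where
  "KK k = ccoord (bc k) ` closure {x. \<rho> k x \<noteq> 0}"

lemma weight: "k < m \<Longrightarrow> compact_weight n (U k) (KK k) (\<kappa> k)"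
proof
  assume k: "k < m"
  note hom = chart(3)[OF k]
  show "copen {..<n} (U k)" by (rule chart(2)[OF k])
  \<comment> \<open>Compactness of X makes the closed supports compact, and their coordinate images
    serve as the sets \<open>K\<close> of the weights.\<close>
  have "compact (closure {x. \<rho> k x \<noteq> 0})"
    using cpt by (metis compact_Int_closed closed_closure inf_top.left_neutral)
  moreover have "continuous_on (closure {x. \<rho> k x \<noteq> 0}) (ccoord (bc k))"
    using hom piece_mem(3)[OF k] by (auto simp: homeomorphism_def intro: continuous_on_subset)
  ultimately show "compact (KK k)" unfolding KK_def by (rule compact_continuous_image[rotated])
  show "KK k \<subseteq> U k" using piece_mem(3)[OF k] by (auto simp: KK_def cimage_def)
  have "continuous_on (U k) (\<lambda>z. \<rho> k (cinv (bc k) z))"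
    using hom by (intro continuous_on_compose2[OF piece_mem(2)[OF k]]) (auto simp: homeomorphism_def)
  then show "continuous_on (U k) (\<kappa> k)"
    unfolding \<kappa>_def by (intro continuous_intros continuous_on_vol[OF k])
  fix z assume z: "z \<in> U k - KK k"
  have "\<rho> k (cinv (bc k) z) = 0"
  proof (rule ccontr)
    assume "\<rho> k (cinv (bc k) z) \<noteq> 0"
    then have "cinv (bc k) z \<in> closure {x. \<rho> k x \<noteq> 0}" by (intro subsetD[OF closure_subset]) simp
    then have "ccoord (bc k) (cinv (bc k) z) \<in> KK k" by (auto simp: KK_def)
    moreover have "ccoord (bc k) (cinv (bc k) z) = z" using hom z by (auto simp: homeomorphism_def)
    ultimately show False using z by simp
  qed
  then show "\<kappa> k z = 0" by (simp add: \<kappa>_def)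
qed

abbreviation "JJ k \<equiv> compact_weight.J n (U k) (\<kappa> k)"

text \<open>Every fiber integral of the formula passes through here: once the volume density is
  split off, it joins the partition function in the weight and the rest is a scalar
  integrand.\<close>

lemma fiber_integral_JJ:
  assumes "\<And>k z. k < m \<Longrightarrow> z \<in> U k \<Longrightarrow> \<Theta> k (case_sum z t) (fvec n v) = f k z * vol k z"
  shows "fiber_integral n (pieces L) \<Theta> t v = (\<Sum>k<m. JJ k (f k))"
  unfolding fiber_integral_def pou_integral_def
proof (intro sum.cong refl)
  fix k assume "k \<in> {..<m}"
  then have k: "k < m" by simp
  have "(LINT z : U k | lebesgue_C n. of_real (\<rho> k (cinv (bc k) z)) * \<Theta> k (case_sum z t) (fvec n v)) = JJ k (f k)"
    unfolding compact_weight.J_def[OF weight[OF k]] set_lebesgue_integral_def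
    by (intro Bochner_Integration.integral_cong refl) (auto simp: indicator_def \<kappa>_def assms[OF k] mult_ac)
  then show "(LINT z : U k | lebesgue_C n. of_real (\<rho> k (cinv (bc k) z)) * \<Theta> k (case_sum z t)
       (\<lambda>m. if m < 2 * n then case_sum (real_frame m) (\<lambda>_. 0) else case_sum (\<lambda>_. 0) (v (m - 2 * n)))) = JJ k (f k)"
    by (simp add: fvec_def[abs_def])
qed

section \<open>The vortex equation in terms of the extension\<close>

lemma point:
  assumes "k < m" "z \<in> U k"
  shows "cinv (bc k) z \<in> cdom (bc k)" "ccoord (bc k) (cinv (bc k) z) = z"
    "(cinv (bc k) z, s) \<in> cover E (jx k)" "case_sum z t0 \<in> B k"
proof -
  note hom = chart(3)[OF assms(1)]
  show 1: "cinv (bc k) z \<in> cdom (bc k)" using hom assms(2) by (auto simp: homeomorphism_def)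
  show "ccoord (bc k) (cinv (bc k) z) = z" using hom assms(2) by (auto simp: homeomorphism_def)
  show "(cinv (bc k) z, s) \<in> cover E (jx k)" using ext_piece(1)[OF assms(1)] 1 s by auto
  show "case_sum z t0 \<in> B k" by (rule prod_domI[OF assms(2) s(2)])
qed

lemma rank_outside:
  assumes "(x, s) \<in> cover E j" "v \<in> verts Q" "v \<notin> VV"
  shows "rk E v j = 0"
  using assms by (auto simp: support_verts_def)

lemma arc_verts: "a \<in> arcs Q \<Longrightarrow> tail Q a \<in> verts Q \<and> head Q a \<in> verts Q"
  using quiver by (simp add: locally_finite_quiver_def wf_digraph_def)

abbreviation "arr k z a \<equiv> arrow E a (jx k) (cinv (bc k) z, s)"
abbreviation "arr_adj k z a \<equiv>
  adj (h (tail Q a) (jx k) (cinv (bc k) z, s)) (h (head Q a) (jx k) (cinv (bc k) z, s)) (arr k z a)"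

lemma arr_carrier:
  assumes "k < m" "z \<in> U k" "a \<in> arcs Q"
  shows "arr k z a \<in> carrier_mat (rv k (head Q a)) (rv k (tail Q a))"
    and "arr_adj k z a \<in> carrier_mat (rv k (tail Q a)) (rv k (head Q a))"
proof -
  note p = point(3)[OF assms(1,2)]
  show 1: "arr k z a \<in> carrier_mat (rv k (head Q a)) (rv k (tail Q a))"
  proof -
    have "\<forall>a\<in>arcs Q. \<forall>j. (\<forall>p\<in>cover E j. arrow E a j p \<in> carrier_mat (rk E (head Q a) j) (rk E (tail Q a) j)) \<and>
        mat_fun_class (locally_extends hol_on AX AS (cover E j)) (rk E (head Q a) j) (rk E (tail Q a) j) (arrow E a j)"
      using hol_family unfolding holomorphic_quiver_family_def by (elim conjE)
    from this[rule_format, OF assms(3)] p show ?thesis by blast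
  qed
  have h: "pos_hermitian (rv k v) (h v (jx k) (cinv (bc k) z, s))" if "v \<in> verts Q" for v
    using metric that p unfolding family_metric_def by blast
  note ht = pos_hermitian_det[OF h] and v = arc_verts[OF assms(3)]
  show "arr_adj k z a \<in> carrier_mat (rv k (tail Q a)) (rv k (head Q a))"
    unfolding adj_def using ht v
    by (intro mult_carrier_mat[OF mult_carrier_mat[OF minv_inverse(1) mat_adjoint_carrier[OF 1]]]) blast+
qed

lemma arr_eq:
  assumes "k < m" "z \<in> U k" "a \<in> AA"
  shows "arr k z a = ext_arrow L a k (case_sum z t0)" "arr_adj k z a = ext_adjoint Q L a k (case_sum z t0)"
  using ext_piece(4,7)[OF assms(1) _ point(1)[OF assms(1,2)]] arc_ends[OF assms(3)] assms(3)
  by (simp_all add: point(2)[OF assms(1,2)] ext_adjoint_def)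

text \<open>The extension agrees with the given metric over \<open>s\<close>, and horizontal
  derivatives do not leave that slice.\<close>

lemma curv_fiber:
  assumes k: "k < m" and z: "z \<in> U k" and p: "p \<in> VV" and ab: "\<alpha> < n" "\<beta> < n"
  shows "curv (\<lambda>y. h p (jx k) (cinv (bc k) y, s)) \<alpha> \<beta> z = curv (ext_metric L p k) (Inl \<alpha>) (Inl \<beta>) (case_sum z t0)"
proof -
  have "curv (\<lambda>y. h p (jx k) (cinv (bc k) y, s)) \<alpha> \<beta> z = curv (\<lambda>y. ext_metric L p k (case_sum y t0)) \<alpha> \<beta> z"
  proof (rule curv_cong[OF chart(2)[OF k] _ z])
    fix y assume y: "y \<in> U k"
    show "h p (jx k) (cinv (bc k) y, s) = ext_metric L p k (case_sum y t0)"
      using ext_piece(4)[OF k p point(1)[OF k y]] by (simp add: point(2)[OF k y])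
  qed (use ab in auto)
  then show ?thesis by (simp add: curv_case_sum)
qed

abbreviation "Gi k z \<equiv> minv (g (bc k) z)"
abbreviation "Rm k p A A' z \<equiv> curv (ext_metric L p k) A A' (case_sum z t0)"
abbreviation "ea k a z \<equiv> ext_arrow L a k (case_sum z t0)"
abbreviation "eP k a z \<equiv> ext_adjoint Q L a k (case_sum z t0)"

lemma vortex_pointwise:
  assumes k: "k < m" and z: "z \<in> U k" and p: "p \<in> VV" and il: "i < rv k p" "l < rv k p"
  shows "of_nat (\<nu> p) * (\<Sum>\<alpha><n. \<Sum>\<beta><n. Gi k z $$ (\<beta>, \<alpha>) * Rm k p (Inl \<alpha>) (Inl \<beta>) z $$ (i, l))
     + (\<Sum>a | a \<in> AA \<and> head Q a = p. (ea k a z * eP k a z) $$ (i, l))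
     - (\<Sum>a | a \<in> AA \<and> tail Q a = p. (eP k a z * ea k a z) $$ (i, l)) = of_real (\<tau> p) * 1\<^sub>m (rv k p) $$ (i, l)"
proof -
  note pt = point[OF k z]
  have "of_nat (\<nu> p) * fiber_iLamF n g (h p) s (jx k) (bc k) z $$ (i, l)
     + (\<Sum>a\<in>in_arcs Q p. (arr k z a * arr_adj k z a) $$ (i, l))
     - (\<Sum>a\<in>out_arcs Q p. (arr_adj k z a * arr k z a) $$ (i, l)) = of_real (\<tau> p) * 1\<^sub>m (rv k p) $$ (i, l)"
    using vortex[unfolded vortex_equation_def Let_def, rule_format, OF p piece_mem(1)[OF k] pt(1,3) il] by (simp only: pt(2))
  moreover have "fiber_iLamF n g (h p) s (jx k) (bc k) z $$ (i, l) =
      (\<Sum>\<alpha><n. \<Sum>\<beta><n. Gi k z $$ (\<beta>, \<alpha>) * Rm k p (Inl \<alpha>) (Inl \<beta>) z $$ (i, l))"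
  proof -
    have "h p (jx k) (cinv (bc k) z, s) = ext_metric L p k (case_sum z t0)"
      using ext_piece(4)[OF k p pt(1)] by (simp add: pt(2))
    then have d: "dim_row (h p (jx k) (cinv (bc k) z, s)) = rv k p"
      using smat_carrier[OF smetric_smat[OF metric_smetric[OF k p]] pt(4)] by simp
    show ?thesis
      \<comment> \<open>The \<i> in \<open>iLamF\<close> meets the - \<i> of \<open>Lam_eq\<close>,
        so the curvature term becomes the plain contraction of R.\<close>
      unfolding fiber_iLamF_def iLamF_def d Lam_eq[OF g_pos[OF k z]] using il
      by (simp add: curv_fiber[OF k z p] mult.assoc[symmetric])
  qed
  moreover have "(\<Sum>a\<in>in_arcs Q p. (arr k z a * arr_adj k z a) $$ (i, l)) =
      (\<Sum>a | a \<in> AA \<and> head Q a = p. (ea k a z * eP k a z) $$ (i, l))"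
  proof -
    have "(\<Sum>a\<in>in_arcs Q p. (arr k z a * arr_adj k z a) $$ (i, l)) =
        (\<Sum>a | a \<in> AA \<and> head Q a = p. (arr k z a * arr_adj k z a) $$ (i, l))"
    \<comment> \<open>The equation sums over all arrows into \<open>p\<close>. If the tail carries
      the zero bundle, the composite with the adjoint factors through rank 0 and vanishes.\<close>
    proof (rule sum.mono_neutral_right)
      show "\<forall>a\<in>in_arcs Q p - {a \<in> AA. head Q a = p}. (arr k z a * arr_adj k z a) $$ (i, l) = 0"
      proof
        fix a assume a: "a \<in> in_arcs Q p - {a \<in> AA. head Q a = p}"
        then have aa: "a \<in> arcs Q" "head Q a = p" "tail Q a \<notin> VV" using p by (auto simp: support_arcs_def)
        then have "rv k (tail Q a) = 0" using rank_outside[OF pt(3)] arc_verts by blast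
        then show "(arr k z a * arr_adj k z a) $$ (i, l) = 0"
          using index_mult_mat_sum[OF arr_carrier[OF k z aa(1)]] il aa(2) by simp
      qed
    qed (use finite_arcs_at[OF p] arc_ends in auto)
    also have "\<dots> = (\<Sum>a | a \<in> AA \<and> head Q a = p. (ea k a z * eP k a z) $$ (i, l))"
      by (intro sum.cong refl arg_cong2[where f = "\<lambda>A A'. (A * A') $$ (i, l)"] arr_eq[OF k z]) auto
    finally show ?thesis .
  qed
  moreover have "(\<Sum>a\<in>out_arcs Q p. (arr_adj k z a * arr k z a) $$ (i, l)) =
      (\<Sum>a | a \<in> AA \<and> tail Q a = p. (eP k a z * ea k a z) $$ (i, l))"
  proof -
    have "(\<Sum>a\<in>out_arcs Q p. (arr_adj k z a * arr k z a) $$ (i, l)) =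
        (\<Sum>a | a \<in> AA \<and> tail Q a = p. (arr_adj k z a * arr k z a) $$ (i, l))"
    proof (rule sum.mono_neutral_right)
      show "\<forall>a\<in>out_arcs Q p - {a \<in> AA. tail Q a = p}. (arr_adj k z a * arr k z a) $$ (i, l) = 0"
      proof
        fix a assume a: "a \<in> out_arcs Q p - {a \<in> AA. tail Q a = p}"
        then have aa: "a \<in> arcs Q" "tail Q a = p" "head Q a \<notin> VV" using p by (auto simp: support_arcs_def)
        then have "rv k (head Q a) = 0" using rank_outside[OF pt(3)] arc_verts by blast
        then show "(arr_adj k z a * arr k z a) $$ (i, l) = 0"
          using index_mult_mat_sum[OF arr_carrier(2,1)[OF k z aa(1)]] il aa(2) by simp
      qed
    qed (use finite_arcs_at[OF p] arc_ends in auto)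
    also have "\<dots> = (\<Sum>a | a \<in> AA \<and> tail Q a = p. (eP k a z * ea k a z) $$ (i, l))"
      by (intro sum.cong refl arg_cong2[where f = "\<lambda>A A'. (A * A') $$ (i, l)"] arr_eq[OF k z]) auto
    finally show ?thesis .
  qed
  ultimately show ?thesis by simp
qed

lemma ext_adjoint_smat: "k < m \<Longrightarrow> a \<in> AA \<Longrightarrow> smat I (B k) (rv k (tail Q a)) (rv k (head Q a)) (ext_adjoint Q L a k)"
  unfolding ext_adjoint_def[abs_def]
  using arc_ends by (intro smat_adj[OF piece_copen metric_smetric smetric_smat[OF metric_smetric] arrow_smat]) auto

lemma curv_smat: "k < m \<Longrightarrow> p \<in> VV \<Longrightarrow> A \<in> I \<Longrightarrow> A' \<in> I \<Longrightarrow> smat I (B k) (rv k p) (rv k p) (curv (ext_metric L p k) A A')"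
  by (rule smat_curv[OF piece_copen metric_smetric])

text \<open>
  \<open>At\<close> and \<open>Nt\<close> are the curvature and arrow parts of the Weil-Petersson integrand, \<open>Bt - At\<close> is the
  \<open>ch\<^sub>2\<close> integrand, \<open>Tt\<close> the \<open>c\<^sub>1\<close> integrand and \<open>Dt\<close> the one of \<open>\<partial>\<partial>\<close>-bar of \<open>tr(\<phi>\<phi>\<^sup>*)\<close>.
\<close>

definition Bt :: "nat \<Rightarrow> 'v \<Rightarrow> nat \<Rightarrow> nat \<Rightarrow> (nat \<Rightarrow> complex) \<Rightarrow> complex" where
  "Bt k p i j z = (\<Sum>\<alpha><n. \<Sum>\<beta><n. Gi k z $$ (\<beta>, \<alpha>) * mtrace (Rm k p (Inl \<alpha>) (Inl \<beta>) z * Rm k p (Inr i) (Inr j) z))"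

definition At :: "nat \<Rightarrow> 'v \<Rightarrow> nat \<Rightarrow> nat \<Rightarrow> (nat \<Rightarrow> complex) \<Rightarrow> complex" where
  "At k p i j z = (\<Sum>\<alpha><n. \<Sum>\<beta><n. Gi k z $$ (\<beta>, \<alpha>) * mtrace (Rm k p (Inr i) (Inl \<beta>) z * Rm k p (Inl \<alpha>) (Inr j) z))"

definition Tt :: "nat \<Rightarrow> 'v \<Rightarrow> nat \<Rightarrow> nat \<Rightarrow> (nat \<Rightarrow> complex) \<Rightarrow> complex" where
  "Tt k p i j z = mtrace (Rm k p (Inr i) (Inr j) z)"

definition Nt :: "nat \<Rightarrow> 'b \<Rightarrow> nat \<Rightarrow> nat \<Rightarrow> (nat \<Rightarrow> complex) \<Rightarrow> complex" where
  "Nt k a i j z = mtrace (nabla_hom (ext_metric L (tail Q a) k) (ext_metric L (head Q a) k) (Inr i) (ext_arrow L a k) (case_sum z t0)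
     * nabla_bar (Inr j) (ext_adjoint Q L a k) (case_sum z t0))"

definition Dt :: "nat \<Rightarrow> 'b \<Rightarrow> nat \<Rightarrow> nat \<Rightarrow> (nat \<Rightarrow> complex) \<Rightarrow> complex" where
  "Dt k a i j z = dz (Inr i) (dzb (Inr j) (\<lambda>w. mtrace (ext_arrow L a k w * ext_adjoint Q L a k w))) (case_sum z t0)"

lemma Dt_eq:
  assumes k: "k < m" and z: "z \<in> U k" and a: "a \<in> AA" and ij: "i < N" "j < N"
  shows "Dt k a i j z = Nt k a i j z + mtrace (eP k a z * ea k a z * Rm k (tail Q a) (Inr i) (Inr j) z)
     - mtrace (ea k a z * eP k a z * Rm k (head Q a) (Inr i) (Inr j) z)"
  using dz_dzb_norm2[OF piece_copen[OF k] metric_smetric[OF k] metric_smetric[OF k] arrow_smat[OF k a] arrow_hol[OF k a] point(4)[OF k z], of "Inr i" "Inr j"]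
    arc_ends[OF a] ij
  unfolding Dt_def Nt_def ext_adjoint_def[abs_def] by auto

text \<open>The vortex equation at \<open>p\<close> is multiplied by R_ij and traced. As it is given
  entry by entry, the trace is formed as a double sum over entries.\<close>

lemma vortex_trace:
  assumes k: "k < m" and z: "z \<in> U k" and p: "p \<in> VV" and ij: "i < N" "j < N"
  shows "of_nat (\<nu> p) * Bt k p i j z
     + (\<Sum>a | a \<in> AA \<and> head Q a = p. mtrace (ea k a z * eP k a z * Rm k p (Inr i) (Inr j) z))
     - (\<Sum>a | a \<in> AA \<and> tail Q a = p. mtrace (eP k a z * ea k a z * Rm k p (Inr i) (Inr j) z))
     = of_real (\<tau> p) * Tt k p i j z"
proof -
  let ?r = "rv k p" and ?R = "Rm k p (Inr i) (Inr j) z"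
  have w: "case_sum z t0 \<in> B k" by (rule point(4)[OF k z])
  have R: "?R \<in> carrier_mat ?r ?r" using ij by (intro smat_carrier[OF curv_smat[OF k p] w]) auto
  have Rab: "Rm k p (Inl \<alpha>) (Inl \<beta>) z \<in> carrier_mat ?r ?r" if "\<alpha> < n" "\<beta> < n" for \<alpha> \<beta>
    using that by (intro smat_carrier[OF curv_smat[OF k p] w]) auto
  have c: "ea k a z \<in> carrier_mat (rv k (head Q a)) (rv k (tail Q a))" "eP k a z \<in> carrier_mat (rv k (tail Q a)) (rv k (head Q a))"
    if "a \<in> AA" for a
    using smat_carrier[OF arrow_smat[OF k that] w] smat_carrier[OF ext_adjoint_smat[OF k that] w] by auto
  have tr: "(\<Sum>q<?r. \<Sum>l<?r. M $$ (q, l) * ?R $$ (l, q)) = mtrace (M * ?R)" if "M \<in> carrier_mat ?r ?r" for M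
    by (rule sum_entries_mult[OF that R])
  have "(\<Sum>q<?r. \<Sum>l<?r. (of_nat (\<nu> p) * (\<Sum>\<alpha><n. \<Sum>\<beta><n. Gi k z $$ (\<beta>, \<alpha>) * Rm k p (Inl \<alpha>) (Inl \<beta>) z $$ (q, l))
     + (\<Sum>a | a \<in> AA \<and> head Q a = p. (ea k a z * eP k a z) $$ (q, l))
     - (\<Sum>a | a \<in> AA \<and> tail Q a = p. (eP k a z * ea k a z) $$ (q, l))) * ?R $$ (l, q)) =
     (\<Sum>q<?r. \<Sum>l<?r. of_real (\<tau> p) * (1\<^sub>m ?r $$ (q, l) * ?R $$ (l, q)))"
    by (intro sum.cong refl) (simp only: vortex_pointwise[OF k z p] lessThan_iff mult.assoc)
  also have "\<dots> = of_real (\<tau> p) * Tt k p i j z"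
    unfolding sum_distrib_left[symmetric] tr[OF one_carrier_mat] Tt_def using R by simp
  also have "(\<Sum>q<?r. \<Sum>l<?r. (of_nat (\<nu> p) * (\<Sum>\<alpha><n. \<Sum>\<beta><n. Gi k z $$ (\<beta>, \<alpha>) * Rm k p (Inl \<alpha>) (Inl \<beta>) z $$ (q, l))
     + (\<Sum>a | a \<in> AA \<and> head Q a = p. (ea k a z * eP k a z) $$ (q, l))
     - (\<Sum>a | a \<in> AA \<and> tail Q a = p. (eP k a z * ea k a z) $$ (q, l))) * ?R $$ (l, q)) =
     of_nat (\<nu> p) * (\<Sum>q<?r. \<Sum>l<?r. \<Sum>\<alpha><n. \<Sum>\<beta><n. Gi k z $$ (\<beta>, \<alpha>) * (Rm k p (Inl \<alpha>) (Inl \<beta>) z $$ (q, l) * ?R $$ (l, q)))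
     + (\<Sum>q<?r. \<Sum>l<?r. \<Sum>a | a \<in> AA \<and> head Q a = p. (ea k a z * eP k a z) $$ (q, l) * ?R $$ (l, q))
     - (\<Sum>q<?r. \<Sum>l<?r. \<Sum>a | a \<in> AA \<and> tail Q a = p. (eP k a z * ea k a z) $$ (q, l) * ?R $$ (l, q))"
    unfolding left_diff_distrib distrib_right sum.distrib sum_subtractf
    by (simp only: sum_distrib_left sum_distrib_right mult.assoc)
  also have "(\<Sum>q<?r. \<Sum>l<?r. \<Sum>\<alpha><n. \<Sum>\<beta><n. Gi k z $$ (\<beta>, \<alpha>) * (Rm k p (Inl \<alpha>) (Inl \<beta>) z $$ (q, l) * ?R $$ (l, q))) = Bt k p i j z"
  proof -
    have "(\<Sum>q<?r. \<Sum>l<?r. \<Sum>\<alpha><n. \<Sum>\<beta><n. Gi k z $$ (\<beta>, \<alpha>) * (Rm k p (Inl \<alpha>) (Inl \<beta>) z $$ (q, l) * ?R $$ (l, q))) =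
       (\<Sum>\<alpha><n. \<Sum>\<beta><n. \<Sum>q<?r. \<Sum>l<?r. Gi k z $$ (\<beta>, \<alpha>) * (Rm k p (Inl \<alpha>) (Inl \<beta>) z $$ (q, l) * ?R $$ (l, q)))"
      by (rule sum_swap4)
    also have "\<dots> = Bt k p i j z"
      unfolding Bt_def sum_distrib_left[symmetric] by (intro sum.cong refl) (simp add: tr[OF Rab])
    finally show ?thesis .
  qed
  also have "(\<Sum>q<?r. \<Sum>l<?r. \<Sum>a | a \<in> AA \<and> head Q a = p. (ea k a z * eP k a z) $$ (q, l) * ?R $$ (l, q)) =
     (\<Sum>a | a \<in> AA \<and> head Q a = p. mtrace (ea k a z * eP k a z * ?R))"
  proof -
    have "(\<Sum>q<?r. \<Sum>l<?r. \<Sum>a | a \<in> AA \<and> head Q a = p. (ea k a z * eP k a z) $$ (q, l) * ?R $$ (l, q)) =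
       (\<Sum>a | a \<in> AA \<and> head Q a = p. \<Sum>q<?r. \<Sum>l<?r. (ea k a z * eP k a z) $$ (q, l) * ?R $$ (l, q))"
      by (rule sum_rotate3[symmetric])
    also have "\<dots> = (\<Sum>a | a \<in> AA \<and> head Q a = p. mtrace (ea k a z * eP k a z * ?R))"
      by (intro sum.cong refl tr) (auto intro!: mult_carrier_mat[OF c(1) c(2)])
    finally show ?thesis .
  qed
  also have "(\<Sum>q<?r. \<Sum>l<?r. \<Sum>a | a \<in> AA \<and> tail Q a = p. (eP k a z * ea k a z) $$ (q, l) * ?R $$ (l, q)) =
     (\<Sum>a | a \<in> AA \<and> tail Q a = p. mtrace (eP k a z * ea k a z * ?R))"
  proof -
    have "(\<Sum>q<?r. \<Sum>l<?r. \<Sum>a | a \<in> AA \<and> tail Q a = p. (eP k a z * ea k a z) $$ (q, l) * ?R $$ (l, q)) =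
       (\<Sum>a | a \<in> AA \<and> tail Q a = p. \<Sum>q<?r. \<Sum>l<?r. (eP k a z * ea k a z) $$ (q, l) * ?R $$ (l, q))"
      by (rule sum_rotate3[symmetric])
    also have "\<dots> = (\<Sum>a | a \<in> AA \<and> tail Q a = p. mtrace (eP k a z * ea k a z * ?R))"
      by (intro sum.cong refl tr) (auto intro!: mult_carrier_mat[OF c(2) c(1)])
    finally show ?thesis .
  qed
  finally show ?thesis .
qed

text \<open>Summed over the vertices, each arrow occurs once at its head and once at its tail. These
  terms cancel against the curvature terms of \<open>Dt_eq\<close> when the two identities are
  added.\<close>

lemma pointwise_identity:
  assumes k: "k < m" and z: "z \<in> U k" and ij: "i < N" "j < N"
  shows "(\<Sum>a\<in>AA. Nt k a i j z) =
    (\<Sum>p\<in>VV. of_real (\<tau> p) * Tt k p i j z) - (\<Sum>p\<in>VV. of_nat (\<nu> p) * Bt k p i j z) + (\<Sum>a\<in>AA. Dt k a i j z)"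
proof -
  let ?H = "\<lambda>a. mtrace (ea k a z * eP k a z * Rm k (head Q a) (Inr i) (Inr j) z)"
  let ?Tl = "\<lambda>a. mtrace (eP k a z * ea k a z * Rm k (tail Q a) (Inr i) (Inr j) z)"
  have "(\<Sum>p\<in>VV. of_real (\<tau> p) * Tt k p i j z) = (\<Sum>p\<in>VV. of_nat (\<nu> p) * Bt k p i j z
     + (\<Sum>a | a \<in> AA \<and> head Q a = p. ?H a) - (\<Sum>a | a \<in> AA \<and> tail Q a = p. ?Tl a))"
    by (intro sum.cong refl) (simp add: vortex_trace[OF k z _ ij, symmetric])
  also have "\<dots> = (\<Sum>p\<in>VV. of_nat (\<nu> p) * Bt k p i j z) + (\<Sum>a\<in>AA. ?H a) - (\<Sum>a\<in>AA. ?Tl a)"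
  proof -
    have "(\<Sum>p\<in>VV. \<Sum>a | a \<in> AA \<and> head Q a = p. ?H a) = (\<Sum>a\<in>AA. ?H a)"
      using arc_ends by (intro sum.group[OF finite_AA finite_VV]) auto
    moreover have "(\<Sum>p\<in>VV. \<Sum>a | a \<in> AA \<and> tail Q a = p. ?Tl a) = (\<Sum>a\<in>AA. ?Tl a)"
      using arc_ends by (intro sum.group[OF finite_AA finite_VV]) auto
    ultimately show ?thesis by (simp add: sum.distrib sum_subtractf)
  qed
  finally have 1: "(\<Sum>p\<in>VV. of_real (\<tau> p) * Tt k p i j z) =
      (\<Sum>p\<in>VV. of_nat (\<nu> p) * Bt k p i j z) + (\<Sum>a\<in>AA. ?H a) - (\<Sum>a\<in>AA. ?Tl a)" .
  have "(\<Sum>a\<in>AA. Dt k a i j z) = (\<Sum>a\<in>AA. Nt k a i j z) + (\<Sum>a\<in>AA. ?Tl a) - (\<Sum>a\<in>AA. ?H a)"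
    by (simp add: Dt_eq[OF k z _ ij] sum.distrib sum_subtractf)
  then show ?thesis unfolding 1 by simp
qed

section \<open>The fiber integrals\<close>

lemma continuous_on_t0:
  "k < m \<Longrightarrow> smooth_on I (B k) f \<Longrightarrow> continuous_on (U k) (\<lambda>z. f (case_sum z t0))"
  by (rule compact_weight.continuous_on_fiber[OF weight _ s(2)])

lemma continuous_on_Gi:
  assumes "k < m" "\<alpha> < n" "\<beta> < n"
  shows "continuous_on (U k) (\<lambda>z. Gi k z $$ (\<beta>, \<alpha>))"
  by (rule smooth_on_imp_continuous[OF smat_entry[OF smat_minv[OF chart(2)[OF assms(1)] g_smat[OF assms(1)]
            pos_hermitian_det(2)[OF g_pos[OF assms(1)]]] assms(3,2)]])

lemma continuous_on_mtrace_curv: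
  assumes "k < m" "p \<in> VV" "A1 \<in> I" "A2 \<in> I" "A3 \<in> I" "A4 \<in> I"
  shows "continuous_on (U k) (\<lambda>z. mtrace (Rm k p A1 A2 z * Rm k p A3 A4 z))"
  by (rule continuous_on_t0[OF assms(1) smooth_on_mtrace[OF piece_copen[OF assms(1)]
        smat_mult[OF piece_copen[OF assms(1)] curv_smat[OF assms(1-4)] curv_smat[OF assms(1,2,5,6)]]]])

lemma continuous_on_Bt: "k < m \<Longrightarrow> p \<in> VV \<Longrightarrow> i < N \<Longrightarrow> j < N \<Longrightarrow> continuous_on (U k) (Bt k p i j)"
  unfolding Bt_def[abs_def]
  by (intro continuous_on_sum continuous_on_mult continuous_on_Gi continuous_on_mtrace_curv) auto

lemma continuous_on_At: "k < m \<Longrightarrow> p \<in> VV \<Longrightarrow> i < N \<Longrightarrow> j < N \<Longrightarrow> continuous_on (U k) (At k p i j)"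
  unfolding At_def[abs_def]
  by (intro continuous_on_sum continuous_on_mult continuous_on_Gi continuous_on_mtrace_curv) auto

lemma continuous_on_Tt:
  assumes "k < m" "p \<in> VV" "i < N" "j < N"
  shows "continuous_on (U k) (Tt k p i j)"
  unfolding Tt_def[abs_def]
  using assms(3,4) by (intro continuous_on_t0[OF assms(1) smooth_on_mtrace[OF piece_copen[OF assms(1)] curv_smat[OF assms(1,2)]]]) auto

lemma smooth_norm2:
  assumes "k < m" "a \<in> AA"
  shows "smooth_on I (B k) (\<lambda>w. mtrace (ext_arrow L a k w * ext_adjoint Q L a k w))"
  by (rule smooth_on_mtrace[OF piece_copen[OF assms(1)] smat_mult[OF piece_copen[OF assms(1)] arrow_smat[OF assms] ext_adjoint_smat[OF assms]]])

lemma continuous_on_Dt: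
  assumes "k < m" "a \<in> AA" "i < N" "j < N"
  shows "continuous_on (U k) (Dt k a i j)"
  unfolding Dt_def[abs_def] dz_wd dzb_wd
  using assms(3,4)
  by (intro continuous_on_t0[OF assms(1) smooth_on_wd[OF piece_copen[OF assms(1)] smooth_on_wd[OF piece_copen[OF assms(1)] smooth_norm2[OF assms(1,2)]]]]) auto

lemma piece_metric_eq: "piece_metric g L k (case_sum z t) = g (bc k) z"
  by (simp add: piece_metric_def o_def)

lemma wp_coeff_eq:
  "wp_coeff n g Q \<nu> E L t0 i j = (\<Sum>k<m. JJ k (\<lambda>z. (\<Sum>a\<in>AA. Nt k a i j z) + (\<Sum>p\<in>VV. of_nat (\<nu> p) * At k p i j z)))"
  if ij: "i < N" "j < N"
  unfolding wp_coeff_def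
proof (rule fiber_integral_JJ)
  fix k z assume k: "k < m" and z: "z \<in> U k"
  have "mtrace (Matrix.mat (dim_row (ext_metric L p k (case_sum z t0))) (dim_row (ext_metric L p k (case_sum z t0)))
      (\<lambda>(q, l). \<Sum>\<alpha><n. \<Sum>\<beta><n. Gi k z $$ (\<beta>, \<alpha>) * (Rm k p (Inr i) (Inl \<beta>) z * Rm k p (Inl \<alpha>) (Inr j) z) $$ (q, l))) = At k p i j z"
    if p: "p \<in> VV" for p
  proof -
    note w = point(4)[OF k z]
    have d: "dim_row (ext_metric L p k (case_sum z t0)) = rv k p"
      using smat_carrier[OF smetric_smat[OF metric_smetric[OF k p]] w] by simp
    have c: "Rm k p (Inr i) (Inl \<beta>) z * Rm k p (Inl \<alpha>) (Inr j) z \<in> carrier_mat (rv k p) (rv k p)" if "\<alpha> < n" "\<beta> < n" for \<alpha> \<beta>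
      using that ij by (intro mult_carrier_mat[OF smat_carrier[OF curv_smat[OF k p] w] smat_carrier[OF curv_smat[OF k p] w]]) auto
    have "(\<Sum>q<rv k p. \<Sum>\<alpha><n. \<Sum>\<beta><n. Gi k z $$ (\<beta>, \<alpha>) * (Rm k p (Inr i) (Inl \<beta>) z * Rm k p (Inl \<alpha>) (Inr j) z) $$ (q, q)) =
       (\<Sum>\<alpha><n. \<Sum>\<beta><n. Gi k z $$ (\<beta>, \<alpha>) * (\<Sum>q<rv k p. (Rm k p (Inr i) (Inl \<beta>) z * Rm k p (Inl \<alpha>) (Inr j) z) $$ (q, q)))"
      unfolding sum_distrib_left by (rule sum_rotate3)
    also have "\<dots> = At k p i j z"
      unfolding At_def by (intro sum.cong refl) (simp add: mtrace_eq[OF c] del: index_mult_mat(1))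
    finally show ?thesis unfolding mtrace_def d by (simp del: index_mult_mat(1))
  qed
  then show "wp_integrand n g Q \<nu> E L i j k (case_sum z t0) (fvec n (\<lambda>_ _. 0)) =
      ((\<Sum>a\<in>AA. Nt k a i j z) + (\<Sum>p\<in>VV. of_nat (\<nu> p) * At k p i j z)) * vol k z"
    unfolding wp_integrand_def piece_metric_eq vol_eq Nt_def by simp
qed

section \<open>The Chern forms and assembly of the formula\<close>

definition W :: "(nat \<Rightarrow> nat \<Rightarrow> complex) \<Rightarrow> nat \<Rightarrow> nat \<Rightarrow> complex" where
  "W v i j = v 0 i * cnj (v 1 j) - v 1 i * cnj (v 0 j)"

lemma form11_W: "form11 {..<N} M v = (\<Sum>i<N. \<Sum>j<N. M i j * W v i j)"
  by (simp add: form11_eq W_def)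

lemma JJ_form:
  assumes k: "k < m" and X: "\<And>i j. i < N \<Longrightarrow> j < N \<Longrightarrow> continuous_on (U k) (X i j)"
  shows "JJ k (\<lambda>z. c * (\<Sum>i<N. \<Sum>j<N. X i j z * W v i j)) = c * (\<Sum>i<N. \<Sum>j<N. JJ k (X i j) * W v i j)"
proof -
  note w = weight[OF k]
  have "JJ k (\<lambda>z. \<Sum>i<N. \<Sum>j<N. X i j z * W v i j) = (\<Sum>i<N. JJ k (\<lambda>z. \<Sum>j<N. X i j z * W v i j))"
    by (rule compact_weight.J_sum[OF w]) (auto intro!: continuous_intros X)
  also have "\<dots> = (\<Sum>i<N. \<Sum>j<N. JJ k (\<lambda>z. X i j z * W v i j))"
    by (intro sum.cong refl compact_weight.J_sum[OF w]) (auto intro!: continuous_intros X)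
  also have "\<dots> = (\<Sum>i<N. \<Sum>j<N. JJ k (X i j) * W v i j)"
    by (intro sum.cong refl) (simp only: mult.commute[of _ "W v _ _"] compact_weight.J_cmult[OF w])
  finally show ?thesis using compact_weight.J_cmult[OF w, of c] by simp
qed

lemma Ginv:
  "k < m \<Longrightarrow> z \<in> U k \<Longrightarrow> \<beta> < n \<Longrightarrow> \<gamma> < n \<Longrightarrow> (\<Sum>\<delta><n. Gi k z $$ (\<beta>, \<delta>) * g (bc k) z $$ (\<delta>, \<gamma>)) = (if \<beta> = \<gamma> then 1 else 0)"
  by (rule minv_mult_entry[OF pos_hermitian_det[OF g_pos]])

text \<open>Wedging with \<omega>_X^n keeps the base block of each diagonal curvature entry, and
  these add up to the trace \<open>Tt\<close>.\<close>

lemma fiber_c1_eq: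
  assumes p: "p \<in> VV"
  shows "fiber_c1 n N g L p t0 v = \<i> / (2 * of_real pi) * (\<Sum>i<N. \<Sum>j<N. (\<Sum>k<m. JJ k (Tt k p i j)) * W v i j)"
proof -
  have "fiber_c1 n N g L p t0 v = (\<Sum>k<m. JJ k (\<lambda>z. \<i> / (2 * of_real pi) * (\<Sum>i<N. \<Sum>j<N. Tt k p i j z * W v i j)))"
    unfolding fiber_c1_def
  proof (rule fiber_integral_JJ)
    fix k z assume k: "k < m" and z: "z \<in> U k"
    note w = point(4)[OF k z]
    let ?H = "ext_metric L p k"
    have d: "dim_row (?H (case_sum z t0)) = rv k p"
      using smat_carrier[OF smetric_smat[OF metric_smetric[OF k p]] w] by simp
    have "wedge 2 (2 * n) (c1_form n N ?H (case_sum z t0)) (kform_power_pullback n (g (bc k) z) n) (fvec n v) =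
       \<i> / (2 * of_real pi) * (\<Sum>a<rv k p. wedge 2 (2 * n) (curv_form n N ?H (case_sum z t0) a a)
          (kform_power_pullback n (g (bc k) z) n) (fvec n v))"
      unfolding c1_form_def[abs_def] d by (rule wedge_linear_left)
    also have "\<dots> = \<i> / (2 * of_real pi) * (\<Sum>a<rv k p. form11 {..<N} (\<lambda>i j. Rm k p (Inr i) (Inr j) z $$ (a, a)) v * vol k z)"
      unfolding curv_form_def vol_eq[of k z v, symmetric]
      by (intro arg_cong2[where f = times] sum.cong refl wedge_form11_kform_power[OF n Ginv[OF k z]])
    also have "\<dots> = \<i> / (2 * of_real pi) * (\<Sum>i<N. \<Sum>j<N. Tt k p i j z * W v i j) * vol k z"
    proof -
      have "Tt k p i j z = (\<Sum>a<rv k p. Rm k p (Inr i) (Inr j) z $$ (a, a))" if "i < N" "j < N" for i j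
        unfolding Tt_def using that by (intro mtrace_eq[OF smat_carrier[OF curv_smat[OF k p] w]]) auto
      then have "(\<Sum>i<N. \<Sum>j<N. Tt k p i j z * W v i j) = (\<Sum>i<N. \<Sum>j<N. \<Sum>a<rv k p. Rm k p (Inr i) (Inr j) z $$ (a, a) * W v i j)"
        by (simp add: sum_distrib_right)
      also have "\<dots> = (\<Sum>a<rv k p. form11 {..<N} (\<lambda>i j. Rm k p (Inr i) (Inr j) z $$ (a, a)) v)"
        unfolding form11_W by (rule sum_rotate3[symmetric])
      finally show ?thesis by (simp add: sum_distrib_right)
    qed
    finally show "wedge 2 (2 * n) (c1_form n N ?H (case_sum z t0)) (kform_power_pullback n (piece_metric g L k (case_sum z t0)) n) (fvec n v) =
       \<i> / (2 * of_real pi) * (\<Sum>i<N. \<Sum>j<N. Tt k p i j z * W v i j) * vol k z"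
      unfolding piece_metric_eq .
  qed
  also have "\<dots> = (\<Sum>k<m. \<i> / (2 * of_real pi) * (\<Sum>i<N. \<Sum>j<N. JJ k (Tt k p i j) * W v i j))"
    by (intro sum.cong refl JJ_form continuous_on_Tt p) auto
  also have "\<dots> = \<i> / (2 * of_real pi) * (\<Sum>i<N. \<Sum>j<N. (\<Sum>k<m. JJ k (Tt k p i j)) * W v i j)"
    unfolding sum_distrib_left[symmetric] sum_distrib_right by (subst sum_rotate3) simp
  finally show ?thesis .
qed

text \<open>By cyclicity the four products coming from tr(\<Omega> \<and> \<Omega>) coincide in
  pairs, which gives - 2 \<i> (\<open>Bt\<close> - \<open>At\<close>). The factor 1/2 (i/2pi)^2 then
  makes i/(4 pi^2).\<close>

lemma fiber_ch2_eq:
  assumes p: "p \<in> VV"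
  shows "fiber_ch2 n N g L p t0 v =
    \<i> / (4 * of_real pi ^ 2) * (\<Sum>i<N. \<Sum>j<N. (\<Sum>k<m. JJ k (\<lambda>z. Bt k p i j z - At k p i j z)) * W v i j)"
proof -
  have "fiber_ch2 n N g L p t0 v =
     (\<Sum>k<m. JJ k (\<lambda>z. \<i> / (4 * of_real pi ^ 2) * (\<Sum>i<N. \<Sum>j<N. (Bt k p i j z - At k p i j z) * W v i j)))"
    unfolding fiber_ch2_def
  proof (rule fiber_integral_JJ)
    fix k z assume k: "k < m" and z: "z \<in> U k"
    note w = point(4)[OF k z]
    let ?H = "ext_metric L p k" and ?r = "rv k p" and ?c = "1 / 2 * (\<i> / (2 * of_real pi))\<^sup>2 :: complex"
    let ?R = "\<lambda>A A'. Rm k p A A' z"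
    let ?K = "kform_power_pullback n (g (bc k) z) (n - 1)"
    let ?M = "\<lambda>a b i j. \<Sum>\<alpha><n. \<Sum>\<beta><n. - \<i> * Gi k z $$ (\<beta>, \<alpha>) *
       (?R (Inl \<alpha>) (Inl \<beta>) $$ (a, b) * ?R (Inr i) (Inr j) $$ (b, a) + ?R (Inr i) (Inr j) $$ (a, b) * ?R (Inl \<alpha>) (Inl \<beta>) $$ (b, a)
        - ?R (Inl \<alpha>) (Inr j) $$ (a, b) * ?R (Inr i) (Inl \<beta>) $$ (b, a) - ?R (Inr i) (Inl \<beta>) $$ (a, b) * ?R (Inl \<alpha>) (Inr j) $$ (b, a))"
    have d: "dim_row (?H (case_sum z t0)) = ?r"
      using smat_carrier[OF smetric_smat[OF metric_smetric[OF k p]] w] by simp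
    have Rc: "?R A A' \<in> carrier_mat ?r ?r" if "A \<in> I" "A' \<in> I" for A A'
      by (rule smat_carrier[OF curv_smat[OF k p that] w])
    have "wedge 4 (2 * (n - 1)) (ch2_form n N ?H (case_sum z t0)) ?K (fvec n v) =
       ?c * (\<Sum>a<?r. wedge 4 (2 * (n - 1)) (\<lambda>v. \<Sum>b<?r. wedge 2 2 (curv_form n N ?H (case_sum z t0) a b) (curv_form n N ?H (case_sum z t0) b a) v) ?K (fvec n v))"
      unfolding ch2_form_def[abs_def] d by (rule wedge_linear_left)
    also have "\<dots> = ?c * (\<Sum>a<?r. \<Sum>b<?r. wedge 4 (2 * (n - 1)) (wedge 2 2 (curv_form n N ?H (case_sum z t0) a b) (curv_form n N ?H (case_sum z t0) b a)) ?K (fvec n v))"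
      unfolding wedge_sum_left ..
    also have "\<dots> = ?c * (\<Sum>a<?r. \<Sum>b<?r. form11 {..<N} (?M a b) v * vol k z)"
      unfolding curv_form_def vol_eq[of k z v, symmetric]
      by (intro arg_cong2[where f = times] sum.cong refl wedge_form11_form11_kform_power[OF n Ginv[OF k z]])
    also have "\<dots> = ?c * (\<Sum>i<N. \<Sum>j<N. (\<Sum>a<?r. \<Sum>b<?r. ?M a b i j) * W v i j) * vol k z"
      unfolding form11_W sum_distrib_right[symmetric] by (subst sum_swap4) (simp only: sum_distrib_right[symmetric] mult.assoc)
    also have "(\<Sum>i<N. \<Sum>j<N. (\<Sum>a<?r. \<Sum>b<?r. ?M a b i j) * W v i j) = (\<Sum>i<N. \<Sum>j<N. - 2 * \<i> * (Bt k p i j z - At k p i j z) * W v i j)"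
    proof (intro sum.cong refl arg_cong2[where f = times])
      fix i j assume "i \<in> {..<N}" "j \<in> {..<N}"
      then have ij: "i < N" "j < N" by auto
      have tr: "(\<Sum>a<?r. \<Sum>b<?r. ?R A1 A2 $$ (a, b) * ?R A3 A4 $$ (b, a)) = mtrace (?R A1 A2 * ?R A3 A4)"
        if "A1 \<in> I" "A2 \<in> I" "A3 \<in> I" "A4 \<in> I" for A1 A2 A3 A4
        by (rule sum_entries_mult[OF Rc[OF that(1,2)] Rc[OF that(3,4)]])
      have tc: "mtrace (?R A1 A2 * ?R A3 A4) = mtrace (?R A3 A4 * ?R A1 A2)"
        if "A1 \<in> I" "A2 \<in> I" "A3 \<in> I" "A4 \<in> I" for A1 A2 A3 A4
        by (rule mtrace_comm[OF Rc[OF that(1,2)] Rc[OF that(3,4)]])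
      have "(\<Sum>a<?r. \<Sum>b<?r. ?M a b i j) = (\<Sum>\<alpha><n. \<Sum>\<beta><n. \<Sum>a<?r. \<Sum>b<?r. - \<i> * Gi k z $$ (\<beta>, \<alpha>) *
         (?R (Inl \<alpha>) (Inl \<beta>) $$ (a, b) * ?R (Inr i) (Inr j) $$ (b, a) + ?R (Inr i) (Inr j) $$ (a, b) * ?R (Inl \<alpha>) (Inl \<beta>) $$ (b, a)
          - ?R (Inl \<alpha>) (Inr j) $$ (a, b) * ?R (Inr i) (Inl \<beta>) $$ (b, a) - ?R (Inr i) (Inl \<beta>) $$ (a, b) * ?R (Inl \<alpha>) (Inr j) $$ (b, a)))"
        by (rule sum_swap4)
      also have "\<dots> = (\<Sum>\<alpha><n. \<Sum>\<beta><n. - 2 * \<i> * (Gi k z $$ (\<beta>, \<alpha>) * mtrace (?R (Inl \<alpha>) (Inl \<beta>) * ?R (Inr i) (Inr j))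
          - Gi k z $$ (\<beta>, \<alpha>) * mtrace (?R (Inr i) (Inl \<beta>) * ?R (Inl \<alpha>) (Inr j))))"
      proof (intro sum.cong refl)
        fix \<alpha> \<beta> assume "\<alpha> \<in> {..<n}" "\<beta> \<in> {..<n}"
        then have mem: "Inl \<alpha> \<in> I" "Inl \<beta> \<in> I" "Inr i \<in> I" "Inr j \<in> I" using ij by auto
        show "(\<Sum>a<?r. \<Sum>b<?r. - \<i> * Gi k z $$ (\<beta>, \<alpha>) *
         (?R (Inl \<alpha>) (Inl \<beta>) $$ (a, b) * ?R (Inr i) (Inr j) $$ (b, a) + ?R (Inr i) (Inr j) $$ (a, b) * ?R (Inl \<alpha>) (Inl \<beta>) $$ (b, a)
          - ?R (Inl \<alpha>) (Inr j) $$ (a, b) * ?R (Inr i) (Inl \<beta>) $$ (b, a) - ?R (Inr i) (Inl \<beta>) $$ (a, b) * ?R (Inl \<alpha>) (Inr j) $$ (b, a))) =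
          - 2 * \<i> * (Gi k z $$ (\<beta>, \<alpha>) * mtrace (?R (Inl \<alpha>) (Inl \<beta>) * ?R (Inr i) (Inr j))
          - Gi k z $$ (\<beta>, \<alpha>) * mtrace (?R (Inr i) (Inl \<beta>) * ?R (Inl \<alpha>) (Inr j)))"
          unfolding sum_distrib_left[symmetric] sum.distrib sum_subtractf tr[OF mem(1,2,3,4)] tr[OF mem(3,4,1,2)]
            tr[OF mem(1,4,3,2)] tr[OF mem(3,2,1,4)] tc[OF mem(3,4,1,2)] tc[OF mem(1,4,3,2)]
          by (simp add: algebra_simps)
      qed
      also have "\<dots> = - 2 * \<i> * (Bt k p i j z - At k p i j z)"
        by (simp only: Bt_def At_def sum_subtractf[symmetric] sum_distrib_left)
      finally show "(\<Sum>a<?r. \<Sum>b<?r. ?M a b i j) = - 2 * \<i> * (Bt k p i j z - At k p i j z)" .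
    qed
    also have "?c * (\<Sum>i<N. \<Sum>j<N. - 2 * \<i> * (Bt k p i j z - At k p i j z) * W v i j) =
       \<i> / (4 * of_real pi ^ 2) * (\<Sum>i<N. \<Sum>j<N. (Bt k p i j z - At k p i j z) * W v i j)"
    proof -
      have "?c * (- 2 * \<i>) = \<i> / (4 * of_real pi ^ 2)" by (simp add: power2_eq_square)
      then have "?c * (- 2 * \<i> * x) = \<i> / (4 * of_real pi ^ 2) * x" for x by (metis mult.assoc)
      then show ?thesis by (simp only: sum_distrib_left mult.assoc)
    qed
    finally show "wedge 4 (2 * (n - 1)) (ch2_form n N ?H (case_sum z t0))
        (kform_power_pullback n (piece_metric g L k (case_sum z t0)) (n - 1)) (fvec n v) =
       \<i> / (4 * of_real pi ^ 2) * (\<Sum>i<N. \<Sum>j<N. (Bt k p i j z - At k p i j z) * W v i j) * vol k z"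
      unfolding piece_metric_eq .
  qed
  also have "\<dots> = (\<Sum>k<m. \<i> / (4 * of_real pi ^ 2) * (\<Sum>i<N. \<Sum>j<N. JJ k (\<lambda>z. Bt k p i j z - At k p i j z) * W v i j))"
    by (intro sum.cong refl JJ_form continuous_on_diff continuous_on_Bt continuous_on_At p) auto
  also have "\<dots> = \<i> / (4 * of_real pi ^ 2) * (\<Sum>i<N. \<Sum>j<N. (\<Sum>k<m. JJ k (\<lambda>z. Bt k p i j z - At k p i j z)) * W v i j)"
    unfolding sum_distrib_left[symmetric] sum_distrib_right by (subst sum_rotate3) simp
  finally show ?thesis .
qed

lemma dz_dzb_norm2_eq:
  assumes ij: "i < N" "j < N"
  shows "dz i (dzb j (\<lambda>t. c * (\<Sum>a\<in>AA. fiber_norm2 n g Q L a t))) t0 = c * (\<Sum>k<m. JJ k (\<lambda>z. \<Sum>a\<in>AA. Dt k a i j z))"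
proof -
  let ?f = "\<lambda>a k w. mtrace (ext_arrow L a k w * ext_adjoint Q L a k w)"
  let ?F = "\<lambda>k w. c * (\<Sum>a\<in>AA. ?f a k w)"
  have sm: "smooth_on I (B k) (?F k)" if "k < m" for k
    by (intro smooth_on_mult[OF piece_copen[OF that]] smooth_on_const[OF piece_copen[OF that]] smooth_on_sum[OF piece_copen[OF that]] smooth_norm2[OF that])
  \<comment> \<open>The equality is established on the whole open set \<open>T\<close> and not just
    at \<open>t0\<close>, because it is going to be differentiated.\<close>
  have eq: "c * (\<Sum>a\<in>AA. fiber_norm2 n g Q L a t) = (\<Sum>k<m. JJ k (\<lambda>z. ?F k (case_sum z t)))" if t: "t \<in> T" for t
  proof -
    have "fiber_norm2 n g Q L a t = (\<Sum>k<m. JJ k (\<lambda>z. ?f a k (case_sum z t)))" for a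
      unfolding fiber_norm2_def by (rule fiber_integral_JJ) (simp only: piece_metric_eq vol_eq)
    then have "c * (\<Sum>a\<in>AA. fiber_norm2 n g Q L a t) = c * (\<Sum>k<m. \<Sum>a\<in>AA. JJ k (\<lambda>z. ?f a k (case_sum z t)))"
      by (simp only:) (subst sum.swap, rule refl)
    also have "\<dots> = (\<Sum>k<m. c * JJ k (\<lambda>z. \<Sum>a\<in>AA. ?f a k (case_sum z t)))"
      unfolding sum_distrib_left[of c "\<lambda>k. \<Sum>a\<in>AA. _ k a"]
      by (intro sum.cong refl arg_cong2[where f = times] compact_weight.J_sum[OF weight, symmetric]
           compact_weight.continuous_on_fiber[OF weight smooth_norm2 t]) auto
    also have "\<dots> = (\<Sum>k<m. JJ k (\<lambda>z. ?F k (case_sum z t)))"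
      by (intro sum.cong refl compact_weight.J_cmult[OF weight, symmetric]) auto
    finally show ?thesis .
  qed
  have "dz i (dzb j (\<lambda>t. c * (\<Sum>a\<in>AA. fiber_norm2 n g Q L a t))) t0 = dz i (dzb j (\<lambda>t. \<Sum>k<m. JJ k (\<lambda>z. ?F k (case_sum z t)))) t0"
    unfolding dz_wd dzb_wd using ij
    by (intro wd_cong[OF ambient_copen s(2)] wd_cong[OF ambient_copen] eq) auto
  also have "\<dots> = (\<Sum>k<m. JJ k (\<lambda>z. dz (Inr i) (dzb (Inr j) (?F k)) (case_sum z t0)))"
    by (rule dz_dzb_sum_J[OF weight ambient_copen sm s(2) ij])
  also have "\<dots> = (\<Sum>k<m. JJ k (\<lambda>z. c * (\<Sum>a\<in>AA. Dt k a i j z)))"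
  proof (intro sum.cong refl)
    fix k assume "k \<in> {..<m}"
    then have k: "k < m" by simp
    note op = piece_copen[OF k]
    have mem: "Inr i \<in> I" "Inr j \<in> I" using ij by auto
    have lin: "wd \<epsilon> A (\<lambda>w. c * (\<Sum>a\<in>AA. f a w)) w = c * (\<Sum>a\<in>AA. wd \<epsilon> A (f a) w)"
      if "\<And>a. a \<in> AA \<Longrightarrow> smooth_on I (B k) (f a)" "w \<in> B k" "A \<in> I" for f w A \<epsilon>
    proof -
      have "wd \<epsilon> A (\<lambda>w. c * (\<Sum>a\<in>AA. f a w)) w = c * wd \<epsilon> A (\<lambda>w. \<Sum>a\<in>AA. f a w) w"
        by (rule wd_cmult[OF op smooth_on_sum[OF op that(1)] that(2,3)])
      also have "wd \<epsilon> A (\<lambda>w. \<Sum>a\<in>AA. f a w) w = (\<Sum>a\<in>AA. wd \<epsilon> A (f a) w)"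
        by (rule wd_sum[OF op that])
      finally show ?thesis .
    qed
    show "JJ k (\<lambda>z. dz (Inr i) (dzb (Inr j) (?F k)) (case_sum z t0)) = JJ k (\<lambda>z. c * (\<Sum>a\<in>AA. Dt k a i j z))"
    proof (rule compact_weight.J_cong[OF weight[OF k]])
      fix z assume z: "z \<in> U k"
      note w = point(4)[OF k z]
      have "wd (- \<i>) (Inr i) (wd \<i> (Inr j) (?F k)) (case_sum z t0) =
          wd (- \<i>) (Inr i) (\<lambda>w. c * (\<Sum>a\<in>AA. wd \<i> (Inr j) (?f a k) w)) (case_sum z t0)"
        by (rule wd_cong[OF op w mem(1)]) (rule lin[OF smooth_norm2[OF k] _ mem(2)])
      also have "\<dots> = c * (\<Sum>a\<in>AA. wd (- \<i>) (Inr i) (wd \<i> (Inr j) (?f a k)) (case_sum z t0))"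
        by (rule lin[OF smooth_on_wd[OF op smooth_norm2[OF k] mem(2)] w mem(1)])
      finally show "dz (Inr i) (dzb (Inr j) (?F k)) (case_sum z t0) = c * (\<Sum>a\<in>AA. Dt k a i j z)"
        by (simp add: Dt_def dz_wd dzb_wd)
    qed
  qed
  also have "\<dots> = (\<Sum>k<m. c * JJ k (\<lambda>z. \<Sum>a\<in>AA. Dt k a i j z))"
    by (intro sum.cong refl compact_weight.J_cmult[OF weight]) auto
  finally show ?thesis by (simp only: sum_distrib_left)
qed

text \<open>The pointwise identity, integrated. The curvature part \<open>At\<close> of the
  Weil-Petersson integrand is just what completes - \<open>Bt\<close> to minus the integrand of
  ch_2.\<close>

lemma wp_coeff_identity:
  assumes ij: "i < N" "j < N"
  shows "wp_coeff n g Q \<nu> E L t0 i j =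
    (\<Sum>p\<in>VV. of_real (\<tau> p) * (\<Sum>k<m. JJ k (Tt k p i j)))
    - (\<Sum>p\<in>VV. of_nat (\<nu> p) * (\<Sum>k<m. JJ k (\<lambda>z. Bt k p i j z - At k p i j z)))
    + (\<Sum>k<m. JJ k (\<lambda>z. \<Sum>a\<in>AA. Dt k a i j z))"
proof -
  have piece: "JJ k (\<lambda>z. (\<Sum>a\<in>AA. Nt k a i j z) + (\<Sum>p\<in>VV. of_nat (\<nu> p) * At k p i j z)) =
     (\<Sum>p\<in>VV. of_real (\<tau> p) * JJ k (Tt k p i j)) - (\<Sum>p\<in>VV. of_nat (\<nu> p) * JJ k (\<lambda>z. Bt k p i j z - At k p i j z))
     + JJ k (\<lambda>z. \<Sum>a\<in>AA. Dt k a i j z)" if k: "k < m" for k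
  proof -
    note w = weight[OF k]
    note cont = continuous_on_Tt[OF k _ ij] continuous_on_Bt[OF k _ ij] continuous_on_At[OF k _ ij] continuous_on_Dt[OF k _ ij]
    have "JJ k (\<lambda>z. (\<Sum>a\<in>AA. Nt k a i j z) + (\<Sum>p\<in>VV. of_nat (\<nu> p) * At k p i j z)) =
       JJ k (\<lambda>z. (\<Sum>p\<in>VV. of_real (\<tau> p) * Tt k p i j z) + ((\<Sum>p\<in>VV. - of_nat (\<nu> p) * (Bt k p i j z - At k p i j z))
         + (\<Sum>a\<in>AA. Dt k a i j z)))"
      by (rule compact_weight.J_cong[OF w])
        (simp add: pointwise_identity[OF k _ ij] sum.distrib sum_subtractf right_diff_distrib sum_negf algebra_simps)
    also have "\<dots> = JJ k (\<lambda>z. \<Sum>p\<in>VV. of_real (\<tau> p) * Tt k p i j z) + (JJ k (\<lambda>z. \<Sum>p\<in>VV. - of_nat (\<nu> p) * (Bt k p i j z - At k p i j z))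
         + JJ k (\<lambda>z. \<Sum>a\<in>AA. Dt k a i j z))"
      by (subst compact_weight.J_add[OF w], intro continuous_intros cont, simp, intro continuous_intros cont, simp_all,
          subst compact_weight.J_add[OF w], intro continuous_intros cont, simp_all, intro continuous_intros cont, simp_all)
    also have "JJ k (\<lambda>z. \<Sum>p\<in>VV. of_real (\<tau> p) * Tt k p i j z) = (\<Sum>p\<in>VV. of_real (\<tau> p) * JJ k (Tt k p i j))"
      by (subst compact_weight.J_sum[OF w], intro continuous_intros cont, simp) (simp only: compact_weight.J_cmult[OF w])
    also have "JJ k (\<lambda>z. \<Sum>p\<in>VV. - of_nat (\<nu> p) * (Bt k p i j z - At k p i j z)) =
        (\<Sum>p\<in>VV. - of_nat (\<nu> p) * JJ k (\<lambda>z. Bt k p i j z - At k p i j z))"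
      by (subst compact_weight.J_sum[OF w], intro continuous_intros cont, simp_all only: compact_weight.J_cmult[OF w])
    finally show ?thesis by (simp add: sum_negf)
  qed
  have "wp_coeff n g Q \<nu> E L t0 i j = (\<Sum>k<m. (\<Sum>p\<in>VV. of_real (\<tau> p) * JJ k (Tt k p i j))
     - (\<Sum>p\<in>VV. of_nat (\<nu> p) * JJ k (\<lambda>z. Bt k p i j z - At k p i j z)) + JJ k (\<lambda>z. \<Sum>a\<in>AA. Dt k a i j z))"
    unfolding wp_coeff_eq[OF ij] by (intro sum.cong refl piece) simp
  also have "\<dots> = (\<Sum>p\<in>VV. \<Sum>k<m. of_real (\<tau> p) * JJ k (Tt k p i j))
     - (\<Sum>p\<in>VV. \<Sum>k<m. of_nat (\<nu> p) * JJ k (\<lambda>z. Bt k p i j z - At k p i j z)) + (\<Sum>k<m. JJ k (\<lambda>z. \<Sum>a\<in>AA. Dt k a i j z))"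
    unfolding sum.distrib sum_subtractf sum.swap[of _ VV] ..
  finally show ?thesis by (simp only: sum_distrib_left)
qed

theorem chern_weil_formula:
  "1 / (4 * of_real pi ^ 2) * wp_form n N g Q \<nu> E L t0 v =
     - (\<Sum>p\<in>VV. of_nat (\<nu> p) * fiber_ch2 n N g L p t0 v)
     + (\<Sum>p\<in>VV. of_real (\<tau> p / (2 * pi)) * fiber_c1 n N g L p t0 v)
     + del_delbar N (\<lambda>t. \<i> / (4 * of_real pi ^ 2) * (\<Sum>a\<in>AA. fiber_norm2 n g Q L a t)) t0 v"
proof -
  let ?c = "\<i> / (4 * of_real pi ^ 2) :: complex"
  let ?ch = "\<lambda>p i j. \<Sum>k<m. JJ k (\<lambda>z. Bt k p i j z - At k p i j z)"
  let ?c1 = "\<lambda>p i j. \<Sum>k<m. JJ k (Tt k p i j)"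
  let ?dd = "\<lambda>i j. \<Sum>k<m. JJ k (\<lambda>z. \<Sum>a\<in>AA. Dt k a i j z)"
  have "1 / (4 * of_real pi ^ 2) * wp_form n N g Q \<nu> E L t0 v = (\<Sum>i<N. \<Sum>j<N. ?c * (wp_coeff n g Q \<nu> E L t0 i j * W v i j))"
    unfolding wp_form_def form11_W by (simp add: sum_distrib_left mult_ac)
  also have "\<dots> = (\<Sum>i<N. \<Sum>j<N. (\<Sum>p\<in>VV. ?c * (of_real (\<tau> p) * ?c1 p i j * W v i j))
      - (\<Sum>p\<in>VV. ?c * (of_nat (\<nu> p) * ?ch p i j * W v i j)) + ?c * (?dd i j * W v i j))"
  proof (rule sum.cong[OF refl], rule sum.cong[OF refl])
    fix i j assume "i \<in> {..<N}" "j \<in> {..<N}"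
    then have ij: "i < N" "j < N" by auto
    show "?c * (wp_coeff n g Q \<nu> E L t0 i j * W v i j) = (\<Sum>p\<in>VV. ?c * (of_real (\<tau> p) * ?c1 p i j * W v i j))
      - (\<Sum>p\<in>VV. ?c * (of_nat (\<nu> p) * ?ch p i j * W v i j)) + ?c * (?dd i j * W v i j)"
      unfolding wp_coeff_identity[OF ij] sum_distrib_left[of ?c, symmetric] sum_distrib_right[symmetric]
      by (simp only: distrib_right left_diff_distrib distrib_left right_diff_distrib)
  qed
  also have "\<dots> = (\<Sum>p\<in>VV. \<Sum>i<N. \<Sum>j<N. ?c * (of_real (\<tau> p) * ?c1 p i j * W v i j))
      - (\<Sum>p\<in>VV. \<Sum>i<N. \<Sum>j<N. ?c * (of_nat (\<nu> p) * ?ch p i j * W v i j)) + (\<Sum>i<N. \<Sum>j<N. ?c * (?dd i j * W v i j))"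
    unfolding sum.distrib sum_subtractf sum_rotate3[of _ _ _ VV] ..
  also have "(\<Sum>p\<in>VV. \<Sum>i<N. \<Sum>j<N. ?c * (of_real (\<tau> p) * ?c1 p i j * W v i j)) =
      (\<Sum>p\<in>VV. of_real (\<tau> p / (2 * pi)) * fiber_c1 n N g L p t0 v)"
  proof (rule sum.cong[OF refl])
    fix p assume p: "p \<in> VV"
    \<comment> \<open>The weight \<tau>/(2 pi) and the i/(2 pi) of \<open>c1_form\<close> combine to
      the i/(4 pi^2) that the other terms carry.\<close>
    have c: "of_real (\<tau> p / (2 * pi)) * (\<i> / (2 * of_real pi) * x) = ?c * (of_real (\<tau> p) * x)" for x
      by (simp add: power2_eq_square)
    show "(\<Sum>i<N. \<Sum>j<N. ?c * (of_real (\<tau> p) * ?c1 p i j * W v i j)) = of_real (\<tau> p / (2 * pi)) * fiber_c1 n N g L p t0 v"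
      unfolding fiber_c1_eq[OF p] c sum_distrib_left[symmetric] mult.assoc ..
  qed
  also have "(\<Sum>p\<in>VV. \<Sum>i<N. \<Sum>j<N. ?c * (of_nat (\<nu> p) * ?ch p i j * W v i j)) =
      (\<Sum>p\<in>VV. of_nat (\<nu> p) * fiber_ch2 n N g L p t0 v)"
  proof (rule sum.cong[OF refl])
    fix p assume p: "p \<in> VV"
    show "(\<Sum>i<N. \<Sum>j<N. ?c * (of_nat (\<nu> p) * ?ch p i j * W v i j)) = of_nat (\<nu> p) * fiber_ch2 n N g L p t0 v"
      unfolding fiber_ch2_eq[OF p] sum_distrib_left[symmetric] mult.assoc by (simp only: mult.left_commute)
  qed
  also have "(\<Sum>i<N. \<Sum>j<N. ?c * (?dd i j * W v i j)) =
      del_delbar N (\<lambda>t. ?c * (\<Sum>a\<in>AA. fiber_norm2 n g Q L a t)) t0 v"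
    unfolding del_delbar_def form11_W by (intro sum.cong refl) (simp only: dz_dzb_norm2_eq lessThan_iff mult.assoc)
  finally show ?thesis by simp
qed

end

theorem proposition4p2:
  fixes n :: nat
    and AX :: "'x::t2_space chart set"
    and g :: "'x chart \<Rightarrow> (nat \<Rightarrow> complex) \<Rightarrow> complex mat"
    and AS :: "'s::t2_space chart set"
    and Q :: "('v, 'b) pre_digraph"
    and K :: "('v, 'b) relation set"
    and \<nu> :: "'v \<Rightarrow> nat"
    and \<tau> :: "'v \<Rightarrow> real"
    and E :: "('v, 'b, 'j, 'x, 's) quiver_family"
    and h :: "'v \<Rightarrow> 'j \<Rightarrow> 'x \<times> 's \<Rightarrow> complex mat"
  assumes "1 \<le> n"
    and "complex_manifold n AX"
    and "compact (UNIV :: 'x set)"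
    and "connected (UNIV :: 'x set)"
    and "kaehler_metric n AX g"
    and "reduced_complex_space AS"
    and "locally_finite_quiver Q"
    and "quiver_relations Q K"
    and "\<And>v. v \<in> verts Q \<Longrightarrow> 1 \<le> \<nu> v"
    and "holomorphic_quiver_family AX AS Q K E"
    and "family_metric AX AS Q E h"
    and "\<And>s. vortex_equation n AX g Q \<nu> \<tau> E h s"
    and "\<And>s. stable_member n AX g Q \<nu> \<tau> E h s"
  shows "\<forall>C\<in>AS. \<forall>L. local_extension n AX C Q E h L \<longrightarrow>
     (\<forall>s\<in>cdom C. ccoord C s \<in> ambient L \<longrightarrow>
       (\<forall>v. (\<forall>k<2. v k \<in> cspace {..<cdim C}) \<longrightarrow>
         1 / (4 * of_real pi ^ 2) * wp_form n (cdim C) g Q \<nu> E L (ccoord C s) v =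
           - (\<Sum>p\<in>support_verts Q E. of_nat (\<nu> p) * fiber_ch2 n (cdim C) g L p (ccoord C s) v)
           + (\<Sum>p\<in>support_verts Q E.
                of_real (\<tau> p / (2 * pi)) * fiber_c1 n (cdim C) g L p (ccoord C s) v)
           + del_delbar (cdim C)
               (\<lambda>t. \<i> / (4 * of_real pi ^ 2) * (\<Sum>a\<in>support_arcs Q E. fiber_norm2 n g Q L a t))
               (ccoord C s) v))"
proof (intro ballI allI impI)
  fix C L s v
  assume "C \<in> AS" "local_extension n AX C Q E h L" "s \<in> cdom C" "ccoord C s \<in> ambient L"
  then interpret family_extension n AX g AS Q K \<nu> \<tau> E h C L s
    using assms by unfold_locales blast+
  show "1 / (4 * of_real pi ^ 2) * wp_form n (cdim C) g Q \<nu> E L (ccoord C s) v =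
           - (\<Sum>p\<in>support_verts Q E. of_nat (\<nu> p) * fiber_ch2 n (cdim C) g L p (ccoord C s) v)
           + (\<Sum>p\<in>support_verts Q E.
                of_real (\<tau> p / (2 * pi)) * fiber_c1 n (cdim C) g L p (ccoord C s) v)
           + del_delbar (cdim C)
               (\<lambda>t. \<i> / (4 * of_real pi ^ 2) * (\<Sum>a\<in>support_arcs Q E. fiber_norm2 n g Q L a t))
               (ccoord C s) v"
    by (rule chern_weil_formula)
qed

end
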